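(* There is a randomized algorithm which, given $n$, an approximation parameter $0<\epsilon<1$, and query access to an (unknown) simple graph $G=(V,E)$ with $|V|=n$ vertices, $m$ edges and $t$ triangles, outputs a value $X$ such that $$(1-\epsilon)\,t\le X\le (1+\epsilon)\,t$$ with probability at least $5/6$. The expected number of queries it performs is $$\left(\frac{n}{t^{1/3}}+\min\left\{m,\frac{m^{3/2}}{t}\right\}\right)\cdot \mathrm{poly}(\log n,1/\epsilon),$$ and its expected running time is $$\left(\frac{n}{t^{1/3}}+\frac{m^{3/2}}{t}\right)\cdot \mathrm{poly}(\log n,1/\epsilon).$$
   Context: Query model: the algorithm may sample vertices of $V$ uniformly at random and may make three types of queries. (1) Degree queries: given a vertex $v$, return its degree $d_v$. (2) Neighbor queries: given $v$ and $i$, return the $i$-th neighbor of $v$, or a special symbol if $i>d_v$; no assumption is made on the order of neighbors. (3) Pair queries: given vertices $u,v$, return whether $(u,v)\in E$. The number $t$ of triangles is the number of unordered vertex triples that are pairwise adjacent. The complexity bounds are understood for graphs with $t\ge 1$. *)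

theory Defs
  imports "HOL-Probability.Probability" "HOL-Library.Log_Nat"
begin

section \<open>Graphs\<close>

definition simple_graph :: "nat \<Rightarrow> nat set set \<Rightarrow> bool" where
  "simple_graph n E \<longleftrightarrow> (\<forall>e\<in>E. e \<subseteq> {1..n} \<and> card e = 2)"

definition neighbors :: "nat set set \<Rightarrow> nat \<Rightarrow> nat set" where
  "neighbors E v = {u. {u, v} \<in> E}"

definition degree :: "nat set set \<Rightarrow> nat \<Rightarrow> nat" where
  "degree E v = card (neighbors E v)"

definition triangles :: "nat \<Rightarrow> nat set set \<Rightarrow> nat set set" where
  "triangles n E = {T. T \<subseteq> {1..n} \<and> card T = 3 \<and> (\<forall>u\<in>T. \<forall>v\<in>T. u \<noteq> v \<longrightarrow> {u, v} \<in> E)}"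

text \<open>\<open>nbr v i\<close> is the \<open>i\<close>-th neighbor of \<open>v\<close>, counted from 1; the order is arbitrary.\<close>

definition neighbor_order :: "nat \<Rightarrow> nat set set \<Rightarrow> (nat \<Rightarrow> nat \<Rightarrow> nat) \<Rightarrow> bool" where
  "neighbor_order n E nbr \<longleftrightarrow>
     (\<forall>v\<in>{1..n}. bij_betw (nbr v) {1..degree E v} (neighbors E v))"


section \<open>Randomized query programs\<close>

text \<open>
  Algorithms are programs of a fixed imperative language over natural numbers, with scalar
  variables and arrays that are initially zero. One program serves all inputs. The input graph is
  accessible through queries only, and local computation is charged by the logarithmic cost
  criterion: every operation costs one plus the bit length of the numbers it handles. Compared
  with unit cost on words of \<open>O(log n + log (1/\<epsilon>))\<close> bits this changes running times by at most a
  factor polynomial in \<open>log n\<close> and \<open>log (1/\<epsilon>)\<close>, and it rules out computing with huge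
  numbers in few steps.
\<close>

type_synonym vname = string

datatype binop = Add | Sub | Mul | Div | Mod | Less | Equal

datatype expr = Const nat | Var vname | Arr vname expr | Op binop expr expr

datatype com =
    Skip
  | Assign vname expr
  | Store vname expr expr
  | Seq com com
  | Cond expr com com
  | While expr com
  | Rand vname expr
  | EpsDigits vname expr
  | SampleVertex vname
  | DegreeQuery vname expr
  | NeighborQuery vname expr expr
  | PairQuery vname expr expr

record state =
  scalar :: "vname \<Rightarrow> nat"
  arr :: "vname \<Rightarrow> nat \<Rightarrow> nat"
  queries :: nat
  time :: nat

text \<open>Subtraction is truncated; division and remainder by 0 follow the HOL conventions.\<close>

fun binop_val :: "binop \<Rightarrow> nat \<Rightarrow> nat \<Rightarrow> nat" where
  "binop_val Add a b = a + b"
| "binop_val Sub a b = a - b"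
| "binop_val Mul a b = a * b"
| "binop_val Div a b = a div b"
| "binop_val Mod a b = a mod b"
| "binop_val Less a b = of_bool (a < b)"
| "binop_val Equal a b = of_bool (a = b)"

primrec val :: "state \<Rightarrow> expr \<Rightarrow> nat" where
  "val s (Const k) = k"
| "val s (Var x) = scalar s x"
| "val s (Arr a e) = arr s a (val s e)"
| "val s (Op f e1 e2) = binop_val f (val s e1) (val s e2)"

definition bits :: "nat \<Rightarrow> nat" where
  "bits k = floorlog 2 k"

text \<open>Each subexpression is charged for its own value, so an operation pays for its operands
  (including the address of an array access) as well as for its result.\<close>

primrec expr_time :: "state \<Rightarrow> expr \<Rightarrow> nat" where
  "expr_time s (Const k) = 1 + bits k"
| "expr_time s (Var x) = 1 + bits (scalar s x)"
| "expr_time s (Arr a e) = expr_time s e + 1 + bits (val s (Arr a e))"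
| "expr_time s (Op f e1 e2) = expr_time s e1 + expr_time s e2 + 1 + bits (val s (Op f e1 e2))"

definition charge :: "nat \<Rightarrow> state \<Rightarrow> state" where
  "charge c s = s\<lparr>time := time s + c\<rparr>"

definition assign :: "vname \<Rightarrow> nat \<Rightarrow> state \<Rightarrow> state" where
  "assign x k s = charge (1 + bits k) (s\<lparr>scalar := (scalar s)(x := k)\<rparr>)"

definition count_query :: "state \<Rightarrow> state" where
  "count_query s = s\<lparr>queries := queries s + 1\<rparr>"

definition uniform :: "nat set \<Rightarrow> nat spmf" where
  "uniform A = (if A = {} then return_spmf 0 else spmf_of_set A)"

partial_function (spmf) loop ::
  "(state \<Rightarrow> bool) \<Rightarrow> (state \<Rightarrow> state) \<Rightarrow> (state \<Rightarrow> state spmf) \<Rightarrow> state \<Rightarrow> state spmf" where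
  "loop g pay body s =
     (if g s then bind_spmf (body (pay s)) (loop g pay body) else return_spmf (pay s))"

text \<open>
  The vertices are \<open>1, ..., n\<close>, and 0 is the special symbol answering a neighbor query beyond the
  degree. The real parameter \<open>\<epsilon>\<close> is given by its binary expansion: reading its first \<open>k\<close> binary
  digits, as a number, costs at least \<open>k\<close>. Vertex samples are counted as queries too.
  The missing mass of the resulting subprobability is the probability of nontermination.
\<close>

primrec exec ::
  "nat \<Rightarrow> real \<Rightarrow> nat set set \<Rightarrow> (nat \<Rightarrow> nat \<Rightarrow> nat) \<Rightarrow> com \<Rightarrow> state \<Rightarrow> state spmf" where
  "exec n \<epsilon> E nbr Skip s = return_spmf (charge 1 s)"
| "exec n \<epsilon> E nbr (Assign x e) s = return_spmf (assign x (val s e) (charge (expr_time s e) s))"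
| "exec n \<epsilon> E nbr (Store a i e) s =
     return_spmf (charge (expr_time s i + expr_time s e + 1)
       (s\<lparr>arr := (arr s)(a := (arr s a)(val s i := val s e))\<rparr>))"
| "exec n \<epsilon> E nbr (Seq c1 c2) s = bind_spmf (exec n \<epsilon> E nbr c1 s) (exec n \<epsilon> E nbr c2)"
| "exec n \<epsilon> E nbr (Cond e c1 c2) s =
     (if val s e \<noteq> 0 then exec n \<epsilon> E nbr c1 (charge (1 + expr_time s e) s)
      else exec n \<epsilon> E nbr c2 (charge (1 + expr_time s e) s))"
| "exec n \<epsilon> E nbr (While e c) s =
     loop (\<lambda>s. val s e \<noteq> 0) (\<lambda>s. charge (1 + expr_time s e) s) (exec n \<epsilon> E nbr c) s"
| "exec n \<epsilon> E nbr (Rand x e) s =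
     map_spmf (\<lambda>k. assign x k (charge (expr_time s e) s)) (uniform {..<val s e})"
| "exec n \<epsilon> E nbr (EpsDigits x e) s =
     return_spmf (assign x (nat \<lfloor>\<epsilon> * 2 ^ val s e\<rfloor>) (charge (expr_time s e + val s e) s))"
| "exec n \<epsilon> E nbr (SampleVertex x) s =
     map_spmf (\<lambda>v. assign x v (count_query s)) (uniform {1..n})"
| "exec n \<epsilon> E nbr (DegreeQuery x e) s =
     return_spmf (assign x (degree E (val s e)) (charge (expr_time s e) (count_query s)))"
| "exec n \<epsilon> E nbr (NeighborQuery x e i) s =
     return_spmf (assign x
       (if val s i \<in> {1..degree E (val s e)} then nbr (val s e) (val s i) else 0)
       (charge (expr_time s e + expr_time s i) (count_query s)))"
| "exec n \<epsilon> E nbr (PairQuery x e1 e2) s =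
     return_spmf (assign x (of_bool ({val s e1, val s e2} \<in> E))
       (charge (expr_time s e1 + expr_time s e2) (count_query s)))"

definition initial :: "nat \<Rightarrow> state" where
  "initial n = \<lparr>scalar = (\<lambda>_. 0)(''n'' := n), arr = (\<lambda>_ _. 0), queries = 0, time = 0\<rparr>"

definition run :: "com \<Rightarrow> nat \<Rightarrow> real \<Rightarrow> nat set set \<Rightarrow> (nat \<Rightarrow> nat \<Rightarrow> nat) \<Rightarrow> state spmf" where
  "run c n \<epsilon> E nbr = exec n \<epsilon> E nbr c (initial n)"

text \<open>The output is a rational number, given by numerator and denominator.\<close>

definition result :: "state \<Rightarrow> real" where
  "result s = real (scalar s ''num'') / real (scalar s ''den'')"

text \<open>Nontermination counts as infinite cost.\<close>

definition expected_cost :: "(state \<Rightarrow> nat) \<Rightarrow> state spmf \<Rightarrow> ennreal" where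
  "expected_cost f p =
     (\<integral>\<^sup>+ r. (case r of None \<Rightarrow> \<infinity> | Some s \<Rightarrow> of_nat (f s)) \<partial>measure_pmf p)"

end

theory Submission
  imports Defs "HOL-Probability.Probability"
begin

text \<open>
  The algorithm searches geometrically for a guess \<open>\<tau>\<close> of \<open>t\<^sup>1\<^sup>/\<^sup>3\<close>. For one guess it samples about \<open>n/\<tau>\<close>
  vertices and explores each of them: a random incident edge, then a random neighbor of its endpoint of
  smaller degree, with rates such that every triangle at the vertex is hit with the same
  probability. The variance is dominated by vertices of large degree or in many triangles. Each such
  heavy vertex is recognized by a second, independent exploration, and a triangle is credited to its light
  vertices in equal shares. There are so few heavy vertices that triangles all of whose vertices are
  heavy are negligible; so all estimates follow from Chebyshev's inequality.

  Queries are cached, and every query at a vertex also reads its next unread neighbor. So the number of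
  queries is at most twice the number of samples plus \<open>6m\<close> with certainty, as well as at most the running time.
\<close>

text \<open>Let q be the estimate of 2m and \<kappa> a power of two near sqrt q. A triangle is found
  at a vertex at rate about 1/\<tau>^2; about K n / \<tau> samples give of the order of K t /
  \<tau>^3 hits. Taking \<kappa> of order sqrt m tames the variance: in degree order an edge has at
  most sqrt (2m) third vertices to consider, so hits sharing an edge cost only a constant factor.
  Lightness is decided afresh at every hit. A label is then merely a probability, the shares of a
  triangle add up in expectation to the probability that one of three independent labels is light,
  and borderline vertices need no care: only the product of that probability and the triangle count
  enters the variance. As m is unknown, the running time involves q^2, whose mean is not controlled
  by the mean of one estimate. The minimum of two independent estimates is used, since its square is
  at most their product. The analysis is done on finitely supported pmfs carrying value and cost.
  The program is coupled with them afterwards, which also yields almost sure termination.\<close>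

lemma card_le_sqrt_sumI:
  fixes d :: "nat \<Rightarrow> nat"
  assumes "finite A" "\<And>x. x \<in> A \<Longrightarrow> card A \<le> d x" "sum d A \<le> k"
  shows "(card A)\<^sup>2 \<le> k"
proof -
  have "card A * card A = (\<Sum>x\<in>A. card A)" by simp
  also have "\<dots> \<le> sum d A" by (intro sum_mono assms)
  finally show ?thesis using assms(3) by (simp add: power2_eq_square)
qed

section \<open>Graphs: degree sums and counting bounds\<close>

locale sgraph =
  fixes n :: nat and E :: "nat set set"
  assumes graph: "simple_graph n E"
begin

abbreviation "V \<equiv> {1..n}"
abbreviation "N \<equiv> neighbors E"
abbreviation "d \<equiv> degree E"
abbreviation "m \<equiv> card E"

lemma edge_props: "{u, v} \<in> E \<Longrightarrow> u \<in> V \<and> v \<in> V \<and> u \<noteq> v"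
  using graph unfolding simple_graph_def by (metis card_1_singleton_iff insert_absorb2 insert_subset numeral_eq_one_iff One_nat_def semiring_norm(85))

lemma N_iff: "u \<in> N v \<longleftrightarrow> {u, v} \<in> E" by (simp add: neighbors_def)

lemma N_sym: "u \<in> N v \<longleftrightarrow> v \<in> N u" by (simp add: N_iff insert_commute)

lemma N_V: "u \<in> N v \<Longrightarrow> u \<in> V \<and> v \<in> V \<and> u \<noteq> v" using edge_props by (auto simp: N_iff)

lemma finite_N [simp]: "finite (N v)"
  by (rule finite_subset[of _ V]) (use N_V in auto)

lemma finite_E [simp]: "finite E"
  by (rule finite_subset[of _ "Pow V"]) (use graph in \<open>auto simp: simple_graph_def\<close>)

lemma card_N: "card (N v) = d v" by (simp add: degree_def)

lemma degree_le: "d v \<le> n"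
proof -
  have "card (N v) \<le> card V" by (intro card_mono) (use N_V in auto)
  then show ?thesis by (simp add: card_N)
qed

lemma degree_out: "v \<notin> V \<Longrightarrow> d v = 0"
  using N_V card_N by (metis card.empty equals0I)

lemma degree_pos_iff: "0 < d v \<longleftrightarrow> N v \<noteq> {}"
  using card_N[of v] by (metis card_gt_0_iff finite_N)

lemma degree_as_edges: "d v = card {e \<in> E. v \<in> e}"
proof -
  have "bij_betw (\<lambda>u. {u, v}) (N v) {e \<in> E. v \<in> e}"
  proof (rule bij_betwI')
    fix x y assume "x \<in> N v" "y \<in> N v"
    then show "({x, v} = {y, v}) = (x = y)" by (metis doubleton_eq_iff)
  next
    fix x assume "x \<in> N v" then show "{x, v} \<in> {e \<in> E. v \<in> e}" by (simp add: N_iff)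
  next
    fix e assume e: "e \<in> {e \<in> E. v \<in> e}"
    then have "card e = 2" using graph by (auto simp: simple_graph_def)
    then obtain a b where "e = {a, b}" by (auto simp: card_2_iff)
    then show "\<exists>x\<in>N v. e = {x, v}" using e by (auto simp: N_iff insert_commute)
  qed
  then show ?thesis using bij_betw_same_card card_N by metis
qed

lemma sum_degree: "(\<Sum>v\<in>V. d v) = 2 * m"
proof -
  have "(\<Sum>v\<in>V. d v) = (\<Sum>v\<in>V. \<Sum>e\<in>E. of_bool (v \<in> e) :: nat)"
    by (intro sum.cong refl) (simp add: degree_as_edges sum.If_cases Int_def flip: of_nat_sum)
  also have "\<dots> = (\<Sum>e\<in>E. \<Sum>v\<in>V. of_bool (v \<in> e))" by (rule sum.swap)
  also have "\<dots> = (\<Sum>e\<in>E. 2)"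
  proof (rule sum.cong[OF refl])
    fix e assume "e \<in> E"
    then have e: "e \<subseteq> V" "card e = 2" using graph by (auto simp: simple_graph_def)
    then have "V \<inter> {v. v \<in> e} = e" by auto
    then show "(\<Sum>v\<in>V. of_bool (v \<in> e)) = (2::nat)" using e(2) by (simp add: sum_of_bool_eq)
  qed
  finally show ?thesis by simp
qed

lemma sum_degree_le: "A \<subseteq> V \<Longrightarrow> (\<Sum>v\<in>A. d v) \<le> 2 * m"
  unfolding sum_degree[symmetric] by (rule sum_mono2) auto

lemma degree_le_edges: "d v \<le> 2 * m"
proof -
  have "card {e \<in> E. v \<in> e} \<le> m" by (intro card_mono) auto
  then show ?thesis by (simp add: degree_as_edges)
qed

section \<open>Degree order and the triangles seen from a vertex\<close>

definition prec :: "nat \<Rightarrow> nat \<Rightarrow> bool" where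
  "prec u w \<longleftrightarrow> d u < d w \<or> (d u = d w \<and> u < w)"

lemma prec_trans: "prec a b \<Longrightarrow> prec b c \<Longrightarrow> prec a c" by (auto simp: prec_def)
lemma prec_total: "a \<noteq> b \<Longrightarrow> prec a b \<or> prec b a" by (auto simp: prec_def)
lemma prec_asym: "prec a b \<Longrightarrow> \<not> prec b a" by (auto simp: prec_def)
lemma prec_irrefl [simp]: "\<not> prec a a" by (auto simp: prec_def)

text \<open>For fixed v the condition \<open>prec u w\<close> selects one of the two orders of the
  other vertices of a triangle, so every triangle at v is counted once; v itself is not compared.
  The condition also makes the degree of w at least that of u, from which the size bound
  comes.\<close>

definition W :: "nat \<Rightarrow> nat \<Rightarrow> nat set" where
  "W v u = {w \<in> N v \<inter> N u. prec u w}"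

lemma finite_W [simp]: "finite (W v u)" by (simp add: W_def)

text \<open>Each w in the set has degree at least d u, hence at least the size k of the set; k
  vertices of degree at least k give k^2 \<le> 2m.\<close>

lemma card_W_sq: "(card (W v u))\<^sup>2 \<le> 2 * m"
proof (rule card_le_sqrt_sumI[where d = d])
  show "card (W v u) \<le> d w" if "w \<in> W v u" for w
  proof -
    have "card (W v u) \<le> card (N u)" by (intro card_mono) (auto simp: W_def)
    also have "\<dots> \<le> d w" using that by (auto simp: W_def prec_def card_N)
    finally show ?thesis .
  qed
  show "sum d (W v u) \<le> 2 * m" by (intro sum_degree_le) (use N_V in \<open>auto simp: W_def\<close>)
qed simp

lemma card_W_le: "real (card (W v u)) \<le> sqrt (2 * m)"
  using card_W_sq[of v u] by (intro real_le_rsqrt) (metis of_nat_le_iff of_nat_power)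

definition TP :: "nat \<Rightarrow> (nat \<times> nat) set" where
  "TP v = (SIGMA u : N v. W v u)"

lemma finite_TP [simp]: "finite (TP v)" by (simp add: TP_def)

abbreviation tv :: "nat \<Rightarrow> nat" where "tv v \<equiv> card (TP v)"

lemma tv_eq: "tv v = (\<Sum>u\<in>N v. card (W v u))" by (simp add: TP_def)

lemma tv_le: "real (tv v) \<le> d v * sqrt (2 * m)"
proof -
  have "real (tv v) = (\<Sum>u\<in>N v. real (card (W v u)))" by (simp add: tv_eq)
  also have "\<dots> \<le> (\<Sum>u\<in>N v. sqrt (2 * m))" by (intro sum_mono card_W_le)
  finally show ?thesis by (simp add: card_N)
qed

definition OT :: "(nat \<times> nat \<times> nat) set" where
  "OT = {(a, b, c). prec a b \<and> prec b c \<and> b \<in> N a \<and> c \<in> N a \<and> c \<in> N b}"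

lemma OT_sub: "OT \<subseteq> V \<times> V \<times> V" using N_V by (auto simp: OT_def)
lemma finite_OT [simp]: "finite OT" by (rule finite_subset[OF OT_sub]) auto

lemma card_OT: "card OT = card (triangles n E)"
proof -
  have "bij_betw (\<lambda>(a, b, c). {a, b, c}) OT (triangles n E)"
    unfolding bij_betw_def
  proof
    show "inj_on (\<lambda>(a, b, c). {a, b, c}) OT"
    proof (rule inj_onI)
      fix x y assume xy: "x \<in> OT" "y \<in> OT" "(\<lambda>(a, b, c). {a, b, c}) x = (\<lambda>(a, b, c). {a, b, c}) y"
      obtain a b c where x: "x = (a, b, c)" by (cases x)
      obtain a' b' c' where y: "y = (a', b', c')" by (cases y)
      have 1: "(a, b, c) \<in> OT" "(a', b', c') \<in> OT" and eq: "{a, b, c} = {a', b', c'}"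
        using xy by (simp_all add: x y)
      have o: "prec a b" "prec b c" "prec a c" "prec a' b'" "prec b' c'" "prec a' c'"
        using 1 by (auto simp: OT_def intro: prec_trans[of a b c] prec_trans[of a' b' c'])
      have m: "a \<in> {a', b', c'}" "b \<in> {a', b', c'}" "c \<in> {a', b', c'}"
        "a' \<in> {a, b, c}" "b' \<in> {a, b, c}" "c' \<in> {a, b, c}" using eq by blast+
      note n = o(1-3)[THEN prec_asym] o(4-6)[THEN prec_asym]
      have "a = a'" using m(1,4) o n by auto
      moreover have "c = c'" using m(3,6) o n by auto
      moreover have "b = b'" using m(2) o(1,2) \<open>a = a'\<close> \<open>c = c'\<close> by auto
      ultimately show "x = y" by (simp add: x y)
    qed
    show "(\<lambda>(a, b, c). {a, b, c}) ` OT = triangles n E"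
    proof (intro subset_antisym subsetI)
      fix T assume "T \<in> (\<lambda>(a, b, c). {a, b, c}) ` OT"
      then obtain a b c where T: "T = {a, b, c}" and o: "(a, b, c) \<in> OT" by auto
      have ne: "a \<noteq> b" "b \<noteq> c" "a \<noteq> c" using o N_V by (auto simp: OT_def)
      have "{a, b, c} \<subseteq> V" using o N_V unfolding OT_def by blast
      then show "T \<in> triangles n E"
        using o ne unfolding T triangles_def OT_def by (auto simp: N_iff insert_commute)
    next
      fix T assume T: "T \<in> triangles n E"
      then obtain a b c where abc: "T = {a, b, c}" "a \<noteq> b" "b \<noteq> c" "a \<noteq> c"
        by (auto simp: triangles_def card_3_iff)
      have N: "b \<in> N a" "c \<in> N a" "c \<in> N b" "a \<in> N b" "a \<in> N c" "b \<in> N c"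
        using T abc by (auto simp: triangles_def N_iff insert_commute)
      consider "prec a b" "prec b c" | "prec a c" "prec c b" | "prec b a" "prec a c"
        | "prec b c" "prec c a" | "prec c a" "prec a b" | "prec c b" "prec b a"
        using prec_total[OF abc(2)] prec_total[OF abc(3)] prec_total[OF abc(4)] by blast
      then show "T \<in> (\<lambda>(a, b, c). {a, b, c}) ` OT"
      proof cases
        case 1 then show ?thesis using N abc(1) by (intro image_eqI[of _ _ "(a, b, c)"]) (auto simp: OT_def)
      next
        case 2 then show ?thesis using N abc(1) by (intro image_eqI[of _ _ "(a, c, b)"]) (auto simp: OT_def)
      next
        case 3 then show ?thesis using N abc(1) by (intro image_eqI[of _ _ "(b, a, c)"]) (auto simp: OT_def)
      next
        case 4 then show ?thesis using N abc(1) by (intro image_eqI[of _ _ "(b, c, a)"]) (auto simp: OT_def)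
      next
        case 5 then show ?thesis using N abc(1) by (intro image_eqI[of _ _ "(c, a, b)"]) (auto simp: OT_def)
      next
        case 6 then show ?thesis using N abc(1) by (intro image_eqI[of _ _ "(c, b, a)"]) (auto simp: OT_def)
      qed
    qed
  qed
  then show ?thesis by (rule bij_betw_same_card)
qed

text \<open>Double counting: v may be the first, middle or last vertex of a sorted triangle, and
  \<open>TP v\<close> keeps the other two in order. This collects the contributions of the three
  vertices of one triangle, so that credits given at different vertices can be added.\<close>

lemma sum_TP:
  fixes F :: "nat \<Rightarrow> nat \<Rightarrow> nat \<Rightarrow> 'b :: comm_monoid_add"
  shows "(\<Sum>v\<in>V. \<Sum>(u, w)\<in>TP v. F v u w) = (\<Sum>(a, b, c)\<in>OT. F a b c + F b a c + F c a b)"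
proof -
  let ?S = "SIGMA v : V. TP v"
  let ?G = "\<lambda>(v, u, w). F v u w"
  let ?A = "OT" let ?B = "(\<lambda>(a, b, c). (b, a, c)) ` OT" let ?C = "(\<lambda>(a, b, c). (c, a, b)) ` OT"
  have "(\<Sum>v\<in>V. \<Sum>(u, w)\<in>TP v. F v u w) = sum ?G ?S"
    by (subst sum.Sigma) (auto simp: case_prod_unfold)
  also have "?S = ?A \<union> ?B \<union> ?C"
  proof (intro subset_antisym subsetI)
    fix x assume x: "x \<in> ?S"
    obtain v u w where [simp]: "x = (v, u, w)" by (cases x)
    from x have h: "u \<in> N v" "w \<in> N v" "w \<in> N u" "prec u w" by (auto simp: TP_def W_def)
    then have h': "v \<in> N u" "v \<in> N w" "u \<in> N w" using N_sym by auto
    have "v \<noteq> u" "v \<noteq> w" using h N_V by auto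
    then consider "prec v u" | "prec u v" "prec v w" | "prec w v" using prec_total by blast
    then show "x \<in> ?A \<union> ?B \<union> ?C"
    proof cases
      case 1 then show ?thesis using h by (auto simp: OT_def)
    next
      case 2 then have "x \<in> ?B" using h h' by (intro image_eqI[of _ _ "(u, v, w)"]) (auto simp: OT_def)
      then show ?thesis by blast
    next
      case 3 then have "x \<in> ?C" using h h' by (intro image_eqI[of _ _ "(u, w, v)"]) (auto simp: OT_def)
      then show ?thesis by blast
    qed
  next
    fix x assume "x \<in> ?A \<union> ?B \<union> ?C"
    then have "\<exists>a b c. (a, b, c) \<in> OT \<and> (x = (a, b, c) \<or> x = (b, a, c) \<or> x = (c, a, b))"
      by (cases x) auto
    then obtain a b c where o: "(a, b, c) \<in> OT" and x: "x = (a, b, c) \<or> x = (b, a, c) \<or> x = (c, a, b)"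
      by blast
    have o': "prec a b" "prec b c" "b \<in> N a" "c \<in> N a" "c \<in> N b" using o by (auto simp: OT_def)
    have "prec a c" using o'(1,2) by (rule prec_trans)
    moreover have "a \<in> V" "b \<in> V" "c \<in> V" using o OT_sub by auto
    moreover have "b \<in> N a" "c \<in> N a" "c \<in> N b" "a \<in> N b" "a \<in> N c" "b \<in> N c" "prec a b" "prec b c"
      using o' by (simp_all add: N_sym[of a] N_sym[of b c])
    ultimately show "x \<in> ?S" using x by (auto simp: TP_def W_def)
  qed
  also have "sum ?G \<dots> = sum ?G ?A + sum ?G ?B + sum ?G ?C"
  proof (subst sum.union_disjoint, simp, simp)
    show "(?A \<union> ?B) \<inter> ?C = {}"
      by (auto simp: OT_def) (metis prec_asym prec_trans)+
    have "?A \<inter> ?B = {}" by (auto simp: OT_def dest: prec_asym)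
    then show "sum ?G (?A \<union> ?B) + sum ?G ?C = sum ?G ?A + sum ?G ?B + sum ?G ?C"
      by (subst sum.union_disjoint) simp_all
  qed
  also have "sum ?G ?B = (\<Sum>(a, b, c)\<in>OT. F b a c)"
    by (subst sum.reindex) (auto simp: inj_on_def case_prod_unfold intro!: sum.cong)
  also have "sum ?G ?C = (\<Sum>(a, b, c)\<in>OT. F c a b)"
    by (subst sum.reindex) (auto simp: inj_on_def case_prod_unfold intro!: sum.cong)
  also have "sum ?G ?A + (\<Sum>(a, b, c)\<in>OT. F b a c) + (\<Sum>(a, b, c)\<in>OT. F c a b)
      = (\<Sum>(a, b, c)\<in>OT. F a b c + F b a c + F c a b)"
    by (simp add: case_prod_unfold sum.distrib)
  finally show ?thesis .
qed

abbreviation t :: nat where "t \<equiv> card (triangles n E)"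

lemma sum_tv: "(\<Sum>v\<in>V. tv v) = 3 * t"
proof -
  have "(\<Sum>v\<in>V. tv v) = (\<Sum>v\<in>V. \<Sum>(u, w)\<in>TP v. 1)" by (simp add: case_prod_unfold)
  also have "\<dots> = 3 * card OT" by (subst sum_TP) (simp add: case_prod_unfold)
  finally show ?thesis by (simp add: card_OT)
qed

text \<open>Summing \<open>tv_le\<close> counts every triangle three times and every edge twice, so
  3t \<le> 2 sqrt 2 * m sqrt m, and 2 sqrt 2 < 3.\<close>

lemma t_le: "real t \<le> m * sqrt m"
proof -
  have "real (3 * t) = (\<Sum>v\<in>V. real (tv v))" unfolding sum_tv[symmetric] by simp
  also have "\<dots> \<le> (\<Sum>v\<in>V. d v * sqrt (2 * m))" by (intro sum_mono tv_le)
  also have "\<dots> = real (2 * m) * sqrt (2 * m)" unfolding sum_degree[symmetric] by (simp add: sum_distrib_right)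
  finally have "3 * real t \<le> (2 * sqrt 2) * (m * sqrt m)" by (simp add: real_sqrt_mult mult_ac)
  also have "\<dots> \<le> 3 * (m * sqrt m)"
  proof (rule mult_right_mono)
    have "sqrt 2 \<le> 3 / 2" by (rule real_le_lsqrt) (auto simp: power2_eq_square)
    then show "2 * sqrt 2 \<le> 3" by simp
  qed simp
  finally show ?thesis by simp
qed

lemma t_le_cube: "t \<le> n ^ 3"
proof -
  have "card OT \<le> card (V \<times> V \<times> V)" by (intro card_mono OT_sub) auto
  then show ?thesis by (simp add: card_OT power3_eq_cube)
qed

text \<open>The total length of the neighbor lists met when each edge at v is explored from its
  endpoint of smaller degree. It enters the running time.\<close>

definition mindeg_sum :: "nat \<Rightarrow> nat" where "mindeg_sum v = (\<Sum>u\<in>N v. min (d u) (d v))"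

text \<open>The minimum is at most d v, which suffices if d v \<le> sqrt (2m). Otherwise the degrees
  of the neighbors sum to at most 2m \<le> d v * sqrt (2m).\<close>

lemma mindeg_sum_le: "real (mindeg_sum v) \<le> d v * sqrt (2 * m)"
proof (cases "real (d v) \<le> sqrt (2 * m)")
  case True
  have "mindeg_sum v \<le> (\<Sum>u\<in>N v. d v)" unfolding mindeg_sum_def by (intro sum_mono) simp
  then have "real (mindeg_sum v) \<le> real (d v * d v)" using card_N by (metis of_nat_le_iff sum_constant of_nat_id)
  also have "\<dots> \<le> d v * sqrt (2 * m)" using True by (simp add: mult_left_mono)
  finally show ?thesis .
next
  case False
  have "mindeg_sum v \<le> (\<Sum>u\<in>N v. d u)" unfolding mindeg_sum_def by (intro sum_mono) simp
  also have "\<dots> \<le> 2 * m" by (intro sum_degree_le) (use N_V in auto)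
  finally have "real (mindeg_sum v) \<le> real (2 * m)" by (simp only: of_nat_le_iff)
  also have "\<dots> = sqrt (2 * m) * sqrt (2 * m)" by simp
  also have "\<dots> \<le> d v * sqrt (2 * m)" using False by (intro mult_right_mono) auto
  finally show ?thesis .
qed

lemma sum_mindeg_sum_le: "(\<Sum>v\<in>V. real (mindeg_sum v)) \<le> 2 * m * sqrt (2 * m)"
proof -
  have "(\<Sum>v\<in>V. real (mindeg_sum v)) \<le> (\<Sum>v\<in>V. d v * sqrt (2 * m))" by (intro sum_mono mindeg_sum_le)
  also have "\<dots> = real (2 * m) * sqrt (2 * m)" unfolding sum_degree[symmetric] by (simp add: sum_distrib_right)
  finally show ?thesis by simp
qed

lemma card_tv_large: "0 < (x::real) \<Longrightarrow> real (card {v \<in> V. x < tv v}) * x \<le> 3 * t"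
proof -
  assume "0 < x"
  have "real (card {v \<in> V. x < tv v}) * x = (\<Sum>v\<in>{v \<in> V. x < tv v}. x)" by simp
  also have "\<dots> \<le> (\<Sum>v\<in>{v \<in> V. x < tv v}. real (tv v))" by (intro sum_mono) auto
  also have "\<dots> \<le> (\<Sum>v\<in>V. real (tv v))" by (intro sum_mono2) auto
  also have "\<dots> = 3 * t" using sum_tv by (metis of_nat_sum of_nat_mult of_nat_numeral)
  finally show ?thesis .
qed

lemma card_degree_large: "0 \<le> (x::real) \<Longrightarrow> real (card {v \<in> V. x < d v}) * x \<le> 2 * m"
proof -
  assume "0 \<le> x"
  have "real (card {v \<in> V. x < d v}) * x = (\<Sum>v\<in>{v \<in> V. x < d v}. x)" by simp
  also have "\<dots> \<le> (\<Sum>v\<in>{v \<in> V. x < d v}. real (d v))" by (intro sum_mono) auto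
  also have "\<dots> \<le> (\<Sum>v\<in>V. real (d v))" by (intro sum_mono2) auto
  also have "\<dots> = 2 * m" using sum_degree by (metis of_nat_sum of_nat_mult of_nat_numeral)
  finally show ?thesis .
qed

text \<open>Fewer than \<open>\<surd>m\<close> vertices have degree above \<open>2\<surd>m\<close>; they span at most half of the edges,
  and every other edge has an endpoint of small degree.\<close>

lemma low_degree_sum: "real m / 2 \<le> (\<Sum>v\<in>{v \<in> V. real (d v) \<le> 2 * sqrt (real m)}. real (d v))"
proof -
  define H where "H = {v \<in> V. 2 * sqrt (real m) < d v}"
  define S where "S = {v \<in> V. real (d v) \<le> 2 * sqrt (real m)}"
  have fin: "finite H" "finite S" by (auto simp: H_def S_def)
  have H: "real (card H) \<le> sqrt m"
  proof (cases "m = 0")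
    case True then have "H = {}" using degree_le_edges by (auto simp: H_def)
    then show ?thesis by simp
  next
    case False
    have "real (card H) * (2 * sqrt m) \<le> 2 * (sqrt m * sqrt m)"
      unfolding H_def using card_degree_large[of "2 * sqrt m"] by simp
    then have "(2 * sqrt m) * real (card H) \<le> (2 * sqrt m) * sqrt m" by (simp only: mult_ac)
    then show ?thesis using False by (subst (asm) mult_le_cancel_left_pos) auto
  qed
  let ?EH = "{e \<in> E. e \<subseteq> H}" let ?ES = "{e \<in> E. \<not> e \<subseteq> H}"
  have "card ?EH \<le> card {e. e \<subseteq> H \<and> card e = 2}"
    using graph fin by (intro card_mono) (auto simp: simple_graph_def)
  also have "\<dots> = card H choose 2" by (rule n_subsets[OF fin(1)])
  finally have "card ?EH \<le> card H * (card H - 1) div 2" by (simp add: choose_two)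
  then have "2 * card ?EH \<le> card H * card H"
    by (smt (verit, best) diff_le_self div_times_less_eq_dividend dual_order.trans mult.commute mult_le_mono2)
  then have "2 * real (card ?EH) \<le> real (card H) * real (card H)" by (metis of_nat_le_iff of_nat_mult of_nat_numeral)
  also have "\<dots> \<le> sqrt m * sqrt m" by (intro mult_mono H) auto
  finally have 1: "2 * real (card ?EH) \<le> m" by simp
  have 2: "m = card ?EH + card ?ES"
    by (subst card_Un_disjoint[symmetric]) (auto intro!: arg_cong[where f = card])
  have "?ES \<subseteq> (\<Union>v\<in>S. {e \<in> E. v \<in> e})"
  proof
    fix e assume e: "e \<in> ?ES"
    then obtain v where "v \<in> e" "v \<notin> H" by auto
    moreover have "e \<subseteq> V" using e graph by (auto simp: simple_graph_def)
    moreover have "v \<in> V" using \<open>v \<in> e\<close> \<open>e \<subseteq> V\<close> by (rule subsetD[rotated])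
    ultimately show "e \<in> (\<Union>v\<in>S. {e \<in> E. v \<in> e})" using e by (auto simp: S_def H_def)
  qed
  then have "card ?ES \<le> card (\<Union>v\<in>S. {e \<in> E. v \<in> e})" using fin by (intro card_mono) auto
  also have "\<dots> \<le> (\<Sum>v\<in>S. d v)" unfolding degree_as_edges by (rule card_UN_le[OF fin(2)])
  finally have "real (card ?ES) \<le> (\<Sum>v\<in>S. real (d v))" by (metis of_nat_le_iff of_nat_sum)
  then show ?thesis using 1 2 by (simp add: S_def)
qed

end

section \<open>Finitely supported random sums\<close>

abbreviation ev :: "'a pmf \<Rightarrow> ('a \<Rightarrow> real) \<Rightarrow> real" where
  "ev p h \<equiv> measure_pmf.expectation p h"

abbreviation fin :: "'a pmf \<Rightarrow> bool" where
  "fin p \<equiv> finite (set_pmf p)"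

lemma ev_bind:
  assumes "fin p" "\<And>x. x \<in> set_pmf p \<Longrightarrow> fin (f x)"
  shows "ev (bind_pmf p f) h = ev p (\<lambda>x. ev (f x) h)"
proof -
  have "ev (bind_pmf p f) h = (\<Sum>a\<in>set_pmf p. pmf p a *\<^sub>R ev (f a) h)"
    by (rule pmf_expectation_bind) (use assms in auto)
  also have "\<dots> = ev p (\<lambda>x. ev (f x) h)"
    by (subst integral_measure_pmf[of "set_pmf p"]) (use assms in auto)
  finally show ?thesis .
qed

lemma ev_add: "fin p \<Longrightarrow> ev p (\<lambda>x. f x + g x) = ev p f + ev p g"
  by (intro Bochner_Integration.integral_add integrable_measure_pmf_finite)

lemma ev_diff: "fin p \<Longrightarrow> ev p (\<lambda>x. f x - g x) = ev p f - ev p g"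
  by (intro Bochner_Integration.integral_diff integrable_measure_pmf_finite)

lemma ev_mono: "fin p \<Longrightarrow> (\<And>x. x \<in> set_pmf p \<Longrightarrow> f x \<le> g x) \<Longrightarrow> ev p f \<le> ev p g"
  by (intro integral_mono_AE integrable_measure_pmf_finite) (auto simp: AE_measure_pmf_iff)

lemma ev_cong: "(\<And>x. x \<in> set_pmf p \<Longrightarrow> f x = g x) \<Longrightarrow> ev p f = ev p g"
  by (intro integral_cong_AE) (auto simp: AE_measure_pmf_iff)

lemma ev_const [simp]: "ev p (\<lambda>x. c) = c"
  by simp

lemma ev_nonneg: "(\<And>x. 0 \<le> f x) \<Longrightarrow> 0 \<le> ev p f"
  by (rule Bochner_Integration.integral_nonneg)

lemma prob_eq_ev: "measure_pmf.prob p A = ev p (indicator A)"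
  by simp

lemma prob_le_ev:
  assumes "fin p" "\<And>x. x \<in> set_pmf p \<Longrightarrow> x \<in> A \<Longrightarrow> 1 \<le> h x" "\<And>x. 0 \<le> h x"
  shows "measure_pmf.prob p A \<le> ev p h"
  unfolding prob_eq_ev by (rule ev_mono) (use assms in \<open>auto simp: indicator_def\<close>)

lemma markov_pmf:
  assumes "fin p" "0 < c" "\<And>x. 0 \<le> h x"
  shows "measure_pmf.prob p {x. c \<le> h x} \<le> ev p h / c"
proof -
  have "measure_pmf.prob p {x. c \<le> h x} \<le> ev p (\<lambda>x. h x / c)"
    by (rule prob_le_ev) (use assms in auto)
  then show ?thesis by simp
qed

text \<open>The variance enters as a bound on the second moment in excess of the squared mean,
  because the estimates for repeated draws come in this additive form.\<close>

lemma chebyshev_pmf: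
  assumes "fin p" "0 < a" "ev p (\<lambda>x. (h x)\<^sup>2) \<le> v + (ev p h)\<^sup>2"
  shows "measure_pmf.prob p {x. a \<le> \<bar>h x - ev p h\<bar>} \<le> v / a\<^sup>2"
proof -
  let ?\<mu> = "ev p h"
  have "measure_pmf.prob p {x. a \<le> \<bar>h x - ?\<mu>\<bar>} \<le> measure_pmf.prob p {x. a\<^sup>2 \<le> (h x - ?\<mu>)\<^sup>2}"
    using assms(2) by (intro measure_pmf.finite_measure_mono) (auto simp: abs_le_square_iff[symmetric])
  also have "\<dots> \<le> ev p (\<lambda>x. (h x - ?\<mu>)\<^sup>2) / a\<^sup>2"
    using assms by (intro markov_pmf) auto
  also have "ev p (\<lambda>x. (h x - ?\<mu>)\<^sup>2) = ev p (\<lambda>x. ((h x)\<^sup>2 - (2 * ?\<mu>) * h x) + ?\<mu>\<^sup>2)"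
    by (simp add: power2_diff algebra_simps)
  also have "\<dots> = ev p (\<lambda>x. (h x)\<^sup>2) - 2 * ?\<mu> * ?\<mu> + ?\<mu>\<^sup>2"
    using assms(1) by (subst ev_add, simp, subst ev_diff) (simp_all)
  also have "\<dots> / a\<^sup>2 \<le> v / a\<^sup>2"
    using assms(3) by (intro divide_right_mono) (auto simp: power2_eq_square)
  finally show ?thesis .
qed

section \<open>Sums of independent draws\<close>

primrec rep :: "nat \<Rightarrow> 'a::comm_monoid_add pmf \<Rightarrow> 'a pmf" where
  "rep 0 D = return_pmf 0"
| "rep (Suc k) D = bind_pmf D (\<lambda>a. map_pmf ((+) a) (rep k D))"

lemma fin_rep [simp]: "fin D \<Longrightarrow> fin (rep k D)"
  by (induction k) auto

lemma ev_rep_Suc: "fin D \<Longrightarrow> ev (rep (Suc k) D) h = ev D (\<lambda>a. ev (rep k D) (\<lambda>b. h (a + b)))"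
  by (simp add: ev_bind)

lemma ev_rep:
  assumes "fin D" and h: "\<And>a b. h (a + b) = h a + h b" "h 0 = 0"
  shows "ev (rep k D) h = k * ev D h"
proof (induction k)
  case (Suc k)
  show ?case unfolding ev_rep_Suc[OF assms(1)] h
    using assms(1) Suc by (simp add: ev_add algebra_simps)
qed (simp add: h)

text \<open>Independence leaves k(k-1) cross terms, each the square of the mean. The additive h is
  general so that values and costs can both be projected out of an outcome.\<close>

lemma ev_rep_sq:
  assumes "fin D" and h: "\<And>a b. h (a + b) = h a + h b" "h 0 = 0"
  shows "ev (rep k D) (\<lambda>x. (h x)\<^sup>2) = k * ev D (\<lambda>x. (h x)\<^sup>2) + (real k * (real k - 1)) * (ev D h)\<^sup>2"
proof (induction k)
  case (Suc k)
  have "ev (rep k D) (\<lambda>b. (h (a + b))\<^sup>2)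
      = (h a)\<^sup>2 + (2 * real k * ev D h) * h a + ev (rep k D) (\<lambda>x. (h x)\<^sup>2)" for a
  proof -
    have "ev (rep k D) (\<lambda>b. (h (a + b))\<^sup>2) = ev (rep k D) (\<lambda>b. ((h a)\<^sup>2 + (2 * h a) * h b) + (h b)\<^sup>2)"
      by (simp add: h power2_sum algebra_simps)
    also have "\<dots> = ((h a)\<^sup>2 + (2 * h a) * ev (rep k D) h) + ev (rep k D) (\<lambda>x. (h x)\<^sup>2)"
      using assms(1) by (simp add: ev_add)
    finally show ?thesis by (simp add: ev_rep[OF assms])
  qed
  then have "ev (rep (Suc k) D) (\<lambda>x. (h x)\<^sup>2)
      = ev D (\<lambda>x. (h x)\<^sup>2) + (2 * real k * ev D h) * ev D h + ev (rep k D) (\<lambda>x. (h x)\<^sup>2)"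
    unfolding ev_rep_Suc[OF assms(1)] using assms(1) by (simp add: ev_add)
  then show ?case unfolding Suc by (simp add: algebra_simps power2_eq_square)
qed (simp add: h)

lemma ev_rep_sq_le:
  assumes "fin D" and h: "\<And>a b. h (a + b) = h a + h b" "h 0 = 0"
  shows "ev (rep k D) (\<lambda>x. (h x)\<^sup>2) \<le> k * ev D (\<lambda>x. (h x)\<^sup>2) + (k * ev D h)\<^sup>2"
  unfolding ev_rep_sq[OF assms] by (simp add: power2_eq_square algebra_simps)

lemma set_rep_le:
  fixes h :: "'a::comm_monoid_add \<Rightarrow> nat"
  assumes "\<And>x. x \<in> set_pmf D \<Longrightarrow> h x \<le> c" "x \<in> set_pmf (rep k D)"
    and h: "\<And>a b. h (a + b) = h a + h b" "h 0 = 0"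
  shows "h x \<le> k * c"
  using assms(2) by (induction k arbitrary: x) (auto simp: h intro!: add_mono assms(1))

text \<open>An outcome consists of a value, a number of steps and a number of vertex samples.\<close>

type_synonym outcome = "nat \<times> nat \<times> nat"

abbreviation vl :: "outcome \<Rightarrow> real" where "vl x \<equiv> real (fst x)"
abbreviation st :: "outcome \<Rightarrow> real" where "st x \<equiv> real (fst (snd x))"

definition tick :: "outcome pmf \<Rightarrow> outcome pmf" where
  "tick D = map_pmf (\<lambda>x. (0, 1, 0) + x) D"

text \<open>Mirrors a counting loop of the program: one step for every passed test of the guard and
  one for the final failing test.\<close>

definition forp :: "nat \<Rightarrow> outcome pmf \<Rightarrow> outcome pmf" where
  "forp k D = tick (rep k (tick D))"

lemma fin_tick [simp]: "fin (tick D) \<longleftrightarrow> fin D"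
  by (auto simp: tick_def dest: finite_imageD intro: finite_imageD[of "(+) (0, 1, 0)"])

lemma fin_forp [simp]: "fin D \<Longrightarrow> fin (forp k D)"
  by (simp add: forp_def)

lemma ev_tick_vl [simp]: "ev (tick D) vl = ev D vl"
  by (simp add: tick_def)

lemma ev_tick_sq [simp]: "ev (tick D) (\<lambda>x. (vl x)\<^sup>2) = ev D (\<lambda>x. (vl x)\<^sup>2)"
  by (simp add: tick_def)

lemma ev_tick_st [simp]: "fin D \<Longrightarrow> ev (tick D) st = 1 + ev D st"
  by (simp add: tick_def ev_add)

lemma ev_forp_vl [simp]: "fin D \<Longrightarrow> ev (forp k D) vl = k * ev D vl"
  by (simp add: forp_def ev_rep)

lemma ev_forp_sq: "fin D \<Longrightarrow> ev (forp k D) (\<lambda>x. (vl x)\<^sup>2) \<le> k * ev D (\<lambda>x. (vl x)\<^sup>2) + (k * ev D vl)\<^sup>2"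
  using ev_rep_sq_le[of "tick D" vl k] by (simp add: forp_def)

lemma ev_forp_st [simp]: "fin D \<Longrightarrow> ev (forp k D) st = 1 + k * (1 + ev D st)"
  by (simp add: forp_def ev_rep)

lemma ev_uniform: "0 < k \<Longrightarrow> (\<And>i. i < k \<Longrightarrow> fin (f i)) \<Longrightarrow>
    ev (bind_pmf (pmf_of_set {..<k}) f) h = (\<Sum>i<k. ev (f i) h) / real k"
  by (subst ev_bind) (auto simp: integral_pmf_of_set lessThan_empty_iff)

section \<open>Sampling triangles at a vertex\<close>

locale qgraph = sgraph +
  fixes nbr :: "nat \<Rightarrow> nat \<Rightarrow> nat"
  assumes order: "neighbor_order n E nbr"
begin

lemma N_empty: "d v = 0 \<Longrightarrow> N v = {}"
  using card_N[of v] by simp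

lemma nbr_bij: "bij_betw (\<lambda>i. nbr v (i + 1)) {..<d v} (N v)"
proof (cases "v \<in> V")
  case True
  then have b: "bij_betw (nbr v) {1..d v} (N v)" using order by (auto simp: neighbor_order_def)
  have "bij_betw (\<lambda>i. i + 1) {..<d v} {1..d v}"
    by (rule bij_betwI[of _ _ _ "\<lambda>i. i - 1"]) auto
  from bij_betw_trans[OF this b] show ?thesis by (simp add: o_def)
next
  case False
  then have "d v = 0" by (rule degree_out)
  moreover have "N v = {}" using \<open>d v = 0\<close> by (rule N_empty)
  ultimately show ?thesis by (simp add: bij_betw_def)
qed

lemma sum_nbr: "(\<Sum>i<d v. F (nbr v (i + 1))) = sum F (N v)"
  using sum.reindex_bij_betw[OF nbr_bij] .

text \<open>A draw from L \<ge> d v slots that ignores the slots beyond the degree still treats all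
  neighbors alike, and L can be chosen to make the rate a round number.\<close>

lemma sum_slots:
  assumes "d v \<le> L"
  shows "(\<Sum>i<L. if i < d v then F (nbr v (i + 1)) else 0) = sum F (N v)"
proof -
  have "(\<Sum>i<L. if i < d v then F (nbr v (i + 1)) else 0) = (\<Sum>i<d v. F (nbr v (i + 1)))"
    using assms by (intro sum.mono_neutral_cong_right) auto
  then show ?thesis unfolding sum_nbr .
qed

section \<open>Exploration of a vertex by random draws\<close>

definition lowend :: "nat \<Rightarrow> nat \<Rightarrow> nat" where "lowend v u = (if d u < d v then u else v)"
definition highend :: "nat \<Rightarrow> nat \<Rightarrow> nat" where "highend v u = (if d u < d v then v else u)"

lemma d_lowend: "d (lowend v u) = min (d u) (d v)" by (simp add: lowend_def)

text \<open>With \<open>slots k x * k\<close> equally likely positions and \<open>slots k x\<close>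
  draws, each position is hit exactly 1/k times in expectation, whatever x is. The count is always
  positive, so the range drawn from is never empty.\<close>

definition slots :: "nat \<Rightarrow> nat \<Rightarrow> nat" where "slots k x = x div k + 1"

lemma slots_le: "0 < k \<Longrightarrow> x \<le> slots k x * k"
  unfolding slots_def by (metis add.commute add_lessD1 dividend_less_times_div less_imp_le_nat mult.commute mult_Suc_right nat_add_left_cancel_less plus_1_eq_Suc)

lemma slots_real_le: "real (slots k x) \<le> real x / real k + 1"
  using of_nat_div_le_of_nat[of x k] by (simp add: slots_def)

text \<open>The list of the endpoint of smaller degree is sampled and membership is tested at the
  other endpoint, so the number of draws is governed by the smaller degree.\<close>

definition wedge :: "nat \<Rightarrow> nat \<Rightarrow> nat \<Rightarrow> (nat \<Rightarrow> nat \<Rightarrow> nat \<Rightarrow> outcome pmf) \<Rightarrow> outcome pmf" where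
  "wedge \<kappa> v u D = bind_pmf (pmf_of_set {..<slots \<kappa> (d (lowend v u)) * \<kappa>})
     (\<lambda>j. let w = nbr (lowend v u) (j + 1) in
       if j < d (lowend v u) \<and> w \<in> N (highend v u) \<and> prec u w then tick (D v u w)
       else return_pmf (0, 1, 0))"

text \<open>The ceiling, unlike the rounding in \<open>slots\<close>: a vertex of degree 0 gets no
  draw, as its range would be empty, and for g = 1 there is no excess, which matters when the number
  R of repetitions is large.\<close>

definition rounds :: "nat \<Rightarrow> nat \<Rightarrow> nat" where "rounds g k = (k + g - 1) div g"

definition edge :: "nat \<Rightarrow> nat \<Rightarrow> nat \<Rightarrow> (nat \<Rightarrow> nat \<Rightarrow> nat \<Rightarrow> outcome pmf) \<Rightarrow> outcome pmf" where
  "edge \<kappa> g v D = bind_pmf (pmf_of_set {..<rounds g (d v) * g})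
     (\<lambda>i. let u = nbr v (i + 1) in
       if i < d v then tick (forp (slots \<kappa> (d (lowend v u))) (wedge \<kappa> v u D))
       else return_pmf (0, 1, 0))"

definition expl :: "nat \<Rightarrow> nat \<Rightarrow> nat \<Rightarrow> nat \<Rightarrow> (nat \<Rightarrow> nat \<Rightarrow> nat \<Rightarrow> outcome pmf) \<Rightarrow> outcome pmf" where
  "expl \<kappa> g R v D = tick (forp (R * rounds g (d v)) (edge \<kappa> g v D))"

lemma rounds_ge: "0 < g \<Longrightarrow> k \<le> rounds g k * g"
  unfolding rounds_def
  using div_mult_mod_eq[of "k + g - 1" g] mod_less_divisor[of g "k + g - 1"] by linarith

lemma rounds_one [simp]: "rounds (Suc 0) k = k" by (simp add: rounds_def)

lemma rounds_zero [simp]: "0 < g \<Longrightarrow> rounds g 0 = 0" by (simp add: rounds_def)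

lemma rounds_real_le: "0 < g \<Longrightarrow> real (rounds g k) \<le> real k / real g + 1"
proof -
  assume g: "0 < g"
  have "real (rounds g k) \<le> real (k + g - 1) / real g" unfolding rounds_def by (rule of_nat_div_le_of_nat)
  also have "\<dots> \<le> real (k + g) / real g" using g by (intro divide_right_mono) auto
  also have "\<dots> = real k / real g + 1" using g by (simp add: add_divide_distrib)
  finally show ?thesis .
qed

lemma sum_wedge:
  assumes "0 < \<kappa>" "u \<in> N v"
  shows "(\<Sum>j<slots \<kappa> (d (lowend v u)) * \<kappa>. let w = nbr (lowend v u) (j + 1) in
       if j < d (lowend v u) \<and> w \<in> N (highend v u) \<and> prec u w then F w else 0) = sum F (W v u)"
proof -
  let ?x = "lowend v u"
  have "(\<Sum>j<slots \<kappa> (d ?x) * \<kappa>. let w = nbr ?x (j + 1) in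
       if j < d ?x \<and> w \<in> N (highend v u) \<and> prec u w then F w else 0)
     = (\<Sum>j<slots \<kappa> (d ?x) * \<kappa>. if j < d ?x then
          (\<lambda>w. if w \<in> N (highend v u) \<and> prec u w then F w else 0) (nbr ?x (j + 1)) else 0)"
    by (intro sum.cong) (auto simp: Let_def)
  also have "\<dots> = (\<Sum>w\<in>N ?x. if w \<in> N (highend v u) \<and> prec u w then F w else 0)"
    by (rule sum_slots) (rule slots_le[OF assms(1)])
  also have "\<dots> = sum F {w \<in> N ?x. w \<in> N (highend v u) \<and> prec u w}"
    by (simp add: sum.inter_filter)
  also have "{w \<in> N ?x. w \<in> N (highend v u) \<and> prec u w} = W v u"
    by (auto simp: W_def lowend_def highend_def)
  finally show ?thesis .
qed

context
  fixes \<kappa> g R :: nat and D :: "nat \<Rightarrow> nat \<Rightarrow> nat \<Rightarrow> outcome pmf"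
  assumes \<kappa>: "0 < \<kappa>" and g: "0 < g" and R: "0 < R"
    and finD: "\<And>v u w. fin (D v u w)"
begin

lemma slots_pos: "0 < slots \<kappa> x * \<kappa>" using \<kappa> by (simp add: slots_def)

lemma slots_pos' [simp]: "0 < slots \<kappa> x" by (simp add: slots_def)

lemma fin_wedge [simp]: "fin (wedge \<kappa> v u D)"
  using slots_pos finD by (auto simp: wedge_def Let_def lessThan_empty_iff set_pmf_of_set)

lemma ev_wedge:
  "ev (wedge \<kappa> v u D) h = (\<Sum>j<slots \<kappa> (d (lowend v u)) * \<kappa>. let w = nbr (lowend v u) (j + 1) in
     if j < d (lowend v u) \<and> w \<in> N (highend v u) \<and> prec u w then ev (tick (D v u w)) h else h (0, 1, 0))
     / real (slots \<kappa> (d (lowend v u)) * \<kappa>)"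
  unfolding wedge_def using slots_pos finD
  by (subst ev_uniform) (auto simp: Let_def intro!: sum.cong arg_cong[where f = "\<lambda>x. x / _"])

text \<open>Number of draws times mean per draw: the rounded number of slots cancels and the rate
  1/\<kappa> is exact. The condition on h says that a miss contributes nothing; this is true of the
  value and of its square, but not of the steps.\<close>

lemma ev_wedge_zero:
  assumes "u \<in> N v" "h (0, 1, 0) = 0"
  shows "slots \<kappa> (d (lowend v u)) * ev (wedge \<kappa> v u D) h = (\<Sum>w\<in>W v u. ev (tick (D v u w)) h) / \<kappa>"
  unfolding ev_wedge assms(2) sum_wedge[OF \<kappa> assms(1), of "\<lambda>w. ev (tick (D v u w)) h"]
  using \<kappa> slots_pos'[of "d (lowend v u)"] by (simp add: field_simps)

lemma ev_wedge_st:
  assumes "u \<in> N v"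
  shows "slots \<kappa> (d (lowend v u)) * ev (wedge \<kappa> v u D) st
     = slots \<kappa> (d (lowend v u)) + (\<Sum>w\<in>W v u. ev (D v u w) st) / \<kappa>"
proof -
  let ?s = "slots \<kappa> (d (lowend v u))"
  have "ev (wedge \<kappa> v u D) st = (\<Sum>j<?s * \<kappa>. 1 + (let w = nbr (lowend v u) (j + 1) in
     if j < d (lowend v u) \<and> w \<in> N (highend v u) \<and> prec u w then ev (D v u w) st else 0))
     / real (?s * \<kappa>)"
    unfolding ev_wedge
    by (intro sum.cong arg_cong[where f = "\<lambda>x. x / _"] refl) (auto simp: Let_def finD)
  also have "\<dots> = (real (?s * \<kappa>) + (\<Sum>w\<in>W v u. ev (D v u w) st)) / real (?s * \<kappa>)"
    by (simp only: sum.distrib sum_wedge[OF \<kappa> assms(1)]) simp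
  finally show ?thesis using \<kappa> slots_pos'[of "d (lowend v u)"] by (simp add: field_simps)
qed

lemma rounds_pos_iff: "0 < rounds g (d v) * g \<longleftrightarrow> 0 < d v"
  using rounds_ge[OF g, of "d v"] g by (cases "d v = 0") (simp_all del: nat_0_less_mult_iff)

lemma fin_edge [simp]: "0 < d v \<Longrightarrow> fin (edge \<kappa> g v D)"
  using rounds_pos_iff[of v] by (auto simp: edge_def Let_def lessThan_empty_iff set_pmf_of_set)

lemma ev_edge_zero:
  assumes "0 < d v" "h (0, 1, 0) = 0"
  shows "rounds g (d v) * ev (edge \<kappa> g v D) h
    = (\<Sum>u\<in>N v. ev (tick (forp (slots \<kappa> (d (lowend v u))) (wedge \<kappa> v u D))) h) / g"
proof -
  have "ev (edge \<kappa> g v D) h = (\<Sum>i<rounds g (d v) * g.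
      if i < d v then (\<lambda>u. ev (tick (forp (slots \<kappa> (d (lowend v u))) (wedge \<kappa> v u D))) h) (nbr v (i + 1)) else 0)
      / real (rounds g (d v) * g)"
    unfolding edge_def using rounds_pos_iff[of v] assms
    by (subst ev_uniform) (auto simp: Let_def intro!: sum.cong arg_cong[where f = "\<lambda>x. x / _"])
  then show ?thesis
    unfolding sum_slots[OF rounds_ge[OF g], of v "\<lambda>u. ev (tick (forp (slots \<kappa> (d (lowend v u))) (wedge \<kappa> v u D))) h"]
    using g rounds_pos_iff[of v] assms by (simp add: field_simps)
qed

lemma ev_edge_st:
  assumes "0 < d v"
  shows "rounds g (d v) * ev (edge \<kappa> g v D) st
    = rounds g (d v) + (\<Sum>u\<in>N v. ev (forp (slots \<kappa> (d (lowend v u))) (wedge \<kappa> v u D)) st) / g"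
proof -
  let ?r = "rounds g (d v) * g"
  have "ev (edge \<kappa> g v D) st = (\<Sum>i<?r. 1 +
      (if i < d v then (\<lambda>u. ev (forp (slots \<kappa> (d (lowend v u))) (wedge \<kappa> v u D)) st) (nbr v (i + 1)) else 0))
      / real ?r"
    unfolding edge_def using rounds_pos_iff[of v] assms
    by (subst ev_uniform) (auto simp: Let_def intro!: sum.cong arg_cong[where f = "\<lambda>x. x / _"])
  also have "\<dots> = (real ?r + (\<Sum>u\<in>N v. ev (forp (slots \<kappa> (d (lowend v u))) (wedge \<kappa> v u D)) st)) / real ?r"
    unfolding sum.distrib
      sum_slots[OF rounds_ge[OF g], of v "\<lambda>u. ev (forp (slots \<kappa> (d (lowend v u))) (wedge \<kappa> v u D)) st"]
    by simp
  finally show ?thesis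
    using g rounds_pos_iff[of v] assms by (simp add: field_simps)
qed

lemma fin_expl [simp]: "fin (expl \<kappa> g R v D)"
  by (cases "d v = 0") (auto simp: expl_def forp_def g)

lemma ev_expl_vl:
  "ev (expl \<kappa> g R v D) vl = R / (g * \<kappa>) * (\<Sum>(u, w)\<in>TP v. ev (D v u w) vl)"
proof (cases "d v = 0")
  case True
  then have "N v = {}" by (rule N_empty)
  then show ?thesis by (simp add: expl_def forp_def tick_def True g TP_def)
next
  case False
  have "ev (expl \<kappa> g R v D) vl = R * (rounds g (d v) * ev (edge \<kappa> g v D) vl)"
    using False by (simp add: expl_def)
  also have "rounds g (d v) * ev (edge \<kappa> g v D) vl
      = (\<Sum>u\<in>N v. slots \<kappa> (d (lowend v u)) * ev (wedge \<kappa> v u D) vl) / g"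
    using False by (subst ev_edge_zero) simp_all
  also have "(\<Sum>u\<in>N v. slots \<kappa> (d (lowend v u)) * ev (wedge \<kappa> v u D) vl)
      = (\<Sum>u\<in>N v. (\<Sum>w\<in>W v u. ev (D v u w) vl) / \<kappa>)"
    by (intro sum.cong refl, subst ev_wedge_zero) simp_all
  also have "\<dots> = (\<Sum>(u, w)\<in>TP v. ev (D v u w) vl) / \<kappa>"
    by (simp add: TP_def sum.Sigma sum_divide_distrib[symmetric])
  finally show ?thesis by (simp add: field_simps)
qed

text \<open>Edge draws are independent, so the second moment of a single one decides. Given the edge
  from v to u, it is at most c q / \<kappa> + (c p / \<kappa>)^2 with c =
  \<open>card (W v u)\<close>. The square accounts for hits that share the edge; one of its factors
  c is bounded by \<beta>, and summing over u turns the other into \<open>tv v\<close>.\<close>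

lemma ev_expl_sq:
  assumes p: "\<And>u w. (u, w) \<in> TP v \<Longrightarrow> ev (D v u w) vl \<le> p"
    and q: "\<And>u w. (u, w) \<in> TP v \<Longrightarrow> ev (D v u w) (\<lambda>x. (vl x)\<^sup>2) \<le> q"
    and \<beta>: "\<And>u. real (card (W v u)) \<le> \<beta>" and "0 \<le> p" "0 \<le> q"
  shows "ev (expl \<kappa> g R v D) (\<lambda>x. (vl x)\<^sup>2)
    \<le> R / (g * \<kappa>) * tv v * (q + \<beta> * p\<^sup>2 / \<kappa>) + (ev (expl \<kappa> g R v D) vl)\<^sup>2"
proof (cases "d v = 0")
  case True
  have "ev (expl \<kappa> g R v D) (\<lambda>x. (vl x)\<^sup>2) = 0" by (simp add: expl_def forp_def tick_def True g)
  moreover have "0 \<le> \<beta>" using \<beta>[of 0] by (meson of_nat_0_le_iff order_trans)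
  ultimately show ?thesis using assms(4,5) by simp
next
  case False
  let ?s = "\<lambda>u. slots \<kappa> (d (lowend v u))"
  let ?c = "\<lambda>u. real (card (W v u))"
  have w: "ev (tick (forp (?s u) (wedge \<kappa> v u D))) (\<lambda>x. (vl x)\<^sup>2) \<le> ?c u * ((q + \<beta> * p\<^sup>2 / \<kappa>) / \<kappa>)"
    if u: "u \<in> N v" for u
  proof -
    have tp: "(u, w) \<in> TP v" if "w \<in> W v u" for w using u that by (simp add: TP_def)
    have "?s u * ev (wedge \<kappa> v u D) (\<lambda>x. (vl x)\<^sup>2) = (\<Sum>w\<in>W v u. ev (D v u w) (\<lambda>x. (vl x)\<^sup>2)) / \<kappa>"
      by (subst ev_wedge_zero[OF u]) simp_all
    also have "\<dots> \<le> (\<Sum>w\<in>W v u. q) / \<kappa>" by (intro divide_right_mono sum_mono q tp) auto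
    finally have 1: "?s u * ev (wedge \<kappa> v u D) (\<lambda>x. (vl x)\<^sup>2) \<le> ?c u * q / \<kappa>" by simp
    have e: "?s u * ev (wedge \<kappa> v u D) vl = (\<Sum>w\<in>W v u. ev (D v u w) vl) / \<kappa>"
      by (subst ev_wedge_zero[OF u]) simp_all
    also have "\<dots> \<le> (\<Sum>w\<in>W v u. p) / \<kappa>" by (intro divide_right_mono sum_mono p tp) auto
    finally have "?s u * ev (wedge \<kappa> v u D) vl \<le> ?c u * p / \<kappa>" by simp
    moreover have "0 \<le> ?s u * ev (wedge \<kappa> v u D) vl" by (intro mult_nonneg_nonneg ev_nonneg) auto
    ultimately have "(?s u * ev (wedge \<kappa> v u D) vl)\<^sup>2 \<le> (?c u * p / \<kappa>)\<^sup>2" by (intro power_mono)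
    also have "\<dots> = ?c u * (?c u * (p\<^sup>2 / \<kappa>\<^sup>2))" by (simp add: power2_eq_square)
    also have "\<dots> \<le> ?c u * (\<beta> * (p\<^sup>2 / \<kappa>\<^sup>2))"
      by (rule mult_left_mono, rule mult_right_mono[OF \<beta>]) simp_all
    finally have 2: "(?s u * ev (wedge \<kappa> v u D) vl)\<^sup>2 \<le> ?c u * (\<beta> * (p\<^sup>2 / \<kappa>\<^sup>2))" .
    have "ev (tick (forp (?s u) (wedge \<kappa> v u D))) (\<lambda>x. (vl x)\<^sup>2)
        \<le> ?c u * q / \<kappa> + ?c u * (\<beta> * (p\<^sup>2 / \<kappa>\<^sup>2))"
      using ev_forp_sq[OF fin_wedge, of "?s u" v u] 1 2 unfolding ev_tick_sq by linarith
    also have "\<dots> = ?c u * ((q + \<beta> * p\<^sup>2 / \<kappa>) / \<kappa>)"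
      using \<kappa> by (simp add: field_simps power2_eq_square)
    finally show ?thesis .
  qed
  have "ev (expl \<kappa> g R v D) (\<lambda>x. (vl x)\<^sup>2)
      \<le> R * (rounds g (d v) * ev (edge \<kappa> g v D) (\<lambda>x. (vl x)\<^sup>2)) + (ev (expl \<kappa> g R v D) vl)\<^sup>2"
    using ev_forp_sq[of "edge \<kappa> g v D" "R * rounds g (d v)"] False by (simp add: expl_def mult_ac)
  also have "rounds g (d v) * ev (edge \<kappa> g v D) (\<lambda>x. (vl x)\<^sup>2)
      = (\<Sum>u\<in>N v. ev (tick (forp (?s u) (wedge \<kappa> v u D))) (\<lambda>x. (vl x)\<^sup>2)) / g"
    using False by (subst ev_edge_zero) simp_all
  also have "R * ((\<Sum>u\<in>N v. ev (tick (forp (?s u) (wedge \<kappa> v u D))) (\<lambda>x. (vl x)\<^sup>2)) / g)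
        + (ev (expl \<kappa> g R v D) vl)\<^sup>2
      \<le> R * ((\<Sum>u\<in>N v. ?c u * ((q + \<beta> * p\<^sup>2 / \<kappa>) / \<kappa>)) / g) + (ev (expl \<kappa> g R v D) vl)\<^sup>2"
    by (intro add_right_mono mult_left_mono divide_right_mono sum_mono w) auto
  also have "(\<Sum>u\<in>N v. ?c u * ((q + \<beta> * p\<^sup>2 / \<kappa>) / \<kappa>)) = tv v * ((q + \<beta> * p\<^sup>2 / \<kappa>) / \<kappa>)"
    unfolding tv_eq of_nat_sum sum_distrib_right ..
  finally have "ev (expl \<kappa> g R v D) (\<lambda>x. (vl x)\<^sup>2)
      \<le> R * (tv v * ((q + \<beta> * p\<^sup>2 / \<kappa>) / \<kappa>) / g) + (ev (expl \<kappa> g R v D) vl)\<^sup>2"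
    .
  then show ?thesis by (simp add: field_simps)
qed

text \<open>The terms are, in order: entering the loop, its passes, constant work per drawn edge,
  and work per wedge draw, where h is paid only at actual triangles.\<close>

lemma ev_expl_st:
  fixes h :: real
  assumes h: "\<And>u w. (u, w) \<in> TP v \<Longrightarrow> ev (D v u w) st \<le> h"
  shows "ev (expl \<kappa> g R v D) st \<le> 2 + 2 * (R * rounds g (d v)) + 3 * (R / g) * d v
     + R / (g * \<kappa>) * (2 * mindeg_sum v + tv v * h)"
proof (cases "d v = 0")
  case True
  then have "N v = {}" by (rule N_empty)
  then show ?thesis using True by (simp add: expl_def forp_def tick_def g TP_def mindeg_sum_def)
next
  case False
  let ?s = "\<lambda>u. slots \<kappa> (d (lowend v u))"
  have w: "ev (forp (?s u) (wedge \<kappa> v u D)) st \<le> 3 + 2 * real (min (d u) (d v)) / \<kappa> + card (W v u) * h / \<kappa>"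
    if u: "u \<in> N v" for u
  proof -
    have "(\<Sum>w\<in>W v u. ev (D v u w) st) \<le> (\<Sum>w\<in>W v u. h)"
      using u by (intro sum_mono h) (simp add: TP_def)
    then have "(\<Sum>w\<in>W v u. ev (D v u w) st) / \<kappa> \<le> card (W v u) * h / \<kappa>"
      by (intro divide_right_mono) auto
    moreover have "real (?s u) \<le> real (min (d u) (d v)) / \<kappa> + 1"
      using slots_real_le d_lowend by metis
    ultimately show ?thesis using ev_wedge_st[OF u] by (simp add: distrib_left)
  qed
  have "ev (expl \<kappa> g R v D) st = 2 + R * rounds g (d v) + R * (rounds g (d v) * ev (edge \<kappa> g v D) st)"
    using False by (simp add: expl_def algebra_simps)
  also have "\<dots> = 2 + 2 * (R * rounds g (d v))
      + R / g * (\<Sum>u\<in>N v. ev (forp (?s u) (wedge \<kappa> v u D)) st)"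
    using False by (simp add: ev_edge_st algebra_simps)
  also have "\<dots> \<le> 2 + 2 * (R * rounds g (d v)) + R / g * (\<Sum>u\<in>N v. 3 + 2 * real (min (d u) (d v)) / \<kappa> + card (W v u) * h / \<kappa>)"
    by (intro add_left_mono mult_left_mono sum_mono w) auto
  also have "(\<Sum>u\<in>N v. 3 + 2 * real (min (d u) (d v)) / \<kappa> + card (W v u) * h / \<kappa>) = 3 * d v + (2 * mindeg_sum v + tv v * h) / \<kappa>"
    by (simp add: sum.distrib card_N mindeg_sum_def tv_eq sum_distrib_right sum_divide_distrib
        add_divide_distrib sum_distrib_left)
  finally have "ev (expl \<kappa> g R v D) st \<le> 2 + 2 * (R * rounds g (d v))
      + R / g * (3 * d v + (2 * mindeg_sum v + tv v * h) / \<kappa>)" .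
  then show ?thesis by (simp add: add_divide_distrib distrib_left mult_ac)
qed

end

end

section \<open>Weighted triangle counts\<close>

definition bernoulli_like :: "outcome pmf \<Rightarrow> bool" where
  "bernoulli_like D \<longleftrightarrow> fin D \<and> (\<forall>x\<in>set_pmf D. fst x \<in> {0, 1})"

lemma ev_bernoulli_like:
  assumes "bernoulli_like D"
  shows "ev D (\<lambda>x. f (fst x)) = (1 - ev D vl) * f 0 + ev D vl * f 1"
proof -
  have D: "fin D" "\<And>x. x \<in> set_pmf D \<Longrightarrow> fst x = 0 \<or> fst x = 1" using assms by (auto simp: bernoulli_like_def)
  have "ev D (\<lambda>x. f (fst x)) = ev D (\<lambda>x. f 0 + (f 1 - f 0) * vl x)"
    by (rule ev_cong) (use D(2) in force)
  also have "\<dots> = f 0 + (f 1 - f 0) * ev D vl" using D(1) by (simp add: ev_add)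
  finally show ?thesis by (simp add: algebra_simps)
qed

lemma bernoulli_like_01:
  assumes "bernoulli_like D"
  shows "0 \<le> ev D vl" "ev D vl \<le> 1"
proof -
  show "0 \<le> ev D vl" by (rule ev_nonneg) simp
  have "ev D vl \<le> ev D (\<lambda>_. 1)" by (rule ev_mono) (use assms in \<open>force simp: bernoulli_like_def\<close>)+
  then show "ev D vl \<le> 1" by simp
qed

text \<open>For labels 0 and 1: as 6 is divisible by 1, 2 and 3, a triangle with i light vertices
  can give each of them 6/i, so the credits are natural numbers with sum 6.\<close>

definition share :: "nat \<Rightarrow> nat \<Rightarrow> nat \<Rightarrow> nat" where
  "share a b c = (if 0 < a then 6 div (a + b + c) else 0)"

definition vote :: "outcome pmf \<Rightarrow> outcome pmf \<Rightarrow> outcome pmf \<Rightarrow> outcome pmf" where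
  "vote A B C = bind_pmf A (\<lambda>(a, wa, ka). bind_pmf B (\<lambda>(b, wb, kb).
     map_pmf (\<lambda>(c, wc, kc). (share a b c, wa + wb + wc + 1, ka + kb + kc)) C))"

lemma fin_vote [simp]: "fin A \<Longrightarrow> fin B \<Longrightarrow> fin C \<Longrightarrow> fin (vote A B C)"
  by (auto simp: vote_def split: prod.splits)

text \<open>Meant for f the identity and the square. The three summands are the cases of one, two
  and three light vertices.\<close>

lemma ev_vote:
  assumes "bernoulli_like A" "bernoulli_like B" "bernoulli_like C"
  defines "p \<equiv> ev A vl" and "q \<equiv> ev B vl" and "r \<equiv> ev C vl"
  assumes "f 0 = 0"
  shows "ev (vote A B C) (\<lambda>x. f (fst x))
    = p * ((1 - q) * (1 - r) * f 6 + (q * (1 - r) + (1 - q) * r) * f 3 + q * r * f 2)"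
proof -
  have fin: "fin A" "fin B" "fin C" using assms by (auto simp: bernoulli_like_def)
  have "ev (vote A B C) (\<lambda>x. f (fst x)) = ev A (\<lambda>a. ev B (\<lambda>b. ev C (\<lambda>c. f (share (fst a) (fst b) (fst c)))))"
    using fin by (simp add: vote_def ev_bind case_prod_unfold)
  also have "\<dots> = ev A (\<lambda>a. ev B (\<lambda>b. (1 - r) * f (share (fst a) (fst b) 0) + r * f (share (fst a) (fst b) 1)))"
    unfolding r_def by (subst ev_bernoulli_like[OF assms(3)]) simp
  also have "\<dots> = ev A (\<lambda>a. (1 - q) * ((1 - r) * f (share (fst a) 0 0) + r * f (share (fst a) 0 1))
      + q * ((1 - r) * f (share (fst a) 1 0) + r * f (share (fst a) 1 1)))"
    unfolding q_def by (subst ev_bernoulli_like[OF assms(2), where f = "\<lambda>b. (1 - r) * f (share _ b 0) + r * f (share _ b 1)"]) simp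
  also have "\<dots> = (1 - p) * 0 + p * ((1 - q) * ((1 - r) * f (share 1 0 0) + r * f (share 1 0 1))
      + q * ((1 - r) * f (share 1 1 0) + r * f (share 1 1 1)))"
    unfolding p_def by (subst ev_bernoulli_like[OF assms(1), where f = "\<lambda>a. (1 - q) * ((1 - r) * f (share a 0 0) + r * f (share a 0 1))
      + q * ((1 - r) * f (share a 1 0) + r * f (share a 1 1))"]) (simp add: share_def assms(7))
  finally show ?thesis by (simp add: share_def algebra_simps flip: numeral_2_eq_2)
qed

lemma ev_vote_st:
  assumes "fin A" "fin B" "fin C"
  shows "ev (vote A B C) st = ev A st + ev B st + ev C st + 1"
  using assms by (simp add: vote_def ev_bind case_prod_unfold ev_add)

context qgraph begin

definition unit_hit :: "nat \<Rightarrow> nat \<Rightarrow> nat \<Rightarrow> outcome pmf" where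
  "unit_hit v u w = return_pmf (1, 0, 0)"

text \<open>Vertices above the degree cap are rejected without exploration; this bounds the expected
  cost of a test in terms of the cap instead of the degree.\<close>

definition light :: "nat \<Rightarrow> nat \<Rightarrow> nat \<Rightarrow> nat \<Rightarrow> nat \<Rightarrow> nat \<Rightarrow> outcome pmf" where
  "light \<kappa> g R dcap thr z = (if dcap < d z then return_pmf (0, 1, 0)
     else map_pmf (\<lambda>(x, w, k). (of_bool (x < thr), w + 1, k)) (expl \<kappa> g R z unit_hit))"

text \<open>All three labels are drawn anew at each hit and nothing is remembered, so repeated draws
  stay independent and a label is described by its probability alone.\<close>

definition hit :: "nat \<Rightarrow> nat \<Rightarrow> nat \<Rightarrow> nat \<Rightarrow> nat \<Rightarrow> nat \<Rightarrow> nat \<Rightarrow> nat \<Rightarrow> outcome pmf" where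
  "hit \<kappa> g R dcap thr v u w =
     vote (light \<kappa> g R dcap thr v) (light \<kappa> g R dcap thr u) (light \<kappa> g R dcap thr w)"

definition mainv :: "nat \<Rightarrow> nat \<Rightarrow> nat \<Rightarrow> nat \<Rightarrow> nat \<Rightarrow> outcome pmf" where
  "mainv \<kappa> g R dcap thr = bind_pmf (pmf_of_set V)
     (\<lambda>v. map_pmf (\<lambda>x. (0, 1, 1) + x) (expl \<kappa> g R v (hit \<kappa> g R dcap thr)))"

lemma scaled_abs_le_iff: "0 < (f::real) \<Longrightarrow> c / f \<le> \<bar>x - S / f\<bar> \<longleftrightarrow> c \<le> \<bar>x * f - S\<bar>"
proof -
  assume f: "0 < f"
  have "x * f - S = (x - S / f) * f" using f by (simp add: algebra_simps)
  then have "\<bar>x * f - S\<bar> = \<bar>x - S / f\<bar> * f" using f by (simp only: abs_mult abs_of_pos)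
  then show ?thesis by (simp only: pos_divide_le_eq[OF f])
qed

text \<open>\<open>A\<close> is the inverse of the rate at which a triangle is found at one of its vertices.\<close>

context
  fixes \<kappa> g R dcap thr \<tau> :: nat and A \<theta> :: real
  assumes pos: "0 < \<kappa>" "0 < g" "0 < R" "0 < \<tau>" "0 < n"
  defines "A \<equiv> g * \<kappa> / R"
  assumes A: "\<tau>\<^sup>2 / 2 \<le> A" "A \<le> 2 * \<tau>\<^sup>2" and gR: "g = 1 \<or> R \<le> 2"
begin

abbreviation "lightp \<equiv> light \<kappa> g R dcap thr"
abbreviation "hitp \<equiv> hit \<kappa> g R dcap thr"
abbreviation "pl z \<equiv> ev (lightp z) vl"

lemma A_pos: "0 < A" using pos by (simp add: A_def)

lemma invA: "R / (g * \<kappa>) = 1 / A" by (simp add: A_def)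

lemma invA_le: "1 / A \<le> 2 / \<tau>\<^sup>2"
  using A(1) A_pos pos by (simp add: field_simps)

lemma Rg_le: "R / g \<le> 2 * \<kappa> / \<tau>\<^sup>2"
proof -
  have "R / g = \<kappa> * (1 / A)" using pos by (simp add: A_def)
  also have "\<dots> \<le> \<kappa> * (2 / \<tau>\<^sup>2)" by (intro mult_left_mono invA_le) auto
  finally show ?thesis by (simp add: mult.commute)
qed

lemma fin_unit_hit [simp]: "fin (unit_hit v u w)" by (simp add: unit_hit_def)

lemma fin_expl_unit [simp]: "fin (expl \<kappa> g R z unit_hit)"
  using pos by (intro fin_expl) auto

lemma fin_light [simp]: "fin (lightp z)" by (simp add: light_def)

lemma light_bernoulli: "bernoulli_like (lightp z)"
  by (auto simp: bernoulli_like_def light_def)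

lemma fin_hit [simp]: "fin (hitp v u w)" by (simp add: hit_def)

lemma fin_expl_hit [simp]: "fin (expl \<kappa> g R v hitp)"
  using pos by (intro fin_expl) auto

lemma finite_V_ne: "V \<noteq> {}" using pos by auto

lemma fin_mainv [simp]: "fin (mainv \<kappa> g R dcap thr)"
  using finite_V_ne by (simp add: mainv_def)

lemma ev_hit_vl:
  "ev (hitp v u w) vl = pl v * (6 * (1 - pl u) * (1 - pl w) + 3 * (pl u * (1 - pl w) + (1 - pl u) * pl w)
     + 2 * pl u * pl w)"
  unfolding hit_def using ev_vote[OF light_bernoulli light_bernoulli light_bernoulli, of real v u w]
  by (simp add: algebra_simps)

lemma pl_01: "0 \<le> pl z" "pl z \<le> 1"
  using bernoulli_like_01[OF light_bernoulli] by auto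

lemma ev_hit_vl_le: "ev (hitp v u w) vl \<le> 6 * pl v"
proof -
  let ?q = "pl u" and ?r = "pl w"
  have "6 * (1 - ?q) * (1 - ?r) + 3 * (?q * (1 - ?r) + (1 - ?q) * ?r) + 2 * ?q * ?r = 6 - 3 * ?q - 3 * ?r + 2 * (?q * ?r)"
    by (simp add: algebra_simps)
  also have "\<dots> \<le> 6" using pl_01[of u] pl_01[of w] mult_left_le[of ?r ?q] by linarith
  finally have "pl v * (6 * (1 - ?q) * (1 - ?r) + 3 * (?q * (1 - ?r) + (1 - ?q) * ?r) + 2 * ?q * ?r) \<le> pl v * 6"
    by (intro mult_left_mono pl_01)
  then show ?thesis unfolding ev_hit_vl by simp
qed

lemma ev_hit_sq_le: "ev (hitp v u w) (\<lambda>x. (vl x)\<^sup>2) \<le> 36 * pl v"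
proof -
  let ?q = "pl u" and ?r = "pl w"
  have "ev (hitp v u w) (\<lambda>x. (vl x)\<^sup>2)
    = pl v * ((1 - ?q) * (1 - ?r) * 36 + (?q * (1 - ?r) + (1 - ?q) * ?r) * 9 + ?q * ?r * 4)"
    unfolding hit_def using ev_vote[OF light_bernoulli light_bernoulli light_bernoulli, of "\<lambda>x. (real x)\<^sup>2" v u w]
    by simp
  also have "(1 - ?q) * (1 - ?r) * 36 + (?q * (1 - ?r) + (1 - ?q) * ?r) * 9 + ?q * ?r * 4
      = 36 - 27 * ?q - 27 * ?r + 22 * (?q * ?r)"
    by (simp add: algebra_simps)
  also have "pl v * \<dots> \<le> pl v * 36"
    using pl_01[of u] pl_01[of w] mult_left_le[of ?r ?q] by (intro mult_left_mono pl_01) linarith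
  finally show ?thesis by simp
qed

text \<open>The votes at the three vertices are different experiments, but expectations add. For
  fixed labels the shares sum to 6 if some vertex is light and to 0 otherwise, so the result is 6
  times the probability that one of three independent labels is light.\<close>

lemma ev_hit_sum:
  "ev (hitp a b c) vl + ev (hitp b a c) vl + ev (hitp c a b) vl
    = 6 * (1 - (1 - pl a) * (1 - pl b) * (1 - pl c))"
  unfolding ev_hit_vl by (simp add: algebra_simps)

text \<open>The number around which the estimate concentrates. It falls short of t only by the
  chance that all three labels of a triangle come out heavy.\<close>

definition Sm :: real where
  "Sm = (\<Sum>(a, b, c)\<in>OT. 1 - (1 - pl a) * (1 - pl b) * (1 - pl c))"

lemma Sm_term: "0 \<le> (1 - pl a) * (1 - pl b) * (1 - pl c)" "(1 - pl a) * (1 - pl b) * (1 - pl c) \<le> 1"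
  using pl_01[of a] pl_01[of b] pl_01[of c] by (auto intro!: mult_nonneg_nonneg mult_le_one)

lemma Sm_le: "Sm \<le> t"
proof -
  have "Sm \<le> (\<Sum>(a, b, c)\<in>OT. 1)" unfolding Sm_def by (intro sum_mono) (auto simp: Sm_term)
  then show ?thesis by (simp add: case_prod_unfold card_OT)
qed

text \<open>Serves the value and its square with c = 0 and the steps with c = 1.\<close>

lemma ev_mainv:
  assumes h: "\<And>x. h ((0, 1, 1) + x) = c + h x"
  shows "ev (mainv \<kappa> g R dcap thr) h = c + (\<Sum>v\<in>V. ev (expl \<kappa> g R v hitp) h) / n"
proof -
  have "ev (mainv \<kappa> g R dcap thr) h = (\<Sum>v\<in>V. ev (expl \<kappa> g R v hitp) (\<lambda>x. h ((0, 1, 1) + x))) / real (card V)"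
    unfolding mainv_def using finite_V_ne
    by (subst ev_bind) (auto simp: integral_pmf_of_set)
  also have "(\<Sum>v\<in>V. ev (expl \<kappa> g R v hitp) (\<lambda>x. h ((0, 1, 1) + x))) = (\<Sum>v\<in>V. c + ev (expl \<kappa> g R v hitp) h)"
    unfolding h by (simp add: ev_add)
  also have "\<dots> = n * c + (\<Sum>v\<in>V. ev (expl \<kappa> g R v hitp) h)"
    by (simp add: sum.distrib)
  finally show ?thesis using pos by (simp add: add_divide_distrib)
qed

lemma ev_mainv_vl: "ev (mainv \<kappa> g R dcap thr) vl = 6 * Sm / (n * A)"
proof -
  have e: "ev (expl \<kappa> g R v hitp) vl = 1 / A * (\<Sum>(u, w)\<in>TP v. ev (hitp v u w) vl)" for v
    unfolding invA[symmetric] by (rule ev_expl_vl) (use pos in auto)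
  have "ev (mainv \<kappa> g R dcap thr) vl = (\<Sum>v\<in>V. ev (expl \<kappa> g R v hitp) vl) / n"
    using ev_mainv[of vl 0] by simp
  also have "(\<Sum>v\<in>V. ev (expl \<kappa> g R v hitp) vl) = 1 / A * (\<Sum>v\<in>V. \<Sum>(u, w)\<in>TP v. ev (hitp v u w) vl)"
    unfolding e sum_distrib_left ..
  also have "(\<Sum>v\<in>V. \<Sum>(u, w)\<in>TP v. ev (hitp v u w) vl) = (\<Sum>(a, b, c)\<in>OT. 6 * (1 - (1 - pl a) * (1 - pl b) * (1 - pl c)))"
    unfolding sum_TP ev_hit_sum ..
  also have "\<dots> = 6 * Sm" unfolding Sm_def by (simp add: sum_distrib_left case_prod_unfold)
  finally show ?thesis by (simp add: field_simps)
qed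

text \<open>Rounding up can add R passes. That is a constant if R \<le> 2, and for g = 1 nothing is
  rounded; hence the two cases of \<open>gR\<close>. All rates are then replaced by multiples of
  1/\<tau>^2.\<close>

lemma ev_expl_st_le:
  fixes h :: real
  assumes D: "\<And>v u w. fin (D v u w)" and h: "\<And>u w. (u, w) \<in> TP v \<Longrightarrow> ev (D v u w) st \<le> h"
    and "0 \<le> h"
  shows "ev (expl \<kappa> g R v D) st \<le> 6 + (10 * \<kappa> * d v + 4 * mindeg_sum v + 2 * tv v * h) / \<tau>\<^sup>2"
proof -
  have r: "real (R * rounds g (d v)) \<le> R / g * d v + 2"
    using gR
  proof
    assume "g = 1" then show ?thesis by simp
  next
    assume "R \<le> 2"
    have "real (R * rounds g (d v)) = R * real (rounds g (d v))" by simp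
    also have "\<dots> \<le> R * (real (d v) / g + 1)" using pos by (intro mult_left_mono rounds_real_le) auto
    also have "\<dots> \<le> R / g * d v + 2" using \<open>R \<le> 2\<close> by (simp add: algebra_simps)
    finally show ?thesis .
  qed
  have "ev (expl \<kappa> g R v D) st \<le> 2 + 2 * (R * rounds g (d v)) + 3 * (R / g) * d v
     + 1 / A * (2 * mindeg_sum v + tv v * h)"
    using ev_expl_st[of \<kappa> g R D v h] pos D h unfolding invA by auto
  moreover have "2 + 2 * real (R * rounds g (d v)) + 3 * (R / g) * d v \<le> 6 + 5 * (R / g) * d v"
    using r by linarith
  then have "2 + 2 * (R * rounds g (d v)) + 3 * (R / g) * d v + 1 / A * (2 * mindeg_sum v + tv v * h)
      \<le> 6 + 5 * (R / g) * d v + 1 / A * (2 * mindeg_sum v + tv v * h)"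
    by simp
  moreover have "6 + 5 * (R / g) * d v + 1 / A * (2 * mindeg_sum v + tv v * h) \<le> 6 + 5 * (2 * \<kappa> / \<tau>\<^sup>2) * d v + 2 / \<tau>\<^sup>2 * (2 * mindeg_sum v + tv v * h)"
    using \<open>0 \<le> h\<close> by (intro add_mono mult_right_mono mult_left_mono Rg_le invA_le) auto
  moreover have "6 + 5 * (2 * \<kappa> / \<tau>\<^sup>2) * d v + 2 / \<tau>\<^sup>2 * (2 * mindeg_sum v + tv v * h)
      = 6 + (10 * \<kappa> * d v + 4 * mindeg_sum v + 2 * tv v * h) / \<tau>\<^sup>2"
    by (simp add: add_divide_distrib distrib_left mult_ac)
  ultimately show ?thesis by linarith
qed

text \<open>Bound for the expected cost of one lightness test, obtained from d z \<le> dcap and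
  \<open>mindeg_sum_le\<close>.\<close>

definition ell :: real where "ell = 7 + (10 * \<kappa> + 4 * sqrt (2 * m)) * dcap / \<tau>\<^sup>2"

lemma ell_nonneg: "0 \<le> ell" by (simp add: ell_def)

lemma ev_light_st: "ev (lightp z) st \<le> ell"
proof (cases "dcap < d z")
  case True
  have "0 \<le> (10 * \<kappa> + 4 * sqrt (2 * m)) * dcap / \<tau>\<^sup>2" by simp
  then show ?thesis using True by (simp add: light_def ell_def)
next
  case False
  have "ev (lightp z) st = ev (expl \<kappa> g R z unit_hit) st + 1"
    using False by (simp add: light_def case_prod_unfold ev_add)
  also have "ev (expl \<kappa> g R z unit_hit) st \<le> 6 + (10 * \<kappa> * d z + 4 * mindeg_sum z + 2 * tv z * 0) / \<tau>\<^sup>2"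
    using ev_expl_st_le[of unit_hit z 0] by (simp add: unit_hit_def)
  also have "\<dots> \<le> 6 + (10 * \<kappa> * dcap + 4 * (dcap * sqrt (2 * m))) / \<tau>\<^sup>2"
  proof -
    have "real (mindeg_sum z) \<le> d z * sqrt (2 * m)" by (rule mindeg_sum_le)
    also have "\<dots> \<le> dcap * sqrt (2 * m)" using False by (intro mult_right_mono) auto
    finally have "4 * real (mindeg_sum z) \<le> 4 * (dcap * sqrt (2 * m))" by simp
    moreover have "10 * \<kappa> * real (d z) \<le> 10 * \<kappa> * real dcap" using False by (intro mult_left_mono) auto
    ultimately show ?thesis by (intro add_left_mono divide_right_mono) auto
  qed
  also have "\<dots> + 1 = ell" by (simp add: ell_def algebra_simps)
  finally show ?thesis by simp
qed

lemma ev_hit_st: "ev (hitp v u w) st \<le> 1 + 3 * ell"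
  unfolding hit_def using ev_light_st[of v] ev_light_st[of u] ev_light_st[of w] by (subst ev_vote_st) auto

text \<open>The last term is the price of the lightness tests: a sample makes 3t / (nA) hits on
  average, and every hit runs three tests.\<close>

lemma ev_mainv_st:
  "ev (mainv \<kappa> g R dcap thr) st
    \<le> 7 + (20 * \<kappa> * m + 8 * m * sqrt (2 * m) + 6 * t * (1 + 3 * ell)) / (n * \<tau>\<^sup>2)"
proof -
  define h where "h = 1 + 3 * ell"
  have h: "0 \<le> h" using ell_nonneg by (simp add: h_def)
  have sums: "(\<Sum>v\<in>V. real (d v)) = 2 * m" "(\<Sum>v\<in>V. real (tv v)) = 3 * t"
    unfolding of_nat_sum[symmetric] sum_degree sum_tv by simp_all
  have e: "ev (expl \<kappa> g R v hitp) st
      \<le> 6 + ((10 * \<kappa>) * real (d v) + 4 * real (mindeg_sum v) + (2 * h) * real (tv v)) / \<tau>\<^sup>2" for v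
  proof -
    have "ev (expl \<kappa> g R v hitp) st \<le> 6 + (10 * \<kappa> * d v + 4 * mindeg_sum v + 2 * tv v * h) / \<tau>\<^sup>2"
      by (rule ev_expl_st_le[OF fin_hit ev_hit_st[folded h_def] h])
    also have "10 * \<kappa> * d v + 4 * mindeg_sum v + 2 * tv v * h
        = (10 * \<kappa>) * real (d v) + 4 * real (mindeg_sum v) + (2 * h) * real (tv v)"
      by simp
    finally show ?thesis .
  qed
  have "ev (mainv \<kappa> g R dcap thr) st = 1 + (\<Sum>v\<in>V. ev (expl \<kappa> g R v hitp) st) / n"
    using ev_mainv[of st 1] by simp
  also have "\<dots> \<le> 1 + (\<Sum>v\<in>V. 6 + ((10 * \<kappa>) * real (d v) + 4 * real (mindeg_sum v) + (2 * h) * real (tv v)) / \<tau>\<^sup>2) / n"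
    by (intro add_left_mono divide_right_mono sum_mono e) auto
  also have "\<dots> = 1 + (6 * real n + ((10 * \<kappa>) * (2 * m) + 4 * (\<Sum>v\<in>V. real (mindeg_sum v))
      + (2 * h) * (3 * t)) / \<tau>\<^sup>2) / n"
    unfolding sum.distrib sum_divide_distrib[symmetric] sum_distrib_left[symmetric] sums by simp
  also have "\<dots> \<le> 1 + (6 * real n + ((10 * \<kappa>) * (2 * m) + 4 * (2 * m * sqrt (2 * m))
      + (2 * h) * (3 * t)) / \<tau>\<^sup>2) / n"
    by (intro add_left_mono add_right_mono divide_right_mono mult_left_mono sum_mindeg_sum_le) auto
  also have "\<dots> = 7 + ((10 * \<kappa>) * (2 * m) + 4 * (2 * m * sqrt (2 * m)) + (2 * h) * (3 * t)) / (n * \<tau>\<^sup>2)"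
  proof -
    have "1 + (6 * real n + z / \<tau>\<^sup>2) / n = 7 + z / (n * \<tau>\<^sup>2)" for z
      using pos by (simp add: add_divide_distrib mult.commute)
    then show ?thesis .
  qed
  also have "(10 * \<kappa>) * (2 * m) + 4 * (2 * m * sqrt (2 * m)) + (2 * h) * (3 * t)
      = 20 * \<kappa> * m + 8 * m * sqrt (2 * m) + 6 * t * h" by simp
  finally show ?thesis unfolding h_def .
qed

subsection \<open>Detecting heavy vertices\<close>

context
  assumes \<kappa>m: "sqrt (2 * m) \<le> 3 * \<kappa>"
    and thr: "\<And>x::nat. x < thr \<longleftrightarrow> x * A < 2 * (\<theta> * \<tau>\<^sup>2)" and \<theta>: "32 \<le> \<theta>"
begin

lemma beta_le: "sqrt (2 * m) / \<kappa> \<le> 3" using \<kappa>m pos by (simp add: field_simps)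

lemma theta_pos: "0 < \<theta> * \<tau>\<^sup>2" using \<theta> pos by simp

lemma ev_unit_vl: "ev (expl \<kappa> g R z unit_hit) vl = tv z / A"
  using ev_expl_vl[of \<kappa> g R unit_hit z] pos unfolding invA by (simp add: unit_hit_def case_prod_unfold)

text \<open>With p = q = 1 the term for hits sharing an edge is sqrt (2m) / \<kappa> \<le> 3, so the
  variance is at most 4 times the mean.\<close>

lemma ev_unit_sq:
  "ev (expl \<kappa> g R z unit_hit) (\<lambda>x. (vl x)\<^sup>2) \<le> 4 * tv z / A + (ev (expl \<kappa> g R z unit_hit) vl)\<^sup>2"
proof -
  have "ev (expl \<kappa> g R z unit_hit) (\<lambda>x. (vl x)\<^sup>2)
      \<le> 1 / A * tv z * (1 + sqrt (2 * m) * 1\<^sup>2 / \<kappa>) + (ev (expl \<kappa> g R z unit_hit) vl)\<^sup>2"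
    unfolding invA[symmetric] using pos
    by (intro ev_expl_sq card_W_le) (auto simp: unit_hit_def)
  also have "1 / A * tv z * (1 + sqrt (2 * m) * 1\<^sup>2 / \<kappa>) \<le> 1 / A * tv z * 4"
    using beta_le A_pos by (intro mult_left_mono) auto
  finally show ?thesis by (simp add: mult_ac)
qed

lemma chebyshev_unit:
  "0 < a \<Longrightarrow> measure_pmf.prob (expl \<kappa> g R z unit_hit) {x. a \<le> \<bar>vl x - tv z / A\<bar>} \<le> 4 * tv z / A / a\<^sup>2"
  using chebyshev_pmf[OF fin_expl_unit _ ev_unit_sq] unfolding ev_unit_vl .

lemma pl_eq_prob:
  assumes "d z \<le> dcap"
  shows "pl z = measure_pmf.prob (expl \<kappa> g R z unit_hit) {x. fst x < thr}"
  unfolding prob_eq_ev using assms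
  by (simp add: light_def case_prod_unfold del: Bochner_Integration.integral_indicator)
    (auto simp: indicator_def intro!: ev_cong simp del: Bochner_Integration.integral_indicator)

text \<open>The threshold corresponds to 2 \<theta> \<tau>^2 triangles. A vertex with at most
  \<theta> \<tau>^2 of them is rejected only if its count exceeds the mean by \<theta> \<tau>^2 /
  A.\<close>

lemma pl_light:
  assumes "d z \<le> dcap" "tv z \<le> \<theta> * \<tau>\<^sup>2"
  shows "1 - 8 / \<theta> \<le> pl z"
proof -
  let ?p = "expl \<kappa> g R z unit_hit" and ?T = "\<theta> * \<tau>\<^sup>2"
  have "1 - pl z = measure_pmf.prob ?p (space ?p - {x. fst x < thr})"
    unfolding pl_eq_prob[OF assms(1)] by (subst measure_pmf.prob_compl) auto
  also have "\<dots> \<le> measure_pmf.prob ?p {x. ?T / A \<le> \<bar>vl x - tv z / A\<bar>}"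
  proof (intro measure_pmf.finite_measure_mono subsetI)
    fix x assume "x \<in> space ?p - {x. fst x < thr}"
    then have "2 * ?T \<le> vl x * A" using thr[of "fst x"] by auto
    then have "2 * ?T / A \<le> vl x" using A_pos by (simp add: field_simps)
    moreover have "tv z / A \<le> ?T / A" using assms(2) A_pos by (simp add: divide_right_mono)
    ultimately show "x \<in> {x. ?T / A \<le> \<bar>vl x - tv z / A\<bar>}" by simp
  qed simp
  also have "\<dots> \<le> 4 * tv z / A / (?T / A)\<^sup>2" using theta_pos A_pos by (intro chebyshev_unit) simp
  also have "\<dots> = 4 * A * tv z / (?T * ?T)" using A_pos by (simp add: field_simps power2_eq_square)
  also have "\<dots> \<le> 4 * (2 * \<tau>\<^sup>2) * ?T / (?T * ?T)"
    using A A_pos assms(2) theta_pos by (intro divide_right_mono mult_mono) auto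
  also have "\<dots> = 8 / \<theta>" using theta_pos pos \<theta> by (simp add: field_simps)
  finally show ?thesis by simp
qed

text \<open>Vertices with a few times \<theta> \<tau>^2 triangles may get either label; the variance
  needs only this product. Beyond 4 \<theta> \<tau>^2, Chebyshev's inequality makes the probability
  of a light label decay like 1 / \<open>tv z\<close>.\<close>

lemma pl_tv_le: "pl z * tv z \<le> 4 * (\<theta> * \<tau>\<^sup>2)"
proof (cases "tv z \<le> 4 * (\<theta> * \<tau>\<^sup>2)")
  case True
  have "pl z * tv z \<le> 1 * real (tv z)" by (intro mult_right_mono pl_01) auto
  then show ?thesis using True by simp
next
  case False
  let ?p = "expl \<kappa> g R z unit_hit" and ?T = "\<theta> * \<tau>\<^sup>2"
  have tpos: "0 < real (tv z)" using False theta_pos by linarith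
  show ?thesis
  proof (cases "d z \<le> dcap")
    case True
    have "pl z \<le> measure_pmf.prob ?p {x :: outcome. tv z / A / 2 \<le> \<bar>vl x - tv z / A\<bar>}"
      unfolding pl_eq_prob[OF True]
    proof (intro measure_pmf.finite_measure_mono subsetI)
      fix x :: outcome assume "x \<in> {x. fst x < thr}"
      then have "vl x * A < 2 * ?T" using thr[of "fst x"] by auto
      then have "vl x * A < tv z / 2" using False by simp
      then have "vl x \<le> tv z / A / 2" using A_pos by (simp add: field_simps)
      then show "x \<in> {x :: outcome. tv z / A / 2 \<le> \<bar>vl x - tv z / A\<bar>}" by simp
    qed simp
    also have "\<dots> \<le> 4 * tv z / A / (tv z / A / 2)\<^sup>2" using tpos A_pos by (intro chebyshev_unit) simp
    also have "\<dots> = 16 * A / tv z" using A_pos tpos by (simp add: field_simps power2_eq_square)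
    finally have "pl z * tv z \<le> 16 * A" using tpos by (simp add: field_simps)
    also have "\<dots> \<le> 32 * real (\<tau>\<^sup>2)" using A by simp
    \<comment> \<open>Here \<theta> \<ge> 32 is used: it absorbs the Chebyshev bound 16 A \<le> 32
      \<tau>^2.\<close>
    also have "\<dots> \<le> \<theta> * real (\<tau>\<^sup>2)" by (rule mult_right_mono[OF \<theta>]) simp
    also have "\<dots> \<le> 4 * ?T" using theta_pos by simp
    finally show ?thesis .
  qed (use theta_pos in \<open>simp add: light_def\<close>)
qed

subsection \<open>Accuracy of the weighted count\<close>

text \<open>Without labels the second moment would contain the sum of the squares of
  \<open>tv v\<close>. The square of the mean at v carries the factor \<open>pl v\<close> twice;
  since \<open>pl v * tv v\<close> is bounded by \<open>pl_tv_le\<close>, one power of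
  \<open>tv v\<close> is traded for \<theta>, and the remaining sum is 3t.\<close>

lemma ev_mainv_sq:
  "ev (mainv \<kappa> g R dcap thr) (\<lambda>x. (vl x)\<^sup>2) \<le> 108 * t * (4 + 8 * \<theta>) / (n * A)"
proof -
  have e: "ev (expl \<kappa> g R v hitp) (\<lambda>x. (vl x)\<^sup>2) \<le> 36 * (4 + 8 * \<theta>) / A * tv v" for v
  proof -
    let ?p = "6 * pl v"
    have sq: "?p * ?p \<le> 36 * pl v" using mult_left_le[of "pl v" "pl v"] pl_01[of v] by simp
    have "ev (expl \<kappa> g R v hitp) vl = 1 / A * (\<Sum>(u, w)\<in>TP v. ev (hitp v u w) vl)"
      unfolding invA[symmetric] by (rule ev_expl_vl) (use pos in auto)
    also have "\<dots> \<le> 1 / A * (\<Sum>(u, w)\<in>TP v. ?p)"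
      using A_pos by (intro mult_left_mono sum_mono) (auto simp: ev_hit_vl_le)
    finally have m1: "ev (expl \<kappa> g R v hitp) vl \<le> ?p * tv v / A" by (simp add: case_prod_unfold mult_ac)
    have "(ev (expl \<kappa> g R v hitp) vl)\<^sup>2 \<le> (?p * tv v / A)\<^sup>2"
      by (intro power_mono m1 ev_nonneg) auto
    also have "\<dots> = (36 * tv v / A) * (pl v * (pl v * tv v) / A)"
      by (simp add: power2_eq_square)
    also have "\<dots> \<le> (36 * tv v / A) * (1 * (4 * (\<theta> * \<tau>\<^sup>2)) / A)"
      using A_pos pl_01[of v] theta_pos by (intro mult_left_mono divide_right_mono mult_mono pl_tv_le) auto
    also have "\<dots> \<le> (36 * tv v / A) * (8 * \<theta>)"
      using A_pos A(1) \<theta> by (intro mult_left_mono) (auto simp: field_simps)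
    finally have 1: "(ev (expl \<kappa> g R v hitp) vl)\<^sup>2 \<le> 36 * tv v / A * (8 * \<theta>)" .
    have "ev (expl \<kappa> g R v hitp) (\<lambda>x. (vl x)\<^sup>2)
      \<le> 1 / A * tv v * (36 * pl v + sqrt (2 * m) * ?p\<^sup>2 / \<kappa>) + (ev (expl \<kappa> g R v hitp) vl)\<^sup>2"
      unfolding invA[symmetric] using pos pl_01[of v]
      by (intro ev_expl_sq card_W_le) (auto simp: ev_hit_vl_le ev_hit_sq_le)
    also have "36 * pl v + sqrt (2 * m) * ?p\<^sup>2 / \<kappa> \<le> 36 * 1 + 3 * 36"
    proof -
      have "sqrt (2 * m) / \<kappa> * ?p\<^sup>2 \<le> 3 * 36"
        using sq pl_01[of v] by (intro mult_mono beta_le) (auto simp: power2_eq_square)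
      then show ?thesis using pl_01[of v] by (simp add: mult_ac)
    qed
    finally have "ev (expl \<kappa> g R v hitp) (\<lambda>x. (vl x)\<^sup>2)
      \<le> 1 / A * tv v * 144 + (ev (expl \<kappa> g R v hitp) vl)\<^sup>2"
      using A_pos by (simp add: mult_left_mono divide_right_mono)
    then show ?thesis using 1 by (simp add: algebra_simps add_divide_distrib)
  qed
  have "ev (mainv \<kappa> g R dcap thr) (\<lambda>x. (vl x)\<^sup>2) = (\<Sum>v\<in>V. ev (expl \<kappa> g R v hitp) (\<lambda>x. (vl x)\<^sup>2)) / n"
    using ev_mainv[of "\<lambda>x. (vl x)\<^sup>2" 0] by simp
  also have "\<dots> \<le> (\<Sum>v\<in>V. 36 * (4 + 8 * \<theta>) / A * tv v) / n"
    by (intro divide_right_mono sum_mono e) auto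
  also have "\<dots> = 36 * (4 + 8 * \<theta>) / A * real (\<Sum>v\<in>V. tv v) / n"
    by (simp add: sum_distrib_left)
  also have "\<dots> = 108 * t * (4 + 8 * \<theta>) / (n * A)"
    unfolding sum_tv by (simp add: field_simps)
  finally show ?thesis .
qed

lemma count_chebyshev:
  fixes c :: real
  assumes "0 < c" "0 < s" "0 < t"
  shows "measure_pmf.prob (forp s (mainv \<kappa> g R dcap thr))
      {x. c * t \<le> \<bar>vl x * (n * A / (6 * s)) - Sm\<bar>} \<le> 3 * (4 + 8 * \<theta>) * (n * A) / (s * c\<^sup>2 * t)"
proof -
  let ?D = "forp s (mainv \<kappa> g R dcap thr)"
  let ?f = "n * A / (6 * real s)"
  have f: "0 < ?f" using pos A_pos assms by simp
  have cf: "0 < c * t / ?f" by (rule divide_pos_pos[OF _ f]) (use assms in simp)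
  have mean: "ev ?D vl = Sm / ?f" using f assms A_pos pos by (simp add: ev_mainv_vl field_simps)
  have "ev ?D (\<lambda>x. (vl x)\<^sup>2) \<le> s * (108 * t * (4 + 8 * \<theta>) / (n * A)) + (ev ?D vl)\<^sup>2"
  proof -
    have "s * ev (mainv \<kappa> g R dcap thr) (\<lambda>x. (vl x)\<^sup>2) \<le> s * (108 * t * (4 + 8 * \<theta>) / (n * A))"
      by (intro mult_left_mono ev_mainv_sq) auto
    then show ?thesis using ev_forp_sq[OF fin_mainv, of s] by simp
  qed
  then have "measure_pmf.prob ?D {x. c * t / ?f \<le> \<bar>vl x - ev ?D vl\<bar>}
      \<le> s * (108 * t * (4 + 8 * \<theta>) / (n * A)) / (c * t / ?f)\<^sup>2"
    by (intro chebyshev_pmf cf fin_forp fin_mainv)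
  also have "{x. c * t / ?f \<le> \<bar>vl x - ev ?D vl\<bar>} = {x. c * t \<le> \<bar>vl x * ?f - Sm\<bar>}"
  proof -
    have "c * t / ?f \<le> \<bar>vl x - Sm / ?f\<bar> \<longleftrightarrow> c * t \<le> \<bar>vl x * ?f - Sm\<bar>" for x :: outcome
      by (rule scaled_abs_le_iff[OF f])
    then show ?thesis unfolding mean by simp
  qed
  also have "s * (108 * t * (4 + 8 * \<theta>) / (n * A)) / (c * t / ?f)\<^sup>2 = 3 * (4 + 8 * \<theta>) * (n * A) / (s * c\<^sup>2 * t)"
  proof -
    have nz: "real n * A \<noteq> 0" "real s \<noteq> 0" "c \<noteq> 0" "real t \<noteq> 0" using pos A_pos assms by auto
    define y where "y = real n * A"
    have "s * (108 * t * (4 + 8 * \<theta>) / y) / (c * t / (y / (6 * s)))\<^sup>2 = 3 * (4 + 8 * \<theta>) * y / (s * c\<^sup>2 * t)"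
      using nz unfolding y_def[symmetric] by (simp add: field_simps power2_eq_square)
    then show ?thesis by (simp add: y_def)
  qed
  finally show ?thesis .
qed

text \<open>Only triangles all of whose vertices are heavy are systematically missed.\<close>

lemma Sm_ge:
  shows "(1 - 8 / \<theta>) * (t - real ((card {z \<in> V. dcap < d z} + card {z \<in> V. \<theta> * \<tau>\<^sup>2 < tv z}) ^ 3)) \<le> Sm"
proof -
  define H where "H = {z \<in> V. dcap < d z} \<union> {z \<in> V. \<theta> * \<tau>\<^sup>2 < tv z}"
  let ?S = "OT - H \<times> H \<times> H" and ?F = "\<lambda>(a, b, c). 1 - (1 - pl a) * (1 - pl b) * (1 - pl c)"
  have fin: "finite H" by (simp add: H_def)
  have cH: "card H \<le> card {z \<in> V. dcap < d z} + card {z \<in> V. \<theta> * \<tau>\<^sup>2 < tv z}"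
    unfolding H_def by (rule card_Un_le)
  have "card (H \<times> H \<times> H) = card H ^ 3" by (simp add: card_cartesian_product power3_eq_cube)
  then have "card (H \<times> H \<times> H) \<le> (card {z \<in> V. dcap < d z} + card {z \<in> V. \<theta> * \<tau>\<^sup>2 < tv z}) ^ 3"
    using cH by (simp add: power_mono)
  then have cH3: "real (card (H \<times> H \<times> H)) \<le> real ((card {z \<in> V. dcap < d z} + card {z \<in> V. \<theta> * \<tau>\<^sup>2 < tv z}) ^ 3)"
    by (simp only: of_nat_le_iff)
  have "card OT \<le> card (?S \<union> H \<times> H \<times> H)" using fin by (intro card_mono) auto
  also have "\<dots> \<le> card ?S + card (H \<times> H \<times> H)" by (rule card_Un_le)
  finally have "real t \<le> real (card ?S) + real (card (H \<times> H \<times> H))"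
    unfolding card_OT by (simp only: of_nat_le_iff flip: of_nat_add)
  then have "(1 - 8 / \<theta>) * (t - real ((card {z \<in> V. dcap < d z} + card {z \<in> V. \<theta> * \<tau>\<^sup>2 < tv z}) ^ 3))
      \<le> (1 - 8 / \<theta>) * card ?S"
    using \<theta> cH3 by (intro mult_left_mono) (auto simp: field_simps)
  also have "\<dots> = (\<Sum>x\<in>?S. 1 - 8 / \<theta>)" by simp
  also have "\<dots> \<le> sum ?F ?S"
  proof (rule sum_mono)
    fix x assume x: "x \<in> ?S"
    obtain a b c where [simp]: "x = (a, b, c)" by (cases x)
    have l: "1 - 8 / \<theta> \<le> pl z" if "z \<in> V" "z \<notin> H" for z
      using that by (intro pl_light) (auto simp: H_def not_less)
    \<comment> \<open>One light vertex suffices: the probability that all labels are heavy is at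
      most the one for that vertex.\<close>
    have le: "(1 - pl a) * (1 - pl b) * (1 - pl c) \<le> 1 - pl z" if "z \<in> {a, b, c}" for z
    proof -
      have 1: "0 \<le> 1 - pl y" "1 - pl y \<le> 1" for y using pl_01[of y] by auto
      have "(1 - pl a) * (1 - pl b) \<le> 1 - pl a" "(1 - pl a) * (1 - pl b) \<le> 1 - pl b"
        "0 \<le> (1 - pl a) * (1 - pl b)" "(1 - pl a) * (1 - pl b) \<le> 1"
        using 1[of a] 1[of b] by (auto intro!: mult_left_le mult_left_le_one_le mult_le_one)
      moreover from this have "(1 - pl a) * (1 - pl b) * (1 - pl c) \<le> (1 - pl a) * (1 - pl b)"
        "(1 - pl a) * (1 - pl b) * (1 - pl c) \<le> 1 - pl c"
        using 1[of c] by (auto intro!: mult_left_le mult_left_le_one_le)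
      ultimately show ?thesis using that by auto
    qed
    have "a \<in> V" "b \<in> V" "c \<in> V" using x OT_sub by auto
    moreover have "a \<notin> H \<or> b \<notin> H \<or> c \<notin> H" using x by auto
    ultimately obtain z where "z \<in> {a, b, c}" "z \<in> V" "z \<notin> H" by blast
    then show "1 - 8 / \<theta> \<le> ?F x" using l[of z] le[of z] by simp
  qed
  also have "\<dots> \<le> sum ?F OT"
    by (intro sum_mono2) (auto simp: Sm_term)
  finally show ?thesis unfolding Sm_def .
qed

end

end

end

section \<open>Geometric search\<close>

type_synonym answer = "(nat \<times> nat) option \<times> nat \<times> nat"

primrec search :: "(nat \<Rightarrow> answer pmf) \<Rightarrow> nat list \<Rightarrow> answer pmf" where
  "search Lv [] = return_pmf (None, 1, 0)"
| "search Lv (x # xs) = bind_pmf (Lv x) (\<lambda>(r, w, k). case r of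
     Some q \<Rightarrow> return_pmf (Some q, w + 1, k)
   | None \<Rightarrow> map_pmf (\<lambda>(r', w', k'). (r', w + w' + 1, k + k')) (search Lv xs))"

lemma search_Cons: "search Lv (x # xs) = bind_pmf (Lv x) (\<lambda>y. if fst y \<noteq> None
     then return_pmf (fst y, fst (snd y) + 1, snd (snd y))
     else map_pmf (\<lambda>z. (fst z, fst (snd y) + fst (snd z) + 1, snd (snd y) + snd (snd z))) (search Lv xs))"
  by (auto intro!: bind_pmf_cong simp: case_prod_unfold split: option.split)

context
  fixes Lv :: "nat \<Rightarrow> answer pmf"
  assumes finL: "\<And>x. fin (Lv x)"
begin

lemma fin_search [simp]: "fin (search Lv xs)"
  by (induction xs) (auto simp: search_Cons finL simp del: search.simps(2))

text \<open>\<open>B\<close> is the set of wrong answers.\<close>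

lemma search_fail_Cons:
  "measure_pmf.prob (search Lv (x # xs)) {y. fst y \<in> insert None (Some ` B)}
   \<le> measure_pmf.prob (Lv x) {y. fst y \<in> Some ` B}
     + measure_pmf.prob (search Lv xs) {y. fst y \<in> insert None (Some ` B)}"
proof -
  define G where "G = insert None (Some ` B)"
  let ?q = "measure_pmf.prob (search Lv xs) {y. fst y \<in> G}"
  have *: "ev (map_pmf (\<lambda>z. (fst z, a + fst (snd z) + 1, b + snd (snd z))) (search Lv xs))
       (\<lambda>y. of_bool (fst y \<in> G)) = ?q" for a b :: nat
    unfolding prob_eq_ev by (auto simp: indicator_def intro!: ev_cong simp del: Bochner_Integration.integral_indicator)
  have "measure_pmf.prob (search Lv (x # xs)) {y. fst y \<in> G} = ev (search Lv (x # xs)) (\<lambda>y. of_bool (fst y \<in> G))"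
    unfolding prob_eq_ev by (intro ev_cong) (simp add: indicator_def)
  also have "\<dots> = ev (Lv x) (\<lambda>y. if fst y \<noteq> None then of_bool (fst y \<in> G) else ?q)"
    unfolding search_Cons using finL
    by (subst ev_bind) (auto simp del: integral_map_pmf simp: *[simplified] intro!: ev_cong)
  also have "\<dots> \<le> ev (Lv x) (\<lambda>y. of_bool (fst y \<in> Some ` B) + ?q)"
    using finL by (intro ev_mono) (auto simp: G_def)
  also have "\<dots> = ev (Lv x) (\<lambda>y. of_bool (fst y \<in> Some ` B)) + ?q"
    using finL by (subst ev_add) auto
  also have "ev (Lv x) (\<lambda>y. of_bool (fst y \<in> Some ` B)) = measure_pmf.prob (Lv x) {y. fst y \<in> Some ` B}"
    unfolding prob_eq_ev by (intro ev_cong) (simp add: indicator_def)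
  finally show ?thesis by (simp only: G_def)
qed

lemma search_fail_append:
  fixes \<delta> :: real
  assumes "\<And>x. x \<in> set xs \<Longrightarrow> measure_pmf.prob (Lv x) {y. fst y \<in> Some ` B} \<le> \<delta>"
  shows "measure_pmf.prob (search Lv (xs @ ys)) {y. fst y \<in> insert None (Some ` B)}
   \<le> length xs * \<delta> + measure_pmf.prob (search Lv ys) {y. fst y \<in> insert None (Some ` B)}"
  using assms
proof (induction xs)
  case (Cons x xs)
  show ?case
    using search_fail_Cons[of x "xs @ ys" B] Cons.IH Cons.prems by (fastforce simp: algebra_simps)
qed simp

text \<open>Nothing is run after a guess that answers, so a failure of the search already shows at
  x, as a wrong or a missing answer.\<close>

lemma search_fail_last:
  "measure_pmf.prob (search Lv (x # xs)) {y. fst y \<in> insert None (Some ` B)}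
   \<le> measure_pmf.prob (Lv x) {y. fst y \<in> insert None (Some ` B)}"
proof -
  let ?G = "insert None (Some ` B)"
  have *: "ev (search Lv xs) (\<lambda>z. of_bool (fst z \<in> ?G)) \<le> 1"
    using ev_mono[OF fin_search, of xs "\<lambda>z. of_bool (fst z \<in> ?G)" "\<lambda>_. 1"] by simp
  have "measure_pmf.prob (search Lv (x # xs)) {y. fst y \<in> ?G} = ev (search Lv (x # xs)) (\<lambda>y. of_bool (fst y \<in> ?G))"
    unfolding prob_eq_ev by (intro ev_cong) (simp add: indicator_def)
  also have "\<dots> = ev (Lv x) (\<lambda>y. if fst y \<noteq> None then of_bool (fst y \<in> ?G) else
      ev (search Lv xs) (\<lambda>z. of_bool (fst z \<in> ?G)))"
    unfolding search_Cons using finL by (subst ev_bind) (auto intro!: ev_cong)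
  also have "\<dots> \<le> ev (Lv x) (\<lambda>y. of_bool (fst y \<in> ?G))"
    using finL * by (intro ev_mono) auto
  also have "\<dots> = measure_pmf.prob (Lv x) {y. fst y \<in> ?G}"
    unfolding prob_eq_ev by (intro ev_cong) (simp add: indicator_def)
  finally show ?thesis .
qed

lemma search_None:
  assumes "\<And>x. x \<in> set xs \<Longrightarrow> measure_pmf.prob (Lv x) {y. fst y \<noteq> None} = 0"
  shows "measure_pmf.prob (search Lv xs) {y. fst y \<noteq> None} = 0"
proof -
  have "fst y = None" if "y \<in> set_pmf (search Lv xs)" for y
    using that assms
  proof (induction xs arbitrary: y)
    case (Cons x xs)
    have "fst z = None" if "z \<in> set_pmf (Lv x)" for z
      using that Cons.prems(2)[of x] unfolding measure_pmf_zero_iff by auto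
    then show ?case using Cons.prems(1) Cons.IH Cons.prems(2) unfolding search_Cons by fastforce
  qed simp
  then show ?thesis by (simp add: measure_pmf_zero_iff disjoint_iff)
qed

text \<open>The cost component \<open>h\<close> will be the number of steps or the number of samples.\<close>

lemma search_cost_Cons:
  fixes h :: "nat \<times> nat \<Rightarrow> real"
  assumes h: "\<And>a b. h (a + b) = h a + h b" "\<And>a. 0 \<le> h a" "h (1, 0) \<le> 1"
  shows "ev (search Lv (x # xs)) (\<lambda>y. h (snd y)) \<le> ev (Lv x) (\<lambda>y. h (snd y)) + 1
    + measure_pmf.prob (Lv x) {y. fst y = None} * ev (search Lv xs) (\<lambda>y. h (snd y))"
proof -
  let ?q = "ev (search Lv xs) (\<lambda>y. h (snd y))"
  have h1: "h (a + 1, b) \<le> h (a, b) + 1" for a b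
    using h(1)[of "(a, b)" "(1, 0)"] h(3) by simp
  have q0: "0 \<le> ?q" by (rule ev_nonneg) (rule h)
  have *: "ev (search Lv xs) (\<lambda>z. h (a + fst (snd z) + 1, b + snd (snd z))) \<le> h (a, b) + 1 + ?q" for a b
  proof -
    have "ev (search Lv xs) (\<lambda>z. h (a + fst (snd z) + 1, b + snd (snd z)))
        \<le> ev (search Lv xs) (\<lambda>z. (h (a, b) + 1) + h (snd z))"
    proof (rule ev_mono)
      fix z :: answer
      have "h (a + fst (snd z), b + snd (snd z)) = h (a, b) + h (snd z)"
        using h(1)[of "(a, b)" "snd z"] by (simp add: plus_prod_def)
      then show "h (a + fst (snd z) + 1, b + snd (snd z)) \<le> (h (a, b) + 1) + h (snd z)"
        using h1[of "a + fst (snd z)" "b + snd (snd z)"] by simp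
    qed simp
    also have "\<dots> = h (a, b) + 1 + ?q" by (subst ev_add) auto
    finally show ?thesis .
  qed
  have "ev (search Lv (x # xs)) (\<lambda>y. h (snd y)) = ev (Lv x) (\<lambda>y. if fst y \<noteq> None
      then h (fst (snd y) + 1, snd (snd y))
      else ev (search Lv xs) (\<lambda>z. h (fst (snd y) + fst (snd z) + 1, snd (snd y) + snd (snd z))))"
    unfolding search_Cons using finL by (subst ev_bind) (auto intro!: ev_cong)
  also have "\<dots> \<le> ev (Lv x) (\<lambda>y. (h (snd y) + 1) + indicator {y. fst y = None} y * ?q)"
  proof (rule ev_mono)
    fix y :: answer
    show "(if fst y \<noteq> None then h (fst (snd y) + 1, snd (snd y))
      else ev (search Lv xs) (\<lambda>z. h (fst (snd y) + fst (snd z) + 1, snd (snd y) + snd (snd z))))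
      \<le> (h (snd y) + 1) + indicator {y. fst y = None} y * ?q"
      using h1[of "fst (snd y)" "snd (snd y)"] *[of "fst (snd y)" "snd (snd y)"] by (auto simp: indicator_def)
  qed (rule finL)
  also have "\<dots> = ev (Lv x) (\<lambda>y. h (snd y)) + 1 + measure_pmf.prob (Lv x) {y. fst y = None} * ?q"
    using finL by (simp add: ev_add)
  finally show ?thesis .
qed

lemma search_cost_append:
  fixes h :: "nat \<times> nat \<Rightarrow> real" and c :: real
  assumes h: "\<And>a b. h (a + b) = h a + h b" "\<And>a. 0 \<le> h a" "h (1, 0) \<le> 1"
    and c: "\<And>x. x \<in> set xs \<Longrightarrow> ev (Lv x) (\<lambda>y. h (snd y)) + 1 \<le> c"
  shows "ev (search Lv (xs @ ys)) (\<lambda>y. h (snd y)) \<le> length xs * c + ev (search Lv ys) (\<lambda>y. h (snd y))"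
  using c
proof (induction xs)
  case (Cons x xs)
  have "0 \<le> ev (search Lv (xs @ ys)) (\<lambda>y. h (snd y))" by (rule ev_nonneg) (rule h)
  then have "measure_pmf.prob (Lv x) {y. fst y = None} * ev (search Lv (xs @ ys)) (\<lambda>y. h (snd y))
      \<le> ev (search Lv (xs @ ys)) (\<lambda>y. h (snd y))"
    by (intro mult_left_le_one_le) auto
  then show ?case
    using search_cost_Cons[of h x "xs @ ys", OF h] Cons.IH Cons.prems by (fastforce simp: algebra_simps)
qed simp

text \<open>The list goes on to ys only if all guesses of xs, in particular x0, give no answer. The
  runs are independent, so the cost of ys is discounted by \<delta>.\<close>

lemma search_cost_append_retry:
  fixes h :: "nat \<times> nat \<Rightarrow> real" and c :: real
  assumes h: "\<And>a b. h (a + b) = h a + h b" "\<And>a. 0 \<le> h a" "h (1, 0) \<le> 1"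
    and c: "\<And>x. x \<in> set xs \<Longrightarrow> ev (Lv x) (\<lambda>y. h (snd y)) + 1 \<le> c" "0 \<le> c"
    and x0: "x0 \<in> set xs" "measure_pmf.prob (Lv x0) {y. fst y = None} \<le> \<delta>"
  shows "ev (search Lv (xs @ ys)) (\<lambda>y. h (snd y)) \<le> length xs * c + \<delta> * ev (search Lv ys) (\<lambda>y. h (snd y))"
proof -
  obtain us vs where xs: "xs = us @ x0 # vs" using x0(1) by (meson split_list)
  let ?Y = "ev (search Lv ys) (\<lambda>y. h (snd y))"
  have d: "0 \<le> \<delta>" "0 \<le> measure_pmf.prob (Lv x0) {y. fst y = None}" "measure_pmf.prob (Lv x0) {y. fst y = None} \<le> 1"
    using x0(2) by (auto intro: order_trans[OF measure_nonneg])
  have nn: "0 \<le> ev (search Lv zs) (\<lambda>y. h (snd y))" for zs by (rule ev_nonneg) (rule h)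
  have 1: "ev (search Lv (us @ x0 # vs @ ys)) (\<lambda>y. h (snd y))
      \<le> length us * c + ev (search Lv (x0 # vs @ ys)) (\<lambda>y. h (snd y))"
    using c(1) xs by (intro search_cost_append[OF h]) auto
  have 2: "ev (search Lv (vs @ ys)) (\<lambda>y. h (snd y)) \<le> length vs * c + ?Y"
    using c(1) xs by (intro search_cost_append[OF h]) auto
  let ?p = "measure_pmf.prob (Lv x0) {y. fst y = None}"
  have "?p * ev (search Lv (vs @ ys)) (\<lambda>y. h (snd y)) \<le> ?p * (length vs * c + ?Y)"
    using 2 d by (intro mult_left_mono)
  also have "\<dots> = ?p * (length vs * c) + ?p * ?Y" by (simp add: distrib_left)
  also have "\<dots> \<le> 1 * (length vs * c) + \<delta> * ?Y"
    by (intro add_mono mult_right_mono d x0 nn mult_nonneg_nonneg of_nat_0_le_iff c)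
  finally have 3: "?p * ev (search Lv (vs @ ys)) (\<lambda>y. h (snd y)) \<le> length vs * c + \<delta> * ?Y" by simp
  have "ev (search Lv (x0 # vs @ ys)) (\<lambda>y. h (snd y)) \<le> c + (length vs * c + \<delta> * ?Y)"
    using search_cost_Cons[of h x0 "vs @ ys", OF h] c(1)[of x0] xs 3 by simp
  with 1 have "ev (search Lv (us @ x0 # vs @ ys)) (\<lambda>y. h (snd y)) \<le> length us * c + (c + (length vs * c + \<delta> * ?Y))"
    by linarith
  then show ?thesis unfolding xs by (simp add: algebra_simps)
qed

end

text \<open>Round \<open>r\<close> tries the guesses \<open>n, n div 2, \<dots>, n div 2^r\<close>, so that every guess below the right one
  is preceded by another attempt at the right one.\<close>

function sched :: "nat \<Rightarrow> nat \<Rightarrow> nat \<Rightarrow> nat list" where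
  "sched n \<tau> b = (if b = 0 \<or> \<tau> = 0 then []
     else \<tau> # (if \<tau> \<le> b then sched n n (b div 2) else sched n (\<tau> div 2) b))"
  by auto
text \<open>Within a round \<tau> falls while b is fixed; at its end \<tau> is reset but b
  falls.\<close>

termination by (relation "measures [\<lambda>(n, \<tau>, b). b, \<lambda>(n, \<tau>, b). \<tau>]") auto

declare sched.simps [simp del]

lemma sched_0 [simp]: "sched n \<tau> 0 = []" "sched n 0 b = []"
  by (simp_all add: sched.simps)

lemma div_power_Suc: "(n::nat) div 2 ^ Suc r = n div 2 ^ r div 2"
  by (simp only: power_Suc2 div_mult2_eq)

text \<open>The schedule in the middle of round r, by induction on the number of guesses left in it.
  Throughout the round b is n div 2^r, the last guess of the round.\<close>

lemma sched_round:
  assumes "i \<le> r" "0 < n div 2 ^ r"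
  shows "sched n (n div 2 ^ i) (n div 2 ^ r) = map (\<lambda>i. n div 2 ^ i) [i..<Suc r] @ sched n n (n div 2 ^ Suc r)"
  using assms
proof (induction "r - i" arbitrary: i)
  case 0
  then have "i = r" by simp
  then show ?case using 0 by (subst sched.simps) (simp add: div_power_Suc del: power_Suc)
next
  case (Suc k)
  then have lt: "i < r" by simp
  have "n div 2 ^ r \<le> n div 2 ^ Suc i" using lt by (intro div_le_mono2 power_increasing) auto
  also have "\<dots> = (n div 2 ^ i) div 2" by (rule div_power_Suc)
  finally have le: "n div 2 ^ r \<le> (n div 2 ^ i) div 2" .
  then have less: "n div 2 ^ r < n div 2 ^ i" using Suc.prems(2) by linarith
  have "sched n (n div 2 ^ i) (n div 2 ^ r) = n div 2 ^ i # sched n (n div 2 ^ Suc i) (n div 2 ^ r)"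
    using less Suc.prems(2) by (subst sched.simps) (simp add: div_power_Suc del: power_Suc)
  also have "sched n (n div 2 ^ Suc i) (n div 2 ^ r) = map (\<lambda>i. n div 2 ^ i) [Suc i..<Suc r] @ sched n n (n div 2 ^ Suc r)"
    using Suc lt by (intro Suc.hyps(1)) auto
  finally show ?case using lt by (simp add: upt_conv_Cons)
qed

section \<open>One guess\<close>

text \<open>Doubling while \<kappa>^2 < q approximates sqrt q from above within a factor 2, by
  multiplication and comparison alone.\<close>

definition kstep :: "nat \<Rightarrow> nat \<Rightarrow> nat" where "kstep q \<kappa> = (if \<kappa> * \<kappa> < q then 2 * \<kappa> else \<kappa>)"

definition kap :: "nat \<Rightarrow> nat \<Rightarrow> nat" where "kap l q = (kstep q ^^ l) 1"

lemma kap_pos: "0 < kap l q"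
  unfolding kap_def by (induction l) (auto simp: kstep_def)

lemma kap_upper: "1 \<le> q \<Longrightarrow> (kap l q)\<^sup>2 \<le> 4 * q"
proof (induction l)
  case (Suc l)
  have "kap (Suc l) q = kstep q (kap l q)" by (simp add: kap_def)
  then show ?case using Suc by (auto simp: kstep_def power2_eq_square)
qed (simp add: kap_def)

text \<open>Either the doubling has stopped, or \<kappa> was doubled in every step and equals 2^l;
  in the latter case the premise gives the bound.\<close>

lemma kap_lower: "q \<le> 4 ^ l \<Longrightarrow> q \<le> (kap l q)\<^sup>2"
proof -
  have "q \<le> (kap l q)\<^sup>2 \<or> kap l q = 2 ^ l"
  proof (induction l)
    case (Suc l)
    have "kap (Suc l) q = kstep q (kap l q)" by (simp add: kap_def)
    then show ?case using Suc by (auto simp: kstep_def power2_eq_square)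
  qed (simp add: kap_def)
  then show "q \<le> 4 ^ l \<Longrightarrow> q \<le> (kap l q)\<^sup>2"
    by (auto simp: power2_eq_square simp flip: power_mult_distrib)
qed

text \<open>Only the outer loops draw vertices, explorations do not; this yields a sure bound on the
  number of samples.\<close>

definition nosamp :: "outcome pmf \<Rightarrow> bool" where
  "nosamp D \<longleftrightarrow> (\<forall>x\<in>set_pmf D. snd (snd x) = 0)"

lemma nosamp_return: "nosamp (return_pmf (a, b, 0))" by (simp add: nosamp_def)

lemma nosamp_tick: "nosamp D \<Longrightarrow> nosamp (tick D)" by (auto simp: nosamp_def tick_def)

lemma nosamp_rep: "nosamp D \<Longrightarrow> nosamp (rep k D)" by (induction k) (auto simp: nosamp_def)

lemma nosamp_forp: "nosamp D \<Longrightarrow> nosamp (forp k D)"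
  unfolding forp_def by (intro nosamp_tick nosamp_rep)

lemma nosamp_bind: "(\<And>x. x \<in> set_pmf p \<Longrightarrow> nosamp (f x)) \<Longrightarrow> nosamp (bind_pmf p f)"
  by (auto simp: nosamp_def)

lemma nosamp_vote: "nosamp A \<Longrightarrow> nosamp B \<Longrightarrow> nosamp C \<Longrightarrow> nosamp (vote A B C)"
  by (auto simp: nosamp_def vote_def case_prod_unfold)

context qgraph begin

lemma nosamp_expl:
  assumes D: "\<And>v u w. nosamp (D v u w)"
  shows "nosamp (expl \<kappa> g R v D)"
proof -
  have w: "nosamp (wedge \<kappa> v u D)" for u
    unfolding wedge_def Let_def by (intro nosamp_bind) (auto intro: nosamp_tick D nosamp_return)
  have e: "nosamp (edge \<kappa> g v D)"
    unfolding edge_def Let_def by (intro nosamp_bind) (auto intro: nosamp_tick nosamp_forp w nosamp_return)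
  show ?thesis unfolding expl_def by (intro nosamp_tick nosamp_forp e)
qed

lemma nosamp_hit: "nosamp (hit \<kappa> g R dc th v u w)"
proof -
  have l: "nosamp (light \<kappa> g R dc th z)" for z
    using nosamp_expl[of unit_hit \<kappa> g R z] by (auto simp: light_def nosamp_def unit_hit_def)
  show ?thesis unfolding hit_def by (intro nosamp_vote l)
qed

end

section \<open>Parameters and distribution of one guess\<close>

locale guess = qgraph +
  fixes P L :: nat
  assumes P: "2 \<le> P" and L: "2 \<le> L" "2 ^ (L - 1) \<le> n" "n < 2 ^ L" and npos: "0 < n"
begin

text \<open>At most L^2 guesses are made up to the end of the round that first contains the right
  one, so failure probability 1 / \<open>Gi\<close> for each leaves 1/100 in total.\<close>

definition "Gi = 100 * L * L"
text \<open>Sampling constant: P^2 for the relative error 1/(2P) in Chebyshev's inequality, a third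
  P because \<theta> = 100 P, one \<open>Gi\<close> for the failure probability, and one because
  \<tau>^3 may exceed t by a factor 2 \<open>Gi\<close>.\<close>

definition "K = 100000 * P * P * P * Gi * Gi"
text \<open>If q \<ge> m/4, at most 8 \<tau> / \<open>Hc\<close> vertices exceed the degree cap. The
  value makes the cube of this number, which bounds the triangles among them, a small fraction of t
  / P.\<close>

definition "Hc = 32 * P * Gi"
definition "samples \<tau> = K * (n div \<tau> + 1)"

text \<open>Limit of the hit counter, to bound its bit length. Accurate estimates are not affected:
  as t \<le> n^3 they are at most 2 n^3, which means a count of at most 12 n^2 * samples *
  R.\<close>

definition "cap \<tau> R = 12 * n * n * samples \<tau> * R"

text \<open>Together with \<open>R_of\<close> this makes g \<kappa> / R of order \<tau>^2 in
  integers: for \<kappa> \<le> \<tau>^2 edges are thinned out by the factor g, otherwise g = 1 and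
  edges are drawn repeatedly.\<close>

definition "g_of \<tau> \<kappa> = \<tau> * \<tau> div \<kappa> + (1::nat)"
definition "R_of \<tau> \<kappa> = \<kappa> div (\<tau> * \<tau>) + (1::nat)"
definition "dcap_of \<tau> q = q * Hc div \<tau>"
text \<open>The quotient 2 \<theta> \<tau>^2 / A for \<theta> = 100 P, rounded up, so that the
  integer comparison is equivalent to the real one.\<close>

definition "thr_of \<tau> \<kappa> = (200 * P * (\<tau> * \<tau>) * R_of \<tau> \<kappa> + (g_of \<tau> \<kappa> * \<kappa> - 1)) div (g_of \<tau> \<kappa> * \<kappa>)"

text \<open>The estimate is n g \<kappa> c / (6 samples R), where 6 is the total credit of a
  triangle. It is kept as a fraction, and the test, cleared of denominators, accepts if it is at
  least \<tau>^3 / 2.\<close>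

definition decide :: "nat \<Rightarrow> nat \<Rightarrow> nat \<Rightarrow> (nat \<times> nat) option" where
  "decide \<tau> \<kappa> x = (let c = min x (cap \<tau> (R_of \<tau> \<kappa>)) in
     if 6 * samples \<tau> * R_of \<tau> \<kappa> * (\<tau> * \<tau> * \<tau>) \<le> 2 * (n * g_of \<tau> \<kappa> * \<kappa> * c)
     then Some (n * g_of \<tau> \<kappa> * \<kappa> * c, 6 * samples \<tau> * R_of \<tau> \<kappa>) else None)"

definition sdeg :: "outcome pmf" where "sdeg = map_pmf (\<lambda>v. (d v, 1, 1)) (pmf_of_set V)"

text \<open>Estimates n times the average degree, that is 2m. The summand 1 keeps q positive, as
  \<open>kap_upper\<close> requires.\<close>

definition mh1 :: "nat \<Rightarrow> nat \<Rightarrow> nat" where "mh1 \<tau> x = n * x div samples \<tau> + 1"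

definition mainp :: "nat \<Rightarrow> nat \<Rightarrow> outcome pmf" where
  "mainp \<tau> q = (let \<kappa> = kap (L + 1) q in
     forp (samples \<tau>) (mainv \<kappa> (g_of \<tau> \<kappa>) (R_of \<tau> \<kappa>) (dcap_of \<tau> q) (thr_of \<tau> \<kappa>)))"

text \<open>The minimum of two estimates is taken for the sake of the running time: its square is at
  most their product, and independence gives the mean of the product. The L + 10 steps are the
  deterministic blocks, including the L + 1 doublings of \<kappa>.\<close>

definition level :: "nat \<Rightarrow> answer pmf" where
  "level \<tau> = bind_pmf (forp (samples \<tau>) sdeg) (\<lambda>(x1, w1, k1). bind_pmf (forp (samples \<tau>) sdeg) (\<lambda>(x2, w2, k2).
     let q = min (mh1 \<tau> x1) (mh1 \<tau> x2) in
     map_pmf (\<lambda>(x, w, k). (decide \<tau> (kap (L + 1) q) x, w1 + w2 + w + (L + 10), k1 + k2 + k)) (mainp \<tau> q)))"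

lemma Gi_pos: "400 \<le> Gi"
  using mult_le_mono[OF L(1) L(1)] by (simp add: Gi_def)

lemma K_pos: "0 < K" using P Gi_pos by (simp add: K_def)

lemma V_ne: "V \<noteq> {}" using npos by auto

lemma fin_sdeg [simp]: "fin sdeg" using V_ne by (simp add: sdeg_def)

lemma ev_sdeg_vl: "ev sdeg vl = 2 * m / n"
proof -
  have "ev sdeg vl = (\<Sum>v\<in>V. real (d v)) / card V" using V_ne by (simp add: sdeg_def integral_pmf_of_set)
  also have "(\<Sum>v\<in>V. real (d v)) = 2 * m" unfolding of_nat_sum[symmetric] sum_degree by simp
  finally show ?thesis by simp
qed

context
  fixes \<tau> :: nat
  assumes \<tau>: "1 \<le> \<tau>" "\<tau> \<le> n"
begin

lemma samples_bounds: "K * real n / \<tau> \<le> samples \<tau>" "samples \<tau> \<le> 2 * K * real n / \<tau>" "1 \<le> samples \<tau>"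
proof -
  have "real n / \<tau> \<le> real (n div \<tau>) + 1"
  proof -
    have "n \<le> \<tau> * (n div \<tau>) + \<tau>" using \<tau> dividend_less_times_div[of \<tau> n] by simp
    then have "real n \<le> real (\<tau> * (n div \<tau>) + \<tau>)" by (simp only: of_nat_le_iff)
    then show ?thesis using \<tau> by (simp add: field_simps)
  qed
  then have "K * (real n / \<tau>) \<le> K * (real (n div \<tau>) + 1)" by (intro mult_left_mono) auto
  then show "K * real n / \<tau> \<le> samples \<tau>" by (simp add: samples_def distrib_left)
  have "real (n div \<tau>) \<le> real n / \<tau>" by (rule of_nat_div_le_of_nat)
  moreover have "1 \<le> real n / \<tau>" using \<tau> by simp
  ultimately have "K * (real (n div \<tau>) + 1) \<le> K * (2 * (real n / \<tau>))" by (intro mult_left_mono) auto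
  then show "samples \<tau> \<le> 2 * K * real n / \<tau>" by (simp add: samples_def distrib_left mult_ac)
  show "1 \<le> samples \<tau>" using K_pos by (simp add: samples_def Suc_le_eq)
qed

lemma \<tau>pos: "0 < \<tau>" using \<tau> by simp

lemma A_bounds:
  fixes \<kappa> :: nat and A :: real assumes "0 < \<kappa>"
  defines "A \<equiv> real (g_of \<tau> \<kappa> * \<kappa>) / R_of \<tau> \<kappa>"
  shows "\<tau>\<^sup>2 / 2 \<le> A" "A \<le> 2 * \<tau>\<^sup>2" "g_of \<tau> \<kappa> = 1 \<or> R_of \<tau> \<kappa> \<le> 2" "0 < g_of \<tau> \<kappa>" "0 < R_of \<tau> \<kappa>"
proof -
  define T where "T = \<tau> * \<tau>"
  have T: "0 < T" using \<tau> by (simp add: T_def)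
  have gk: "T < g_of \<tau> \<kappa> * \<kappa>" "g_of \<tau> \<kappa> * \<kappa> \<le> T + \<kappa>"
    using assms(1) dividend_less_times_div[of \<kappa> T] div_times_less_eq_dividend[of T \<kappa>]
    by (auto simp: g_of_def T_def algebra_simps)
  have RT: "\<kappa> < T * R_of \<tau> \<kappa>" "T * R_of \<tau> \<kappa> \<le> \<kappa> + T"
    using T dividend_less_times_div[of T \<kappa>] div_times_less_eq_dividend[of \<kappa> T]
    by (auto simp: R_of_def T_def[symmetric] algebra_simps)
  show g0: "0 < g_of \<tau> \<kappa>" and R0: "0 < R_of \<tau> \<kappa>" by (simp_all add: g_of_def R_of_def)
  have lo: "T * R_of \<tau> \<kappa> \<le> 2 * (g_of \<tau> \<kappa> * \<kappa>) \<and> g_of \<tau> \<kappa> * \<kappa> \<le> 2 * T * R_of \<tau> \<kappa> \<and>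
      (g_of \<tau> \<kappa> = 1 \<or> R_of \<tau> \<kappa> \<le> 2)"
  proof (cases "\<kappa> \<le> T")
    case True
    then have R2: "T * R_of \<tau> \<kappa> \<le> T * 2" using RT by linarith
    then have "R_of \<tau> \<kappa> \<le> 2" using T by simp
    moreover have "2 * T * 1 \<le> 2 * T * R_of \<tau> \<kappa>" using R0 by (intro mult_le_mono2) simp
    then have "g_of \<tau> \<kappa> * \<kappa> \<le> 2 * T * R_of \<tau> \<kappa>" using gk True by linarith
    moreover have "T * R_of \<tau> \<kappa> \<le> 2 * (g_of \<tau> \<kappa> * \<kappa>)" using gk R2 by linarith
    ultimately show ?thesis by blast
  next
    case False
    then have "g_of \<tau> \<kappa> = 1" by (simp add: g_of_def T_def[symmetric])
    then show ?thesis using RT False by simp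
  qed
  then have "real (T * R_of \<tau> \<kappa>) \<le> real (2 * (g_of \<tau> \<kappa> * \<kappa>))" "real (g_of \<tau> \<kappa> * \<kappa>) \<le> real (2 * T * R_of \<tau> \<kappa>)"
    by (simp_all only: of_nat_le_iff)
  then show "\<tau>\<^sup>2 / 2 \<le> A" "A \<le> 2 * \<tau>\<^sup>2"
    using R0 by (simp_all add: A_def T_def field_simps power2_eq_square)
  show "g_of \<tau> \<kappa> = 1 \<or> R_of \<tau> \<kappa> \<le> 2" using lo by blast
qed

lemma thr_iff:
  fixes \<kappa> :: nat assumes "0 < \<kappa>"
  shows "x < thr_of \<tau> \<kappa> \<longleftrightarrow> x * (real (g_of \<tau> \<kappa> * \<kappa>) / R_of \<tau> \<kappa>) < 2 * (100 * real P * \<tau>\<^sup>2)"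
proof -
  let ?a = "200 * P * (\<tau> * \<tau>) * R_of \<tau> \<kappa>" and ?b = "g_of \<tau> \<kappa> * \<kappa>"
  have b: "0 < ?b" and R: "0 < R_of \<tau> \<kappa>" using assms A_bounds(4,5) by auto
  have "x < thr_of \<tau> \<kappa> \<longleftrightarrow> Suc x \<le> (?a + (?b - 1)) div ?b" by (simp add: thr_of_def Suc_le_eq)
  also have "\<dots> \<longleftrightarrow> Suc x * ?b \<le> ?a + (?b - 1)" by (rule less_eq_div_iff_mult_less_eq[OF b])
  also have "\<dots> \<longleftrightarrow> x * ?b < ?a"
  proof -
    have "y + b \<le> a + (b - 1) \<longleftrightarrow> y < a" if "0 < b" for y a b :: nat using that by arith
    from this[OF b] show ?thesis unfolding mult_Suc by (subst add.commute)
  qed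
  also have "\<dots> \<longleftrightarrow> real (x * ?b) < real ?a" by (simp only: of_nat_less_iff)
  also have "\<dots> \<longleftrightarrow> x * (real (g_of \<tau> \<kappa> * \<kappa>) / R_of \<tau> \<kappa>) < 2 * (100 * real P * \<tau>\<^sup>2)"
    using R by (simp add: field_simps power2_eq_square)
  finally show ?thesis .
qed

lemma fin_mainp [simp]: "fin (mainp \<tau> q)"
  unfolding mainp_def Let_def
  using kap_pos[of "L + 1" q] A_bounds[OF kap_pos] \<tau>pos npos
  by (intro fin_forp fin_mainv[where \<tau> = \<tau>]) auto

lemma fin_level: "fin (level \<tau>)"
  by (auto simp: level_def split: prod.splits simp: Let_def)

lemma level_eq: "level \<tau> = bind_pmf (forp (samples \<tau>) sdeg) (\<lambda>y. bind_pmf (forp (samples \<tau>) sdeg) (\<lambda>z.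
     let q = min (mh1 \<tau> (fst y)) (mh1 \<tau> (fst z)) in
     map_pmf (\<lambda>x. (decide \<tau> (kap (L + 1) q) (fst x), fst (snd y) + fst (snd z) + fst (snd x) + (L + 10),
       snd (snd y) + snd (snd z) + snd (snd x))) (mainp \<tau> q)))"
  by (simp add: level_def case_prod_unfold)

lemma ev_level: "ev (level \<tau>) h = ev (forp (samples \<tau>) sdeg) (\<lambda>y. ev (forp (samples \<tau>) sdeg) (\<lambda>z.
     let q = min (mh1 \<tau> (fst y)) (mh1 \<tau> (fst z)) in
     ev (mainp \<tau> q) (\<lambda>x. h (decide \<tau> (kap (L + 1) q) (fst x), fst (snd y) + fst (snd z) + fst (snd x) + (L + 10),
       snd (snd y) + snd (snd z) + snd (snd x)))))"
  unfolding level_eq by (subst ev_bind) (auto simp: ev_bind Let_def)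

lemma ev_mainp_vl_le: "ev (mainp \<tau> q) vl \<le> 6 * samples \<tau> * t * R_of \<tau> (kap (L + 1) q) / (n * real (g_of \<tau> (kap (L + 1) q) * kap (L + 1) q))"
proof -
  let ?\<kappa> = "kap (L + 1) q"
  note ab = A_bounds[OF kap_pos, of "L + 1" q]
  let ?A = "real (g_of \<tau> ?\<kappa> * ?\<kappa>) / R_of \<tau> ?\<kappa>"
  note pos = kap_pos[of "L + 1" q] ab(4,5) \<tau>pos npos
  let ?S = "Sm ?\<kappa> (g_of \<tau> ?\<kappa>) (R_of \<tau> ?\<kappa>) (dcap_of \<tau> q) (thr_of \<tau> ?\<kappa>)"
  have "ev (mainp \<tau> q) vl = samples \<tau> * (6 * ?S / (n * ?A))"
    unfolding mainp_def Let_def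
    using ev_mainv_vl[OF pos ab(1,2,3)] fin_mainv[OF pos ab(1,2,3)] by simp
  also have "\<dots> \<le> samples \<tau> * (6 * t / (n * ?A))"
    using Sm_le[OF pos ab(1,2,3)] by (intro mult_left_mono divide_right_mono) auto
  finally show ?thesis by (simp add: field_simps)
qed

text \<open>Markov's inequality: for every q the estimate has mean \<open>Sm\<close> \<le> t before
  the cap, which only lowers it. So guesses far above the cube root of t are rejected although their
  variance is not under control, and for t = 0 acceptance has probability 0.\<close>

lemma level_accept_le: "measure_pmf.prob (level \<tau>) {y. fst y \<noteq> None} \<le> 2 * t / \<tau> ^ 3"
proof -
  have main: "ev (mainp \<tau> q) (\<lambda>x. of_bool (decide \<tau> (kap (L + 1) q) (fst x) \<noteq> None)) \<le> 2 * t / \<tau> ^ 3" for q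
  proof -
    let ?\<kappa> = "kap (L + 1) q"
    let ?R = "R_of \<tau> ?\<kappa>" and ?G = "g_of \<tau> ?\<kappa> * ?\<kappa>"
    define c where "c = 3 * real (samples \<tau>) * ?R * \<tau> ^ 3 / (n * real ?G)"
    note ab = A_bounds[OF kap_pos, of "L + 1" q]
    have G: "0 < real n * real ?G" using ab kap_pos npos by simp
    have c: "0 < c" using G samples_bounds(3) ab(5) \<tau> by (simp add: c_def)
    have "ev (mainp \<tau> q) (\<lambda>x. of_bool (decide \<tau> ?\<kappa> (fst x) \<noteq> None)) \<le> ev (mainp \<tau> q) (\<lambda>x. vl x / c)"
    proof (rule ev_mono)
      fix x :: outcome
      have "c \<le> vl x" if "decide \<tau> ?\<kappa> (fst x) \<noteq> None"
      proof -
        have "6 * samples \<tau> * ?R * (\<tau> * \<tau> * \<tau>) \<le> 2 * (n * g_of \<tau> ?\<kappa> * ?\<kappa> * min (fst x) (cap \<tau> ?R))"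
        proof (rule ccontr)
          assume "\<not> ?thesis"
          then have "decide \<tau> ?\<kappa> (fst x) = None" unfolding decide_def Let_def by (rule if_not_P)
          with that show False by blast
        qed
        also have "\<dots> \<le> 2 * (n * g_of \<tau> ?\<kappa> * ?\<kappa> * fst x)" by (intro mult_le_mono2) simp
        finally have "real (6 * samples \<tau> * ?R * (\<tau> * \<tau> * \<tau>)) \<le> real (2 * (n * g_of \<tau> ?\<kappa> * ?\<kappa> * fst x))"
          by (simp only: of_nat_le_iff)
        then show ?thesis using G by (simp add: c_def pos_divide_le_eq power3_eq_cube mult_ac)
      qed
      then show "of_bool (decide \<tau> ?\<kappa> (fst x) \<noteq> None) \<le> vl x / c" using c by simp
    qed simp
    also have "\<dots> = ev (mainp \<tau> q) vl / c" by simp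
    also have "\<dots> \<le> 6 * samples \<tau> * t * ?R / (n * real ?G) / c"
      using ev_mainp_vl_le c by (intro divide_right_mono) auto
    also have "\<dots> = 2 * t / \<tau> ^ 3"
    proof -
      have "6 * s * z * r / y / (3 * s * r * u / y) = 2 * z / u" if "0 < y" "0 < s" "0 < r" "0 < u" for y s r u z :: real
        using that by (simp add: field_simps)
      from this[of "n * real ?G" "samples \<tau>" ?R "\<tau> ^ 3" t] show ?thesis
        using G samples_bounds(3) ab(5) \<tau> by (simp add: c_def)
    qed
    finally show ?thesis .
  qed
  have "measure_pmf.prob (level \<tau>) {y. fst y \<noteq> None} = ev (level \<tau>) (\<lambda>y. of_bool (fst y \<noteq> None))"
    unfolding prob_eq_ev by (intro ev_cong) (simp add: indicator_def)
  also have "\<dots> \<le> ev (forp (samples \<tau>) sdeg) (\<lambda>y. ev (forp (samples \<tau>) sdeg) (\<lambda>z. 2 * t / \<tau> ^ 3))"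
    unfolding ev_level fst_conv Let_def by (intro ev_mono main) auto
  finally show ?thesis by simp
qed

text \<open>Each pass of the three outer loops draws one vertex, so the bound holds surely.\<close>

lemma level_samples:
  assumes "y \<in> set_pmf (level \<tau>)" shows "snd (snd y) \<le> 3 * samples \<tau>"
proof -
  have forp1: "snd (snd x) \<le> k" if "x \<in> set_pmf (forp k D)" "\<And>x. x \<in> set_pmf D \<Longrightarrow> snd (snd x) \<le> 1" for x :: outcome and k D
  proof -
    have "x \<in> (\<lambda>x. (0, 1, 0) + x) ` set_pmf (rep k (tick D))"
      using that(1) unfolding forp_def tick_def[of "rep k (tick D)"] set_map_pmf .
    then obtain z where z: "z \<in> set_pmf (rep k (tick D))" "x = (0, 1, 0) + z" by blast
    have "snd (snd z) \<le> k * 1"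
      by (rule set_rep_le[OF _ z(1)]) (use that(2) in \<open>auto simp: tick_def\<close>)
    then show ?thesis using z by simp
  qed
  have mainv1: "snd (snd x) \<le> 1" if hx: "x \<in> set_pmf (mainv \<kappa> g R dc th)" "0 < \<kappa>" for x \<kappa> g R dc th
  proof -
    have ns: "nosamp (expl \<kappa> g R v (hit \<kappa> g R dc th))" for v
      by (intro nosamp_expl nosamp_hit)
    obtain v z where z: "z \<in> set_pmf (expl \<kappa> g R v (hit \<kappa> g R dc th))" "x = (0, 1, 1) + z"
      using hx(1) unfolding mainv_def set_bind_pmf set_map_pmf by blast
    have "snd (snd z) = 0" using ns[of v] z(1) unfolding nosamp_def by blast
    then show ?thesis unfolding z(2) by simp
  qed
  have sdeg1: "snd (snd x) \<le> 1" if "x \<in> set_pmf sdeg" for x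
    using that unfolding sdeg_def set_map_pmf by (elim imageE) simp
  from assms obtain a b where ab: "a \<in> set_pmf (forp (samples \<tau>) sdeg)" "b \<in> set_pmf (forp (samples \<tau>) sdeg)"
    and "y \<in> set_pmf (let q = min (mh1 \<tau> (fst a)) (mh1 \<tau> (fst b)) in
     map_pmf (\<lambda>x. (decide \<tau> (kap (L + 1) q) (fst x), fst (snd a) + fst (snd b) + fst (snd x) + (L + 10),
       snd (snd a) + snd (snd b) + snd (snd x))) (mainp \<tau> q))"
    unfolding level_eq set_bind_pmf by blast
  then obtain x q where x: "x \<in> set_pmf (mainp \<tau> q)" and y: "snd (snd y) = snd (snd a) + snd (snd b) + snd (snd x)"
    unfolding Let_def set_map_pmf by (elim imageE) simp
  have "snd (snd x) \<le> samples \<tau>"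
    using x unfolding mainp_def Let_def by (rule forp1) (rule mainv1[OF _ kap_pos])
  with forp1[OF ab(1) sdeg1] forp1[OF ab(2) sdeg1] show ?thesis unfolding y by linarith
qed

end

end

section \<open>Accuracy of one guess\<close>

lemma rep_map:
  assumes "\<And>a b. \<phi> (a + b) = \<phi> a + \<phi> b" "\<phi> 0 = 0"
  shows "rep k (map_pmf \<phi> D) = map_pmf \<phi> (rep k D)"
  by (induction k) (simp_all add: assms map_bind_pmf bind_map_pmf map_pmf_comp)

lemma add_cube_le: "0 \<le> x \<Longrightarrow> 0 \<le> y \<Longrightarrow> (x + y) ^ 3 \<le> 4 * (x ^ 3 + y ^ 3 :: real)"
proof -
  assume xy: "0 \<le> x" "0 \<le> y"
  have "0 \<le> 3 * (x + y) * (x - y)\<^sup>2" using xy by simp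
  also have "\<dots> = 4 * (x ^ 3 + y ^ 3) - (x + y) ^ 3"
    by (simp add: power3_eq_cube power2_eq_square algebra_simps)
  finally show ?thesis by simp
qed

text \<open>Here b counts the vertices with more than 100 p T^2 triangles, a is t and T the guess.
  Using a \<le> 27 T^3 twice turns b^3 = O(a^3 / (p^3 T^6)) into O(a / p^3). The factor 4 comes from
  \<open>add_cube_le\<close>.\<close>

lemma cube_light_bound:
  fixes a b p T :: real
  assumes "b * (100 * p * T\<^sup>2) \<le> 3 * a" "a \<le> 27 * T ^ 3" "0 \<le> b" "0 \<le> a" "0 < T" "1 \<le> p"
  shows "4 * b ^ 3 \<le> a / (12 * p)"
proof -
  define U where "U = T ^ 3"
  have U: "0 < U" using assms by (simp add: U_def)
  have "(b * (100 * p * T\<^sup>2)) ^ 3 \<le> (3 * a) ^ 3" using assms by (intro power_mono) auto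
  moreover have "(b * (100 * p * T\<^sup>2)) ^ 3 = 1000000 * (b ^ 3 * p ^ 3) * (U * U)"
    by (simp add: U_def power_mult_distrib power2_eq_square power3_eq_cube)
  moreover have "(3 * a) ^ 3 = 27 * a * (a * a)" by (simp add: power3_eq_cube)
  moreover have "27 * a * (a * a) \<le> 27 * a * ((27 * U) * (27 * U))"
    using assms by (intro mult_left_mono mult_mono) (auto simp: U_def)
  moreover have "27 * a * ((27 * U) * (27 * U)) = (19683 * a) * (U * U)" by simp
  ultimately have "(1000000 * (b ^ 3 * p ^ 3)) * (U * U) \<le> (19683 * a) * (U * U)" by linarith
  then have 1: "1000000 * (b ^ 3 * p ^ 3) \<le> 19683 * a"
    using U by (subst (asm) mult_le_cancel_right_pos) auto
  have "b ^ 3 * p \<le> b ^ 3 * p ^ 3" using assms self_le_power[of p 3] by (intro mult_left_mono) auto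
  moreover have "0 \<le> b ^ 3 * p" using assms by simp
  ultimately have "48 * (b ^ 3 * p) \<le> a" using 1 assms(4) by linarith
  then show ?thesis using assms(6) by (simp add: field_simps)
qed

text \<open>Here a counts the vertices above the degree cap, s is t and H is \<open>Hc\<close>; T^3
  \<le> 2 s G limits the guesses for which accuracy is claimed.\<close>

lemma cube_degree_bound:
  fixes a p T H G s :: real
  assumes "a \<le> 8 * T / H" "T ^ 3 \<le> 2 * s * G" "32768 * (p * G) \<le> H ^ 3" "0 \<le> a" "0 < H" "0 < G" "1 \<le> p"
  shows "4 * a ^ 3 \<le> s / (8 * p)"
proof -
  have "a * H \<le> 8 * T" using assms by (simp add: field_simps)
  then have "(a * H) ^ 3 \<le> (8 * T) ^ 3" using assms by (intro power_mono) auto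
  then have "a ^ 3 * H ^ 3 \<le> 512 * T ^ 3" by (simp add: power_mult_distrib)
  moreover have "a ^ 3 * (32768 * (p * G)) \<le> a ^ 3 * H ^ 3" using assms by (intro mult_left_mono) auto
  ultimately have "(32 * (a ^ 3 * p)) * (1024 * G) \<le> s * (1024 * G)" using assms(2) by (simp add: mult_ac)
  then have "32 * (a ^ 3 * p) \<le> s" using assms(6) by (subst (asm) mult_le_cancel_right_pos) auto
  then show ?thesis using assms(7) by (simp add: field_simps)
qed

context guess begin

lemma edges_pos: "1 \<le> t \<Longrightarrow> 1 \<le> m"
  using t_le by (cases m) auto

text \<open>Accuracy is measured by 1 / P, which is at most \<epsilon> in the final
  instance.\<close>

definition Bad :: "(nat \<times> nat) set" where
  "Bad = {r. t / P < \<bar>real (fst r) / real (snd r) - t\<bar>}"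

context
  fixes \<tau> :: nat
  assumes \<tau>: "1 \<le> \<tau>" "\<tau> \<le> n"
begin

lemma K_ge: "128 * Gi * Gi \<le> K"
proof -
  have "1 * 1 * 1 * 128 * (Gi * Gi) \<le> (P * P * P * 100000) * (Gi * Gi)"
    using P by (intro mult_le_mono) auto
  then show ?thesis by (simp add: K_def mult_ac)
qed

lemma sdeg_sum_le: "y \<in> set_pmf (forp (samples \<tau>) sdeg) \<Longrightarrow> fst y \<le> samples \<tau> * n"
proof -
  assume y: "y \<in> set_pmf (forp (samples \<tau>) sdeg)"
  have "y \<in> (\<lambda>x. (0, 1, 0) + x) ` set_pmf (rep (samples \<tau>) (tick sdeg))"
    using y unfolding forp_def tick_def[of "rep (samples \<tau>) (tick sdeg)"] set_map_pmf .
  then obtain z where z: "z \<in> set_pmf (rep (samples \<tau>) (tick sdeg))" "y = (0, 1, 0) + z" by blast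
  have "fst z \<le> samples \<tau> * n"
    by (rule set_rep_le[OF _ z(1)]) (use V_ne degree_le in \<open>auto simp: tick_def sdeg_def\<close>)
  then show ?thesis using z by simp
qed

text \<open>Degrees are at most n, so estimates are at most n^2 + 1 \<le> 4^L, and the L + 1
  doublings satisfy the premise of \<open>kap_lower\<close>.\<close>

lemma mh1_le: "y \<in> set_pmf (forp (samples \<tau>) sdeg) \<Longrightarrow> mh1 \<tau> (fst y) \<le> 4 ^ (L + 1)"
proof -
  assume "y \<in> set_pmf (forp (samples \<tau>) sdeg)"
  then have "n * fst y div samples \<tau> \<le> n * (samples \<tau> * n) div samples \<tau>"
    by (intro div_le_mono mult_le_mono2 sdeg_sum_le)
  also have "\<dots> = n * n" using samples_bounds(3)[OF \<tau>] by (simp add: mult.left_commute)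
  finally have "mh1 \<tau> (fst y) \<le> n * n + 1" by (simp add: mh1_def)
  also have "\<dots> \<le> 2 ^ L * 2 ^ L" using L(3) mult_strict_mono[of n "2 ^ L" n "2 ^ L"] by (simp add: Suc_le_eq)
  also have "\<dots> = 4 ^ L" by (simp flip: power_mult_distrib)
  also have "\<dots> \<le> 4 ^ (L + 1)" by (intro power_increasing) auto
  finally show ?thesis .
qed

lemma ev_mh1: "ev (forp (samples \<tau>) sdeg) (\<lambda>y. real (mh1 \<tau> (fst y))) \<le> 2 * m + 1"
proof -
  have s: "0 < real (samples \<tau>)" using samples_bounds(3)[OF \<tau>] by simp
  have le: "real (mh1 \<tau> x) \<le> n / samples \<tau> * x + 1" for x
    using of_nat_div_le_of_nat[of "n * x" "samples \<tau>", where ?'a = real] by (simp add: mh1_def)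
  have "ev (forp (samples \<tau>) sdeg) (\<lambda>y. real (mh1 \<tau> (fst y)))
      \<le> ev (forp (samples \<tau>) sdeg) (\<lambda>y. n / samples \<tau> * vl y + 1)"
    by (intro ev_mono le) simp
  also have "\<dots> = n / samples \<tau> * (samples \<tau> * ev sdeg vl) + 1" by (simp add: ev_add)
  also have "\<dots> = 2 * m + 1" unfolding ev_sdeg_vl using s npos by simp
  finally show ?thesis .
qed

text \<open>Degrees above \<open>2\<surd>m\<close> are ignored for the lower tail: they have large variance, but
  at least half of the edges are seen without them.\<close>

lemma mh1_tail:
  assumes t: "1 \<le> t" "real \<tau> ^ 3 \<le> 2 * t * Gi"
  shows "measure_pmf.prob (forp (samples \<tau>) sdeg) {y. real (mh1 \<tau> (fst y)) < m / 4} \<le> 1 / (4 * Gi)"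
proof -
  let ?s = "samples \<tau>"
  have s: "0 < real ?s" using samples_bounds(3)[OF \<tau>] by simp
  have m: "1 \<le> m" using t(1) by (rule edges_pos)
  have sm: "0 < sqrt m" using m by simp
  have Gp: "0 < real Gi" "1 \<le> real Gi" using Gi_pos by simp_all
  define f where "f v = (if real (d v) \<le> 2 * sqrt m then d v else 0)" for v
  \<comment> \<open>Degree and truncated degree of the same random vertex, summed jointly: the full
    sum, seen by the algorithm, dominates the truncated one, to which Chebyshev's inequality
    applies. The 2 includes the tick of a loop pass.\<close>
  define D where "D = map_pmf (\<lambda>v. ((d v, 2, 1) :: outcome, f v)) (pmf_of_set V)"
  define h :: "outcome \<times> nat \<Rightarrow> real" where "h z = real (snd z)" for z
  define M where "M = (\<Sum>v\<in>V. real (f v))"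
  have M: "m / 2 \<le> M"
  proof -
    have "M = (\<Sum>v\<in>{v \<in> V. real (d v) \<le> 2 * sqrt m}. real (d v))"
      unfolding M_def f_def by (subst sum.inter_filter) (auto intro: sum.cong)
    then show ?thesis using low_degree_sum by simp
  qed
  have M0: "0 < M" using M m by linarith
  have finD: "fin D" using V_ne by (simp add: D_def)
  have tick_eq: "tick sdeg = map_pmf fst D"
    by (simp add: tick_def sdeg_def D_def map_pmf_comp flip: numeral_2_eq_2)
  have forp_eq: "forp ?s sdeg = map_pmf (\<lambda>z. (0, 1, 0) + fst z) (rep ?s D)"
    unfolding forp_def tick_eq by (subst rep_map) (auto simp: tick_def map_pmf_comp)
  have dom: "snd z \<le> fst (fst z)" if "z \<in> set_pmf (rep k D)" for z k
    using that
  proof (induction k arbitrary: z)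
    case (Suc k)
    then obtain a b where "a \<in> set_pmf D" "b \<in> set_pmf (rep k D)" "z = a + b" by auto
    then show ?case using Suc.IH[of b] V_ne by (auto simp: D_def f_def)
  qed simp
  have h: "\<And>a b. h (a + b) = h a + h b" "h 0 = 0" by (auto simp: h_def)
  have evh: "ev D h = M / n" unfolding D_def h_def M_def using V_ne by (simp add: integral_pmf_of_set)
  have "ev D (\<lambda>z. (h z)\<^sup>2) = (\<Sum>v\<in>V. (real (f v))\<^sup>2) / n"
    unfolding D_def h_def using V_ne by (simp add: integral_pmf_of_set)
  also have "\<dots> \<le> (\<Sum>v\<in>V. 2 * sqrt m * real (f v)) / n"
    by (intro divide_right_mono sum_mono) (auto simp: f_def power2_eq_square intro!: mult_right_mono)
  also have "\<dots> = 2 * sqrt m * M / n" by (simp add: M_def sum_distrib_left)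
  finally have evh2: "ev D (\<lambda>z. (h z)\<^sup>2) \<le> 2 * sqrt m * M / n" .
  let ?R = "rep ?s D"
  have mean: "ev ?R h = ?s * M / n" by (simp add: ev_rep[OF finD h] evh)
  have mpos: "0 < ev ?R h" unfolding mean using s M0 npos by simp
  have sq: "ev ?R (\<lambda>z. (h z)\<^sup>2) \<le> ?s * (2 * sqrt m * M / n) + (ev ?R h)\<^sup>2"
  proof -
    have "ev ?R (\<lambda>z. (h z)\<^sup>2) \<le> ?s * ev D (\<lambda>z. (h z)\<^sup>2) + (?s * ev D h)\<^sup>2" by (rule ev_rep_sq_le[OF finD h])
    moreover have "?s * ev D (\<lambda>z. (h z)\<^sup>2) \<le> ?s * (2 * sqrt m * M / n)" using evh2 by (intro mult_left_mono) auto
    ultimately show ?thesis by (simp add: mean evh)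
  qed
  have "measure_pmf.prob (forp ?s sdeg) {y. real (mh1 \<tau> (fst y)) < m / 4}
      = measure_pmf.prob ?R {z. real (mh1 \<tau> (fst (fst z))) < real m / 4}"
    unfolding forp_eq by (simp add: measure_map_pmf vimage_def)
  also have "\<dots> \<le> measure_pmf.prob ?R {z. ev ?R h / 2 \<le> \<bar>h z - ev ?R h\<bar>}"
  proof (intro measure_pmf.finite_measure_mono_AE)
    show "AE z in measure_pmf ?R. z \<in> {z. real (mh1 \<tau> (fst (fst z))) < real m / 4} \<longrightarrow> z \<in> {z. ev ?R h / 2 \<le> \<bar>h z - ev ?R h\<bar>}"
    proof (rule AE_pmfI, rule impI)
      fix z assume z: "z \<in> set_pmf ?R" "z \<in> {z. real (mh1 \<tau> (fst (fst z))) < real m / 4}"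
      let ?x = "fst (fst z)"
      have "real n * ?x / ?s \<le> real (mh1 \<tau> ?x)"
      proof -
        have "n * ?x \<le> ?s * (n * ?x div ?s + 1)"
          using dividend_less_times_div[of ?s "n * ?x"] samples_bounds(3)[OF \<tau>] by simp
        then have "real (n * ?x) \<le> real (?s * mh1 \<tau> ?x)" unfolding mh1_def by (simp only: of_nat_le_iff)
        then show ?thesis using s by (simp add: field_simps)
      qed
      then have "real n * ?x / ?s < M / 2" using z(2) M by simp
      moreover have "real n * h z / ?s \<le> real n * ?x / ?s"
        using dom[OF z(1)] by (intro divide_right_mono mult_left_mono) (auto simp: h_def)
      ultimately have "real n * h z / ?s < M / 2" by linarith
      then have "h z < ev ?R h / 2" unfolding mean using s npos by (simp add: field_simps)
      then show "z \<in> {z. ev ?R h / 2 \<le> \<bar>h z - ev ?R h\<bar>}"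
        unfolding mem_Collect_eq by linarith
    qed
  qed simp
  also have "\<dots> \<le> ?s * (2 * sqrt m * M / n) / (ev ?R h / 2)\<^sup>2"
    using mpos finD sq by (intro chebyshev_pmf) auto
  also have "\<dots> = 8 * sqrt m * n / (?s * M)"
    unfolding mean using s M0 npos by (simp add: field_simps power2_eq_square)
  also have "\<dots> \<le> 8 * sqrt m * n / ((K * real n / \<tau>) * (m / 2))"
    using samples_bounds(1)[OF \<tau>] M s npos m \<tau> K_pos by (intro divide_left_mono mult_mono mult_pos_pos divide_pos_pos) auto
  also have "\<dots> = 16 * \<tau> / (K * sqrt m)"
  proof -
    have "8 * r * y / ((k * y / z) * ((r * r) / 2)) = 16 * z / (k * r)" if "0 < y" "0 < z" "0 < k" "0 < r" for y z k r :: real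
      using that by (simp add: field_simps)
    from this[of n \<tau> K "sqrt m"] show ?thesis using npos \<tau> K_pos sm by simp
  qed
  also have "\<dots> \<le> 16 * (2 * Gi * sqrt m) / (K * sqrt m)"
  proof -
    \<comment> \<open>As t \<le> m sqrt m, the guess cannot be much larger than sqrt m; this is why
      about n / \<tau> samples suffice to estimate m.\<close>
    have "real \<tau> ^ 3 \<le> (2 * real Gi) * real t" using t(2) by (simp add: mult_ac)
    also have "\<dots> \<le> (2 * real Gi) * (m * sqrt m)" using t_le by (intro mult_left_mono) auto
    also have "\<dots> = (2 * Gi) * sqrt m ^ 3" by (simp add: power3_eq_cube)
    also have "\<dots> \<le> (2 * real Gi) ^ 3 * sqrt m ^ 3"
      using Gp self_le_power[of "2 * real Gi" 3] by (intro mult_right_mono) auto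
    also have "\<dots> = (2 * Gi * sqrt m) ^ 3" by (simp add: power_mult_distrib)
    finally have "real \<tau> ^ Suc 2 \<le> (2 * Gi * sqrt m) ^ Suc 2" by simp
    then have "real \<tau> \<le> 2 * Gi * sqrt m" by (rule power_le_imp_le_base) simp
    then show ?thesis by (intro divide_right_mono mult_left_mono) auto
  qed
  also have "\<dots> = 32 * Gi / K"
  proof -
    have "16 * (2 * g * r) / (k * r) = 32 * g / k" if "0 < r" for g k r :: real
      using that by simp
    from this[OF sm] show ?thesis by simp
  qed
  also have "\<dots> \<le> 32 * Gi / (128 * Gi * Gi)"
    using K_ge Gp K_pos by (intro divide_left_mono) (auto simp flip: of_nat_mult)
  also have "\<dots> = 1 / (4 * Gi)" using Gp by simp
  finally show ?thesis .
qed

definition Xval :: "nat \<Rightarrow> outcome \<Rightarrow> real" where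
  "Xval q x = (let \<kappa> = kap (L + 1) q in
     vl x * (n * (real (g_of \<tau> \<kappa> * \<kappa>) / R_of \<tau> \<kappa>) / (6 * real (samples \<tau>))))"

text \<open>The error t / P is split evenly between the bias, which stems from triangles among heavy
  vertices and from light vertices labelled heavy, and the deviation from the mean
  \<open>Sm\<close>.\<close>

lemma main_accurate:
  assumes t: "1 \<le> t" "real \<tau> ^ 3 \<le> 2 * t * Gi" "t \<le> 27 * real \<tau> ^ 3"
    and q: "m / 4 \<le> real q" "q \<le> 4 ^ (L + 1)"
  shows "measure_pmf.prob (mainp \<tau> q) {x. t / P < \<bar>Xval q x - t\<bar>} \<le> 1 / (2 * Gi)"
proof -
  let ?\<kappa> = "kap (L + 1) q"
  note ab = A_bounds[OF \<tau> kap_pos, of "L + 1" q]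
  let ?A = "real (g_of \<tau> ?\<kappa> * ?\<kappa>) / R_of \<tau> ?\<kappa>"
  note pos = kap_pos[of "L + 1" q] ab(4,5) \<tau>pos[OF \<tau>] npos
  let ?s = "samples \<tau>"
  let ?S = "Sm ?\<kappa> (g_of \<tau> ?\<kappa>) (R_of \<tau> ?\<kappa>) (dcap_of \<tau> q) (thr_of \<tau> ?\<kappa>)"
  have Gp: "0 < real Gi" "1 \<le> real Gi" using Gi_pos by simp_all
  have Pp: "2 \<le> real P" using P by simp
  have m: "1 \<le> m" using t(1) by (rule edges_pos)
  have k2: "sqrt (2 * m) \<le> 3 * ?\<kappa>"
  proof -
    have "real q \<le> real (?\<kappa>\<^sup>2)" using kap_lower[OF q(2)] by (simp only: of_nat_le_iff)
    then have "real q \<le> (real ?\<kappa>)\<^sup>2" by (simp only: of_nat_power)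
    moreover have "(3 * real ?\<kappa>)\<^sup>2 = 9 * (real ?\<kappa>)\<^sup>2" by (simp add: power_mult_distrib)
    ultimately have "2 * real m \<le> (3 * real ?\<kappa>)\<^sup>2" using q(1) by linarith
    then have "sqrt (2 * real m) \<le> 3 * real ?\<kappa>" by (intro real_le_lsqrt) auto
    then show ?thesis by simp
  qed
  have th: "32 \<le> 100 * real P" using Pp by simp
  have thr: "x < thr_of \<tau> ?\<kappa> \<longleftrightarrow> x * ?A < 2 * (100 * real P * \<tau>\<^sup>2)" for x
    by (rule thr_iff[OF \<tau> kap_pos])
  have T: "0 < real \<tau>" using \<tau> by simp
  have S_le: "?S \<le> t" by (rule Sm_le[OF pos ab(1,2,3)])
  have S_ge: "t - t / (2 * P) \<le> ?S"
  proof -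
    let ?a = "real (card {z \<in> V. dcap_of \<tau> q < d z})"
    let ?b = "real (card {z \<in> V. 100 * real P * \<tau>\<^sup>2 < tv z})"
    have H0: "0 < real Hc" using P Gi_pos by (simp add: Hc_def)
    have qpos: "0 < real q" using q(1) m by (intro less_le_trans[OF _ q(1)]) simp
    have "?a \<le> 8 * \<tau> / Hc"
    proof -
      have sub: "{z \<in> V. dcap_of \<tau> q < d z} \<subseteq> {z \<in> V. q * Hc / \<tau> < d z}"
      proof
        fix z assume "z \<in> {z \<in> V. dcap_of \<tau> q < d z}"
        then have "z \<in> V" "q * Hc div \<tau> + 1 \<le> d z" by (auto simp: dcap_of_def)
        moreover have "q * Hc < \<tau> * (q * Hc div \<tau>) + \<tau>" using \<tau> dividend_less_times_div[of \<tau> "q * Hc"] by simp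
        ultimately have "q * Hc < \<tau> * d z" using mult_le_mono2[of "q * Hc div \<tau> + 1" "d z" \<tau>] by simp
        then have "real (q * Hc) < real (\<tau> * d z)" by (simp only: of_nat_less_iff)
        then show "z \<in> {z \<in> V. q * Hc / \<tau> < d z}" using T \<open>z \<in> V\<close> by (simp add: field_simps)
      qed
      have "?a \<le> real (card {z \<in> V. q * Hc / \<tau> < d z})"
        by (simp only: of_nat_le_iff) (rule card_mono[OF _ sub], simp)
      moreover have "real (card {z \<in> V. q * Hc / \<tau> < d z}) * (q * Hc / \<tau>) \<le> 2 * m"
        by (rule card_degree_large) simp
      moreover have "2 * real m \<le> 8 * q" using q(1) by simp
      moreover from calculation(1) have "?a * (q * Hc / \<tau>)
          \<le> real (card {z \<in> V. q * Hc / \<tau> < d z}) * (q * Hc / \<tau>)"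
        by (rule mult_right_mono) simp
      ultimately have "?a * (q * Hc / \<tau>) \<le> 8 * q" by linarith
      then show ?thesis using qpos H0 T by (simp add: field_simps)
    qed
    moreover have "32768 * (real P * Gi) \<le> real Hc ^ 3"
    proof -
      have "1 \<le> P * Gi" using P Gi_pos by (simp add: Suc_le_eq)
      then have "P * Gi \<le> (P * Gi) ^ 3" by (rule self_le_power) simp
      then have "32768 * (P * Gi) \<le> Hc ^ 3" by (simp add: Hc_def power_mult_distrib mult.assoc)
      then have "real (32768 * (P * Gi)) \<le> real (Hc ^ 3)" by (simp only: of_nat_le_iff)
      then show ?thesis by simp
    qed
    ultimately have a3': "4 * ?a ^ 3 \<le> t / (8 * P)"
      using cube_degree_bound[of ?a \<tau> Hc t Gi P] t(2) H0 Gp Pp by simp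
    have "?b * (100 * real P * \<tau>\<^sup>2) \<le> 3 * t"
      using Pp T by (intro card_tv_large) auto
    then have b3: "4 * ?b ^ 3 \<le> t / (12 * P)"
      using cube_light_bound[of ?b P \<tau> t] t(3) T Pp by simp
    have "(?a + ?b) ^ 3 \<le> 4 * (?a ^ 3 + ?b ^ 3)" by (rule add_cube_le) auto
    also have "\<dots> \<le> t / (8 * P) + t / (12 * P)" unfolding distrib_left by (rule add_mono[OF a3' b3])
    finally have ab3: "(?a + ?b) ^ 3 \<le> t / (8 * P) + t / (12 * P)" .
    define y where "y = 1 / real P"
    have y: "0 \<le> y" "y \<le> 1" using Pp by (auto simp: y_def)
    have ty: "0 \<le> t * y" "0 \<le> t * y * y" using y by auto
    have e: "t / (8 * P) = t * y / 8" "t / (12 * P) = t * y / 12" "t / (2 * P) = t * y / 2" "8 / (100 * P) = 8 / 100 * y"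
      by (simp_all add: y_def)
    \<comment> \<open>The triangles among heavy vertices cost at most t / (4P), because 1/8 + 1/12 <
      1/4; wrong labels cost a further factor 1 - 8 / \<theta>.\<close>
    have "t - t * y / 2 \<le> (1 - 8 / 100 * y) * (t - t * y / 4)"
      using ty by (simp add: algebra_simps)
    also have "\<dots> \<le> (1 - 8 / 100 * y) * (t - (?a + ?b) ^ 3)"
    proof (rule mult_left_mono)
      have "(?a + ?b) ^ 3 \<le> t * y / 4" using ab3[unfolded e] ty(1) by linarith
      then show "t - t * y / 4 \<le> t - (?a + ?b) ^ 3" by simp
      show "0 \<le> 1 - 8 / 100 * y" using y by simp
    qed
    finally have "t - t / (2 * P) \<le> (1 - 8 / (100 * P)) * (t - (?a + ?b) ^ 3)" unfolding e .
    also have "\<dots> \<le> ?S"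
      using Sm_ge[OF pos ab(1,2,3) k2 thr th, of "dcap_of \<tau> q"] by simp
    finally show ?thesis .
  qed
  have "measure_pmf.prob (mainp \<tau> q) {x. t / P < \<bar>Xval q x - t\<bar>}
      \<le> measure_pmf.prob (mainp \<tau> q) {x. (1 / (2 * P)) * t \<le> \<bar>vl x * (n * ?A / (6 * real ?s)) - ?S\<bar>}"
  proof (intro measure_pmf.finite_measure_mono subsetI CollectI)
    fix x assume "x \<in> {x. t / P < \<bar>Xval q x - t\<bar>}"
    then have "t / P < \<bar>vl x * (n * ?A / (6 * real ?s)) - t\<bar>" by (simp add: Xval_def Let_def)
    moreover have "t / P = t / (2 * P) + t / (2 * P)" by simp
    ultimately have h: "t / (2 * P) + t / (2 * P) < \<bar>vl x * (n * ?A / (6 * real ?s)) - t\<bar>" by (simp only:)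
    have gen: "b \<le> \<bar>v - c\<bar>" if "b + b < \<bar>v - a\<bar>" "c \<le> a" "a - b \<le> c" for a b c v :: real
      using that by linarith
    have "t / (2 * P) \<le> \<bar>vl x * (n * ?A / (6 * real ?s)) - ?S\<bar>" by (rule gen[OF h S_le S_ge])
    then show "(1 / (2 * P)) * t \<le> \<bar>vl x * (n * ?A / (6 * real ?s)) - ?S\<bar>" by simp
  qed simp
  also have "\<dots> \<le> 3 * (4 + 8 * (100 * real P)) * (n * ?A) / (?s * (1 / (2 * P))\<^sup>2 * t)"
    unfolding mainp_def Let_def using Pp t(1) samples_bounds(3)[OF \<tau>]
    by (intro count_chebyshev[OF pos ab(1,2,3) k2 thr th]) auto
  also have "\<dots> \<le> 3 * (804 * P) * (n * (2 * \<tau>\<^sup>2)) / ((K * real n / \<tau>) * (1 / (2 * P))\<^sup>2 * t)"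
  proof (rule frac_le)
    have "3 * (4 + 8 * (100 * real P)) \<le> 3 * (804 * P)" using Pp by simp
    moreover have "real n * ?A \<le> real n * (2 * \<tau>\<^sup>2)" by (rule mult_left_mono[OF ab(2)]) simp
    ultimately have "3 * (4 + 8 * (100 * real P)) * (n * ?A) \<le> real (3 * (804 * P)) * (real n * real (2 * \<tau>\<^sup>2))"
      by (rule mult_mono) (simp_all del: of_nat_mult)
    then show "3 * (4 + 8 * (100 * real P)) * (n * ?A) \<le> 3 * (804 * P) * (n * (2 * \<tau>\<^sup>2))"
      by (simp only: of_nat_mult)
    show "0 < (K * real n / \<tau>) * (1 / (2 * P))\<^sup>2 * t" using Pp t(1) T npos K_pos by simp
    show "(K * real n / \<tau>) * (1 / (2 * P))\<^sup>2 * t \<le> ?s * (1 / (2 * P))\<^sup>2 * t"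
      by (intro mult_right_mono samples_bounds(1)[OF \<tau>]) auto
  qed simp
  also have "\<dots> = 19296 * real P ^ 3 * real \<tau> ^ 3 / (K * t)"
  proof -
    have "3 * (804 * p) * (a * (2 * (T * T))) / ((k * a / T) * ((1 / (2 * p)) * (1 / (2 * p))) * s)
        = 19296 * (p * p * p) * (T * T * T) / (k * s)"
      if "0 < p" "0 < a" "0 < T" "0 < k" "0 < s" for p a T k s :: real
      using that by (simp add: field_simps)
    from this[of P n \<tau> K t] show ?thesis
      using npos T Pp K_pos t(1) by (simp add: power2_eq_square power3_eq_cube)
  qed
  also have "\<dots> \<le> 19296 * real P ^ 3 * (2 * t * Gi) / (K * t)"
    using t(2) by (intro divide_right_mono mult_left_mono) auto
  also have "\<dots> = 38592 * real P ^ 3 * Gi / K" using t(1) by simp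
  also have "\<dots> = 38592 / (100000 * Gi)"
    using Pp Gp by (simp add: K_def power3_eq_cube)
  also have "\<dots> \<le> 1 / (2 * Gi)" using Gp by (simp add: field_simps)
  finally show ?thesis .
qed

text \<open>An accurate estimate stays below the cap and is output unchanged. As P \<ge> 2 it is at
  least t / 2, hence accepted if \<tau>^3 \<le> t.\<close>

lemma decide_good:
  assumes X: "\<bar>Xval q x - t\<bar> \<le> t / P"
  shows "decide \<tau> (kap (L + 1) q) (fst x) \<notin> Some ` Bad"
    and "real \<tau> ^ 3 \<le> t \<Longrightarrow> decide \<tau> (kap (L + 1) q) (fst x) \<noteq> None"
proof -
  let ?\<kappa> = "kap (L + 1) q"
  let ?R = "R_of \<tau> ?\<kappa>" and ?G = "g_of \<tau> ?\<kappa> * ?\<kappa>" and ?s = "samples \<tau>"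
  note ab = A_bounds[OF \<tau> kap_pos, of "L + 1" q]
  have "1 \<le> ?G" using ab(4) kap_pos[of "L + 1" q] by (simp add: Suc_le_eq)
  then have "real 1 \<le> real ?G" by (simp only: of_nat_le_iff)
  then have G: "1 \<le> real ?G" by simp
  have R: "0 < real ?R" using ab(5) by simp
  have s: "0 < real ?s" using samples_bounds(3)[OF \<tau>] by simp
  have n0: "0 < real n" using npos by simp
  have Xv: "Xval q x = real n * ?G * vl x / (6 * ?s * ?R)" by (simp add: Xval_def Let_def mult_ac)
  have tP: "t / P \<le> t / 2" using P by (intro divide_left_mono) auto
  have "real t \<le> real (n ^ 3)" using t_le_cube by (simp only: of_nat_le_iff)
  then have "real t \<le> real n ^ 3" by (simp only: of_nat_power)
  then have "Xval q x \<le> 2 * real n ^ 3" using X tP by linarith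
  then have "real n * ?G * vl x \<le> 2 * real n ^ 3 * (6 * ?s * ?R)"
    unfolding Xv using s R by (simp add: pos_divide_le_eq)
  moreover have "real n * 1 * vl x \<le> real n * ?G * vl x" using G by (intro mult_right_mono mult_left_mono) auto
  moreover have "2 * real n ^ 3 * (6 * ?s * ?R) = real n * real (cap \<tau> ?R)"
    by (simp add: cap_def power3_eq_cube)
  ultimately have "real n * vl x \<le> real n * real (cap \<tau> ?R)" by simp
  then have "vl x \<le> real (cap \<tau> ?R)" using n0 by (rule mult_left_le_imp_le)
  then have c: "min (fst x) (cap \<tau> ?R) = fst x" by simp
  show "decide \<tau> ?\<kappa> (fst x) \<notin> Some ` Bad"
  proof
    assume "decide \<tau> ?\<kappa> (fst x) \<in> Some ` Bad"
    then obtain r where r: "decide \<tau> ?\<kappa> (fst x) = Some r" "r \<in> Bad" by auto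
    then have "r = (n * g_of \<tau> ?\<kappa> * ?\<kappa> * fst x, 6 * ?s * ?R)"
      unfolding decide_def Let_def c by (auto split: if_split_asm)
    then have "real (fst r) / real (snd r) = Xval q x" unfolding Xv by (simp add: mult_ac)
    then show False using r(2) X by (simp add: Bad_def)
  qed
  show "decide \<tau> ?\<kappa> (fst x) \<noteq> None" if "real \<tau> ^ 3 \<le> t"
  proof -
    have "real \<tau> ^ 3 \<le> 2 * Xval q x" using that X tP by linarith
    then have h: "real \<tau> ^ 3 \<le> 2 * (real n * ?G * vl x) / (6 * ?s * ?R)" unfolding Xv by simp
    have "0 < real (6 * ?s * ?R)" using s R by simp
    from h[unfolded pos_le_divide_eq[OF this]] have "real (6 * ?s * ?R * (\<tau> * \<tau> * \<tau>)) \<le> real (2 * (n * g_of \<tau> ?\<kappa> * ?\<kappa> * fst x))"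
      by (simp add: power3_eq_cube mult_ac)
    then have "6 * ?s * ?R * (\<tau> * \<tau> * \<tau>) \<le> 2 * (n * g_of \<tau> ?\<kappa> * ?\<kappa> * fst x)"
      by (simp only: of_nat_le_iff)
    then show ?thesis unfolding decide_def Let_def c by (simp only: if_True) simp
  qed
qed

text \<open>F will be the set of wrong answers, without or with rejection. Each degree estimate is
  too small with probability at most 1 / (4 \<open>Gi\<close>); if neither is, the minimum q suits
  \<open>main_accurate\<close>. A q that is too large costs time, not accuracy.\<close>

lemma level_fail:
  assumes t: "1 \<le> t" "real \<tau> ^ 3 \<le> 2 * t * Gi" "t \<le> 27 * real \<tau> ^ 3"
    and F: "\<And>q x. \<bar>Xval q x - t\<bar> \<le> t / P \<Longrightarrow> decide \<tau> (kap (L + 1) q) (fst x) \<notin> F"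
  shows "measure_pmf.prob (level \<tau>) {y. fst y \<in> F} \<le> 1 / Gi"
proof -
  let ?D = "forp (samples \<tau>) sdeg"
  let ?b = "\<lambda>y::outcome. (of_bool (real (mh1 \<tau> (fst y)) < m / 4) :: real)"
  have main: "ev (mainp \<tau> q) (\<lambda>x. of_bool (decide \<tau> (kap (L + 1) q) (fst x) \<in> F)) \<le> 1" for q
    using ev_mono[OF fin_mainp[OF \<tau>], of q "\<lambda>x. of_bool (decide \<tau> (kap (L + 1) q) (fst x) \<in> F)" "\<lambda>_. 1"] by simp
  have main': "ev (mainp \<tau> q) (\<lambda>x. of_bool (decide \<tau> (kap (L + 1) q) (fst x) \<in> F)) \<le> 1 / (2 * Gi)"
    if q: "m / 4 \<le> real q" "q \<le> 4 ^ (L + 1)" for q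
  proof -
    have "ev (mainp \<tau> q) (\<lambda>x. of_bool (decide \<tau> (kap (L + 1) q) (fst x) \<in> F))
        \<le> ev (mainp \<tau> q) (indicator {x. t / P < \<bar>Xval q x - t\<bar>})"
      using F by (intro ev_mono) (auto simp: indicator_def not_less[symmetric] fin_mainp[OF \<tau>])
    also have "\<dots> \<le> 1 / (2 * Gi)"
      unfolding prob_eq_ev[symmetric] by (rule main_accurate[OF t q])
    finally show ?thesis .
  qed
  have tail: "ev ?D ?b \<le> 1 / (4 * Gi)"
  proof -
    have "ev ?D ?b = measure_pmf.prob ?D {y. real (mh1 \<tau> (fst y)) < m / 4}"
      unfolding prob_eq_ev by (intro ev_cong) (simp add: indicator_def)
    then show ?thesis using mh1_tail[OF t(1,2)] by simp
  qed
  have "measure_pmf.prob (level \<tau>) {y. fst y \<in> F} = ev (level \<tau>) (\<lambda>y. of_bool (fst y \<in> F))"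
    unfolding prob_eq_ev by (intro ev_cong) (simp add: indicator_def)
  also have "\<dots> \<le> ev ?D (\<lambda>y. ev ?D (\<lambda>z. (?b y + 1 / (2 * Gi)) + ?b z))"
    unfolding ev_level[OF \<tau>] fst_conv Let_def
  proof (intro ev_mono fin_forp fin_sdeg)
    fix y z :: outcome assume yz: "y \<in> set_pmf ?D" "z \<in> set_pmf ?D"
    let ?q = "min (mh1 \<tau> (fst y)) (mh1 \<tau> (fst z))"
    have q4: "?q \<le> 4 ^ (L + 1)" using mh1_le[OF yz(1)] by simp
    have Gn: "0 \<le> 1 / (2 * real Gi)" by simp
    show "ev (mainp \<tau> ?q) (\<lambda>x. of_bool (decide \<tau> (kap (L + 1) ?q) (fst x) \<in> F)) \<le> (?b y + 1 / (2 * Gi)) + ?b z"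
    proof (cases "m / 4 \<le> real ?q")
      case True
      have "0 \<le> ?b y" "0 \<le> ?b z" by simp_all
      then show ?thesis using main'[OF True q4] by linarith
    next
      case False
      then have "1 \<le> ?b y + ?b z" by (auto simp: min_def split: if_splits)
      then show ?thesis using main[of ?q] Gn by linarith
    qed
  qed
  also have "\<dots> = ev ?D ?b + 1 / (2 * Gi) + ev ?D ?b"
    by (simp add: ev_add)
  also have "\<dots> \<le> 1 / Gi" using tail by simp
  finally show ?thesis .
qed

lemma level_bad:
  assumes "1 \<le> t" "real \<tau> ^ 3 \<le> 2 * t * Gi" "t \<le> 27 * real \<tau> ^ 3"
  shows "measure_pmf.prob (level \<tau>) {y. fst y \<in> Some ` Bad} \<le> 1 / Gi"
  by (rule level_fail[OF assms decide_good(1)])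

lemma level_bad_or_None:
  assumes "1 \<le> t" "real \<tau> ^ 3 \<le> t" "t \<le> 27 * real \<tau> ^ 3"
  shows "measure_pmf.prob (level \<tau>) {y. fst y \<in> insert None (Some ` Bad)} \<le> 1 / Gi"
proof (rule level_fail)
  have "real t * 1 \<le> real t * (2 * Gi)" using Gi_pos by (intro mult_left_mono) auto
  then have "real t \<le> 2 * t * Gi" by simp
  then show "real \<tau> ^ 3 \<le> 2 * t * Gi" using assms by linarith
qed (use assms decide_good in auto)

text \<open>Up to \<tau>^3 = 2 t \<open>Gi\<close> the guess is accurate; above, acceptance alone is
  unlikely enough by Markov's inequality.\<close>

lemma level_bad_always:
  assumes "1 \<le> t" "t \<le> 27 * real \<tau> ^ 3"
  shows "measure_pmf.prob (level \<tau>) {y. fst y \<in> Some ` Bad} \<le> 1 / Gi"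
proof (cases "real \<tau> ^ 3 \<le> 2 * t * Gi")
  case True
  then show ?thesis using assms by (intro level_bad)
next
  case False
  have "measure_pmf.prob (level \<tau>) {y. fst y \<in> Some ` Bad} \<le> measure_pmf.prob (level \<tau>) {y. fst y \<noteq> None}"
    by (intro measure_pmf.finite_measure_mono) auto
  also have "\<dots> \<le> 2 * t / \<tau> ^ 3" by (rule level_accept_le[OF \<tau>])
  also have "\<dots> \<le> 1 / Gi" using False \<tau> Gi_pos by (simp add: field_simps)
  finally show ?thesis .
qed

subsection \<open>Expected cost of one guess\<close>

text \<open>Since \<kappa> is of order sqrt q while only means of an estimate and of a product of
  two are available, all terms with \<kappa> are replaced by polynomials of degree at most 2 in q,
  weighted by powers of sqrt m, using 2ac \<le> a^2 + c^2.\<close>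

lemma ev_mainp_st:
  fixes u M b :: real
  assumes m: "1 \<le> m" and q: "1 \<le> q"
  defines "u \<equiv> samples \<tau> / (n * (real \<tau>)\<^sup>2)" and "M \<equiv> m * sqrt m" and "b \<equiv> t * Hc / real \<tau> ^ 3"
  shows "ev (mainp \<tau> q) st \<le> 1 + 8 * samples \<tau> + u * (22 * M + 132 * t)
     + u * ((40 + 468 * b) * sqrt m) * q + u * (90 * b / sqrt m) * (real q * q)"
proof -
  let ?\<kappa> = "kap (L + 1) q"
  note ab = A_bounds[OF \<tau> kap_pos, of "L + 1" q]
  note pos = kap_pos[of "L + 1" q] ab(4,5) \<tau>pos[OF \<tau>] npos
  let ?s = "real (samples \<tau>)" and ?r = "sqrt m"
  let ?ell = "ell ?\<kappa> (dcap_of \<tau> q) \<tau>"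
  have T: "0 < real \<tau>" using \<tau> by simp
  have r: "1 \<le> ?r" "0 < ?r" and rr: "?r * ?r = m" using m by simp_all
  have r2: "sqrt (2 * m) \<le> 3 / 2 * ?r"
  proof (rule real_le_lsqrt)
    have "(3 / 2 * ?r)\<^sup>2 = 9 / 4 * m" using rr by (simp add: power2_eq_square)
    then show "real (2 * m) \<le> (3 / 2 * ?r)\<^sup>2" by simp
  qed simp_all
  define k where "k = real ?\<kappa>"
  have "real (?\<kappa>\<^sup>2) \<le> real (4 * q)" using kap_upper[OF q] by (simp only: of_nat_le_iff)
  then have k2: "k * k \<le> 4 * real q" by (simp add: power2_eq_square k_def)
  have k0: "0 \<le> k" by (simp add: k_def)
  have amgm: "2 * (a * c) \<le> a * a + c * c" for a c :: real
    using zero_le_power2[of "a - c"] by (simp add: power2_eq_square algebra_simps)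
  have kr: "k * ?r \<le> 2 * q + m / 2" using amgm[of k ?r] k2 rr by linarith
  have km: "k * m \<le> (2 * q + m / 2) * ?r"
    using mult_right_mono[OF kr, of ?r] r rr by (simp add: mult.assoc)
  have kq: "k * q \<le> 2 * q * ?r + q * q / (2 * ?r)"
  proof -
    have "2 * (k * ?r * q) \<le> k * k * m + real q * q"
      using amgm[of "k * ?r" "real q"] rr by (simp add: mult_ac)
    also have "\<dots> \<le> 4 * real q * m + real q * q" by (intro add_right_mono mult_right_mono k2) simp
    finally have "k * q * (2 * ?r) \<le> (2 * q * ?r + q * q / (2 * ?r)) * (2 * ?r)"
      using r(2) rr by (simp add: field_simps)
    then show ?thesis using r(2) by simp
  qed
  have dc: "real (dcap_of \<tau> q) \<le> q * Hc / \<tau>"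
    unfolding dcap_of_def using of_nat_div_le_of_nat[of "q * Hc" \<tau>, where ?'a = real] by simp
  have ell: "?ell \<le> 7 + (26 * q * ?r + 5 * (q * q / ?r)) * (Hc / real \<tau> ^ 3)"
  proof -
    have "(10 * k + 4 * sqrt (2 * m)) * dcap_of \<tau> q \<le> (10 * k + 6 * ?r) * (q * Hc / \<tau>)"
      using r2 dc k0 r by (intro mult_mono) auto
    also have "\<dots> = (10 * (k * q) + 6 * q * ?r) * (Hc / \<tau>)" by (simp add: algebra_simps add_divide_distrib)
    also have "\<dots> \<le> (10 * (2 * q * ?r + q * q / (2 * ?r)) + 6 * q * ?r) * (Hc / \<tau>)"
      using kq by (intro mult_right_mono add_mono mult_left_mono) auto
    also have "\<dots> = (26 * q * ?r + 5 * (q * q / ?r)) * (Hc / \<tau>)" by (simp add: algebra_simps)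
    finally have "(10 * k + 4 * sqrt (2 * m)) * dcap_of \<tau> q / \<tau>\<^sup>2
        \<le> (26 * q * ?r + 5 * (q * q / ?r)) * (Hc / \<tau>) / \<tau>\<^sup>2" by (intro divide_right_mono) auto
    also have "\<dots> = (26 * q * ?r + 5 * (q * q / ?r)) * (Hc / real \<tau> ^ 3)"
      using T by (simp add: power2_eq_square power3_eq_cube mult_ac)
    finally show ?thesis unfolding ell_def[OF pos ab(1,2,3)] k_def by simp
  qed
  have "20 * k * m + 8 * m * sqrt (2 * m) + 6 * t * (1 + 3 * ?ell)
      \<le> 20 * ((2 * q + m / 2) * ?r) + 12 * M + 6 * t * (1 + 3 * (7 + (26 * q * ?r + 5 * (q * q / ?r)) * (Hc / real \<tau> ^ 3)))"
  proof (intro add_mono mult_left_mono ell)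
    show "20 * k * m \<le> 20 * ((2 * q + m / 2) * ?r)" using km by simp
    show "8 * m * sqrt (2 * m) \<le> 12 * M"
      using mult_left_mono[OF r2, of "8 * m"] by (simp add: M_def)
  qed auto
  also have "\<dots> = (22 * M + 132 * t) + ((40 + 468 * b) * ?r) * q + (90 * b / ?r) * (real q * q)"
    using r(2) by (simp add: M_def b_def algebra_simps add_divide_distrib)
  finally have bound: "20 * k * m + 8 * m * sqrt (2 * m) + 6 * t * (1 + 3 * ?ell)
      \<le> (22 * M + 132 * t) + ((40 + 468 * b) * ?r) * q + (90 * b / ?r) * (real q * q)" .
  have "ev (mainv ?\<kappa> (g_of \<tau> ?\<kappa>) (R_of \<tau> ?\<kappa>) (dcap_of \<tau> q) (thr_of \<tau> ?\<kappa>)) st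
      \<le> 7 + (20 * k * m + 8 * m * sqrt (2 * m) + 6 * t * (1 + 3 * ?ell)) / (n * (real \<tau>)\<^sup>2)"
    using ev_mainv_st[OF pos ab(1,2,3), of "dcap_of \<tau> q" "thr_of \<tau> ?\<kappa>"] by (simp add: k_def mult_ac)
  also have "\<dots> \<le> 7 + ((22 * M + 132 * t) + ((40 + 468 * b) * ?r) * q + (90 * b / ?r) * (real q * q)) / (n * (real \<tau>)\<^sup>2)"
    using bound by (intro add_left_mono divide_right_mono) auto
  finally have e: "ev (mainv ?\<kappa> (g_of \<tau> ?\<kappa>) (R_of \<tau> ?\<kappa>) (dcap_of \<tau> q) (thr_of \<tau> ?\<kappa>)) st
      \<le> 7 + ((22 * M + 132 * t) + ((40 + 468 * b) * ?r) * q + (90 * b / ?r) * (real q * q)) / (n * (real \<tau>)\<^sup>2)" .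
  have "ev (mainp \<tau> q) st = 1 + ?s * (1 + ev (mainv ?\<kappa> (g_of \<tau> ?\<kappa>) (R_of \<tau> ?\<kappa>) (dcap_of \<tau> q) (thr_of \<tau> ?\<kappa>)) st)"
    unfolding mainp_def Let_def by (rule ev_forp_st) (rule fin_mainv[OF pos ab(1,2,3)])
  also have "\<dots> \<le> 1 + ?s * (1 + (7 + ((22 * M + 132 * t) + ((40 + 468 * b) * ?r) * q + (90 * b / ?r) * (real q * q)) / (n * (real \<tau>)\<^sup>2)))"
    using e by (intro add_left_mono mult_left_mono) auto
  also have "\<dots> = 1 + 8 * ?s + u * ((22 * M + 132 * t) + ((40 + 468 * b) * ?r) * q + (90 * b / ?r) * (real q * q))"
  proof -
    have "1 + a * (1 + (7 + z / c)) = 1 + 8 * a + a / c * z" for a z c :: real by (simp add: distrib_left)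
    then show ?thesis unfolding u_def .
  qed
  also have "\<dots> = 1 + 8 * ?s + u * (22 * M + 132 * t)
     + u * ((40 + 468 * b) * ?r) * q + u * (90 * b / ?r) * (real q * q)"
    by (simp only: distrib_left mult.assoc add.assoc)
  finally show ?thesis by (simp only: of_nat_add of_nat_mult of_nat_1 of_nat_numeral)
qed

text \<open>The third term pays for the lightness tests: up to constants and \<open>K\<close>, there
  are t / \<tau>^3 hits with tests of cost M / \<tau>^3. It stays below the second term as long as
  \<tau>^3 \<ge> t.\<close>

lemma ev_level_st:
  fixes M :: real
  assumes "1 \<le> t"
  defines "M \<equiv> m * sqrt m"
  shows "ev (level \<tau>) (\<lambda>y. real (fst (snd y))) \<le> 5000 * (real K * Hc) * (n / \<tau> + M / real \<tau> ^ 3 + t * M / real \<tau> ^ 6)"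
proof -
  let ?D = "forp (samples \<tau>) sdeg" and ?s = "real (samples \<tau>)" and ?r = "sqrt m"
  have m: "1 \<le> m" using assms(1) by (rule edges_pos)
  have T: "0 < real \<tau>" using \<tau> by simp
  have s1: "1 \<le> ?s" using samples_bounds(3)[OF \<tau>] by simp
  define u where "u = ?s / (n * (real \<tau>)\<^sup>2)"
  define b where "b = t * Hc / real \<tau> ^ 3"
  define c0 where "c0 = 1 + 8 * ?s + u * (22 * M + 132 * t)"
  define c1 where "c1 = u * ((40 + 468 * b) * ?r)"
  define c2 where "c2 = u * (90 * b / ?r)"
  have nn: "0 \<le> u" "0 \<le> b" "0 \<le> c1" "0 \<le> c2" by (simp_all add: u_def b_def c1_def c2_def)
  have mp: "ev (mainp \<tau> q) st \<le> c0 + c1 * q + c2 * (real q * q)" if "1 \<le> q" for q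
    using ev_mainp_st[OF m that] unfolding c0_def c1_def c2_def u_def b_def M_def by simp
  have sst: "ev ?D st = 1 + 2 * ?s"
    using V_ne by (simp add: sdeg_def integral_pmf_of_set)
  define H where "H = (\<lambda>y::outcome. real (mh1 \<tau> (fst y)))"
  have evH: "ev ?D H \<le> 3 * real m" using ev_mh1 m by (simp add: H_def)
  have H0: "0 \<le> ev ?D H" by (rule ev_nonneg) (simp add: H_def)
  \<comment> \<open>q is bounded by the first estimate and q^2 by the product of both, so that only
    means remain.\<close>
  have "ev (level \<tau>) (\<lambda>y. real (fst (snd y)))
      \<le> ev ?D (\<lambda>y. ev ?D (\<lambda>z. (st y + (L + 10) + c0 + c1 * H y) + (st z + c2 * H y * H z)))"
    unfolding ev_level[OF \<tau>] fst_conv snd_conv Let_def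
  proof (intro ev_mono fin_forp fin_sdeg)
    fix y z :: outcome
    let ?q = "min (mh1 \<tau> (fst y)) (mh1 \<tau> (fst z))"
    have "ev (mainp \<tau> ?q) (\<lambda>x. real (fst (snd y) + fst (snd z) + fst (snd x) + (L + 10)))
        = st y + st z + (L + 10) + ev (mainp \<tau> ?q) st"
      using fin_mainp[OF \<tau>] by (simp add: ev_add)
    also have "ev (mainp \<tau> ?q) st \<le> c0 + c1 * ?q + c2 * (real ?q * ?q)"
      by (rule mp) (simp add: mh1_def)
    also have "\<dots> \<le> c0 + c1 * H y + c2 * (H y * H z)"
      using nn by (intro add_mono mult_left_mono mult_mono order_refl) (auto simp: H_def)
    finally show "ev (mainp \<tau> ?q) (\<lambda>x. real (fst (snd y) + fst (snd z) + fst (snd x) + (L + 10)))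
        \<le> (st y + (L + 10) + c0 + c1 * H y) + (st z + c2 * H y * H z)" by (simp add: algebra_simps)
  qed
  also have "\<dots> = ev ?D st + (L + 10) + c0 + c1 * ev ?D H + ev ?D st + c2 * (ev ?D H * ev ?D H)"
  proof -
    have "ev ?D (\<lambda>z. (st y + (L + 10) + c0 + c1 * H y) + (st z + c2 * H y * H z))
        = (st y + c1 * H y) + ((L + 10) + c0 + ev ?D st) + (c2 * ev ?D H) * H y" for y
      by (simp add: ev_add mult.assoc)
    then show ?thesis by (simp add: ev_add)
  qed
  also have "\<dots> \<le> (1 + 2 * ?s) + (L + 10) + c0 + c1 * (3 * m) + (1 + 2 * ?s) + c2 * ((3 * m) * (3 * m))"
  proof -
    have "ev ?D H * ev ?D H \<le> (3 * real m) * (3 * real m)" by (intro mult_mono evH H0) simp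
    then have "c2 * (ev ?D H * ev ?D H) \<le> c2 * ((3 * real m) * (3 * real m))" by (rule mult_left_mono) (rule nn)
    moreover have "c1 * ev ?D H \<le> c1 * (3 * real m)" using evH nn(3) by (rule mult_left_mono)
    ultimately show ?thesis unfolding sst by simp
  qed
  also have "\<dots> = 13 + L + 12 * ?s + u * (22 * M + 132 * t + 120 * M + (1404 + 810) * b * M)"
  proof -
    have 1: "c1 * (3 * m) = u * ((120 + 1404 * b) * M)" by (simp add: c1_def M_def)
    have r: "m / ?r = ?r" using m by (simp add: real_div_sqrt)
    have "c2 * ((3 * m) * (3 * m)) = u * (810 * b * (m * (m / ?r)))" by (simp add: c2_def)
    then have "c2 * ((3 * m) * (3 * m)) = u * (810 * b * M)" unfolding r M_def .
    then show ?thesis unfolding 1 c0_def by (simp add: algebra_simps)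
  qed
  also have "\<dots> \<le> 26 * (2 * K * real n / \<tau>) + (2 * K / real \<tau> ^ 3) * (142 * M + 132 * M + 2214 * b * M)"
  proof (rule add_mono[OF _ mult_mono])
    have "L \<le> K"
    proof -
      have "1 * L \<le> (100000 * P * P * P * Gi * 100 * L) * L" using P Gi_pos L by (intro mult_le_mono1) (simp add: Suc_le_eq)
      then show ?thesis by (simp add: K_def Gi_def mult_ac)
    qed
    then have "real L \<le> K" by simp
    also have "\<dots> \<le> 2 * K * real n / \<tau>"
    proof -
      have "real K * \<tau> \<le> real K * (2 * n)" using \<tau> by (intro mult_left_mono) auto
      then show ?thesis using T by (simp add: field_simps)
    qed
    finally show "13 + L + 12 * ?s \<le> 26 * (2 * K * real n / \<tau>)"
      using samples_bounds(2)[OF \<tau>] s1 by linarith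
    have "u \<le> (2 * K * real n / \<tau>) / (n * (real \<tau>)\<^sup>2)"
      unfolding u_def using samples_bounds(2)[OF \<tau>] by (intro divide_right_mono) auto
    also have "\<dots> = 2 * K / real \<tau> ^ 3" using npos T by (simp add: field_simps power2_eq_square power3_eq_cube)
    finally show "u \<le> 2 * K / real \<tau> ^ 3" .
    show "22 * M + 132 * t + 120 * M + (1404 + 810) * b * M \<le> 142 * M + 132 * M + 2214 * b * M"
      using t_le by (simp add: M_def)
  qed (use nn in \<open>auto simp: M_def\<close>)
  also have "\<dots> = 52 * K * (n / \<tau>) + 548 * K * (M / real \<tau> ^ 3) + 4428 * (real K * Hc) * (t * M / real \<tau> ^ 6)"
    using T by (simp add: b_def field_simps power_add[of _ 3 3, simplified])
  also have "\<dots> \<le> 5000 * (real K * Hc) * (n / \<tau>) + 5000 * (real K * Hc) * (M / real \<tau> ^ 3) + 5000 * (real K * Hc) * (t * M / real \<tau> ^ 6)"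
  proof -
    have "1 \<le> Hc" using P Gi_pos by (simp add: Hc_def Suc_le_eq)
    then have "real K * 1 \<le> real K * Hc" by (intro mult_left_mono) auto
    then have KH: "K \<le> real K * Hc" "0 \<le> real K * Hc" by simp_all
    have "52 * real K \<le> 5000 * (real K * Hc)" "548 * real K \<le> 5000 * (real K * Hc)"
      "4428 * (real K * Hc) \<le> 5000 * (real K * Hc)" using KH by linarith+
    then show ?thesis by (intro add_mono mult_right_mono) (auto simp: M_def)
  qed
  finally show ?thesis by (simp add: distrib_left)
qed

end

section \<open>The whole search\<close>

abbreviation "guesses \<equiv> sched n n n"

text \<open>The lemmas on \<open>search\<close> ask for finite support at every argument; for
  \<open>level\<close> it is known only between 1 and n.\<close>

definition lev :: "nat \<Rightarrow> answer pmf" where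
  "lev \<tau> = (if 1 \<le> \<tau> \<and> \<tau> \<le> n then level \<tau> else return_pmf (None, 0, 0))"

lemma fin_lev: "fin (lev \<tau>)" using fin_level by (simp add: lev_def)

lemma guess_range: "i < L \<Longrightarrow> 1 \<le> n div 2 ^ i \<and> n div 2 ^ i \<le> n"
proof -
  assume "i < L"
  then have "(2::nat) ^ i \<le> 2 ^ (L - 1)" by (intro power_increasing) auto
  then have "2 ^ i \<le> n" using L(2) by linarith
  then show ?thesis by (simp add: div_greater_zero_iff Suc_le_eq)
qed

lemma guess_end: "L \<le> r \<Longrightarrow> n div 2 ^ r = 0"
proof -
  assume "L \<le> r"
  then have "(2::nat) ^ L \<le> 2 ^ r" by (intro power_increasing) auto
  then have "n < 2 ^ r" using L(3) by linarith
  then show ?thesis by simp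
qed

lemma guess_round:
  "r < L \<Longrightarrow> sched n n (n div 2 ^ r) = map (\<lambda>i. n div 2 ^ i) [0..<Suc r] @ sched n n (n div 2 ^ Suc r)"
  using sched_round[of 0 r n] guess_range[of r] by simp

lemma set_sched: "x \<in> set (sched n \<tau> b) \<Longrightarrow> \<tau> \<le> n \<Longrightarrow> 1 \<le> x \<and> x \<le> n"
proof (induction n \<tau> b rule: sched.induct)
  case (1 n \<tau> b)
  show ?case
  proof (cases "b = 0 \<or> \<tau> = 0")
    case True then show ?thesis using 1(3) by auto
  next
    case False
    then have "x = \<tau> \<or> x \<in> set (if \<tau> \<le> b then sched n n (b div 2) else sched n (\<tau> div 2) b)"
      using 1(3) by (subst (asm) sched.simps) auto
    moreover have "\<tau> div 2 \<le> n" using 1(4) by simp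
    ultimately show ?thesis using 1 False by (cases "\<tau> \<le> b") (auto simp: Suc_le_eq)
  qed
qed

lemma search_cong: "(\<And>x. x \<in> set xs \<Longrightarrow> Lv x = Lv' x) \<Longrightarrow> search Lv xs = search Lv' xs"
  by (induction xs) (auto intro!: bind_pmf_cong split: option.split)

lemma search_lev: "search level guesses = search lev guesses"
  by (rule search_cong) (use set_sched[of _ n n] in \<open>auto simp: lev_def\<close>)

lemma search_no_triangles:
  assumes "t = 0"
  shows "measure_pmf.prob (search lev guesses) {y. fst y \<noteq> None} = 0"
proof (rule search_None[OF fin_lev])
  fix x assume "x \<in> set guesses"
  then have x: "1 \<le> x" "x \<le> n" using set_sched[of x n n] by auto
  show "measure_pmf.prob (lev x) {y. fst y \<noteq> None} = 0"
    using level_accept_le[OF x] assms x by (simp add: lev_def measure_le_0_iff)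
qed

text \<open>The right guess is the largest one whose cube is at most t; it exists because the
  guesses descend to 1.\<close>

lemma right_guess:
  assumes "1 \<le> t"
  obtains r where "r < L" "(n div 2 ^ r) ^ 3 \<le> t" "\<And>i. i < r \<Longrightarrow> t < (n div 2 ^ i) ^ 3"
proof -
  have "n div 2 ^ (L - 1) < 2"
  proof -
    have "n < 2 * 2 ^ (L - 1)" using L by (simp flip: power_Suc)
    then show ?thesis by (simp add: less_mult_imp_div_less)
  qed
  then have "(n div 2 ^ (L - 1)) ^ 3 \<le> 1 ^ 3" by (intro power_mono) auto
  then have ex: "(n div 2 ^ (L - 1)) ^ 3 \<le> t" using assms by simp
  define r where "r = (LEAST i. (n div 2 ^ i) ^ 3 \<le> t)"
  have "(n div 2 ^ r) ^ 3 \<le> t" unfolding r_def by (rule LeastI[of "\<lambda>i. (n div 2 ^ i) ^ 3 \<le> t", OF ex])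
  moreover have "r \<le> L - 1" unfolding r_def by (rule Least_le) (rule ex)
  moreover have "t < (n div 2 ^ i) ^ 3" if "i < r" for i
    using not_less_Least[of i "\<lambda>i. (n div 2 ^ i) ^ 3 \<le> t"] that unfolding r_def by simp
  ultimately show thesis using that[of r] L(1) by auto
qed

text \<open>The guess before the right one has a cube above t, and halving a number with rounding
  down loses at most a factor 3 unless the result is 0; 27 is 3^3. If n itself is right, t \<le> n^3
  is used.\<close>

lemma guess_near:
  assumes "r < L" "\<And>i. i < r \<Longrightarrow> t < (n div 2 ^ i) ^ 3" "i \<le> r"
  shows "real t \<le> 27 * real (n div 2 ^ i) ^ 3"
proof (cases "i < r")
  case True
  have "real t < real ((n div 2 ^ i) ^ 3)" using assms(2)[OF True] by (simp only: of_nat_less_iff)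
  then have "real t < real (n div 2 ^ i) ^ 3" by (simp only: of_nat_power)
  moreover have "0 \<le> real (n div 2 ^ i) ^ 3" by simp
  ultimately show ?thesis by linarith
next
  case False
  then have i: "i = r" using assms by simp
  show ?thesis
  proof (cases r)
    case 0
    have "real t \<le> real (n ^ 3)" using t_le_cube by (simp only: of_nat_le_iff)
    then have "real t \<le> real n ^ 3" by (simp only: of_nat_power)
    moreover have "0 \<le> real n ^ 3" by simp
    ultimately have "real t \<le> 27 * real n ^ 3" by linarith
    then show ?thesis using i 0 by simp
  next
    case (Suc j)
    let ?y = "n div 2 ^ j"
    have y: "n div 2 ^ r = ?y div 2" unfolding Suc by (rule div_power_Suc)
    have "1 \<le> n div 2 ^ r" using guess_range assms(1) by blast
    then have "?y \<le> 3 * (n div 2 ^ r)" unfolding y by linarith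
    then have "?y ^ 3 \<le> (3 * (n div 2 ^ r)) ^ 3" by (intro power_mono) auto
    then have "t \<le> 27 * (n div 2 ^ r) ^ 3" using assms(2)[of j] Suc by (simp add: power_mult_distrib)
    then have "real t \<le> real (27 * (n div 2 ^ r) ^ 3)" by (simp only: of_nat_le_iff)
    then show ?thesis using i by simp
  qed
qed

text \<open>Up to round r0 all guesses are at or above the right one, and each gives a wrong answer
  with probability at most 1 / \<open>Gi\<close>. Round r0 ends with the right guess, which fails to
  answer well with the same small probability.\<close>

lemma search_fail:
  assumes t: "1 \<le> t"
  shows "measure_pmf.prob (search lev guesses) {y. fst y \<in> insert None (Some ` Bad)} \<le> 1 / 100"
proof -
  obtain r0 where r0: "r0 < L" "(n div 2 ^ r0) ^ 3 \<le> t" "\<And>i. i < r0 \<Longrightarrow> t < (n div 2 ^ i) ^ 3"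
    using right_guess[OF t] by blast
  let ?G = "insert None (Some ` Bad)"
  have bad: "measure_pmf.prob (lev (n div 2 ^ i)) {y. fst y \<in> Some ` Bad} \<le> 1 / Gi" if "i \<le> r0" for i
    using level_bad_always[OF _ _ t guess_near[OF r0(1,3) that]] guess_range[of i] that r0(1) by (simp add: lev_def)
  have last: "measure_pmf.prob (lev (n div 2 ^ r0)) {y. fst y \<in> ?G} \<le> 1 / Gi"
  proof -
    have "real ((n div 2 ^ r0) ^ 3) \<le> real t" using r0(2) by (simp only: of_nat_le_iff)
    then have "real (n div 2 ^ r0) ^ 3 \<le> real t" by (simp only: of_nat_power)
    then show ?thesis
      using level_bad_or_None[OF _ _ t _ guess_near[OF r0(1,3) order_refl]] guess_range[of r0] r0(1) by (simp add: lev_def)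
  qed
  have "measure_pmf.prob (search lev (sched n n (n div 2 ^ r))) {y. fst y \<in> ?G} \<le> (r0 - r + 1) * L / Gi"
    if "r \<le> r0" for r
    using that
  proof (induction "r0 - r" arbitrary: r)
    case 0
    then have r: "r = r0" by simp
    have split: "map (\<lambda>i. n div 2 ^ i) [0..<Suc r0] = map (\<lambda>i. n div 2 ^ i) [0..<r0] @ [n div 2 ^ r0]" by simp
    have "measure_pmf.prob (search lev (sched n n (n div 2 ^ r))) {y. fst y \<in> ?G}
        \<le> length (map (\<lambda>i. n div 2 ^ i) [0..<r0]) * (1 / Gi)
          + measure_pmf.prob (search lev (n div 2 ^ r0 # sched n n (n div 2 ^ Suc r0))) {y. fst y \<in> ?G}"
      unfolding r guess_round[OF r0(1)] split append_assoc append_Cons append_Nil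
      by (rule search_fail_append[where Lv = lev, OF fin_lev]) (use bad in auto)
    also have "measure_pmf.prob (search lev (n div 2 ^ r0 # sched n n (n div 2 ^ Suc r0))) {y. fst y \<in> ?G} \<le> 1 / Gi"
      using search_fail_last[where Lv = lev, OF fin_lev, of "n div 2 ^ r0" "sched n n (n div 2 ^ Suc r0)" Bad] last by (rule order_trans)
    also have "length (map (\<lambda>i. n div 2 ^ i) [0..<r0]) * (1 / Gi) + 1 / Gi = (r0 + 1) * (1 / Gi)"
      by (simp add: add_divide_distrib)
    also have "\<dots> \<le> L * (1 / Gi)" using r0(1) by (intro mult_right_mono) auto
    finally show ?case using r by simp
  next
    case (Suc k)
    then have rl: "r < r0" "r < L" using r0(1) by auto
    have "measure_pmf.prob (search lev (sched n n (n div 2 ^ r))) {y. fst y \<in> ?G}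
        \<le> length (map (\<lambda>i. n div 2 ^ i) [0..<Suc r]) * (1 / Gi)
          + measure_pmf.prob (search lev (sched n n (n div 2 ^ Suc r))) {y. fst y \<in> ?G}"
      unfolding guess_round[OF rl(2)]
      by (rule search_fail_append[OF fin_lev]) (use bad rl in auto)
    also have "\<dots> \<le> L * (1 / Gi) + (r0 - Suc r + 1) * L / Gi"
      using Suc rl by (intro add_mono mult_right_mono Suc.hyps(1)) auto
    also have "\<dots> = (r0 - r + 1) * L / Gi"
    proof -
      have "r0 - r = Suc (r0 - Suc r)" using rl by simp
      then show ?thesis by (simp add: algebra_simps add_divide_distrib)
    qed
    finally show ?case .
  qed
  from this[of 0] have "measure_pmf.prob (search lev guesses) {y. fst y \<in> ?G} \<le> (r0 + 1) * L / Gi" by simp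
  also have "\<dots> \<le> real (L * L) / Gi"
  proof -
    have "(r0 + 1) * L \<le> L * L" using r0(1) by (intro mult_le_mono1) simp
    then have "real ((r0 + 1) * L) \<le> real (L * L)" by (simp only: of_nat_le_iff)
    then show ?thesis by (intro divide_right_mono) simp_all
  qed
  also have "\<dots> = 1 / 100" using L(1) by (simp add: Gi_def)
  finally show ?thesis .
qed

text \<open>A guess below the cube root of t by a factor y may cost y^6 times the normal price, so
  one more halving costs a factor 64. But a further round is entered only after the right guess has
  failed to answer in the round before, with probability at most 1/400: the late rounds form a
  convergent geometric series.\<close>

lemma search_cost:
  fixes h :: "nat \<times> nat \<Rightarrow> real" and U \<rho> :: real
  assumes h: "\<And>a b. h (a + b) = h a + h b" "\<And>a. 0 \<le> h a" "h (1, 0) \<le> 1"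
    and t: "1 \<le> t" and U: "1 \<le> U" and \<rho>: "\<rho> ^ 3 = t" "0 \<le> \<rho>"
    and c: "\<And>\<tau> y. 1 \<le> \<tau> \<Longrightarrow> \<tau> \<le> n \<Longrightarrow> 1 \<le> y \<Longrightarrow> \<rho> \<le> y * real \<tau> \<Longrightarrow>
      ev (level \<tau>) (\<lambda>z. h (snd z)) + 1 \<le> U * y ^ 6"
  shows "ev (search lev guesses) (\<lambda>z. h (snd z)) \<le> 9000 * real L * L * U"
proof -
  obtain r0 where r0: "r0 < L" "(n div 2 ^ r0) ^ 3 \<le> t" "\<And>i. i < r0 \<Longrightarrow> t < (n div 2 ^ i) ^ 3"
    using right_guess[OF t] by blast
  let ?F = "\<lambda>r. ev (search lev (sched n n (n div 2 ^ r))) (\<lambda>z. h (snd z))"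
  have c': "ev (lev \<tau>) (\<lambda>z. h (snd z)) + 1 \<le> U * y ^ 6"
    if "1 \<le> \<tau>" "\<tau> \<le> n" "1 \<le> y" "\<rho> \<le> y * real \<tau>" for \<tau> y
    using c[OF that] that by (simp add: lev_def)
  have early: "\<rho> \<le> 1 * real (n div 2 ^ i)" if "i < r0" for i
  proof -
    have "\<rho> ^ 3 \<le> real ((n div 2 ^ i) ^ 3)" unfolding \<rho> using r0(3)[OF that] by simp
    then have "\<rho> ^ Suc 2 \<le> real (n div 2 ^ i) ^ Suc 2" by (simp add: eval_nat_numeral)
    then have "\<rho> \<le> real (n div 2 ^ i)" by (rule power_le_imp_le_base) simp
    then show ?thesis by simp
  qed
  \<comment> \<open>One factor 2 because \<rho> is compared with the guess before the right one,
    another for rounding down.\<close>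
  have late: "\<rho> \<le> (4 * 2 ^ j) * real (n div 2 ^ (r0 + j))" if "r0 + j < L" for j
  proof -
    have half: "real x \<le> 2 * 2 ^ k * real (x div 2 ^ k)" if "1 \<le> x div 2 ^ k" for x k :: nat
    proof -
      have "x < 2 ^ k * (x div 2 ^ k) + 2 ^ k" using dividend_less_times_div[of "2 ^ k" x] by simp
      also have "\<dots> \<le> 2 ^ k * (x div 2 ^ k) + 2 ^ k * (x div 2 ^ k)" using that by (intro add_left_mono) simp
      finally have "real x \<le> real (2 * 2 ^ k * (x div 2 ^ k))" by (simp only: of_nat_le_iff)
      then show ?thesis by simp
    qed
    have pos: "1 \<le> n div 2 ^ (r0 + j)" using guess_range[OF that] by simp
    show ?thesis
    proof (cases r0)
      case 0
      have "\<rho> ^ Suc 2 \<le> real n ^ Suc 2"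
      proof -
        have "real t \<le> real (n ^ 3)" using t_le_cube by (simp only: of_nat_le_iff)
        then show ?thesis using \<rho> by (simp add: eval_nat_numeral)
      qed
      then have "\<rho> \<le> real n" by (rule power_le_imp_le_base) simp
      also have "\<dots> \<le> 2 * 2 ^ j * real (n div 2 ^ j)" using pos 0 by (intro half) simp
      also have "\<dots> \<le> (4 * 2 ^ j) * real (n div 2 ^ (r0 + j))" using 0 by (simp add: mult_right_mono)
      finally show ?thesis .
    next
      case (Suc k)
      have eq: "n div 2 ^ (r0 + j) = n div 2 ^ k div 2 ^ Suc j"
        unfolding Suc div_mult2_eq[symmetric] power_add[symmetric] by simp
      have "\<rho> \<le> real (n div 2 ^ k)" using early[of k] Suc by simp
      also have "\<dots> \<le> 2 * 2 ^ Suc j * real (n div 2 ^ k div 2 ^ Suc j)" using pos eq by (intro half) simp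
      finally show ?thesis unfolding eq by simp
    qed
  qed
  have mono: "\<rho> \<le> y * real (n div 2 ^ i)" if "\<rho> \<le> y * real (n div 2 ^ r)" "i \<le> r" "0 \<le> y" for i r y
  proof -
    have "n div 2 ^ r \<le> n div 2 ^ i" using that(2) by (intro div_le_mono2 power_increasing) auto
    then have "y * real (n div 2 ^ r) \<le> y * real (n div 2 ^ i)" using that(3) by (intro mult_left_mono) auto
    then show ?thesis using that(1) by linarith
  qed
  have stop: "?F r \<le> 1" if "L \<le> r" for r
    using guess_end[OF that] h(3) by simp
  have Gp: "1 / real Gi \<le> 1 / 400" using Gi_pos by (intro divide_left_mono) auto
  have F_late: "?F (r0 + j) \<le> 2 * (L * (U * (4 * 2 ^ j) ^ 6))" for j
  proof (cases "r0 + j < L")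
    case False
    have "1 * (1 * 1) \<le> L * (U * (4 * 2 ^ j) ^ 6)"
      using L U by (intro mult_mono one_le_power) (auto simp: mult_ge1_I)
    then show ?thesis using stop[of "r0 + j"] False by simp
  next
    case True
    then show ?thesis
    proof (induction "L - (r0 + j)" arbitrary: j)
      case 0 then show ?case by simp
    next
      case (Suc k)
      let ?c = "U * (4 * 2 ^ j) ^ 6"
      have c0: "1 \<le> ?c"
      proof -
        have "1 * 1 \<le> U * (4 * 2 ^ j) ^ 6" using U by (intro mult_mono one_le_power) (auto simp: mult_ge1_I)
        then show ?thesis by simp
      qed
      have next_: "?F (r0 + Suc j) \<le> 2 * (L * (U * (4 * 2 ^ Suc j) ^ 6))"
      proof (cases "r0 + Suc j < L")
        case True then show ?thesis using Suc by (intro Suc.hyps(1)) auto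
      next
        case False
        have "1 * (1 * 1) \<le> L * (U * (4 * 2 ^ Suc j) ^ 6)"
          using L U by (intro mult_mono one_le_power) (auto simp: mult_ge1_I)
        then show ?thesis using stop[of "r0 + Suc j"] False by simp
      qed
      have cost: "ev (lev x) (\<lambda>z. h (snd z)) + 1 \<le> ?c" if x: "x \<in> set (map (\<lambda>i. n div 2 ^ i) [0..<Suc (r0 + j)])" for x
      proof -
        have "x \<in> (\<lambda>i. n div 2 ^ i) ` {0..<Suc (r0 + j)}" using x by (simp only: set_map set_upt)
        then obtain i where i: "i \<le> r0 + j" "x = n div 2 ^ i" by (elim imageE) (simp add: less_Suc_eq_le)
        have "i < L" using i(1) Suc.prems by simp
        then show ?thesis unfolding i(2) using guess_range[of i]
          by (intro c' mono[OF late[OF Suc.prems] i(1)]) (auto simp: mult_ge1_I)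
      qed
      have "?F (r0 + j) \<le> length (map (\<lambda>i. n div 2 ^ i) [0..<Suc (r0 + j)]) * ?c + 1 / Gi * ?F (Suc (r0 + j))"
        unfolding guess_round[OF Suc.prems]
      proof (rule search_cost_append_retry[where Lv = lev, OF fin_lev h cost])
        show "n div 2 ^ r0 \<in> set (map (\<lambda>i. n div 2 ^ i) [0..<Suc (r0 + j)])"
          unfolding set_map set_upt by (rule imageI) simp
        have "real ((n div 2 ^ r0) ^ 3) \<le> real t" using r0(2) by (simp only: of_nat_le_iff)
        then have "real (n div 2 ^ r0) ^ 3 \<le> real t" by (simp only: of_nat_power)
        then have "measure_pmf.prob (lev (n div 2 ^ r0)) {y. fst y \<in> insert None (Some ` Bad)} \<le> 1 / Gi"
          using level_bad_or_None[OF _ _ t _ guess_near[OF r0(1,3) order_refl]] guess_range[of r0] r0(1) by (simp add: lev_def)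
        moreover have "measure_pmf.prob (lev (n div 2 ^ r0)) {y. fst y = None}
            \<le> measure_pmf.prob (lev (n div 2 ^ r0)) {y. fst y \<in> insert None (Some ` Bad)}"
          by (intro measure_pmf.finite_measure_mono) auto
        ultimately show "measure_pmf.prob (lev (n div 2 ^ r0)) {y. fst y = None} \<le> 1 / Gi" by linarith
      qed (use c0 in auto)
      also have "\<dots> \<le> L * ?c + 1 / 400 * (2 * (L * (U * (4 * 2 ^ Suc j) ^ 6)))"
      proof (intro add_mono mult_mono Gp)
        show "?F (Suc (r0 + j)) \<le> 2 * (L * (U * (4 * 2 ^ Suc j) ^ 6))" using next_ by simp
        show "0 \<le> ?F (Suc (r0 + j))" by (rule ev_nonneg) (rule h)
      qed (use c0 U Suc.prems in auto)
      also have "(U * (4 * 2 ^ Suc j) ^ 6) = 64 * ?c" by (simp add: power_mult_distrib)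
      \<comment> \<open>2 * 64 / 400 < 1, so twice the price of one round covers all later
        ones.\<close>
      also have "L * ?c + 1 / 400 * (2 * (L * (64 * ?c))) \<le> 2 * (L * ?c)"
      proof -
        have "0 \<le> L * ?c" using c0 by simp
        then show ?thesis by simp
      qed
      finally show ?case .
    qed
  qed
  \<comment> \<open>8192 = 2 * 4^6 is the late bound for j = 0. The rounds before r0 contain only
    guesses above the cube root of t and cost at most L U each.\<close>
  have F_early: "?F r \<le> (r0 - r) * (L * U) + 8192 * (L * U)" if "r \<le> r0" for r
    using that
  proof (induction "r0 - r" arbitrary: r)
    case 0
    then show ?case using F_late[of 0] by (simp add: mult_ac)
  next
    case (Suc k)
    then have rl: "r < r0" "r < L" using r0(1) by auto
    have cost: "ev (lev x) (\<lambda>z. h (snd z)) + 1 \<le> U" if x: "x \<in> set (map (\<lambda>i. n div 2 ^ i) [0..<Suc r])" for x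
    proof -
      have "x \<in> (\<lambda>i. n div 2 ^ i) ` {0..<Suc r}" using x by (simp only: set_map set_upt)
      then obtain i where i: "i \<le> r" "x = n div 2 ^ i" by (elim imageE) (simp add: less_Suc_eq_le)
      have "ev (lev x) (\<lambda>z. h (snd z)) + 1 \<le> U * 1 ^ 6" unfolding i(2)
        using i rl guess_range[of i] by (intro c' early) auto
      then show ?thesis by simp
    qed
    have "?F r \<le> length (map (\<lambda>i. n div 2 ^ i) [0..<Suc r]) * U + ?F (Suc r)"
      unfolding guess_round[OF rl(2)] by (rule search_cost_append[where Lv = lev, OF fin_lev h cost])
    also have "\<dots> \<le> L * U + ((r0 - Suc r) * (L * U) + 8192 * (L * U))"
      using rl U Suc by (intro add_mono mult_right_mono Suc.hyps(1)) auto
    also have "\<dots> = (r0 - r) * (L * U) + 8192 * (L * U)"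
    proof -
      have "r0 - r = Suc (r0 - Suc r)" using rl by simp
      then show ?thesis by (simp add: algebra_simps)
    qed
    finally show ?case .
  qed
  have "?F 0 \<le> r0 * (L * U) + 8192 * (L * U)" using F_early[of 0] by simp
  also have "\<dots> = (r0 + 8192) * (L * U)" by (simp add: algebra_simps)
  also have "\<dots> \<le> (9000 * L) * (L * U)"
    using r0(1) L(1) U by (intro mult_right_mono) auto
  finally show ?thesis by (simp add: mult_ac)
qed

lemma root_facts:
  assumes "1 \<le> t"
  shows "root 3 t ^ 3 = t" "1 \<le> root 3 t" "root 3 t \<le> n"
proof -
  show 1: "root 3 t ^ 3 = t" by simp
  show "1 \<le> root 3 t" using assms by simp
  have "real t \<le> real (n ^ 3)" using t_le_cube by (simp only: of_nat_le_iff)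
  then have "root 3 t ^ Suc 2 \<le> real n ^ Suc 2" using 1 by (simp add: eval_nat_numeral)
  then show "root 3 t \<le> n" by (rule power_le_imp_le_base) simp
qed

lemma KHc_ge: "1 \<le> real K" "real K \<le> real K * Hc"
proof -
  show K1: "1 \<le> real K" using K_pos by simp
  have "1 \<le> Hc" using P Gi_pos by (simp add: Hc_def Suc_le_eq)
  then have "real K * 1 \<le> real K * Hc" using K1 by (intro mult_left_mono) auto
  then show "real K \<le> real K * Hc" by simp
qed

lemma search_samples:
  assumes t: "1 \<le> t"
  shows "ev (search lev guesses) (\<lambda>z. real (snd (snd z))) \<le> 9000 * real L * L * (7 * real K * (n / root 3 t))"
proof (rule search_cost[where h = "\<lambda>p. real (snd p)" and \<rho> = "root 3 t"])
  note r = root_facts[OF t]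
  have n1: "1 \<le> n / root 3 t" using r by simp
  have "1 * 1 \<le> 7 * real K * (n / root 3 t)" using n1 KHc_ge by (intro mult_mono) auto
  then show "1 \<le> 7 * real K * (n / root 3 t)" by simp
  fix \<tau> y assume \<tau>: "1 \<le> \<tau>" "\<tau> \<le> n" and y: "1 \<le> (y::real)" "root 3 t \<le> y * real \<tau>"
  have T: "0 < real \<tau>" using \<tau> by simp
  have "ev (level \<tau>) (\<lambda>z. real (snd (snd z))) \<le> ev (level \<tau>) (\<lambda>_. 3 * real (samples \<tau>))"
    using fin_level[OF \<tau>] level_samples[OF \<tau>] by (intro ev_mono) fastforce+
  also have "\<dots> \<le> 3 * (2 * real K * real n / \<tau>)" using samples_bounds(2)[OF \<tau>] by simp
  also have "\<dots> = 6 * real K * (n / \<tau>)" by simp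
  also have "\<dots> \<le> 6 * real K * (n / root 3 t * y)"
  proof (intro mult_left_mono)
    have "n * root 3 t \<le> n * (y * real \<tau>)" using y by (intro mult_left_mono) auto
    then show "n / \<tau> \<le> n / root 3 t * y" using r(2) T by (simp add: field_simps)
  qed simp
  also have "\<dots> \<le> 6 * real K * (n / root 3 t * y ^ 6)"
    using y(1) r(2) self_le_power[of y 6] by (intro mult_left_mono) auto
  finally have "ev (level \<tau>) (\<lambda>z. real (snd (snd z))) \<le> 6 * real K * (n / root 3 t) * y ^ 6" by simp
  moreover have "1 * 1 * 1 \<le> K * (n / root 3 t) * y ^ 6"
    using n1 KHc_ge y by (intro mult_mono one_le_power mult_nonneg_nonneg) auto
  moreover have "7 * real K * (n / root 3 t) * y ^ 6 = 6 * real K * (n / root 3 t) * y ^ 6 + K * (n / root 3 t) * y ^ 6"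
    by (simp add: distrib_right[symmetric])
  moreover have "x + 1 \<le> r" if "x \<le> p" "1 * 1 * 1 \<le> q" "r = p + q" for x p q r :: real
    using that by simp
  ultimately show "ev (level \<tau>) (\<lambda>z. real (snd (snd z))) + 1 \<le> 7 * real K * (n / root 3 t) * y ^ 6" by blast
qed (use t in auto)

lemma search_steps:
  assumes t: "1 \<le> t"
  shows "ev (search lev guesses) (\<lambda>z. real (fst (snd z)))
    \<le> 9000 * real L * L * (20000 * (real K * Hc) * (n / root 3 t + m * sqrt m / t))"
proof (rule search_cost[where h = "\<lambda>p. real (fst p)" and \<rho> = "root 3 t"])
  define M where "M = m * sqrt m"
  let ?\<rho> = "root 3 t" and ?Q = "n / root 3 t + M / t"
  have M0: "0 \<le> M" by (simp add: M_def)
  note r = root_facts[OF t]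
  have n1: "1 \<le> n / ?\<rho>" using r by simp
  have tp: "0 < real t" using t by simp
  have Q1: "1 \<le> ?Q" using n1 M0 tp by (smt (verit) divide_nonneg_pos)
  have KH: "1 \<le> real K * Hc" using KHc_ge by linarith
  have "1 * 1 \<le> 20000 * (real K * Hc) * ?Q" using KH Q1 by (intro mult_mono) auto
  then show "1 \<le> 20000 * (real K * Hc) * (n / root 3 t + m * sqrt m / t)" by (simp add: M_def)
  fix \<tau> y assume \<tau>: "1 \<le> \<tau>" "\<tau> \<le> n" and y: "1 \<le> (y::real)" "root 3 t \<le> y * real \<tau>"
  have T: "0 < real \<tau>" using \<tau> by simp
  have a: "n / \<tau> \<le> n / ?\<rho> * y ^ 6"
  proof -
    have "n * root 3 t \<le> n * (y * real \<tau>)" using y by (intro mult_left_mono) auto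
    then have "n / \<tau> \<le> n / root 3 t * y" using r(2) T by (simp add: field_simps)
    also have "\<dots> \<le> n / root 3 t * y ^ 6" using y(1) r(2) self_le_power[of y 6] by (intro mult_left_mono) auto
    finally show ?thesis .
  qed
  have t3: "real t \<le> y ^ 3 * real \<tau> ^ 3"
    using power_mono[OF y(2), of 3] r by (simp add: power_mult_distrib)
  have y3: "1 \<le> y ^ 3" using y(1) by simp
  have b: "M / real \<tau> ^ 3 \<le> M / t * y ^ 3"
  proof -
    have "M * t \<le> M * (y ^ 3 * real \<tau> ^ 3)" using t3 M0 by (rule mult_left_mono)
    then show ?thesis using T tp by (simp add: field_simps)
  qed
  have b': "M / t * y ^ 3 \<le> M / t * y ^ 6"
    using y(1) M0 tp by (intro mult_left_mono power_increasing) auto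
  have c: "t * M / real \<tau> ^ 6 \<le> M / t * y ^ 6"
  proof -
    have "t * (M / real \<tau> ^ 3) \<le> (y ^ 3 * real \<tau> ^ 3) * (M / t * y ^ 3)"
      using t3 b y3 M0 T by (intro mult_mono) auto
    then have "t * (M / real \<tau> ^ 3) / real \<tau> ^ 3 \<le> (y ^ 3 * real \<tau> ^ 3) * (M / t * y ^ 3) / real \<tau> ^ 3"
      using T by (intro divide_right_mono) auto
    then show ?thesis using T by (simp add: power_add[of _ 3 3, simplified] field_simps)
  qed
  have "ev (level \<tau>) (\<lambda>z. real (fst (snd z))) \<le> 5000 * (real K * Hc) * (n / \<tau> + M / real \<tau> ^ 3 + t * M / real \<tau> ^ 6)"
    using ev_level_st[OF \<tau> t] by (simp add: M_def)
  also have "\<dots> \<le> 5000 * (real K * Hc) * (2 * ?Q * y ^ 6)"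
  proof (intro mult_left_mono)
    have "n / \<tau> + M / real \<tau> ^ 3 + t * M / real \<tau> ^ 6 \<le> n / ?\<rho> * y ^ 6 + M / t * y ^ 6 + M / t * y ^ 6"
      using a b b' c by linarith
    also have "\<dots> \<le> 2 * (n / ?\<rho> * y ^ 6) + 2 * (M / t * y ^ 6)"
    proof -
      have "0 \<le> n / ?\<rho> * y ^ 6" using r(2) y(1) by simp
      moreover have "a + c + c \<le> 2 * a + 2 * c" if "0 \<le> a" for a c :: real using that by simp
      ultimately show ?thesis by blast
    qed
    finally show "n / \<tau> + M / real \<tau> ^ 3 + t * M / real \<tau> ^ 6 \<le> 2 * ?Q * y ^ 6" by (simp add: algebra_simps)
  qed (use KH in linarith)
  also have "\<dots> = 10000 * ((real K * Hc) * ?Q * y ^ 6)" by simp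
  finally have 1: "ev (level \<tau>) (\<lambda>z. real (fst (snd z))) \<le> 10000 * ((real K * Hc) * ?Q * y ^ 6)" .
  have "1 * 1 * 1 \<le> (real K * Hc) * ?Q * y ^ 6"
    using Q1 KH y by (intro mult_mono one_le_power mult_nonneg_nonneg) auto
  moreover have "x + 1 \<le> 20000 * q" if "x \<le> 10000 * q" "1 * 1 * 1 \<le> q" for x q :: real
    using that by simp
  ultimately have "ev (level \<tau>) (\<lambda>z. real (fst (snd z))) + 1 \<le> 20000 * ((real K * Hc) * ?Q * y ^ 6)"
    using 1 by blast
  then show "ev (level \<tau>) (\<lambda>z. real (fst (snd z))) + 1 \<le> 20000 * (real K * Hc) * (n / root 3 t + m * sqrt m / t) * y ^ 6"
    by (simp add: M_def mult.assoc)
qed (use t in auto)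

end

section \<open>Program semantics\<close>

primrec wr :: "com \<Rightarrow> vname set" where
  "wr Skip = {}"
| "wr (Assign x e) = {x}"
| "wr (Store a i e) = {}"
| "wr (Seq c1 c2) = wr c1 \<union> wr c2"
| "wr (Cond e c1 c2) = wr c1 \<union> wr c2"
| "wr (While e c) = wr c"
| "wr (Rand x e) = {x}"
| "wr (EpsDigits x e) = {x}"
| "wr (SampleVertex x) = {x}"
| "wr (DegreeQuery x e) = {x}"
| "wr (NeighborQuery x e i) = {x}"
| "wr (PairQuery x e1 e2) = {x}"

text \<open>A loop may diverge, so statements about its final states are proved by fixpoint
  induction, for a preorder Q that is respected by payments and passes.\<close>

lemma loop_set:
  assumes "s' \<in> set_spmf (loop g pay body s)"
    and "\<And>s. Q s s" "\<And>s t u. Q s t \<Longrightarrow> Q t u \<Longrightarrow> Q s u" "\<And>s. Q s (pay s)"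
    and "\<And>s s'. s' \<in> set_spmf (body s) \<Longrightarrow> Q s s'"
  shows "Q s s'"
  using assms
proof (induction arbitrary: s s' rule: loop.fixp_induct)
  case 1
  show ?case by (simp add: ccpo.admissibleI)
next
  case 2
  then show ?case by simp
next
  case (3 f)
  show ?case
  proof (cases "g s")
    case True
    then obtain x where x: "x \<in> set_spmf (body (pay s))" "s' \<in> set_spmf (f g pay body x)"
      using 3(2) by (auto simp: set_bind_spmf)
    have "Q x s'" by (rule 3(1)[OF x(2) 3(3-6)])
    then show ?thesis using 3(4)[OF 3(5) 3(4)[OF 3(6)[OF x(1)]]] by blast
  next
    case False
    then show ?thesis using 3(2,5) by simp
  qed
qed

text \<open>Every query is charged at least one time unit, so the query counter grows at most as
  fast as the clock. This makes the time bound a query bound as well.\<close>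

lemma exec_frame:
  "s' \<in> set_spmf (exec n \<epsilon> E nbr c s) \<Longrightarrow>
    (\<forall>x. x \<notin> wr c \<longrightarrow> scalar s' x = scalar s x) \<and> queries s' + time s \<le> queries s + time s'"
proof (induction c arbitrary: s s')
  case (Seq c1 c2)
  then obtain s1 where "s1 \<in> set_spmf (exec n \<epsilon> E nbr c1 s)" "s' \<in> set_spmf (exec n \<epsilon> E nbr c2 s1)"
    by (auto simp: set_bind_spmf)
  then show ?case using Seq.IH by fastforce
next
  case (Cond e c1 c2)
  then show ?case by (fastforce simp: charge_def split: if_splits)
next
  case (While e c)
  show ?case
    by (rule loop_set[where Q = "\<lambda>s s'. (\<forall>x. x \<notin> wr (While e c) \<longrightarrow> scalar s' x = scalar s x)
        \<and> queries s' + time s \<le> queries s + time s'", OF While.prems[unfolded exec.simps]])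
      (use While.IH in \<open>auto simp: charge_def\<close>)
qed (auto simp: assign_def charge_def count_query_def)


section \<open>Static bounds\<close>

text \<open>\<open>\<beta> x\<close> bounds the variable \<open>x\<close> by \<open>M ^ \<beta> x\<close>; array entries are at most \<open>M\<close>.\<close>

context
  fixes \<beta> :: "vname \<Rightarrow> nat"
begin

text \<open>For M \<ge> 2 a sum is at most 2 M^(a+b) \<le> M^(a+b+1), and truth values are at most
  M^0.\<close>

fun wop :: "binop \<Rightarrow> nat \<Rightarrow> nat \<Rightarrow> nat" where
  "wop Add a b = a + b + 1"
| "wop Sub a b = a"
| "wop Mul a b = a + b"
| "wop Div a b = a"
| "wop Mod a b = a"
| "wop Less a b = 0"
| "wop Equal a b = 0"

primrec wE :: "expr \<Rightarrow> nat" where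
  "wE (Const k) = k"
| "wE (Var x) = \<beta> x"
| "wE (Arr a e) = 1"
| "wE (Op f e1 e2) = wop f (wE e1) (wE e2)"

text \<open>The minimum of \<open>a\<close> and \<open>b\<close> in truncated subtraction.\<close>

definition clamp :: "expr \<Rightarrow> expr \<Rightarrow> expr" where "clamp a b = Op Sub a (Op Sub a b)"

text \<open>The second alternative admits accumulators: in x := min (x + e) c the sum exceeds the
  exponent of x, but the minimum inherits the one of c.\<close>

definition okA :: "nat \<Rightarrow> expr \<Rightarrow> bool" where
  "okA k e \<longleftrightarrow> wE e \<le> k \<or> (\<exists>a b. e = clamp a b \<and> wE b \<le> k)"

primrec okc :: "com \<Rightarrow> bool" where
  "okc Skip = True"
| "okc (Assign x e) = okA (\<beta> x) e"
| "okc (Store a i e) = okA 1 e"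
| "okc (Seq c1 c2) = (okc c1 \<and> okc c2)"
| "okc (Cond e c1 c2) = (okc c1 \<and> okc c2)"
| "okc (While e c) = okc c"
| "okc (Rand x e) = (wE e \<le> \<beta> x)"
| "okc (EpsDigits x e) = False"
| "okc (SampleVertex x) = (1 \<le> \<beta> x)"
| "okc (DegreeQuery x e) = (1 \<le> \<beta> x)"
| "okc (NeighborQuery x e i) = (1 \<le> \<beta> x)"
| "okc (PairQuery x e1 e2) = True"

primrec tX :: "expr \<Rightarrow> nat" where
  "tX (Const k) = k + 2"
| "tX (Var x) = \<beta> x + 2"
| "tX (Arr a e) = tX e + 3"
| "tX (Op f e1 e2) = tX e1 + tX e2 + wop f (wE e1) (wE e2) + 2"

text \<open>Measured in units of \<open>bb M\<close>. A loop counts as one test and one pass, so for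
  programs with loops this bounds a stretch between two steps of the abstract process, not a whole
  run.\<close>

primrec tb :: "com \<Rightarrow> nat" where
  "tb Skip = 1"
| "tb (Assign x e) = tX e + wE e + 2"
| "tb (Store a i e) = tX i + tX e + 1"
| "tb (Seq c1 c2) = tb c1 + tb c2"
| "tb (Cond e c1 c2) = 1 + tX e + tb c1 + tb c2"
| "tb (While e c) = 1 + tX e + tb c"
| "tb (Rand x e) = tX e + wE e + 2"
| "tb (EpsDigits x e) = 0"
| "tb (SampleVertex x) = 3"
| "tb (DegreeQuery x e) = tX e + 3"
| "tb (NeighborQuery x e i) = tX e + tX i + 3"
| "tb (PairQuery x e1 e2) = tX e1 + tX e2 + 3"

primrec straight :: "com \<Rightarrow> bool" where
  "straight Skip = True"
| "straight (Assign x e) = True"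
| "straight (Store a i e) = True"
| "straight (Seq c1 c2) = (straight c1 \<and> straight c2)"
| "straight (Cond e c1 c2) = (straight c1 \<and> straight c2)"
| "straight (While e c) = False"
| "straight (Rand x e) = True"
| "straight (EpsDigits x e) = False"
| "straight (SampleVertex x) = True"
| "straight (DegreeQuery x e) = True"
| "straight (NeighborQuery x e i) = True"
| "straight (PairQuery x e1 e2) = True"

definition bnd :: "nat \<Rightarrow> state \<Rightarrow> bool" where
  "bnd M s \<longleftrightarrow> (\<forall>x. scalar s x \<le> M ^ \<beta> x) \<and> (\<forall>a i. arr s a i \<le> M)"

lemma bnd_charge [simp]: "bnd M (charge c s) = bnd M s" by (simp add: bnd_def charge_def)
lemma bnd_count_query [simp]: "bnd M (count_query s) = bnd M s" by (simp add: bnd_def count_query_def)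

lemma bnd_assign: "bnd M s \<Longrightarrow> k \<le> M ^ \<beta> x \<Longrightarrow> bnd M (assign x k s)"
  by (auto simp: bnd_def assign_def charge_def)

lemma le_power_self2: "2 \<le> M \<Longrightarrow> (k::nat) \<le> M ^ k"
  using less_exp[of k] power_mono[of 2 M k] by linarith

lemma power_mono_exp: "1 \<le> (M::nat) \<Longrightarrow> x \<le> M ^ i \<Longrightarrow> i \<le> j \<Longrightarrow> x \<le> M ^ j"
  by (meson order_trans power_increasing)

lemma wop_le:
  assumes "2 \<le> (M::nat)" "u \<le> M ^ a" "v \<le> M ^ b"
  shows "binop_val f u v \<le> M ^ wop f a b"
proof (cases f)
  case Add
  have "u \<le> M ^ (a + b)" "v \<le> M ^ (a + b)"
    using assms power_mono_exp[of M u a "a + b"] power_mono_exp[of M v b "a + b"] by auto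
  then have "u + v \<le> 2 * M ^ (a + b)" by simp
  also have "\<dots> \<le> M ^ (a + b + 1)" using assms(1) by simp
  finally show ?thesis using Add by simp
next
  case Sub then show ?thesis using assms by simp
next
  case Mul then show ?thesis using assms by (simp add: power_add mult_le_mono)
next
  case Div then show ?thesis using assms using order_trans[OF div_le_dividend] by simp
next
  case Mod then show ?thesis using assms using order_trans[OF mod_less_eq_dividend] by simp
qed (use assms in \<open>auto simp: of_bool_def\<close>)

lemma val_le: "2 \<le> M \<Longrightarrow> bnd M s \<Longrightarrow> val s e \<le> M ^ wE e"
  by (induction e) (auto simp: bnd_def le_power_self2 simp del: binop_val.simps intro: wop_le)

lemma okA_val_le: "2 \<le> M \<Longrightarrow> bnd M s \<Longrightarrow> okA k e \<Longrightarrow> val s e \<le> M ^ k"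
proof -
  assume h: "2 \<le> M" "bnd M s" "okA k e"
  have mono: "x \<le> M ^ k" if "x \<le> M ^ j" "j \<le> k" for x j
    using that power_mono_exp[of M x j k] h(1) by simp
  from h(3) consider "wE e \<le> k" | a b where "e = clamp a b" "wE b \<le> k" by (auto simp: okA_def)
  then show ?thesis
  proof cases
    case 1 then show ?thesis using val_le[OF h(1,2), of e] mono by blast
  next
    case 2
    have "val s e \<le> val s b" using 2(1) by (simp add: clamp_def)
    also have "\<dots> \<le> M ^ k" using val_le[OF h(1,2), of b] mono 2(2) by blast
    finally show ?thesis .
  qed
qed

lemma bits_less: "k < 2 ^ j \<Longrightarrow> bits k \<le> j"
  unfolding bits_def by (rule floorlog_leI) auto

lemma less_bits: "k < 2 ^ bits k"
  unfolding bits_def using floorlog_bounds[of k 2] by (cases "k = 0") (auto simp: floorlog_def)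

lemma bits_power_le: "v \<le> M ^ w \<Longrightarrow> bits v \<le> w * bits M + 1"
proof (rule bits_less)
  assume "v \<le> M ^ w"
  also have "\<dots> \<le> (2 ^ bits M) ^ w" using less_bits[of M] by (intro power_mono) auto
  also have "\<dots> < 2 ^ (w * bits M + 1)" by (simp add: power_mult[symmetric] mult.commute)
  finally show "v < 2 ^ (w * bits M + 1)" .
qed

definition bb :: "nat \<Rightarrow> nat" where "bb M = 1 + bits M"

lemma bits_le_bb: "v \<le> M ^ w \<Longrightarrow> 1 + bits v \<le> (w + 2) * bb M"
  using bits_power_le[of v M w] by (simp add: bb_def algebra_simps)

lemma expr_time_le: "2 \<le> M \<Longrightarrow> bnd M s \<Longrightarrow> expr_time s e \<le> tX e * bb M"
proof (induction e)
  case (Const k)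
  then show ?case using bits_le_bb[of k M k] le_power_self2[of M k] by simp
next
  case (Var x)
  then show ?case using bits_le_bb[of "scalar s x" M "\<beta> x"] by (simp add: bnd_def)
next
  case (Arr a e)
  then have "arr s a (val s e) \<le> M ^ 1" by (simp add: bnd_def)
  then show ?case using bits_le_bb[of "arr s a (val s e)" M 1] Arr by (simp add: algebra_simps)
next
  case (Op f e1 e2)
  have "val s (Op f e1 e2) \<le> M ^ wop f (wE e1) (wE e2)" using val_le[OF Op.prems, of "Op f e1 e2"] by simp
  from bits_le_bb[OF this] show ?case using Op by (simp add: algebra_simps)
qed

end

section \<open>Soundness of the static size and time bounds\<close>

context sgraph begin

context
  fixes nbr :: "nat \<Rightarrow> nat \<Rightarrow> nat" and \<epsilon> :: real and M :: nat and \<beta> :: "vname \<Rightarrow> nat"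
  assumes order: "neighbor_order n E nbr" and M: "2 \<le> M" "n \<le> M" and n0: "0 < n"
begin

lemma neighbor_query_le: "(if i \<in> {1..d v} then nbr v i else 0) \<le> M"
proof (cases "i \<in> {1..d v}")
  case True
  then have "v \<in> V" using degree_out[of v] by (cases "v \<in> V") auto
  then have "nbr v i \<in> N v" using True order unfolding neighbor_order_def by (meson bij_betwE)
  then show ?thesis using True N_V[of "nbr v i" v] M by simp
qed auto

lemma pow_ge: "v \<le> M \<Longrightarrow> 1 \<le> j \<Longrightarrow> v \<le> M ^ j"
  using self_le_power[of M j] M by (simp add: order_trans)

lemma exec_bnd:
  "s' \<in> set_spmf (exec n \<epsilon> E nbr c s) \<Longrightarrow> okc \<beta> c \<Longrightarrow> bnd \<beta> M s \<Longrightarrow> bnd \<beta> M s'"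
proof (induction c arbitrary: s s')
  case (Assign x e)
  then show ?case using okA_val_le[OF M(1)] by (auto intro!: bnd_assign)
next
  case (Store a i e)
  then show ?case using okA_val_le[OF M(1) Store(3), of 1 e] by (auto simp: bnd_def charge_def)
next
  case (Seq c1 c2)
  then obtain s1 where "s1 \<in> set_spmf (exec n \<epsilon> E nbr c1 s)" "s' \<in> set_spmf (exec n \<epsilon> E nbr c2 s1)"
    by (auto simp: set_bind_spmf)
  then show ?case using Seq by auto
next
  case (Cond e c1 c2)
  then show ?case by (fastforce split: if_splits)
next
  case (While e c)
  have "okc \<beta> c \<longrightarrow> bnd \<beta> M s \<longrightarrow> bnd \<beta> M s'"
    by (rule loop_set[where Q = "\<lambda>s s'. okc \<beta> c \<longrightarrow> bnd \<beta> M s \<longrightarrow> bnd \<beta> M s'", OF While.prems(1)[unfolded exec.simps]])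
      (use While.IH in auto)
  then show ?case using While.prems by simp
next
  case (Rand x e)
  have "val s e \<le> M ^ \<beta> x"
    using val_le[OF M(1) Rand(3), of e] Rand(2) power_mono_exp[of M "val s e" "wE \<beta> e" "\<beta> x"] M by simp
  then show ?case using Rand by (auto simp: uniform_def split: if_splits intro!: bnd_assign)
next
  case (SampleVertex x)
  then show ?case using n0 M by (auto simp: uniform_def intro!: bnd_assign pow_ge)
next
  case (DegreeQuery x e)
  then show ?case using degree_le M by (auto intro!: bnd_assign pow_ge intro: order_trans)
next
  case (NeighborQuery x e i)
  then show ?case using neighbor_query_le[of "val s i" "val s e"] by (auto intro!: bnd_assign pow_ge)
next
  case (PairQuery x e1 e2)
  have "1 \<le> M ^ \<beta> x" using M by simp
  then show ?case using PairQuery by (auto intro!: bnd_assign simp: of_bool_def)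
qed auto

lemma straight_time:
  "s' \<in> set_spmf (exec n \<epsilon> E nbr c s) \<Longrightarrow> straight c \<Longrightarrow> okc \<beta> c \<Longrightarrow> bnd \<beta> M s \<Longrightarrow>
    time s' \<le> time s + tb \<beta> c * bb M"
proof (induction c arbitrary: s s')
  case Skip
  then show ?case by (simp add: charge_def bb_def)
next
  case (Assign x e)
  have "val s e \<le> M ^ wE \<beta> e" using val_le[OF M(1) Assign(4)] .
  from bits_le_bb[OF this] show ?case
    using Assign expr_time_le[OF M(1) Assign(4), of e] by (simp add: assign_def charge_def algebra_simps)
next
  case (Store a i e)
  then show ?case using expr_time_le[OF M(1) Store(4), of e] expr_time_le[OF M(1) Store(4), of i]
    by (simp add: charge_def algebra_simps bb_def)
next
  case (Seq c1 c2)
  then obtain s1 where s1: "s1 \<in> set_spmf (exec n \<epsilon> E nbr c1 s)" "s' \<in> set_spmf (exec n \<epsilon> E nbr c2 s1)"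
    by (auto simp: set_bind_spmf)
  then have "bnd \<beta> M s1" using exec_bnd Seq by auto
  then show ?case using Seq s1 by (fastforce simp: algebra_simps)
next
  case (Cond e c1 c2)
  let ?s = "charge (1 + expr_time s e) s"
  have b: "bnd \<beta> M ?s" using Cond by simp
  have "time s' \<le> time ?s + (tb \<beta> c1 + tb \<beta> c2) * bb M"
    using Cond b by (fastforce simp: algebra_simps split: if_splits)
  also have "time ?s \<le> time s + (1 + tX \<beta> e) * bb M"
    using expr_time_le[OF M(1) Cond.prems(4), of e] by (simp add: charge_def algebra_simps bb_def)
  finally show ?case by (simp add: algebra_simps)
next
  case (Rand x e)
  have v: "val s e \<le> M ^ wE \<beta> e" using val_le[OF M(1) Rand(4)] .
  have "\<exists>k\<le>val s e. s' = assign x k (charge (expr_time s e) s)"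
    using Rand(1) by (auto simp: uniform_def split: if_splits intro: less_imp_le_nat)
  then obtain k where k: "k \<le> val s e" "s' = assign x k (charge (expr_time s e) s)" by blast
  show ?case using bits_le_bb[OF order_trans[OF k(1) v]] expr_time_le[OF M(1) Rand(4), of e]
    by (simp add: k(2) assign_def charge_def algebra_simps)
next
  case (SampleVertex x)
  then obtain v where "v \<in> V" "s' = assign x v (count_query s)"
    using n0 by (auto simp: uniform_def)
  moreover from this have "v \<le> M ^ 1" using M by simp
  ultimately have "v \<le> M ^ 1" "s' = assign x v (count_query s)" by simp_all
  then show ?case using bits_le_bb[of v M 1] by (simp add: assign_def charge_def count_query_def)
next
  case (DegreeQuery x e)
  have "d (val s e) \<le> M ^ 1" using degree_le[of "val s e"] M by simp
  from bits_le_bb[OF this] show ?case using DegreeQuery expr_time_le[OF M(1) DegreeQuery(4), of e]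
    by (simp add: assign_def charge_def count_query_def algebra_simps)
next
  case (NeighborQuery x e i)
  have "(if val s i \<in> {1..d (val s e)} then nbr (val s e) (val s i) else 0) \<le> M ^ 1"
    using neighbor_query_le by simp
  from bits_le_bb[OF this] show ?case
    using NeighborQuery expr_time_le[OF M(1) NeighborQuery(4), of e] expr_time_le[OF M(1) NeighborQuery(4), of i]
    by (simp add: assign_def charge_def count_query_def algebra_simps)
next
  case (PairQuery x e1 e2)
  have "of_bool ({val s e1, val s e2} \<in> E) \<le> M ^ 1" using M by (simp add: of_bool_def)
  from bits_le_bb[OF this] show ?case
    using PairQuery expr_time_le[OF M(1) PairQuery(4), of e1] expr_time_le[OF M(1) PairQuery(4), of e2]
    by (simp add: assign_def charge_def count_query_def algebra_simps)
qed auto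

end

end

section \<open>The program\<close>

abbreviation "eadd \<equiv> Op Add"
abbreviation "esub \<equiv> Op Sub"
abbreviation "emul \<equiv> Op Mul"
abbreviation "ediv \<equiv> Op Div"
abbreviation "eless \<equiv> Op Less"
abbreviation "eeq \<equiv> Op Equal"

text \<open>Codes pairs (v, i) with i \<le> n injectively, as arrays are one-dimensional.\<close>

definition idx :: "expr \<Rightarrow> expr \<Rightarrow> expr" where
  "idx v i = eadd (emul v (eadd (Var ''n'') (Const 1))) i"

text \<open>
  The arrays \<open>Ad\<close>, \<open>Ap\<close>, \<open>An\<close>, \<open>Aa\<close> cache degrees, the number of neighbors read so far, these neighbors,
  and the corresponding adjacency. A neighbor or pair query at \<open>v\<close> also reads the next unread neighbor
  of \<open>v\<close>; once all of them are known, no further query at \<open>v\<close> is made. So there are at most \<open>O(m)\<close>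
  queries in total.
\<close>

definition touchc :: "vname \<Rightarrow> vname \<Rightarrow> com" where
  "touchc v dv =
     Seq (Store ''Ap'' (Var v) (clamp (eadd (Arr ''Ap'' (Var v)) (Const 1)) (Var dv)))
    (Seq (NeighborQuery ''Gyy'' (Var v) (Arr ''Ap'' (Var v)))
    (Seq (Store ''An'' (idx (Var v) (Arr ''Ap'' (Var v))) (Var ''Gyy''))
         (Store ''Aa'' (idx (Var v) (Var ''Gyy'')) (Const 1))))"

definition nbrc :: "vname \<Rightarrow> vname \<Rightarrow> vname \<Rightarrow> vname \<Rightarrow> com" where
  "nbrc x v dv j = Cond (eless (Arr ''Ap'' (Var v)) (Var dv))
     (Seq (touchc v dv) (NeighborQuery x (Var v) (eadd (Var j) (Const 1))))
     (Assign x (Arr ''An'' (idx (Var v) (eadd (Var j) (Const 1)))))"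

definition pairc :: "vname \<Rightarrow> vname \<Rightarrow> vname \<Rightarrow> vname \<Rightarrow> com" where
  "pairc x v dv w = Cond (eless (Arr ''Ap'' (Var v)) (Var dv))
     (Seq (touchc v dv) (PairQuery x (Var v) (Var w)))
     (Assign x (Arr ''Aa'' (idx (Var v) (Var w))))"

text \<open>A stored 0 means unknown. The macro is applied only to vertices known to have a
  neighbor, whose degree cannot be 0.\<close>

definition degc :: "vname \<Rightarrow> vname \<Rightarrow> com" where
  "degc x v = Seq (Assign x (Arr ''Ad'' (Var v)))
     (Cond (eeq (Var x) (Const 0)) (Seq (DegreeQuery x (Var v)) (Store ''Ad'' (Var v) (Var x))) Skip)"

definition forc :: "vname \<Rightarrow> com \<Rightarrow> com" where
  "forc q c = While (Var q) (Seq (Assign q (esub (Var q) (Const 1))) c)"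

lemma state_simps [simp]:
  "scalar (assign x k s) = (scalar s)(x := k)" "arr (assign x k s) = arr s" "queries (assign x k s) = queries s"
  "scalar (charge c s) = scalar s" "arr (charge c s) = arr s" "queries (charge c s) = queries s"
  "scalar (count_query s) = scalar s" "arr (count_query s) = arr s" "queries (count_query s) = queries s + 1"
  "time (count_query s) = time s" "time (charge c s) = time s + c" "time (assign x k s) = time s + (1 + bits k)"
  by (simp_all add: assign_def charge_def count_query_def)

lemma val_idx [simp]: "val s (idx v i) = val s v * (scalar s ''n'' + 1) + val s i"
  by (simp add: idx_def)

lemma idx_inj: "i \<le> n \<Longrightarrow> j \<le> n \<Longrightarrow> v * (n + 1) + i = w * (n + 1) + j \<longleftrightarrow> v = w \<and> i = (j::nat)"
proof
  assume h: "i \<le> n" "j \<le> n" "v * (n + 1) + i = w * (n + 1) + j"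
  have aux: "a = b \<and> k = l" if "k < c" "l < c" "a * c + k = b * c + l" for a b c k l :: nat
  proof -
    have "(a * c + k) div c = a" "(b * c + l) div c = b" using that(1,2) by simp_all
    with that(3) have "a = b" by simp
    then show ?thesis using that(3) by simp
  qed
  show "v = w \<and> i = j" by (rule aux[of i "n + 1"]) (use h in auto)
qed simp

lemma val_clamp [simp]: "val s (clamp a b) = min (val s a) (val s b)"
  by (auto simp: clamp_def)

section \<open>Cache invariant and amortized queries\<close>

context qgraph begin

definition CI :: "(vname \<Rightarrow> nat \<Rightarrow> nat) \<Rightarrow> bool" where
  "CI a \<longleftrightarrow> (\<forall>v\<in>V. a ''Ad'' v = 0 \<or> a ''Ad'' v = d v) \<and> (\<forall>v\<in>V. a ''Ap'' v \<le> d v) \<and>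
     (\<forall>v\<in>V. \<forall>i\<in>{1..a ''Ap'' v}. a ''An'' (v * (n + 1) + i) = nbr v i) \<and>
     (\<forall>v\<in>V. \<forall>w\<in>V. a ''Aa'' (v * (n + 1) + w) \<noteq> 0 \<longleftrightarrow> (\<exists>i\<in>{1..a ''Ap'' v}. nbr v i = w))"

text \<open>A newly stored nonzero degree pays for one query; a newly read neighbor pays for two,
  the reading and the query that caused it.\<close>

definition pot :: "(vname \<Rightarrow> nat \<Rightarrow> nat) \<Rightarrow> nat" where
  "pot a = card {v \<in> V. a ''Ad'' v \<noteq> 0} + 2 * (\<Sum>v\<in>V. a ''Ap'' v)"

lemma CI_deg: "CI a \<Longrightarrow> v \<in> V \<Longrightarrow> a ''Ad'' v = 0 \<or> a ''Ad'' v = d v" unfolding CI_def by blast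
lemma CI_ptr: "CI a \<Longrightarrow> v \<in> V \<Longrightarrow> a ''Ap'' v \<le> d v" unfolding CI_def by blast
lemma CI_nb: "CI a \<Longrightarrow> v \<in> V \<Longrightarrow> i \<in> {1..a ''Ap'' v} \<Longrightarrow> a ''An'' (v * (n + 1) + i) = nbr v i"
  unfolding CI_def by blast
lemma CI_adj: "CI a \<Longrightarrow> v \<in> V \<Longrightarrow> w \<in> V \<Longrightarrow>
    a ''Aa'' (v * (n + 1) + w) \<noteq> 0 \<longleftrightarrow> (\<exists>i\<in>{1..a ''Ap'' v}. nbr v i = w)"
  unfolding CI_def by blast

text \<open>Vertices with a stored nonzero degree number at most the degree sum 2m, and the read
  positions, counted twice, contribute at most 4m.\<close>

lemma pot_le: "CI a \<Longrightarrow> pot a \<le> 6 * m"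
proof -
  assume C: "CI a"
  have "card {v \<in> V. a ''Ad'' v \<noteq> 0} = (\<Sum>v\<in>{v \<in> V. a ''Ad'' v \<noteq> 0}. 1)" by simp
  also have "\<dots> \<le> (\<Sum>v\<in>{v \<in> V. a ''Ad'' v \<noteq> 0}. d v)" proof (intro sum_mono)
    fix v assume "v \<in> {v \<in> V. a ''Ad'' v \<noteq> 0}"
    then show "1 \<le> d v" using CI_deg[OF C, of v] by auto
  qed
  also have "\<dots> \<le> 2 * m" by (intro sum_degree_le) auto
  finally have 1: "card {v \<in> V. a ''Ad'' v \<noteq> 0} \<le> 2 * m" .
  have "(\<Sum>v\<in>V. a ''Ap'' v) \<le> (\<Sum>v\<in>V. d v)" by (intro sum_mono CI_ptr[OF C])
  then show ?thesis using 1 unfolding sum_degree pot_def by linarith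
qed

lemma nbr_N: "v \<in> V \<Longrightarrow> i \<in> {1..d v} \<Longrightarrow> nbr v i \<in> N v"
  using order unfolding neighbor_order_def by (meson bij_betwE)

lemma N_nbr: "v \<in> V \<Longrightarrow> w \<in> N v \<longleftrightarrow> (\<exists>i\<in>{1..d v}. nbr v i = w)"
proof -
  assume "v \<in> V"
  then have "N v = nbr v ` {1..d v}" using order by (simp add: neighbor_order_def bij_betw_def)
  then show "w \<in> N v \<longleftrightarrow> (\<exists>i\<in>{1..d v}. nbr v i = w)" by (auto simp only: image_iff)
qed

abbreviation "ex \<epsilon> \<equiv> exec n \<epsilon> E nbr"

lemma touch_arrays:
  assumes C: "CI a" and z: "z \<in> V" and p: "a ''Ap'' z < d z"
  defines "y \<equiv> nbr z (a ''Ap'' z + 1)"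
  defines "b \<equiv> a(''Ap'' := (a ''Ap'')(z := a ''Ap'' z + 1), ''An'' := (a ''An'')(z * (n + 1) + (a ''Ap'' z + 1) := y),
      ''Aa'' := (a ''Aa'')(z * (n + 1) + y := 1))"
  shows "CI b" "pot b = pot a + 2"
proof -
  let ?p = "a ''Ap'' z"
  have y: "y \<in> N z" unfolding y_def using z p by (intro nbr_N) auto
  then have yV: "y \<in> V" using N_V by blast
  have dn: "d v \<le> n" for v by (rule degree_le)
  have Ad: "b ''Ad'' = a ''Ad''" and Ap: "b ''Ap'' = (a ''Ap'')(z := ?p + 1)"
    and An: "b ''An'' = (a ''An'')(z * (n + 1) + (?p + 1) := y)" and Aa: "b ''Aa'' = (a ''Aa'')(z * (n + 1) + y := 1)"
    by (simp_all add: b_def)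
  have Cp: "v \<in> V \<Longrightarrow> a ''Ap'' v \<le> d v" for v using C by (rule CI_ptr)
  show "CI b" unfolding CI_def
  proof (intro conjI ballI)
    fix v assume v: "v \<in> V"
    show "b ''Ad'' v = 0 \<or> b ''Ad'' v = d v" using CI_deg[OF C v] unfolding Ad .
    show "b ''Ap'' v \<le> d v" using Cp[OF v] p unfolding Ap by simp
    fix i assume i: "i \<in> {1..b ''Ap'' v}"
    show "b ''An'' (v * (n + 1) + i) = nbr v i"
    proof (cases "v = z \<and> i = ?p + 1")
      case True then show ?thesis unfolding An y_def by simp
    next
      case False
      have "i \<le> n" using i Cp[OF v] p dn[of v] unfolding Ap by (auto split: if_splits)
      moreover have "?p + 1 \<le> n" using p dn[of z] by simp
      ultimately have "v * (n + 1) + i \<noteq> z * (n + 1) + (?p + 1)" using False idx_inj by blast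
      moreover have "i \<in> {1..a ''Ap'' v}" using i False unfolding Ap by (auto split: if_splits)
      ultimately show ?thesis using CI_nb[OF C v] unfolding An by simp
    qed
  next
    fix v w assume v: "v \<in> V" and w: "w \<in> V"
    have old: "a ''Aa'' (v * (n + 1) + w) \<noteq> 0 \<longleftrightarrow> (\<exists>i\<in>{1..a ''Ap'' v}. nbr v i = w)"
      by (rule CI_adj[OF C v w])
    have e: "v * (n + 1) + w = z * (n + 1) + y \<longleftrightarrow> v = z \<and> w = y"
      using w yV by (intro idx_inj) auto
    show "b ''Aa'' (v * (n + 1) + w) \<noteq> 0 \<longleftrightarrow> (\<exists>i\<in>{1..b ''Ap'' v}. nbr v i = w)"
    proof (cases "v = z")
      case True
      have "{1..b ''Ap'' z} = insert (?p + 1) {1..?p}" unfolding Ap by auto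
      then show ?thesis using old e True unfolding Aa by (auto simp: y_def)
    next
      case False
      then show ?thesis using old e unfolding Aa Ap by simp
    qed
  qed
  have "(\<Sum>v\<in>V. b ''Ap'' v) = (\<Sum>v\<in>V. a ''Ap'' v) + 1"
  proof -
    have "(\<Sum>v\<in>V - {z}. b ''Ap'' v) = (\<Sum>v\<in>V - {z}. a ''Ap'' v)" by (intro sum.cong) (auto simp: Ap)
    then show ?thesis using z sum.remove[of V z "b ''Ap''"] sum.remove[of V z "a ''Ap''"] by (simp add: Ap)
  qed
  then show "pot b = pot a + 2" by (simp add: pot_def Ad)
qed

lemma touchc_det:
  assumes "CI (arr s)" "scalar s v \<in> V" "scalar s dv = d (scalar s v)" "arr s ''Ap'' (scalar s v) < d (scalar s v)"
    "scalar s ''n'' = n" "v \<noteq> ''Gyy''" "dv \<noteq> ''Gyy''"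
  shows "\<exists>s'. ex \<epsilon> (touchc v dv) s = return_spmf s' \<and> CI (arr s') \<and> pot (arr s') = pot (arr s) + 2
     \<and> queries s' = queries s + 1"
proof -
  let ?z = "scalar s v" and ?a = "arr s"
  have i: "?a ''Ap'' ?z + 1 \<in> {1..d ?z}" using assms(4) by simp
  have mn: "min (Suc (?a ''Ap'' ?z)) (d ?z) = Suc (?a ''Ap'' ?z)" using assms(4) by simp
  note t = touch_arrays[OF assms(1,2,4)]
  show ?thesis
    unfolding touchc_def exec.simps return_bind_spmf
    by (rule exI, rule conjI, rule refl) (use t i mn assms in simp)
qed

text \<open>Queries minus potential do not grow; all cached operations are specified in this
  amortized form.\<close>

lemma nbrc_det:
  assumes "CI (arr s)" "scalar s v \<in> V" "scalar s dv = d (scalar s v)" "scalar s j < d (scalar s v)"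
    "scalar s ''n'' = n" "v \<noteq> ''Gyy''" "dv \<noteq> ''Gyy''" "j \<noteq> ''Gyy''"
  shows "\<exists>s'. ex \<epsilon> (nbrc x v dv j) s = return_spmf s' \<and> CI (arr s')
     \<and> queries s' + pot (arr s) \<le> queries s + pot (arr s') \<and> scalar s' x = nbr (scalar s v) (scalar s j + 1)"
proof (cases "arr s ''Ap'' (scalar s v) < d (scalar s v)")
  case True
  let ?s = "charge (1 + expr_time s (eless (Arr ''Ap'' (Var v)) (Var dv))) s"
  obtain s1 where s1: "ex \<epsilon> (touchc v dv) ?s = return_spmf s1" "CI (arr s1)" "pot (arr s1) = pot (arr s) + 2"
     "queries s1 = queries s + 1"
    using touchc_det[of ?s v dv \<epsilon>] assms True by auto
  have "s1 \<in> set_spmf (ex \<epsilon> (touchc v dv) ?s)" using s1 by simp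
  from exec_frame[OF this] have f: "scalar s1 v = scalar s v" "scalar s1 j = scalar s j"
    using assms by (auto simp: touchc_def)
  show ?thesis unfolding nbrc_def using True assms s1 f by (auto simp: exec.simps)
next
  case False
  then have "arr s ''Ap'' (scalar s v) = d (scalar s v)" using CI_ptr[OF assms(1,2)] by linarith
  then have "arr s ''An'' (scalar s v * (n + 1) + (scalar s j + 1)) = nbr (scalar s v) (scalar s j + 1)"
    using assms(4) by (intro CI_nb[OF assms(1,2)]) auto
  then show ?thesis unfolding nbrc_def using False assms by auto
qed

lemma pairc_det:
  assumes "CI (arr s)" "scalar s v \<in> V" "scalar s dv = d (scalar s v)" "scalar s w \<in> V"
    "scalar s ''n'' = n" "v \<noteq> ''Gyy''" "dv \<noteq> ''Gyy''" "w \<noteq> ''Gyy''"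
  shows "\<exists>s'. ex \<epsilon> (pairc x v dv w) s = return_spmf s' \<and> CI (arr s')
     \<and> queries s' + pot (arr s) \<le> queries s + pot (arr s') \<and> (scalar s' x \<noteq> 0 \<longleftrightarrow> scalar s w \<in> N (scalar s v))"
proof (cases "arr s ''Ap'' (scalar s v) < d (scalar s v)")
  case True
  let ?s = "charge (1 + expr_time s (eless (Arr ''Ap'' (Var v)) (Var dv))) s"
  obtain s1 where s1: "ex \<epsilon> (touchc v dv) ?s = return_spmf s1" "CI (arr s1)" "pot (arr s1) = pot (arr s) + 2"
     "queries s1 = queries s + 1"
    using touchc_det[of ?s v dv \<epsilon>] assms True by auto
  have "s1 \<in> set_spmf (ex \<epsilon> (touchc v dv) ?s)" using s1 by simp
  from exec_frame[OF this] have f: "scalar s1 v = scalar s v" "scalar s1 w = scalar s w"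
    using assms by (auto simp: touchc_def)
  show ?thesis unfolding pairc_def using True assms s1 f by (auto simp: N_iff insert_commute)
next
  case False
  then have "arr s ''Ap'' (scalar s v) = d (scalar s v)" using CI_ptr[OF assms(1,2)] by linarith
  then have "arr s ''Aa'' (scalar s v * (n + 1) + scalar s w) \<noteq> 0 \<longleftrightarrow> scalar s w \<in> N (scalar s v)"
    using CI_adj[OF assms(1,2,4)] N_nbr[OF assms(2)] by simp
  then show ?thesis unfolding pairc_def using False assms by auto
qed

lemma CI_set_degree:
  assumes "CI a" "z \<in> V"
  shows "CI (a(''Ad'' := (a ''Ad'')(z := d z)))" "pot a \<le> pot (a(''Ad'' := (a ''Ad'')(z := d z)))"
    "a ''Ad'' z = 0 \<Longrightarrow> 0 < d z \<Longrightarrow> pot (a(''Ad'' := (a ''Ad'')(z := d z))) = pot a + 1"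
proof -
  show "CI (a(''Ad'' := (a ''Ad'')(z := d z)))" using assms by (simp add: CI_def)
  let ?b = "a(''Ad'' := (a ''Ad'')(z := d z))"
  have "{v \<in> V. a ''Ad'' v \<noteq> 0} \<subseteq> {v \<in> V. ?b ''Ad'' v \<noteq> 0}"
    using CI_deg[OF assms] by auto
  then have "card {v \<in> V. a ''Ad'' v \<noteq> 0} \<le> card {v \<in> V. ?b ''Ad'' v \<noteq> 0}" by (intro card_mono) auto
  then show "pot a \<le> pot ?b" by (simp add: pot_def)
  assume h: "a ''Ad'' z = 0" "0 < d z"
  then have "{v \<in> V. ?b ''Ad'' v \<noteq> 0} = insert z {v \<in> V. a ''Ad'' v \<noteq> 0}" using assms by auto
  then show "pot ?b = pot a + 1" using h by (simp add: pot_def)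
qed

lemma degc_det:
  assumes "CI (arr s)" "scalar s v \<in> V" "0 < d (scalar s v)" "v \<noteq> x"
  shows "\<exists>s'. ex \<epsilon> (degc x v) s = return_spmf s' \<and> CI (arr s')
     \<and> queries s' + pot (arr s) \<le> queries s + pot (arr s') \<and> scalar s' x = d (scalar s v)"
proof (cases "arr s ''Ad'' (scalar s v) = 0")
  case True
  then show ?thesis using CI_set_degree[OF assms(1,2)] assms unfolding degc_def by auto
next
  case False
  then have "arr s ''Ad'' (scalar s v) = d (scalar s v)" using CI_deg[OF assms(1,2)] by simp
  then show ?thesis using assms unfolding degc_def by auto
qed

end

section \<open>Refinement\<close>

lemma forp_Suc: "forp (Suc k) D = bind_pmf (tick D) (\<lambda>a. map_pmf ((+) a) (forp k D))"
  unfolding forp_def tick_def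
  by (simp add: map_bind_pmf bind_map_pmf map_pmf_comp add_ac)

lemma forp_0: "forp 0 D = return_pmf (0, 1, 0)"
  by (simp add: forp_def tick_def zero_prod_def)

text \<open>Counters are clamped to keep their size statically bounded; x is the amount added before
  clamping.\<close>

definition accr :: "vname \<Rightarrow> vname \<Rightarrow> state \<Rightarrow> state \<Rightarrow> nat \<Rightarrow> bool" where
  "accr a c s s' x \<longleftrightarrow> scalar s' a = min (scalar s a + x) (scalar s c)"

text \<open>Names of local variables of an exploration consist of a prefix \<open>p\<close> and one letter, because an outer exploration
  (\<open>M\<close>) starts inner ones (\<open>H\<close>): \<open>v\<close>, \<open>u\<close>, \<open>w\<close> are the vertices of a possible triangle, \<open>d\<close>, \<open>e\<close>, \<open>k\<close> their degrees,
  and \<open>x\<close>, \<open>y\<close> the endpoints of smaller and larger degree, \<open>f\<close> and \<open>h\<close>.\<close>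

definition swapc :: "char \<Rightarrow> com" where
  "swapc p = Cond (eless (Var [p, CHR ''e'']) (Var [p, CHR ''d'']))
     (Seq (Assign [p, CHR ''x''] (Var [p, CHR ''u''])) (Seq (Assign [p, CHR ''f''] (Var [p, CHR ''e'']))
       (Seq (Assign [p, CHR ''y''] (Var [p, CHR ''v''])) (Assign [p, CHR ''h''] (Var [p, CHR ''d''])))))
     (Seq (Assign [p, CHR ''x''] (Var [p, CHR ''v''])) (Seq (Assign [p, CHR ''f''] (Var [p, CHR ''d'']))
       (Seq (Assign [p, CHR ''y''] (Var [p, CHR ''u''])) (Assign [p, CHR ''h''] (Var [p, CHR ''e''])))))"

definition precE :: "char \<Rightarrow> expr" where
  "precE p = eadd (eless (Var [p, CHR ''e'']) (Var [p, CHR ''k'']))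
     (emul (eeq (Var [p, CHR ''e'']) (Var [p, CHR ''k''])) (eless (Var [p, CHR ''u'']) (Var [p, CHR ''w''])))"

definition slotE :: "char \<Rightarrow> expr" where
  "slotE p = eadd (ediv (Var [p, CHR ''f'']) (Var ''Gkap'')) (Const 1)"

definition roundE :: "char \<Rightarrow> expr" where
  "roundE p = ediv (esub (eadd (Var [p, CHR ''d'']) (Var ''Ggap'')) (Const 1)) (Var ''Ggap'')"

definition wedgec :: "char \<Rightarrow> com \<Rightarrow> com" where
  "wedgec p hitc = Seq (Rand [p, CHR ''j''] (emul (slotE p) (Var ''Gkap'')))
     (Cond (eless (Var [p, CHR ''j'']) (Var [p, CHR ''f'']))
       (Seq (nbrc [p, CHR ''w''] [p, CHR ''x''] [p, CHR ''f''] [p, CHR ''j''])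
       (Seq (pairc [p, CHR ''b''] [p, CHR ''y''] [p, CHR ''h''] [p, CHR ''w''])
         (Cond (Var [p, CHR ''b''])
           (Seq (degc [p, CHR ''k''] [p, CHR ''w'']) (Cond (precE p) hitc Skip)) Skip))) Skip)"

definition edgec :: "char \<Rightarrow> com \<Rightarrow> com" where
  "edgec p hitc = Seq (Rand [p, CHR ''i''] (emul (roundE p) (Var ''Ggap'')))
     (Cond (eless (Var [p, CHR ''i'']) (Var [p, CHR ''d'']))
       (Seq (nbrc [p, CHR ''u''] [p, CHR ''v''] [p, CHR ''d''] [p, CHR ''i''])
       (Seq (degc [p, CHR ''e''] [p, CHR ''u''])
       (Seq (swapc p)
       (Seq (Assign [p, CHR ''r''] (slotE p)) (forc [p, CHR ''r''] (wedgec p hitc)))))) Skip)"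

definition explorec :: "char \<Rightarrow> com \<Rightarrow> com" where
  "explorec p hitc = Seq (Assign [p, CHR ''q''] (emul (Var ''Grep'') (roundE p))) (forc [p, CHR ''q''] (edgec p hitc))"

section \<open>Coupling of programs with abstract outcomes\<close>

locale refinement = qgraph +
  fixes \<epsilon> :: real and \<beta> :: "vname \<Rightarrow> nat" and M WW :: nat
  assumes M: "2 \<le> M" "n \<le> M" and n0: "0 < n"
begin

abbreviation "exc \<equiv> exec n \<epsilon> E nbr"

definition good :: "state \<Rightarrow> bool" where
  "good s \<longleftrightarrow> CI (arr s) \<and> bnd \<beta> M s \<and> scalar s ''n'' = n"

text \<open>\<open>adv\<close> measures a deterministic stretch in units of \<open>bb M\<close>,
  \<open>cst\<close> measures in abstract steps of length \<open>WW\<close>. A stretch whose budget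
  fits into \<open>WW\<close> counts as one step.\<close>

definition adv :: "state \<Rightarrow> state \<Rightarrow> nat \<Rightarrow> bool" where
  "adv s s' k \<longleftrightarrow> good s' \<and> time s' \<le> time s + k * bb M \<and> queries s' + pot (arr s) \<le> queries s + pot (arr s')"

definition cst :: "state \<Rightarrow> state \<Rightarrow> nat \<times> nat \<Rightarrow> bool" where
  "cst s s' p \<longleftrightarrow> good s' \<and> time s' \<le> time s + fst p * WW \<and>
     queries s' + pot (arr s) \<le> queries s + pot (arr s') + 2 * snd p"

text \<open>The program \<open>c\<close> run from \<open>s\<close> is coupled with the abstract outcomes \<open>D\<close>, where costs are counted from an earlier
  state \<open>s0\<close>. An abstract step pays for time \<open>WW\<close>, a sample for two queries, and all
  other queries are paid by the potential of the cache.\<close>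

definition ref :: "state \<Rightarrow> (state \<Rightarrow> 'v \<Rightarrow> bool) \<Rightarrow> com \<Rightarrow> state \<Rightarrow> ('v \<times> nat \<times> nat) pmf \<Rightarrow> bool" where
  "ref s0 \<Phi> c s D \<longleftrightarrow> rel_spmf (\<lambda>s' x. \<Phi> s' (fst x) \<and> cst s0 s' (snd x)) (exc c s) (spmf_of_pmf D)"

lemma bnd_set: "s' \<in> set_spmf (exc c s) \<Longrightarrow> okc \<beta> c \<Longrightarrow> bnd \<beta> M s \<Longrightarrow> bnd \<beta> M s'"
  by (rule exec_bnd[OF order M n0])

lemma time_set: "s' \<in> set_spmf (exc c s) \<Longrightarrow> straight c \<Longrightarrow> okc \<beta> c \<Longrightarrow> bnd \<beta> M s \<Longrightarrow> time s' \<le> time s + tb \<beta> c * bb M"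
  by (rule straight_time[OF order M n0])

lemma adv_refl: "good s \<Longrightarrow> adv s s 0" by (simp add: adv_def)

lemma adv_trans: "adv s s1 a \<Longrightarrow> adv s1 s2 b \<Longrightarrow> adv s s2 (a + b)"
  by (auto simp: adv_def algebra_simps)

lemma adv_good: "adv s s' k \<Longrightarrow> good s'" by (simp add: adv_def)

lemma adv_mono: "adv s s' a \<Longrightarrow> a \<le> b \<Longrightarrow> adv s s' b"
  unfolding adv_def using mult_le_mono1[of a b "bb M"] by linarith

lemma adv_charge: "good s \<Longrightarrow> adv s (charge (1 + expr_time s e) s) (1 + tX \<beta> e)"
  using expr_time_le[OF M(1), of \<beta> s e] by (simp add: adv_def good_def bb_def)

lemma adv_det:
  assumes "good s" "exc c s = return_spmf s'" "straight c" "okc \<beta> c" "''n'' \<notin> wr c" "CI (arr s')"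
    "queries s' + pot (arr s) \<le> queries s + pot (arr s')"
  shows "adv s s' (tb \<beta> c)" "\<forall>y. y \<notin> wr c \<longrightarrow> scalar s' y = scalar s y"
proof -
  have s': "s' \<in> set_spmf (exc c s)" using assms(2) by simp
  show "\<forall>y. y \<notin> wr c \<longrightarrow> scalar s' y = scalar s y" using exec_frame[OF s'] by blast
  then show "adv s s' (tb \<beta> c)"
    using assms bnd_set[OF s'] time_set[OF s'] by (auto simp: adv_def good_def)
qed

lemma straight_macros [simp]: "straight (nbrc x v dv j)" "straight (pairc x v dv w)" "straight (degc x v)"
  by (simp_all add: nbrc_def pairc_def degc_def touchc_def)

lemma wr_macros [simp]: "wr (nbrc x v dv j) = {x, ''Gyy''}" "wr (pairc x v dv w) = {x, ''Gyy''}" "wr (degc x v) = {x}"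
  by (auto simp: nbrc_def pairc_def degc_def touchc_def)

lemma nbrc_adv:
  assumes "good s" "okc \<beta> (nbrc x v dv j)" "scalar s v \<in> V" "scalar s dv = d (scalar s v)" "scalar s j < d (scalar s v)"
    "length x = 2" "length v = 2" "length dv = 2" "length j = 2"
  obtains s' where "exc (nbrc x v dv j) s = return_spmf s'" "adv s s' (tb \<beta> (nbrc x v dv j))"
    "scalar s' x = nbr (scalar s v) (scalar s j + 1)" "\<And>y. y \<noteq> x \<Longrightarrow> y \<noteq> ''Gyy'' \<Longrightarrow> scalar s' y = scalar s y"
proof -
  have ne: "v \<noteq> ''Gyy''" "dv \<noteq> ''Gyy''" "j \<noteq> ''Gyy''" "''n'' \<notin> {x, ''Gyy''}" using assms(6-9) by auto
  obtain s' where s': "exc (nbrc x v dv j) s = return_spmf s'" "CI (arr s')"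
     "queries s' + pot (arr s) \<le> queries s + pot (arr s')" "scalar s' x = nbr (scalar s v) (scalar s j + 1)"
    using nbrc_det[of s v dv j \<epsilon> x] assms ne by (auto simp: good_def)
  show thesis
    using that[OF s'(1)] adv_det[OF assms(1) s'(1) _ assms(2) _ s'(2,3)] s'(4) ne(4) by auto
qed

lemma pairc_adv:
  assumes "good s" "okc \<beta> (pairc x v dv w)" "scalar s v \<in> V" "scalar s dv = d (scalar s v)" "scalar s w \<in> V"
    "length x = 2" "length v = 2" "length dv = 2" "length w = 2"
  obtains s' where "exc (pairc x v dv w) s = return_spmf s'" "adv s s' (tb \<beta> (pairc x v dv w))"
    "scalar s' x \<noteq> 0 \<longleftrightarrow> scalar s w \<in> N (scalar s v)" "\<And>y. y \<noteq> x \<Longrightarrow> y \<noteq> ''Gyy'' \<Longrightarrow> scalar s' y = scalar s y"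
proof -
  have ne: "v \<noteq> ''Gyy''" "dv \<noteq> ''Gyy''" "w \<noteq> ''Gyy''" "''n'' \<notin> {x, ''Gyy''}" using assms(6-9) by auto
  obtain s' where s': "exc (pairc x v dv w) s = return_spmf s'" "CI (arr s')"
     "queries s' + pot (arr s) \<le> queries s + pot (arr s')" "scalar s' x \<noteq> 0 \<longleftrightarrow> scalar s w \<in> N (scalar s v)"
    using pairc_det[of s v dv w \<epsilon> x] assms ne by (auto simp: good_def)
  show thesis
    using that[OF s'(1)] adv_det[OF assms(1) s'(1) _ assms(2) _ s'(2,3)] s'(4) ne(4) by auto
qed

lemma degc_adv:
  assumes "good s" "okc \<beta> (degc x v)" "scalar s v \<in> V" "0 < d (scalar s v)" "x \<noteq> v" "length x = 2"
  obtains s' where "exc (degc x v) s = return_spmf s'" "adv s s' (tb \<beta> (degc x v))"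
    "scalar s' x = d (scalar s v)" "\<And>y. y \<noteq> x \<Longrightarrow> scalar s' y = scalar s y"
proof -
  have ne: "''n'' \<notin> {x}" using assms(6) by auto
  obtain s' where s': "exc (degc x v) s = return_spmf s'" "CI (arr s')"
     "queries s' + pot (arr s) \<le> queries s + pot (arr s')" "scalar s' x = d (scalar s v)"
    using degc_det[of s v x \<epsilon>] assms ne by (auto simp: good_def)
  show thesis
    using that[OF s'(1)] adv_det[OF assms(1) s'(1) _ assms(2) _ s'(2,3)] s'(4) ne by auto
qed

lemma assign_adv:
  assumes "good s" "okc \<beta> (Assign x e)" "x \<noteq> ''n''"
  defines "s' \<equiv> assign x (val s e) (charge (expr_time s e) s)"
  shows "exc (Assign x e) s = return_spmf s'" "adv s s' (tb \<beta> (Assign x e))"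
proof -
  show 1: "exc (Assign x e) s = return_spmf s'" by (simp add: s'_def)
  show "adv s s' (tb \<beta> (Assign x e))"
    by (rule adv_det(1)[OF assms(1) 1]) (use assms in \<open>auto simp: good_def\<close>)
qed

lemma cst_of_adv: "adv s s' k \<Longrightarrow> k * bb M \<le> WW \<Longrightarrow> cst s s' (1, 0)"
  by (auto simp: adv_def cst_def)

lemma cst_trans: "cst s s1 a \<Longrightarrow> cst s1 s2 b \<Longrightarrow> cst s s2 (a + b)"
  by (auto simp: cst_def algebra_simps)

lemma ref_return: "exc c s = return_spmf s' \<Longrightarrow> adv s0 s' k \<Longrightarrow> k * bb M \<le> WW \<Longrightarrow> \<Phi> s' x \<Longrightarrow>
    ref s0 \<Phi> c s (return_pmf (x, 1, 0))"
  using cst_of_adv by (simp add: ref_def)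

lemma ref_map:
  assumes "ref s1 \<Psi> c s D" "cst s0 s1 p" "\<And>s' x. \<Psi> s' x \<Longrightarrow> \<Phi> s' (g x)"
  shows "ref s0 \<Phi> c s (map_pmf (\<lambda>x. (g (fst x), p + snd x)) D)"
proof -
  have "rel_spmf (\<lambda>s' x. \<Phi> s' (fst (g (fst x), p + snd x)) \<and> cst s0 s' (snd (g (fst x), p + snd x)))
      (exc c s) (spmf_of_pmf D)"
    by (rule rel_spmf_mono[OF assms(1)[unfolded ref_def]]) (use assms(2,3) cst_trans in auto)
  then have "rel_spmf (\<lambda>s' x. \<Phi> s' (fst x) \<and> cst s0 s' (snd x))
      (exc c s) (map_spmf (\<lambda>x. (g (fst x), p + snd x)) (spmf_of_pmf D))"
    by (simp only: spmf_rel_map)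
  then show ?thesis unfolding ref_def map_spmf_of_pmf .
qed

lemma ref_tick:
  assumes "ref s1 \<Phi> c s D" "adv s0 s1 k" "k * bb M \<le> WW"
  shows "ref s0 \<Phi> c s (tick D)"
proof -
  have "tick D = map_pmf (\<lambda>x. (id (fst x), (1, 0) + snd x)) D"
    unfolding tick_def by (rule map_pmf_cong) (auto simp: plus_prod_def)
  then show ?thesis using ref_map[OF assms(1) cst_of_adv[OF assms(2,3)], of \<Phi> id] by simp
qed

lemma ref_seq: "exc c1 s = return_spmf s1 \<Longrightarrow> ref s0 \<Phi> c2 s1 D \<Longrightarrow> ref s0 \<Phi> (Seq c1 c2) s D"
  by (simp add: ref_def)

lemma spmf_of_pmf_bind_spmf:
  "spmf_of_pmf (bind_pmf p f) = bind_spmf (spmf_of_pmf p) (\<lambda>x. spmf_of_pmf (f x))"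
  by (simp add: bind_spmf_of_pmf spmf_of_pmf_bind)

lemma ref_rand:
  assumes "0 < val s e" "\<And>i. i < val s e \<Longrightarrow> ref s0 \<Phi> c (assign x i (charge (expr_time s e) s)) (f i)"
  shows "ref s0 \<Phi> (Seq (Rand x e) c) s (bind_pmf (pmf_of_set {..<val s e}) f)"
proof -
  let ?A = "{..<val s e}"
  have A: "finite ?A" "?A \<noteq> {}" using assms(1) by auto
  have "rel_spmf (\<lambda>i j. i = j \<and> i \<in> ?A) (spmf_of_set ?A) (spmf_of_pmf (pmf_of_set ?A))"
    unfolding spmf_of_pmf_pmf_of_set[OF A] by (rule rel_spmf_reflI) (use A in auto)
  then show ?thesis
    unfolding ref_def exec.simps spmf_of_pmf_bind_spmf uniform_def bind_map_spmf if_not_P[OF A(2)]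
    by (rule rel_spmf_bindI) (use assms(2)[unfolded ref_def] in \<open>auto simp: o_def\<close>)
qed

lemma ref_bind:
  assumes "ref s0 \<Psi> c1 s D"
    and "\<And>s1 x. s1 \<in> set_spmf (exc c1 s) \<Longrightarrow> \<Psi> s1 (fst x) \<Longrightarrow> cst s0 s1 (snd x) \<Longrightarrow> ref s0' \<Phi> c2 s1 (f x)"
  shows "ref s0' \<Phi> (Seq c1 c2) s (bind_pmf D f)"
proof -
  have "rel_spmf (\<lambda>s' x. s' \<in> set_spmf (exc c1 s) \<and> \<Psi> s' (fst x) \<and> cst s0 s' (snd x)) (exc c1 s) (spmf_of_pmf D)"
    by (rule rel_spmf_mono_strong[OF assms(1)[unfolded ref_def]]) auto
  then show ?thesis unfolding ref_def exec.simps spmf_of_pmf_bind_spmf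
    by (rule rel_spmf_bindI) (use assms(2)[unfolded ref_def] in auto)
qed

text \<open>Clamped additions compose, min (min (a + x) c + y) c = min (a + x + y) c, so the passes
  add up as in \<open>forp\<close>. The body has to be coupled only if there is a pass: an edge draw
  makes sense only at positive degree.\<close>

lemma ref_for:
  assumes ok: "okc \<beta> (forc q c)" and tb: "tb \<beta> (forc q c) * bb M \<le> WW"
    and names: "q \<notin> wr c" "a \<noteq> q" "b \<noteq> q" "b \<notin> wr c" "''n'' \<notin> wr c" "q \<noteq> ''n''"
    and body: "\<And>s. 0 < scalar s0 q \<Longrightarrow> good s \<Longrightarrow> (\<And>x. x \<noteq> q \<Longrightarrow> x \<notin> wr c \<Longrightarrow> scalar s x = scalar s0 x) \<Longrightarrow> scalar s a \<le> scalar s b \<Longrightarrow>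
      ref s (accr a b s) c s D"
    and s0: "good s0" "scalar s0 a \<le> scalar s0 b"
  shows "ref s0 (accr a b s0) (forc q c) s0 (forp (scalar s0 q) D)"
proof -
  let ?g = "\<lambda>s. val s (Var q) \<noteq> 0" and ?pay = "\<lambda>s. charge (1 + expr_time s (Var q)) s"
  let ?dec = "Assign q (esub (Var q) (Const 1))"
  have okd: "okc \<beta> ?dec" and okb: "okc \<beta> c" using ok by (auto simp: forc_def)
  have tb': "(1 + tX \<beta> (Var q) + tb \<beta> ?dec) * bb M \<le> WW"
  proof -
    have "(1 + tX \<beta> (Var q) + tb \<beta> ?dec) * bb M \<le> tb \<beta> (forc q c) * bb M"
      by (intro mult_le_mono1) (simp add: forc_def)
    then show ?thesis using tb by linarith
  qed
  have unroll: "exc (forc q c) s = (if scalar s q \<noteq> 0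
      then bind_spmf (exc c (assign q (scalar s q - 1) (charge (expr_time (?pay s) (esub (Var q) (Const 1))) (?pay s)))) (exc (forc q c))
      else return_spmf (?pay s))" for s
    unfolding forc_def exec.simps by (subst loop.simps) simp
  have "ref s (accr a b s) (forc q c) s (forp k D)"
    if "good s" "\<And>x. x \<noteq> q \<Longrightarrow> x \<notin> wr c \<Longrightarrow> scalar s x = scalar s0 x" "scalar s a \<le> scalar s b" "scalar s q = k" "k \<le> scalar s0 q" for k s
    using that
  proof (induction k arbitrary: s)
    case 0
    have "(1 + tX \<beta> (Var q)) * bb M \<le> WW" using tb' by (simp add: algebra_simps)
    then show ?case unfolding forp_0 using 0
      by (intro ref_return[OF _ adv_charge[OF 0(1), of "Var q"]]) (auto simp: unroll accr_def)
  next
    case (Suc k)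
    define s1 where "s1 = assign q k (charge (expr_time (?pay s) (esub (Var q) (Const 1))) (?pay s))"
    have gp: "good (?pay s)" by (rule adv_good[OF adv_charge[OF Suc.prems(1)]])
    have v: "val (?pay s) (esub (Var q) (Const 1)) = k" using Suc.prems(4) by simp
    have a1: "adv s s1 (1 + tX \<beta> (Var q) + tb \<beta> ?dec)"
      unfolding s1_def v[symmetric] by (rule adv_trans[OF adv_charge[OF Suc.prems(1)] assign_adv(2)[OF gp okd names(6)]])
    have sc: "scalar s1 x = scalar s x" if "x \<noteq> q" for x using that by (simp add: s1_def)
    have "accr a b s1 = accr a b s" using sc names by (auto simp: accr_def fun_eq_iff)
    moreover have "ref s1 (accr a b s1) c s1 D"
      by (rule body[OF _ adv_good[OF a1]]) (use Suc.prems sc names in auto)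
    ultimately have r1: "ref s (accr a b s) c s1 (tick D)"
      using ref_tick[OF _ a1 tb'] by simp
    have e: "exc (forc q c) s = exc (Seq c (forc q c)) s1"
      unfolding unroll[of s] using Suc.prems(4) by (simp add: s1_def)
    have "ref s (accr a b s) (Seq c (forc q c)) s1 (bind_pmf (tick D) (\<lambda>x. map_pmf ((+) x) (forp k D)))"
    proof (rule ref_bind[OF r1])
      fix s2 x assume s2: "s2 \<in> set_spmf (exc c s1)" "accr a b s s2 (fst x)" "cst s s2 (snd x)"
      have fr: "scalar s2 y = scalar s1 y" if "y \<notin> wr c" for y using exec_frame[OF s2(1)] that by blast
      have "ref s2 (accr a b s2) (forc q c) s2 (forp k D)"
      proof (rule Suc.IH)
        show "good s2" using s2(3) by (simp add: cst_def)
        show "scalar s2 y = scalar s0 y" if "y \<noteq> q" "y \<notin> wr c" for y using that fr sc Suc.prems(2) by simp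
        have "scalar s2 b = scalar s b" using fr sc names by simp
        then show "scalar s2 a \<le> scalar s2 b" using s2(2) by (simp add: accr_def)
        show "scalar s2 q = k" using fr names by (simp add: s1_def)
        show "k \<le> scalar s0 q" using Suc.prems(5) by simp
      qed
      from ref_map[OF this s2(3), of "accr a b s" "\<lambda>y. fst x + y"]
      have "ref s (accr a b s) (forc q c) s2 (map_pmf (\<lambda>y. (fst x + fst y, snd x + snd y)) (forp k D))"
        using s2(2) fr sc names by (auto simp: accr_def)
      moreover have "map_pmf (\<lambda>y. (fst x + fst y, snd x + snd y)) (forp k D) = map_pmf ((+) x) (forp k D)"
        by (intro map_pmf_cong) (auto simp: plus_prod_def)
      ultimately show "ref s (accr a b s) (forc q c) s2 (map_pmf ((+) x) (forp k D))" by simp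
    qed
    then show ?case unfolding ref_def e forp_Suc .
  qed
  from this[OF s0(1) _ s0(2), of "scalar s0 q"] show ?thesis by simp
qed

end

section \<open>Refinement of the exploration\<close>

context refinement begin

lemma adv_set:
  assumes "good s" "s' \<in> set_spmf (exc c s)" "straight c" "okc \<beta> c" "''n'' \<notin> wr c" "arr s' = arr s" "queries s' = queries s"
  shows "adv s s' (tb \<beta> c)"
  using assms bnd_set[OF assms(2,4)] time_set[OF assms(2-4)] exec_frame[OF assms(2)] by (auto simp: adv_def good_def)

lemma rand_adv:
  assumes "good s" "okc \<beta> (Rand x e)" "x \<noteq> ''n''" "i < val s e"
  shows "adv s (assign x i (charge (expr_time s e) s)) (tb \<beta> (Rand x e))"
  by (rule adv_set[OF assms(1)]) (use assms in \<open>auto simp: uniform_def\<close>)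

lemma skip_adv: "adv s s1 k \<Longrightarrow> adv s (charge 1 s1) (k + 1)"
  by (auto simp: adv_def good_def bb_def algebra_simps)

lemma adv_cond: "adv s s1 k \<Longrightarrow> adv s (charge (1 + expr_time s1 e) s1) (k + (1 + tX \<beta> e))"
  by (meson adv_charge adv_good adv_trans)

lemma adv_seq_assign:
  assumes "adv s s1 k" "okc \<beta> (Assign x e)" "x \<noteq> ''n''"
  shows "adv s (assign x (val s1 e) (charge (expr_time s1 e) s1)) (k + tb \<beta> (Assign x e))"
  using adv_trans[OF assms(1) assign_adv(2)[OF adv_good[OF assms(1)] assms(2,3)]] .

lemma ref_cond:
  assumes "val s e \<noteq> 0 \<Longrightarrow> ref s0 \<Phi> c1 (charge (1 + expr_time s e) s) D"
    and "val s e = 0 \<Longrightarrow> ref s0 \<Phi> c2 (charge (1 + expr_time s e) s) D"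
  shows "ref s0 \<Phi> (Cond e c1 c2) s D"
  using assms by (auto simp: ref_def)

lemma le_WW: "k \<le> l \<Longrightarrow> l * bb M \<le> WW \<Longrightarrow> k * bb M \<le> WW"
  by (meson mult_le_mono1 order_trans)

lemma ref_skip:
  assumes "adv s0 s k" "(k + 1) * bb M \<le> WW" "\<Phi> (charge 1 s) x"
  shows "ref s0 \<Phi> Skip s (return_pmf (x, 1, 0))"
  by (rule ref_return[OF _ skip_adv[OF assms(1)] assms(2)]) (use assms(3) in simp_all)

context
  fixes p :: char and hitc :: com and a b :: vname and s0 :: state and D :: "nat \<Rightarrow> nat \<Rightarrow> nat \<Rightarrow> outcome pmf"
    and v \<kappa> g R :: nat
  assumes ok: "okc \<beta> (explorec p hitc)" and tbW: "tb \<beta> (explorec p hitc) * bb M \<le> WW"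
    and loc: "\<And>c. [p, c] \<notin> wr hitc" "\<And>c. a \<noteq> [p, c]" "\<And>c. b \<noteq> [p, c]" "a \<noteq> ''Gyy''" "b \<noteq> ''Gyy''"
    and glob: "''Gkap'' \<notin> wr hitc" "''Ggap'' \<notin> wr hitc" "''Grep'' \<notin> wr hitc" "''n'' \<notin> wr hitc" "b \<notin> wr hitc"
    and s0: "good s0" "scalar s0 [p, CHR ''v''] = v" "scalar s0 [p, CHR ''d''] = d v" "v \<in> V"
      "scalar s0 ''Gkap'' = \<kappa>" "scalar s0 ''Ggap'' = g" "scalar s0 ''Grep'' = R" "0 < \<kappa>" "0 < g"
      "scalar s0 a \<le> scalar s0 b"
    and hit: "\<And>s sa k u w. adv sa s k \<Longrightarrow> (k + tb \<beta> hitc) * bb M \<le> WW \<Longrightarrow>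
      (\<And>x. x \<notin> wr (explorec p hitc) \<Longrightarrow> scalar s x = scalar s0 x) \<Longrightarrow>
      scalar s [p, CHR ''u''] = u \<Longrightarrow> scalar s [p, CHR ''e''] = d u \<Longrightarrow>
      scalar s [p, CHR ''w''] = w \<Longrightarrow> scalar s [p, CHR ''k''] = d w \<Longrightarrow>
      u \<in> N v \<Longrightarrow> w \<in> W v u \<Longrightarrow> scalar s a \<le> scalar s b \<Longrightarrow> ref sa (accr a b s) hitc s (tick (D v u w))"
begin

lemma oks: "okc \<beta> (edgec p hitc)" "okc \<beta> (wedgec p hitc)" "okc \<beta> (forc [p, CHR ''r''] (wedgec p hitc))"
  using ok by (auto simp: explorec_def edgec_def forc_def)

lemma tbs: "tb \<beta> (edgec p hitc) \<le> tb \<beta> (explorec p hitc)" "tb \<beta> (wedgec p hitc) \<le> tb \<beta> (edgec p hitc)"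
  by (simp_all add: explorec_def edgec_def forc_def)

text \<open>The checks of a draw and the first stretch of the hit code share one abstract step. This
  is why the assumption \<open>hit\<close> measures cost from an earlier state and grants the hit
  code the rest of \<open>WW\<close>.\<close>

lemma ref_wedge:
  assumes s: "good s" "\<And>x. x \<notin> wr (explorec p hitc) \<Longrightarrow> scalar s x = scalar s0 x"
    "scalar s [p, CHR ''u''] = u" "scalar s [p, CHR ''e''] = d u" "u \<in> N v"
    "scalar s [p, CHR ''x''] = lowend v u" "scalar s [p, CHR ''f''] = d (lowend v u)"
    "scalar s [p, CHR ''y''] = highend v u" "scalar s [p, CHR ''h''] = d (highend v u)"
    "scalar s a \<le> scalar s b"
  shows "ref s (accr a b s) (wedgec p hitc) s (wedge \<kappa> v u D)"
proof -
  let ?e = "emul (slotE p) (Var ''Gkap'')"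
  let ?T = "tb \<beta> (wedgec p hitc)"
  have okw: "okc \<beta> (Rand [p, CHR ''j''] ?e)" "okc \<beta> (nbrc [p, CHR ''w''] [p, CHR ''x''] [p, CHR ''f''] [p, CHR ''j''])"
    "okc \<beta> (pairc [p, CHR ''b''] [p, CHR ''y''] [p, CHR ''h''] [p, CHR ''w''])" "okc \<beta> (degc [p, CHR ''k''] [p, CHR ''w''])"
    using oks(2) by (auto simp: wedgec_def)
  have TW: "?T * bb M \<le> WW" using le_WW[OF order_trans[OF tbs(2,1)] tbW] .
  have T: "?T = tb \<beta> (Rand [p, CHR ''j''] ?e) + (1 + tX \<beta> (eless (Var [p, CHR ''j'']) (Var [p, CHR ''f'']))
     + (tb \<beta> (nbrc [p, CHR ''w''] [p, CHR ''x''] [p, CHR ''f''] [p, CHR ''j''])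
     + (tb \<beta> (pairc [p, CHR ''b''] [p, CHR ''y''] [p, CHR ''h''] [p, CHR ''w'']) + (1 + tX \<beta> (Var [p, CHR ''b''])
     + (tb \<beta> (degc [p, CHR ''k''] [p, CHR ''w'']) + (1 + tX \<beta> (precE p) + tb \<beta> hitc + 1)) + 1))) + 1)"
    by (simp only: wedgec_def tb.simps)
  have kap: "scalar s ''Gkap'' = \<kappa>" using s(2)[of "''Gkap''"] s0 glob
    by (simp add: explorec_def edgec_def wedgec_def forc_def swapc_def)
  have ve: "val s ?e = slots \<kappa> (d (lowend v u)) * \<kappa>" using s kap by (simp add: slotE_def slots_def)
  have uV: "u \<in> V" using s(5) N_V by blast
  have lhV: "lowend v u \<in> V" "highend v u \<in> V" using uV s0(4) by (auto simp: lowend_def highend_def)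
  have pos: "0 < slots \<kappa> (d (lowend v u)) * \<kappa>" using s0(8) by (simp add: slots_def)
  show ?thesis unfolding wedgec_def wedge_def ve[symmetric]
  proof (rule ref_rand)
    show "0 < val s ?e" using pos unfolding ve .
    fix i assume i: "i < val s ?e"
    let ?s1 = "assign [p, CHR ''j''] i (charge (expr_time s ?e) s)"
    have a1: "adv s ?s1 (tb \<beta> (Rand [p, CHR ''j''] ?e))" by (rule rand_adv[OF s(1) okw(1) _ i]) simp
    let ?c = "eless (Var [p, CHR ''j'']) (Var [p, CHR ''f''])"
    let ?s2 = "charge (1 + expr_time ?s1 ?c) ?s1"
    note a2 = adv_cond[OF a1, of ?c]
    let ?ok = "i < d (lowend v u) \<and> nbr (lowend v u) (i + 1) \<in> N (highend v u) \<and> prec u (nbr (lowend v u) (i + 1))"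
    let ?fail = "return_pmf (0, 1, 0) :: outcome pmf"
    show "ref s (accr a b s) (Cond ?c (Seq (nbrc [p, CHR ''w''] [p, CHR ''x''] [p, CHR ''f''] [p, CHR ''j''])
       (Seq (pairc [p, CHR ''b''] [p, CHR ''y''] [p, CHR ''h''] [p, CHR ''w''])
         (Cond (Var [p, CHR ''b''])
           (Seq (degc [p, CHR ''k''] [p, CHR ''w'']) (Cond (precE p) hitc Skip)) Skip))) Skip) ?s1
       (let w = nbr (lowend v u) (i + 1) in if i < d (lowend v u) \<and> w \<in> N (highend v u) \<and> prec u w
         then tick (D v u w) else return_pmf (0, 1, 0))"
    proof (rule ref_cond)
      assume "val ?s1 ?c = 0"
      then have ni: "\<not> i < d (lowend v u)" using s by (simp split: if_splits)
      show "ref s (accr a b s) Skip ?s2 (let w = nbr (lowend v u) (i + 1) in if i < d (lowend v u) \<and> w \<in> N (highend v u) \<and> prec u w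
         then tick (D v u w) else return_pmf (0, 1, 0))"
        proof -
          have nok: "\<not> ?ok" using ni by blast
          show ?thesis unfolding Let_def if_not_P[OF nok]
            by (intro ref_skip[OF a2] le_WW[OF _ TW]) (use loc s(10) in \<open>auto simp: T accr_def\<close>)
        qed
    next
      assume "val ?s1 ?c \<noteq> 0"
      then have ni: "i < d (lowend v u)" using s by (simp split: if_splits)
      let ?w = "nbr (lowend v u) (i + 1)"
      obtain s3 where s3: "exc (nbrc [p, CHR ''w''] [p, CHR ''x''] [p, CHR ''f''] [p, CHR ''j'']) ?s2 = return_spmf s3"
        "adv ?s2 s3 (tb \<beta> (nbrc [p, CHR ''w''] [p, CHR ''x''] [p, CHR ''f''] [p, CHR ''j'']))"
        "scalar s3 [p, CHR ''w''] = ?w" "\<And>y. y \<noteq> [p, CHR ''w''] \<Longrightarrow> y \<noteq> ''Gyy'' \<Longrightarrow> scalar s3 y = scalar ?s2 y"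
        by (rule nbrc_adv[OF adv_good[OF a2] okw(2)]) (use ni s lhV in simp_all)
      note a3 = adv_trans[OF a2 s3(2)]
      have wl: "?w \<in> N (lowend v u)" using nbr_N[OF lhV(1), of "i + 1"] ni by simp
      then have wV: "?w \<in> V" using N_V by blast
      obtain s4 where s4: "exc (pairc [p, CHR ''b''] [p, CHR ''y''] [p, CHR ''h''] [p, CHR ''w'']) s3 = return_spmf s4"
        "adv s3 s4 (tb \<beta> (pairc [p, CHR ''b''] [p, CHR ''y''] [p, CHR ''h''] [p, CHR ''w'']))"
        "scalar s4 [p, CHR ''b''] \<noteq> 0 \<longleftrightarrow> scalar s3 [p, CHR ''w''] \<in> N (scalar s3 [p, CHR ''y''])"
        "\<And>y. y \<noteq> [p, CHR ''b''] \<Longrightarrow> y \<noteq> ''Gyy'' \<Longrightarrow> scalar s4 y = scalar s3 y"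
        by (rule pairc_adv[OF adv_good[OF a3] okw(3)]) (use s3 s lhV wV in simp_all)
      note a4 = adv_trans[OF a3 s4(2)]
      let ?s5 = "charge (1 + expr_time s4 (Var [p, CHR ''b''])) s4"
      note a5 = adv_cond[OF a4, of "Var [p, CHR ''b'']"]
      have b4: "scalar s4 [p, CHR ''b''] \<noteq> 0 \<longleftrightarrow> ?w \<in> N (highend v u)" using s4(3) s3 s by simp
      have ab4: "scalar s4 a = scalar s a" "scalar s4 b = scalar s b" using loc s3(4) s4(4) by simp_all
      show "ref s (accr a b s) (Seq (nbrc [p, CHR ''w''] [p, CHR ''x''] [p, CHR ''f''] [p, CHR ''j''])
       (Seq (pairc [p, CHR ''b''] [p, CHR ''y''] [p, CHR ''h''] [p, CHR ''w''])
         (Cond (Var [p, CHR ''b''])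
           (Seq (degc [p, CHR ''k''] [p, CHR ''w'']) (Cond (precE p) hitc Skip)) Skip))) ?s2
       (let w = nbr (lowend v u) (i + 1) in if i < d (lowend v u) \<and> w \<in> N (highend v u) \<and> prec u w
         then tick (D v u w) else return_pmf (0, 1, 0))"
      proof (rule ref_seq[OF s3(1)], rule ref_seq[OF s4(1)], rule ref_cond)
        assume "val s4 (Var [p, CHR ''b'']) = 0"
        then have nw: "?w \<notin> N (highend v u)" using b4 by simp
        show "ref s (accr a b s) Skip ?s5 (let w = nbr (lowend v u) (i + 1) in if i < d (lowend v u) \<and> w \<in> N (highend v u) \<and> prec u w
         then tick (D v u w) else return_pmf (0, 1, 0))"
          proof -
          have nok: "\<not> ?ok" using nw by blast
          show ?thesis unfolding Let_def if_not_P[OF nok]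
            by (intro ref_skip[OF a5] le_WW[OF _ TW]) (use ab4 s(10) in \<open>auto simp: T accr_def\<close>)
        qed
      next
        assume "val s4 (Var [p, CHR ''b'']) \<noteq> 0"
        then have nw: "?w \<in> N (highend v u)" using b4 by simp
        \<comment> \<open>Being adjacent to an endpoint, w has positive degree, so the cached degree
          lookup is valid.\<close>
        have w0: "0 < d ?w" using nw N_sym degree_pos_iff by (metis N_empty empty_iff not_gr_zero)
        obtain s6 where s6: "exc (degc [p, CHR ''k''] [p, CHR ''w'']) ?s5 = return_spmf s6"
          "adv ?s5 s6 (tb \<beta> (degc [p, CHR ''k''] [p, CHR ''w'']))"
          "scalar s6 [p, CHR ''k''] = d (scalar ?s5 [p, CHR ''w''])" "\<And>y. y \<noteq> [p, CHR ''k''] \<Longrightarrow> scalar s6 y = scalar ?s5 y"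
          by (rule degc_adv[OF adv_good[OF a5] okw(4)]) (use s3 s4 s wV w0 in simp_all)
        note a6 = adv_trans[OF a5 s6(2)]
        let ?s7 = "charge (1 + expr_time s6 (precE p)) s6"
        note a7 = adv_cond[OF a6, of "precE p"]
        have w6: "scalar s6 [p, CHR ''w''] = ?w" "scalar s6 [p, CHR ''k''] = d ?w" using s6 s4 s3 by simp_all
        have u6: "scalar s6 [p, CHR ''u''] = u" "scalar s6 [p, CHR ''e''] = d u" using s6 s4 s3 s by simp_all
        have pr: "val s6 (precE p) \<noteq> 0 \<longleftrightarrow> prec u ?w" using w6 u6 by (auto simp: precE_def prec_def)
        have ab6: "scalar s6 a = scalar s a" "scalar s6 b = scalar s b" using loc ab4 s6(4) by simp_all
        show "ref s (accr a b s) (Seq (degc [p, CHR ''k''] [p, CHR ''w'']) (Cond (precE p) hitc Skip)) ?s5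
          (let w = nbr (lowend v u) (i + 1) in if i < d (lowend v u) \<and> w \<in> N (highend v u) \<and> prec u w
         then tick (D v u w) else return_pmf (0, 1, 0))"
        proof (rule ref_seq[OF s6(1)], rule ref_cond)
          assume "val s6 (precE p) = 0"
          then have np: "\<not> prec u ?w" using pr by simp
          show "ref s (accr a b s) Skip ?s7 (let w = nbr (lowend v u) (i + 1) in if i < d (lowend v u) \<and> w \<in> N (highend v u) \<and> prec u w
           then tick (D v u w) else return_pmf (0, 1, 0))"
            proof -
          have nok: "\<not> ?ok" using np by blast
          show ?thesis unfolding Let_def if_not_P[OF nok]
            by (intro ref_skip[OF a7] le_WW[OF _ TW]) (use ab6 s(10) in \<open>auto simp: T accr_def\<close>)
        qed
        next
          assume "val s6 (precE p) \<noteq> 0"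
          then have np: "prec u ?w" using pr by simp
          have wW: "?w \<in> W v u" using wl nw np by (auto simp: W_def lowend_def highend_def split: if_splits)
          have "ref s (accr a b ?s7) hitc ?s7 (tick (D v u ?w))"
          proof (rule hit[OF a7])
            show "(tb \<beta> (Rand [p, CHR ''j''] ?e) + (1 + tX \<beta> ?c) + tb \<beta> (nbrc [p, CHR ''w''] [p, CHR ''x''] [p, CHR ''f''] [p, CHR ''j'']) +
              tb \<beta> (pairc [p, CHR ''b''] [p, CHR ''y''] [p, CHR ''h''] [p, CHR ''w'']) + (1 + tX \<beta> (Var [p, CHR ''b''])) +
              tb \<beta> (degc [p, CHR ''k''] [p, CHR ''w'']) + (1 + tX \<beta> (precE p)) + tb \<beta> hitc) * bb M \<le> WW"
              by (rule le_WW[OF _ TW]) (simp add: T)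
            show "scalar ?s7 x = scalar s0 x" if x: "x \<notin> wr (explorec p hitc)" for x
            proof -
              have "x \<notin> {[p, CHR ''k''], [p, CHR ''b''], [p, CHR ''w''], [p, CHR ''j''], ''Gyy''}"
                using x by (auto simp: explorec_def edgec_def wedgec_def forc_def)
              then show ?thesis using s(2)[OF x] s6(4)[of x] s4(4)[of x] s3(4)[of x] by simp
            qed
          qed (use w6 u6 s(5,10) wW ab6 in simp_all)
          moreover have "accr a b ?s7 = accr a b s" using ab6 by (simp add: accr_def fun_eq_iff)
          ultimately show "ref s (accr a b s) hitc ?s7 (let w = nbr (lowend v u) (i + 1) in if i < d (lowend v u) \<and> w \<in> N (highend v u) \<and> prec u w
           then tick (D v u w) else return_pmf (0, 1, 0))"
            unfolding Let_def using np nw ni by simp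
        qed
      qed
    qed
  qed
qed


lemma swap_adv:
  assumes "good s" "scalar s [p, CHR ''v''] = v" "scalar s [p, CHR ''d''] = d v"
    "scalar s [p, CHR ''u''] = u" "scalar s [p, CHR ''e''] = d u"
  obtains s' where "exc (swapc p) s = return_spmf s'" "adv s s' (tb \<beta> (swapc p))"
    "scalar s' [p, CHR ''x''] = lowend v u" "scalar s' [p, CHR ''f''] = d (lowend v u)"
    "scalar s' [p, CHR ''y''] = highend v u" "scalar s' [p, CHR ''h''] = d (highend v u)"
    "\<And>y. y \<notin> {[p, CHR ''x''], [p, CHR ''f''], [p, CHR ''y''], [p, CHR ''h'']} \<Longrightarrow> scalar s' y = scalar s y"
proof -
  have "\<exists>s'. exc (swapc p) s = return_spmf s' \<and> arr s' = arr s \<and> queries s' = queries s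
    \<and> scalar s' [p, CHR ''x''] = lowend v u \<and> scalar s' [p, CHR ''f''] = d (lowend v u)
    \<and> scalar s' [p, CHR ''y''] = highend v u \<and> scalar s' [p, CHR ''h''] = d (highend v u)"
    using assms(2-5) by (auto simp: swapc_def lowend_def highend_def)
  then obtain s' where s': "exc (swapc p) s = return_spmf s'" "arr s' = arr s" "queries s' = queries s"
    "scalar s' [p, CHR ''x''] = lowend v u" "scalar s' [p, CHR ''f''] = d (lowend v u)"
    "scalar s' [p, CHR ''y''] = highend v u" "scalar s' [p, CHR ''h''] = d (highend v u)" by blast
  have sw: "straight (swapc p)" "wr (swapc p) = {[p, CHR ''x''], [p, CHR ''f''], [p, CHR ''y''], [p, CHR ''h'']}"
    by (auto simp: swapc_def)
  have "okc \<beta> (swapc p)" using oks(1) by (simp add: edgec_def)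
  then show thesis
    using that[OF s'(1)] adv_det[OF assms(1) s'(1) sw(1)] assms(1) s' sw(2) by (auto simp: good_def)
qed

lemma ref_edge:
  assumes s: "good s" "\<And>x. x \<notin> wr (explorec p hitc) \<Longrightarrow> scalar s x = scalar s0 x"
    "scalar s a \<le> scalar s b" and dv: "0 < d v"
  shows "ref s (accr a b s) (edgec p hitc) s (edge \<kappa> g v D)"
proof -
  let ?e = "emul (roundE p) (Var ''Ggap'')"
  let ?T = "tb \<beta> (edgec p hitc)"
  let ?wr = "{[p, CHR ''q''], [p, CHR ''i''], [p, CHR ''u''], [p, CHR ''e''], [p, CHR ''x''], [p, CHR ''f''], [p, CHR ''y''],
    [p, CHR ''h''], [p, CHR ''r''], [p, CHR ''j''], [p, CHR ''w''], [p, CHR ''k''], [p, CHR ''b''], ''Gyy''} \<union> wr hitc"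
  have wrE: "wr (explorec p hitc) = ?wr"
    by (auto simp: explorec_def edgec_def wedgec_def forc_def swapc_def)
  have okw: "okc \<beta> (Rand [p, CHR ''i''] ?e)" "okc \<beta> (nbrc [p, CHR ''u''] [p, CHR ''v''] [p, CHR ''d''] [p, CHR ''i''])"
    "okc \<beta> (degc [p, CHR ''e''] [p, CHR ''u''])" "okc \<beta> (swapc p)" "okc \<beta> (Assign [p, CHR ''r''] (slotE p))"
    using oks(1) by (auto simp: edgec_def)
  have TW: "?T * bb M \<le> WW" using le_WW[OF tbs(1) tbW] .
  let ?c = "eless (Var [p, CHR ''i'']) (Var [p, CHR ''d''])"
  have T: "?T = tb \<beta> (Rand [p, CHR ''i''] ?e) + (1 + tX \<beta> ?c
     + (tb \<beta> (nbrc [p, CHR ''u''] [p, CHR ''v''] [p, CHR ''d''] [p, CHR ''i''])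
     + (tb \<beta> (degc [p, CHR ''e''] [p, CHR ''u'']) + (tb \<beta> (swapc p) + (tb \<beta> (Assign [p, CHR ''r''] (slotE p))
       + tb \<beta> (forc [p, CHR ''r''] (wedgec p hitc))))) + 1))"
    by (simp only: edgec_def tb.simps)
  have st: "scalar s [p, CHR ''v''] = v" "scalar s [p, CHR ''d''] = d v" "scalar s ''Gkap'' = \<kappa>" "scalar s ''Ggap'' = g"
    using s(2) s0 glob loc(1) by (auto simp: wrE)
  have ve: "val s ?e = rounds g (d v) * g" using st by (simp add: roundE_def rounds_def)
  show ?thesis unfolding edgec_def
  proof -
    have pos: "0 < val s ?e" unfolding ve using dv s0(9) rounds_ge[of g "d v"] by (metis gr_zeroI le_zero_eq)
    show "ref s (accr a b s) (Seq (Rand [p, CHR ''i''] ?e)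
     (Cond ?c
       (Seq (nbrc [p, CHR ''u''] [p, CHR ''v''] [p, CHR ''d''] [p, CHR ''i''])
       (Seq (degc [p, CHR ''e''] [p, CHR ''u''])
       (Seq (swapc p)
       (Seq (Assign [p, CHR ''r''] (slotE p)) (forc [p, CHR ''r''] (wedgec p hitc)))))) Skip)) s (edge \<kappa> g v D)"
      unfolding edge_def ve[symmetric]
    proof (rule ref_rand[OF pos])
      fix i assume i: "i < val s ?e"
      let ?s1 = "assign [p, CHR ''i''] i (charge (expr_time s ?e) s)"
      have a1: "adv s ?s1 (tb \<beta> (Rand [p, CHR ''i''] ?e))" by (rule rand_adv[OF s(1) okw(1) _ i]) simp
      let ?s2 = "charge (1 + expr_time ?s1 ?c) ?s1"
      note a2 = adv_cond[OF a1, of ?c]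
      show "ref s (accr a b s) (Cond ?c
       (Seq (nbrc [p, CHR ''u''] [p, CHR ''v''] [p, CHR ''d''] [p, CHR ''i''])
       (Seq (degc [p, CHR ''e''] [p, CHR ''u''])
       (Seq (swapc p)
       (Seq (Assign [p, CHR ''r''] (slotE p)) (forc [p, CHR ''r''] (wedgec p hitc)))))) Skip) ?s1
       (let u = nbr v (i + 1) in if i < d v then tick (forp (slots \<kappa> (d (lowend v u))) (wedge \<kappa> v u D)) else return_pmf (0, 1, 0))"
      proof (rule ref_cond)
        assume "val ?s1 ?c = 0"
        then have ni: "\<not> i < d v" using st by (simp split: if_splits)
        show "ref s (accr a b s) Skip ?s2 (let u = nbr v (i + 1) in if i < d v then tick (forp (slots \<kappa> (d (lowend v u))) (wedge \<kappa> v u D)) else return_pmf (0, 1, 0))"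
          unfolding Let_def if_not_P[OF ni]
          by (intro ref_skip[OF a2] le_WW[OF _ TW]) (use loc s(3) in \<open>auto simp: T accr_def\<close>)
      next
        assume "val ?s1 ?c \<noteq> 0"
        then have ni: "i < d v" using st by (simp split: if_splits)
        let ?u = "nbr v (i + 1)"
        have uN: "?u \<in> N v" using nbr_N[OF s0(4), of "i + 1"] ni by simp
        then have uV: "?u \<in> V" using N_V by blast
        have u0: "0 < d ?u" using uN N_sym by (metis N_empty empty_iff not_gr_zero)
        obtain s3 where s3: "exc (nbrc [p, CHR ''u''] [p, CHR ''v''] [p, CHR ''d''] [p, CHR ''i'']) ?s2 = return_spmf s3"
          "adv ?s2 s3 (tb \<beta> (nbrc [p, CHR ''u''] [p, CHR ''v''] [p, CHR ''d''] [p, CHR ''i'']))"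
          "scalar s3 [p, CHR ''u''] = ?u" "\<And>y. y \<noteq> [p, CHR ''u''] \<Longrightarrow> y \<noteq> ''Gyy'' \<Longrightarrow> scalar s3 y = scalar ?s2 y"
          by (rule nbrc_adv[OF adv_good[OF a2] okw(2)]) (use ni st s0 in simp_all)
        note a3 = adv_trans[OF a2 s3(2)]
        obtain s4 where s4: "exc (degc [p, CHR ''e''] [p, CHR ''u'']) s3 = return_spmf s4"
          "adv s3 s4 (tb \<beta> (degc [p, CHR ''e''] [p, CHR ''u'']))"
          "scalar s4 [p, CHR ''e''] = d (scalar s3 [p, CHR ''u''])" "\<And>y. y \<noteq> [p, CHR ''e''] \<Longrightarrow> scalar s4 y = scalar s3 y"
          by (rule degc_adv[OF adv_good[OF a3] okw(3)]) (use s3 uV u0 in simp_all)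
        note a4 = adv_trans[OF a3 s4(2)]
        obtain s5 where s5: "exc (swapc p) s4 = return_spmf s5" "adv s4 s5 (tb \<beta> (swapc p))"
          "scalar s5 [p, CHR ''x''] = lowend v ?u" "scalar s5 [p, CHR ''f''] = d (lowend v ?u)"
          "scalar s5 [p, CHR ''y''] = highend v ?u" "scalar s5 [p, CHR ''h''] = d (highend v ?u)"
          "\<And>y. y \<notin> {[p, CHR ''x''], [p, CHR ''f''], [p, CHR ''y''], [p, CHR ''h'']} \<Longrightarrow> scalar s5 y = scalar s4 y"
          by (rule swap_adv[of s4 ?u]) (use adv_good[OF a4] s4 s3 st in simp_all)
        note a5 = adv_trans[OF a4 s5(2)]
        let ?s6 = "assign [p, CHR ''r''] (val s5 (slotE p)) (charge (expr_time s5 (slotE p)) s5)"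
        have a6: "adv s ?s6 (tb \<beta> (Rand [p, CHR ''i''] ?e) + (1 + tX \<beta> ?c) + tb \<beta> (nbrc [p, CHR ''u''] [p, CHR ''v''] [p, CHR ''d''] [p, CHR ''i'']) +
           tb \<beta> (degc [p, CHR ''e''] [p, CHR ''u'']) + tb \<beta> (swapc p) + tb \<beta> (Assign [p, CHR ''r''] (slotE p)))"
          by (rule adv_seq_assign[OF a5 okw(5)]) simp
        have kap5: "scalar s5 ''Gkap'' = \<kappa>" using s5 s4 s3 st by simp
        have r: "scalar ?s6 [p, CHR ''r''] = slots \<kappa> (d (lowend v ?u))"
          using s5(4) kap5 by (simp add: slotE_def slots_def)
        have ab6: "scalar ?s6 a = scalar s a" "scalar ?s6 b = scalar s b" using loc s5(7) s4(4) s3(4) by simp_all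
        have sc6: "scalar ?s6 x = scalar s x" if "x \<notin> {[p, CHR ''i''], [p, CHR ''u''], [p, CHR ''e''], [p, CHR ''x''], [p, CHR ''f''],
          [p, CHR ''y''], [p, CHR ''h''], [p, CHR ''r''], ''Gyy''}" for x using that s5(7) s4(4) s3(4) by simp
        have "ref ?s6 (accr a b ?s6) (forc [p, CHR ''r''] (wedgec p hitc)) ?s6
          (forp (scalar ?s6 [p, CHR ''r'']) (wedge \<kappa> v ?u D))"
        proof (rule ref_for)
          show "okc \<beta> (forc [p, CHR ''r''] (wedgec p hitc))" by (rule oks)
          show "tb \<beta> (forc [p, CHR ''r''] (wedgec p hitc)) * bb M \<le> WW" by (rule le_WW[OF _ TW]) (simp add: T)
          show "[p, CHR ''r''] \<notin> wr (wedgec p hitc)" "b \<notin> wr (wedgec p hitc)" "''n'' \<notin> wr (wedgec p hitc)"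
            using loc glob by (auto simp: wedgec_def)
          show "good ?s6" by (rule adv_good[OF a6])
          fix s' assume s': "good s'" "\<And>x. x \<noteq> [p, CHR ''r''] \<Longrightarrow> x \<notin> wr (wedgec p hitc) \<Longrightarrow> scalar s' x = scalar ?s6 x"
            "scalar s' a \<le> scalar s' b"
          have s'6: "scalar s' [p, c] = scalar ?s6 [p, c]" if "c \<notin> {CHR ''r'', CHR ''j'', CHR ''w'', CHR ''b'', CHR ''k''}" for c
            using s'(2)[of "[p, c]"] that loc(1) by (simp add: wedgec_def)
          show "ref s' (accr a b s') (wedgec p hitc) s' (wedge \<kappa> v ?u D)"
          proof (rule ref_wedge[OF s'(1)])
            fix x assume x: "x \<notin> wr (explorec p hitc)"
            then have "x \<notin> wr (wedgec p hitc)" "x \<noteq> [p, CHR ''r'']" by (auto simp: explorec_def edgec_def forc_def)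
            then have "scalar s' x = scalar ?s6 x" using s'(2) by blast
            also have "\<dots> = scalar s x" by (rule sc6) (use x in \<open>auto simp: wrE\<close>)
            finally show "scalar s' x = scalar s0 x" using s(2)[OF x] by simp
          next
            show "scalar s' [p, CHR ''u''] = ?u" "scalar s' [p, CHR ''e''] = d ?u" using s'6 s5(7) s4 s3 by simp_all
            show "scalar s' [p, CHR ''x''] = lowend v ?u" "scalar s' [p, CHR ''f''] = d (lowend v ?u)"
              "scalar s' [p, CHR ''y''] = highend v ?u" "scalar s' [p, CHR ''h''] = d (highend v ?u)"
              using s'6 s5(3-6) by simp_all
          qed (use uN s'(3) in simp_all)
        qed (use loc ab6 s(3) in simp_all)
        then have "ref s (accr a b ?s6) (forc [p, CHR ''r''] (wedgec p hitc)) ?s6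
          (tick (forp (slots \<kappa> (d (lowend v ?u))) (wedge \<kappa> v ?u D)))"
          unfolding r by (rule ref_tick[OF _ a6]) (rule le_WW[OF _ TW], simp add: T)
        moreover have "accr a b ?s6 = accr a b s" unfolding accr_def ab6 ..
        ultimately show "ref s (accr a b s) (Seq (nbrc [p, CHR ''u''] [p, CHR ''v''] [p, CHR ''d''] [p, CHR ''i''])
         (Seq (degc [p, CHR ''e''] [p, CHR ''u''])
         (Seq (swapc p)
         (Seq (Assign [p, CHR ''r''] (slotE p)) (forc [p, CHR ''r''] (wedgec p hitc)))))) ?s2
         (let u = nbr v (i + 1) in if i < d v then tick (forp (slots \<kappa> (d (lowend v u))) (wedge \<kappa> v u D)) else return_pmf (0, 1, 0))"
          unfolding Let_def using ni
          by (intro ref_seq[OF s3(1)] ref_seq[OF s4(1)] ref_seq[OF s5(1)] ref_seq[OF exec.simps(2)]) simp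
      qed
    qed
  qed
qed

lemma ref_explore: "ref s0 (accr a b s0) (explorec p hitc) s0 (expl \<kappa> g R v D)"
proof -
  let ?e = "emul (Var ''Grep'') (roundE p)"
  let ?q = "[p, CHR ''q'']"
  let ?s1 = "assign ?q (val s0 ?e) (charge (expr_time s0 ?e) s0)"
  have a1: "adv s0 ?s1 (tb \<beta> (Assign ?q ?e))"
    by (rule assign_adv(2)[OF s0(1)]) (use ok in \<open>auto simp: explorec_def\<close>)
  have T: "tb \<beta> (explorec p hitc) = tb \<beta> (Assign ?q ?e) + tb \<beta> (forc ?q (edgec p hitc))"
    by (simp only: explorec_def tb.simps)
  have q: "scalar ?s1 ?q = R * rounds g (d v)" using s0 by (simp add: roundE_def rounds_def)
  have "ref ?s1 (accr a b ?s1) (forc ?q (edgec p hitc)) ?s1 (forp (scalar ?s1 ?q) (edge \<kappa> g v D))"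
  proof (rule ref_for)
    show "okc \<beta> (forc ?q (edgec p hitc))" using ok by (simp add: explorec_def)
    show "tb \<beta> (forc ?q (edgec p hitc)) * bb M \<le> WW" by (rule le_WW[OF _ tbW]) (simp add: T)
    show "?q \<notin> wr (edgec p hitc)" "b \<notin> wr (edgec p hitc)" "''n'' \<notin> wr (edgec p hitc)"
      using loc glob by (auto simp: edgec_def wedgec_def forc_def swapc_def)
    show "good ?s1" by (rule adv_good[OF a1])
    fix s assume s: "0 < scalar ?s1 ?q" "good s" "\<And>x. x \<noteq> ?q \<Longrightarrow> x \<notin> wr (edgec p hitc) \<Longrightarrow> scalar s x = scalar ?s1 x"
      "scalar s a \<le> scalar s b"
    \<comment> \<open>A pass requires at least one round, hence positive degree; at an isolated
      vertex \<open>edge\<close> would draw from an empty range.\<close>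
    have "0 < d v" using s(1) s0(9) unfolding q by (cases "d v = 0") (auto simp: rounds_def)
    then show "ref s (accr a b s) (edgec p hitc) s (edge \<kappa> g v D)"
      by (intro ref_edge s) (use s(3) in \<open>auto simp: explorec_def forc_def\<close>)
  qed (use loc s0(10) in simp_all)
  then have "ref s0 (accr a b ?s1) (forc ?q (edgec p hitc)) ?s1 (tick (forp (R * rounds g (d v)) (edge \<kappa> g v D)))"
    unfolding q by (rule ref_tick[OF _ a1]) (rule le_WW[OF _ tbW], simp add: T)
  moreover have "accr a b ?s1 = accr a b s0" using loc by (simp add: accr_def fun_eq_iff)
  ultimately show ?thesis unfolding explorec_def expl_def by (intro ref_seq[OF exec.simps(2)]) simp
qed

end
end

section \<open>Lightness test, hits and sampling loops\<close>

definition incc :: com where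
  "incc = Assign ''Ghc'' (clamp (eadd (Var ''Ghc'') (Const 1)) (Var ''Gthr''))"

definition lightc :: "vname \<Rightarrow> vname \<Rightarrow> vname \<Rightarrow> com" where
  "lightc z dz res = Cond (eless (Var ''Gdcap'') (Var dz)) (Assign res (Const 0))
     (Seq (Assign ''Hv'' (Var z)) (Seq (Assign ''Hd'' (Var dz)) (Seq (Assign ''Ghc'' (Const 0))
       (Seq (explorec (CHR ''H'') incc) (Assign res (eless (Var ''Ghc'') (Var ''Gthr'')))))))"

definition hitc :: com where
  "hitc = Seq (lightc ''Mv'' ''Md'' ''Gla'') (Seq (lightc ''Mu'' ''Me'' ''Glb'') (Seq (lightc ''Mw'' ''Mk'' ''Glc'')
     (Cond (Var ''Gla'')
       (Assign ''Gcnt'' (clamp (eadd (Var ''Gcnt'') (ediv (Const 6) (eadd (eadd (Var ''Gla'') (Var ''Glb'')) (Var ''Glc''))))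
         (Var ''Gcap''))) Skip)))"

text \<open>The degree is queried directly: a sampled vertex may be isolated, and the cache reads 0
  as unknown. These are the two queries charged to a sample.\<close>

definition samplec :: "com \<Rightarrow> com" where
  "samplec c = Seq (SampleVertex ''Mv'') (Seq (DegreeQuery ''Md'' (Var ''Mv'')) (Seq (Store ''Ad'' (Var ''Mv'') (Var ''Md'')) c))"

definition mainc :: com where "mainc = forc ''Gmq'' (samplec (explorec (CHR ''M'') hitc))"

definition sdegc :: com where
  "sdegc = forc ''Gmq'' (samplec (Assign ''Gsum'' (clamp (eadd (Var ''Gsum'') (Var ''Md'')) (Var ''Gsmx''))))"

lemma wr_explorec: "wr (explorec p c) = {[p, CHR ''q''], [p, CHR ''i''], [p, CHR ''u''], [p, CHR ''e''], [p, CHR ''x''],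
    [p, CHR ''f''], [p, CHR ''y''], [p, CHR ''h''], [p, CHR ''r''], [p, CHR ''j''], [p, CHR ''w''], [p, CHR ''k''],
    [p, CHR ''b''], ''Gyy''} \<union> wr c"
  by (auto simp: explorec_def edgec_def wedgec_def forc_def swapc_def nbrc_def pairc_def degc_def touchc_def)

lemma wr_incc [simp]: "wr incc = {''Ghc''}" by (simp add: incc_def)

lemma wr_lightc: "wr (lightc z dz res) = {res, ''Hv'', ''Hd'', ''Ghc''} \<union> wr (explorec (CHR ''H'') incc)"
  by (auto simp: lightc_def)

lemma wr_hitc: "wr hitc = {''Gla'', ''Glb'', ''Glc'', ''Gcnt'', ''Hv'', ''Hd'', ''Ghc''} \<union> wr (explorec (CHR ''H'') incc)"
  by (auto simp: hitc_def wr_lightc)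

context refinement begin

definition globs :: "nat \<Rightarrow> nat \<Rightarrow> nat \<Rightarrow> nat \<Rightarrow> nat \<Rightarrow> state \<Rightarrow> bool" where
  "globs \<kappa> g R dc th s \<longleftrightarrow> scalar s ''Gkap'' = \<kappa> \<and> scalar s ''Ggap'' = g \<and> scalar s ''Grep'' = R \<and>
     scalar s ''Gdcap'' = dc \<and> scalar s ''Gthr'' = th \<and> 0 < \<kappa> \<and> 0 < g"

text \<open>For a random part between two deterministic stretches, whose costs are merged into a
  single abstract step.\<close>

lemma ref_post:
  assumes "ref s1 \<Psi> c1 s1 D" "adv s0 s1 k1" "(k1 + k2) * bb M \<le> WW"
    "\<And>s2 x. s2 \<in> set_spmf (exc c1 s1) \<Longrightarrow> \<Psi> s2 x \<Longrightarrow> good s2 \<Longrightarrow>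
      \<exists>s3. exc c2 s2 = return_spmf s3 \<and> adv s2 s3 k2 \<and> \<Phi> s3 (h x)"
  shows "ref s0 \<Phi> (Seq c1 c2) s1 (map_pmf (\<lambda>x. (h (fst x), (1, 0) + snd x)) D)"
proof -
  have 1: "rel_spmf (\<lambda>s' x. s' \<in> set_spmf (exc c1 s1) \<and> \<Psi> s' (fst x) \<and> cst s1 s' (snd x)) (exc c1 s1) (spmf_of_pmf D)"
    by (rule rel_spmf_mono_strong[OF assms(1)[unfolded ref_def]]) auto
  have "rel_spmf (\<lambda>s' x. \<Phi> s' (fst x) \<and> cst s0 s' (snd x)) (exc c2 s2) (return_spmf (h (fst x), (1, 0) + snd x))"
    if s2: "s2 \<in> set_spmf (exc c1 s1) \<and> \<Psi> s2 (fst x) \<and> cst s1 s2 (snd x)" for s2 x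
  proof -
    obtain s3 where s3: "exc c2 s2 = return_spmf s3" "adv s2 s3 k2" "\<Phi> s3 (h (fst x))"
      using assms(4)[of s2 "fst x"] s2 by (auto simp: cst_def)
    have "time s3 \<le> time s2 + k2 * bb M" "time s2 \<le> time s1 + fst (snd x) * WW" "time s1 \<le> time s0 + k1 * bb M"
      using s3(2) s2 assms(2) by (auto simp: adv_def cst_def)
    then have "time s3 \<le> time s0 + (1 + fst (snd x)) * WW" using assms(3) by (simp add: algebra_simps)
    then have "cst s0 s3 ((1, 0) + snd x)"
      using s3(2) s2 assms(2) unfolding adv_def cst_def by simp
    then show ?thesis using s3 by simp
  qed
  then have "rel_spmf (\<lambda>s' x. \<Phi> s' (fst x) \<and> cst s0 s' (snd x)) (bind_spmf (exc c1 s1) (exc c2))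
      (bind_spmf (spmf_of_pmf D) (\<lambda>x. return_spmf (h (fst x), (1, 0) + snd x)))"
    by (rule rel_spmf_bindI[OF 1])
  moreover have "bind_spmf (spmf_of_pmf D) (\<lambda>x. return_spmf (h (fst x), (1, 0) + snd x))
      = spmf_of_pmf (map_pmf (\<lambda>x. (h (fst x), (1, 0) + snd x)) D)"
    by (simp add: map_spmf_of_pmf[symmetric] map_spmf_conv_bind_spmf o_def)
  ultimately show ?thesis unfolding ref_def exec.simps by simp
qed

lemma ref_bind2:
  assumes "ref s \<Psi> c1 s D"
    "\<And>s1 x. s1 \<in> set_spmf (exc c1 s) \<Longrightarrow> good s1 \<Longrightarrow> \<Psi> s1 x \<Longrightarrow> ref s1 \<Phi> c2 s1 (F x)"
  shows "ref s \<Phi> (Seq c1 c2) s (bind_pmf D (\<lambda>x. map_pmf (\<lambda>y. (fst y, snd x + snd y)) (F (fst x))))"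
proof (rule ref_bind[OF assms(1)])
  fix s1 x assume h: "s1 \<in> set_spmf (exc c1 s)" "\<Psi> s1 (fst x)" "cst s s1 (snd x)"
  have "ref s1 \<Phi> c2 s1 (F (fst x))" using assms(2)[OF h(1) _ h(2)] h(3) by (simp add: cst_def)
  from ref_map[OF this h(3), of \<Phi> id]
  show "ref s \<Phi> c2 s1 (map_pmf (\<lambda>y. (fst y, snd x + snd y)) (F (fst x)))" by simp
qed

lemma ref_inc:
  assumes "adv sa s k" "(k + tb \<beta> incc) * bb M \<le> WW" "okc \<beta> incc"
  shows "ref sa (accr ''Ghc'' ''Gthr'' s) incc s (tick (unit_hit v u w))"
proof -
  have a: "adv sa (assign ''Ghc'' (val s (clamp (eadd (Var ''Ghc'') (Const 1)) (Var ''Gthr''))) (charge (expr_time s (clamp (eadd (Var ''Ghc'') (Const 1)) (Var ''Gthr''))) s)) (k + tb \<beta> incc)"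
    unfolding incc_def by (rule adv_seq_assign[OF assms(1)]) (use assms(3) in \<open>simp_all add: incc_def\<close>)
  have "tick (unit_hit v u w) = return_pmf (1, 1, 0)" by (simp add: tick_def unit_hit_def)
  then show ?thesis using ref_return[OF _ a assms(2), of incc s "accr ''Ghc'' ''Gthr'' s" 1]
    by (simp add: accr_def incc_def)
qed

text \<open>Clamping the inner counter at the threshold preserves the comparison: min x th < th iff
  x < th.\<close>

lemma ref_light:
  assumes ok: "okc \<beta> (lightc z dz res)" and tbW: "tb \<beta> (lightc z dz res) * bb M \<le> WW"
    and names: "dz \<noteq> ''Hv''" "res \<noteq> ''n''"
    and s: "good s" "globs \<kappa> g R dc th s" "scalar s z = v" "v \<in> V" "scalar s dz = d v"
  shows "ref s (\<lambda>s' x. scalar s' res = x) (lightc z dz res) s (light \<kappa> g R dc th v)"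
proof -
  let ?x = "explorec (CHR ''H'') incc" and ?c = "eless (Var ''Gdcap'') (Var dz)"
  let ?e = "eless (Var ''Ghc'') (Var ''Gthr'')"
  have T: "tb \<beta> (lightc z dz res) = 1 + tX \<beta> ?c + tb \<beta> (Assign res (Const 0)) + (tb \<beta> (Assign ''Hv'' (Var z)) +
     (tb \<beta> (Assign ''Hd'' (Var dz)) + (tb \<beta> (Assign ''Ghc'' (Const 0)) + (tb \<beta> ?x + tb \<beta> (Assign res ?e)))))"
    by (simp only: lightc_def tb.simps)
  have oks: "okc \<beta> (Assign res (Const 0))" "okc \<beta> (Assign ''Hv'' (Var z))" "okc \<beta> (Assign ''Hd'' (Var dz))"
    "okc \<beta> (Assign ''Ghc'' (Const 0))" "okc \<beta> ?x" "okc \<beta> (Assign res ?e)"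
    using ok by (auto simp: lightc_def)
  have oki: "okc \<beta> incc" using oks(5) by (simp add: explorec_def edgec_def wedgec_def forc_def)
  let ?s1 = "charge (1 + expr_time s ?c) s"
  note a1 = adv_charge[OF s(1), of ?c]
  show ?thesis unfolding lightc_def
  proof (rule ref_cond)
    assume c: "val s ?c \<noteq> 0"
    let ?s2 = "assign res (val ?s1 (Const 0)) (charge (expr_time ?s1 (Const 0)) ?s1)"
    have a2: "adv s ?s2 (1 + tX \<beta> ?c + tb \<beta> (Assign res (Const 0)))"
      by (rule adv_seq_assign[OF a1 oks(1) names(2)])
    have "light \<kappa> g R dc th v = return_pmf (0, 1, 0)"
      using c s by (simp add: light_def globs_def split: if_splits)
    then show "ref s (\<lambda>s' x. scalar s' res = x) (Assign res (Const 0)) ?s1 (light \<kappa> g R dc th v)"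
      using ref_return[OF exec.simps(2) a2 le_WW[OF _ tbW], of "\<lambda>s' x. scalar s' res = x" 0] by (simp add: T)
  next
    assume c: "val s ?c = 0"
    let ?s2 = "assign ''Hv'' (val ?s1 (Var z)) (charge (expr_time ?s1 (Var z)) ?s1)"
    let ?s3 = "assign ''Hd'' (val ?s2 (Var dz)) (charge (expr_time ?s2 (Var dz)) ?s2)"
    let ?s4 = "assign ''Ghc'' (val ?s3 (Const 0)) (charge (expr_time ?s3 (Const 0)) ?s3)"
    have a4: "adv s ?s4 (1 + tX \<beta> ?c + tb \<beta> (Assign ''Hv'' (Var z)) + tb \<beta> (Assign ''Hd'' (Var dz)) + tb \<beta> (Assign ''Ghc'' (Const 0)))"
      by (intro adv_seq_assign a1 oks) simp_all
    have x: "ref ?s4 (accr ''Ghc'' ''Gthr'' ?s4) ?x ?s4 (expl \<kappa> g R v unit_hit)"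
    proof (rule ref_explore)
      show "tb \<beta> ?x * bb M \<le> WW" by (rule le_WW[OF _ tbW]) (simp add: T)
      show "good ?s4" by (rule adv_good[OF a4])
    next
      fix s sa k u w assume "adv sa s k" "(k + tb \<beta> incc) * bb M \<le> WW"
      then show "ref sa (accr ''Ghc'' ''Gthr'' s) incc s (tick (unit_hit v u w))" using oki by (rule ref_inc)
    qed (use oks(5) s names in \<open>simp_all add: globs_def\<close>)
    have "ref s (\<lambda>s' x. scalar s' res = x) (Seq ?x (Assign res ?e)) ?s4
       (map_pmf (\<lambda>x. (of_bool (fst x < th), (1, 0) + snd x)) (expl \<kappa> g R v unit_hit))"
    proof (rule ref_post[OF x a4])
      show "(1 + tX \<beta> ?c + tb \<beta> (Assign ''Hv'' (Var z)) + tb \<beta> (Assign ''Hd'' (Var dz)) + tb \<beta> (Assign ''Ghc'' (Const 0)) + tb \<beta> (Assign res ?e)) * bb M \<le> WW"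
        by (rule le_WW[OF _ tbW]) (simp add: T)
      fix s2 x assume s2: "s2 \<in> set_spmf (exc ?x ?s4)" "accr ''Ghc'' ''Gthr'' ?s4 s2 x" "good s2"
      have th: "scalar s2 ''Gthr'' = th" using exec_frame[OF s2(1)] s(2) by (simp add: wr_explorec globs_def)
      have "scalar s2 ''Ghc'' = min x th" using s2(2) s(2) by (simp add: accr_def globs_def)
      then have v: "val s2 ?e = of_bool (x < th)" using th by auto
      show "\<exists>s3. exc (Assign res ?e) s2 = return_spmf s3 \<and> adv s2 s3 (tb \<beta> (Assign res ?e)) \<and> scalar s3 res = of_bool (x < th)"
        using assign_adv[OF s2(3) oks(6) names(2)] v by auto
    qed
    moreover have "map_pmf (\<lambda>x. (of_bool (fst x < th), (1, 0) + snd x)) (expl \<kappa> g R v unit_hit) = light \<kappa> g R dc th v"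
      unfolding light_def using c s by (auto simp: globs_def intro!: map_pmf_cong split: if_splits)
    ultimately have "ref s (\<lambda>s' x. scalar s' res = x) (Seq ?x (Assign res ?e)) ?s4 (light \<kappa> g R dc th v)" by simp
    then show "ref s (\<lambda>s' x. scalar s' res = x) (Seq (Assign ''Hv'' (Var z)) (Seq (Assign ''Hd'' (Var dz)) (Seq (Assign ''Ghc'' (Const 0))
       (Seq ?x (Assign res ?e))))) ?s1 (light \<kappa> g R dc th v)"
      by (intro ref_seq[OF exec.simps(2)])
  qed
qed

lemma ref_hit:
  assumes ok: "okc \<beta> hitc" and tbW: "(k + tb \<beta> hitc) * bb M \<le> WW" and a: "adv sa s k"
    and s: "globs \<kappa> g R dc th s" "scalar s ''Mv'' = v" "scalar s ''Mu'' = u" "scalar s ''Mw'' = w"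
      "v \<in> V" "u \<in> V" "w \<in> V" "scalar s ''Md'' = d v" "scalar s ''Me'' = d u" "scalar s ''Mk'' = d w"
      "scalar s ''Gcnt'' \<le> scalar s ''Gcap''"
  shows "ref sa (accr ''Gcnt'' ''Gcap'' s) hitc s (tick (hit \<kappa> g R dc th v u w))"
proof -
  let ?A = "lightc ''Mv'' ''Md'' ''Gla''" and ?B = "lightc ''Mu'' ''Me'' ''Glb''" and ?C = "lightc ''Mw'' ''Mk'' ''Glc''"
  let ?e = "clamp (eadd (Var ''Gcnt'') (ediv (Const 6) (eadd (eadd (Var ''Gla'') (Var ''Glb'')) (Var ''Glc'')))) (Var ''Gcap'')"
  let ?I = "Assign ''Gcnt'' ?e"
  let ?F = "Cond (Var ''Gla'') ?I Skip"
  have T: "tb \<beta> hitc = tb \<beta> ?A + (tb \<beta> ?B + (tb \<beta> ?C + tb \<beta> ?F))" by (simp only: hitc_def tb.simps)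
  have TF: "tb \<beta> ?F = 1 + tX \<beta> (Var ''Gla'') + tb \<beta> ?I + 1" by (simp only: tb.simps)
  have oks: "okc \<beta> ?A" "okc \<beta> ?B" "okc \<beta> ?C" "okc \<beta> ?I" using ok by (auto simp: hitc_def)
  note fr = exec_frame
  note [simp] = wr_lightc wr_explorec
  have fin: "\<exists>s3. exc ?F s2 = return_spmf s3 \<and> adv s2 s3 (tb \<beta> ?F) \<and> accr ''Gcnt'' ''Gcap'' s s3 (share la lb lc)"
    if s2: "good s2" "scalar s2 ''Gla'' = la" "scalar s2 ''Glb'' = lb" "scalar s2 ''Glc'' = lc"
      "scalar s2 ''Gcnt'' = scalar s ''Gcnt''" "scalar s2 ''Gcap'' = scalar s ''Gcap''" for s2 la lb lc
  proof -
    let ?s3 = "charge (1 + expr_time s2 (Var ''Gla'')) s2"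
    note a3 = adv_charge[OF s2(1), of "Var ''Gla''"]
    show ?thesis
    proof (cases "la = 0")
      case True
      have "adv s2 (charge 1 ?s3) (tb \<beta> ?F)" by (rule adv_mono[OF skip_adv[OF a3]]) (simp add: TF)
      then show ?thesis using s2 s(11) True by (auto simp: accr_def share_def)
    next
      case False
      have "adv s2 (assign ''Gcnt'' (val ?s3 ?e) (charge (expr_time ?s3 ?e) ?s3)) (tb \<beta> ?F)"
        by (rule adv_mono[OF adv_seq_assign[OF a3 oks(4)]]) (simp_all only: TF, simp_all)
      then show ?thesis using s2 s(11) False
        by (intro exI[of _ "assign ''Gcnt'' (val ?s3 ?e) (charge (expr_time ?s3 ?e) ?s3)"]) (simp add: accr_def share_def)
    qed
  qed
  have g: "good s" using a by (simp add: adv_def)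
  have W: "tb \<beta> ?A * bb M \<le> WW" "tb \<beta> ?B * bb M \<le> WW" "tb \<beta> ?C * bb M \<le> WW" "(0 + tb \<beta> ?F) * bb M \<le> WW"
    by (rule le_WW[OF _ tbW], simp add: T)+
  let ?LA = "light \<kappa> g R dc th v" and ?LB = "light \<kappa> g R dc th u" and ?LC = "light \<kappa> g R dc th w"
  have "ref s (accr ''Gcnt'' ''Gcap'' s) hitc s (bind_pmf ?LA (\<lambda>x. map_pmf (\<lambda>y. (fst y, snd x + snd y))
      (bind_pmf ?LB (\<lambda>x'. map_pmf (\<lambda>y. (fst y, snd x' + snd y))
         (map_pmf (\<lambda>z. (share (fst x) (fst x') (fst z), (1, 0) + snd z)) ?LC)))))"
    unfolding hitc_def
  proof (rule ref_bind2)
    show "ref s (\<lambda>s' x. scalar s' ''Gla'' = x) ?A s ?LA"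
      by (rule ref_light[OF oks(1) W(1)]) (use g s in simp_all)
    fix s1 la assume s1: "s1 \<in> set_spmf (exc ?A s)" "good s1" "scalar s1 ''Gla'' = la"
    note f1 = conjunct1[OF fr[OF s1(1)], rule_format]
    have g1: "globs \<kappa> g R dc th s1" using s(1) f1 by (simp add: globs_def)
    show "ref s1 (accr ''Gcnt'' ''Gcap'' s) (Seq ?B (Seq ?C ?F)) s1 (bind_pmf ?LB (\<lambda>x'. map_pmf (\<lambda>y. (fst y, snd x' + snd y))
         (map_pmf (\<lambda>z. (share la (fst x') (fst z), (1, 0) + snd z)) ?LC)))"
    proof (rule ref_bind2)
      show "ref s1 (\<lambda>s' x. scalar s' ''Glb'' = x) ?B s1 ?LB"
        by (rule ref_light[OF oks(2) W(2) _ _ s1(2) g1]) (use s f1 in simp_all)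
      fix s2 lb assume s2: "s2 \<in> set_spmf (exc ?B s1)" "good s2" "scalar s2 ''Glb'' = lb"
      note f2 = conjunct1[OF fr[OF s2(1)], rule_format]
      have g2: "globs \<kappa> g R dc th s2" using g1 f2 by (simp add: globs_def)
      show "ref s2 (accr ''Gcnt'' ''Gcap'' s) (Seq ?C ?F) s2 (map_pmf (\<lambda>z. (share la lb (fst z), (1, 0) + snd z)) ?LC)"
      proof (rule ref_post[OF _ adv_refl[OF s2(2)] W(4)])
        show "ref s2 (\<lambda>s' x. scalar s' ''Glc'' = x) ?C s2 ?LC"
          by (rule ref_light[OF oks(3) W(3) _ _ s2(2) g2]) (use s f1 f2 in simp_all)
        fix s3 lc assume s3: "s3 \<in> set_spmf (exc ?C s2)" "scalar s3 ''Glc'' = lc" "good s3"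
        note f3 = conjunct1[OF fr[OF s3(1)], rule_format]
        show "\<exists>s'. exc ?F s3 = return_spmf s' \<and> adv s3 s' (tb \<beta> ?F) \<and> accr ''Gcnt'' ''Gcap'' s s' (share la lb lc)"
          by (rule fin) (use s3 s2(3) s1(3) f1 f2 f3 in simp_all)
      qed
    qed
  qed
  moreover have "bind_pmf ?LA (\<lambda>x. map_pmf (\<lambda>y. (fst y, snd x + snd y))
      (bind_pmf ?LB (\<lambda>x'. map_pmf (\<lambda>y. (fst y, snd x' + snd y))
         (map_pmf (\<lambda>z. (share (fst x) (fst x') (fst z), (1, 0) + snd z)) ?LC)))) = hit \<kappa> g R dc th v u w"
    unfolding hit_def vote_def
    by (auto simp: map_bind_pmf map_pmf_comp split_def add_ac intro!: bind_pmf_cong map_pmf_cong prod_eqI)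
  ultimately have "ref s (accr ''Gcnt'' ''Gcap'' s) hitc s (hit \<kappa> g R dc th v u w)" by simp
  then show ?thesis by (rule ref_tick[OF _ a]) (rule le_WW[OF _ tbW], simp)
qed


lemma ref_sample:
  assumes "\<And>v. v \<in> V \<Longrightarrow> ref s0 \<Phi> c (assign x v (count_query s)) (f v)"
  shows "ref s0 \<Phi> (Seq (SampleVertex x) c) s (bind_pmf (pmf_of_set V) f)"
proof -
  have A: "finite V" "V \<noteq> {}" using n0 by auto
  have "rel_spmf (\<lambda>i j. i = j \<and> i \<in> V) (spmf_of_set V) (spmf_of_pmf (pmf_of_set V))"
    unfolding spmf_of_pmf_pmf_of_set[OF A] by (rule rel_spmf_reflI) (use A in auto)
  then show ?thesis
    unfolding ref_def exec.simps spmf_of_pmf_bind_spmf uniform_def bind_map_spmf if_not_P[OF A(2)]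
    by (rule rel_spmf_bindI) (use assms[unfolded ref_def] in \<open>auto simp: o_def\<close>)
qed

lemma ref_samplec:
  assumes ok: "okc \<beta> (samplec c)" and tbW: "tb \<beta> (samplec c) * bb M \<le> WW" and s: "good s"
    and c: "\<And>s1 v. good s1 \<Longrightarrow> (\<And>x. x \<noteq> ''Mv'' \<Longrightarrow> x \<noteq> ''Md'' \<Longrightarrow> scalar s1 x = scalar s x) \<Longrightarrow>
      v \<in> V \<Longrightarrow> scalar s1 ''Mv'' = v \<Longrightarrow> scalar s1 ''Md'' = d v \<Longrightarrow> cst s s1 (1, 1) \<Longrightarrow>
      time s1 + tb \<beta> c * bb M \<le> time s + tb \<beta> (samplec c) * bb M \<Longrightarrow> ref s \<Phi> c s1 (f v)"
  shows "ref s \<Phi> (samplec c) s (bind_pmf (pmf_of_set V) f)"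
  unfolding samplec_def
proof (rule ref_sample)
  fix v assume v: "v \<in> V"
  let ?pre = "Seq (SampleVertex ''Mv'') (Seq (DegreeQuery ''Md'' (Var ''Mv'')) (Store ''Ad'' (Var ''Mv'') (Var ''Md'')))"
  let ?s1 = "assign ''Mv'' v (count_query s)"
  let ?s2 = "assign ''Md'' (d v) (charge (expr_time ?s1 (Var ''Mv'')) (count_query ?s1))"
  let ?s3 = "charge (expr_time ?s2 (Var ''Mv'') + expr_time ?s2 (Var ''Md'') + 1)
     (?s2\<lparr>arr := (arr ?s2)(''Ad'' := (arr ?s2 ''Ad'')(v := d v))\<rparr>)"
  have e2: "exc (DegreeQuery ''Md'' (Var ''Mv'')) ?s1 = return_spmf ?s2" by simp
  have e3: "exc (Store ''Ad'' (Var ''Mv'') (Var ''Md'')) ?s2 = return_spmf ?s3" by simp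
  have m: "?s3 \<in> set_spmf (exc ?pre s)"
    using v n0 by (auto simp: uniform_def set_bind_spmf bind_UNION intro!: image_eqI[where x = v] bexI[where x = v])
  have okp: "okc \<beta> ?pre" using ok by (simp add: samplec_def)
  have b: "bnd \<beta> M ?s3" by (rule bnd_set[OF m okp]) (use s in \<open>simp add: good_def\<close>)
  have t: "time ?s3 \<le> time s + tb \<beta> ?pre * bb M"
    by (rule time_set[OF m _ okp]) (use s in \<open>simp_all add: good_def\<close>)
  have t': "time ?s3 + tb \<beta> c * bb M \<le> time s + tb \<beta> (samplec c) * bb M"
    using t by (simp add: samplec_def algebra_simps)
  have "tb \<beta> ?pre * bb M \<le> WW" by (rule le_WW[OF _ tbW]) (simp add: samplec_def)
  then have "cst s ?s3 (1, 1)"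
    using b t s CI_set_degree[of "arr s" v] v by (simp add: cst_def good_def del: tb.simps)
  then have "ref s \<Phi> c ?s3 (f v)"
    using t' by (intro c) (use v in \<open>auto simp: cst_def\<close>)
  then show "ref s \<Phi> (Seq (DegreeQuery ''Md'' (Var ''Mv'')) (Seq (Store ''Ad'' (Var ''Mv'') (Var ''Md'')) c)) ?s1 (f v)"
    by (intro ref_seq[OF e2] ref_seq[OF e3])
qed

lemma ref_mainc:
  assumes ok: "okc \<beta> mainc" and tbW: "tb \<beta> mainc * bb M \<le> WW"
    and s: "good s" "globs \<kappa> g R dc th s" "scalar s ''Gcnt'' \<le> scalar s ''Gcap''"
  shows "ref s (accr ''Gcnt'' ''Gcap'' s) mainc s (forp (scalar s ''Gmq'') (mainv \<kappa> g R dc th))"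
  unfolding mainc_def
proof (rule ref_for)
  let ?x = "explorec (CHR ''M'') hitc"
  have okx: "okc \<beta> ?x" using ok by (simp add: mainc_def forc_def samplec_def)
  have okh: "okc \<beta> hitc" using okx by (simp add: explorec_def edgec_def wedgec_def forc_def)
  note [simp] = wr_explorec wr_hitc
  fix s' assume s': "good s'" "\<And>x. x \<noteq> ''Gmq'' \<Longrightarrow> x \<notin> wr (samplec ?x) \<Longrightarrow> scalar s' x = scalar s x"
    "scalar s' ''Gcnt'' \<le> scalar s' ''Gcap''"
  show "ref s' (accr ''Gcnt'' ''Gcap'' s') (samplec ?x) s' (mainv \<kappa> g R dc th)"
    unfolding mainv_def
  proof (rule ref_samplec)
    show "okc \<beta> (samplec ?x)" using ok by (simp add: mainc_def forc_def)
    show tbs: "tb \<beta> (samplec ?x) * bb M \<le> WW" by (rule le_WW[OF _ tbW]) (simp add: mainc_def forc_def)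
    fix s1 v assume s1: "good s1" "\<And>x. x \<noteq> ''Mv'' \<Longrightarrow> x \<noteq> ''Md'' \<Longrightarrow> scalar s1 x = scalar s' x"
      "v \<in> V" "scalar s1 ''Mv'' = v" "scalar s1 ''Md'' = d v" "cst s' s1 (1, 1)"
    have g1: "globs \<kappa> g R dc th s1" using s(2) s'(2) s1(2) by (simp add: globs_def samplec_def)
    have "ref s1 (accr ''Gcnt'' ''Gcap'' s1) ?x s1 (expl \<kappa> g R v (hit \<kappa> g R dc th))"
    proof (rule ref_explore[OF okx])
      show "tb \<beta> ?x * bb M \<le> WW" by (rule le_WW[OF _ tbs]) (simp add: samplec_def)
      fix s2 sa k u w assume s2: "adv sa s2 k" "(k + tb \<beta> hitc) * bb M \<le> WW"
        "\<And>x. x \<notin> wr ?x \<Longrightarrow> scalar s2 x = scalar s1 x"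
        "scalar s2 ''Mu'' = u" "scalar s2 ''Me'' = d u" "scalar s2 ''Mw'' = w" "scalar s2 ''Mk'' = d w"
        "u \<in> N v" "w \<in> W v u" "scalar s2 ''Gcnt'' \<le> scalar s2 ''Gcap''"
      have uw: "u \<in> V" "w \<in> V" using s2(8,9) N_V by (auto simp: W_def)
      have "globs \<kappa> g R dc th s2" using g1 s2(3) by (simp add: globs_def)
      then show "ref sa (accr ''Gcnt'' ''Gcap'' s2) hitc s2 (tick (hit \<kappa> g R dc th v u w))"
        by (rule ref_hit[OF okh s2(2,1)]) (use s2 s1 uw in simp_all)
    qed (use s1 s' g1 in \<open>simp_all add: globs_def\<close>)
    from ref_map[OF this s1(6), of "accr ''Gcnt'' ''Gcap'' s'" id]
    have "ref s' (accr ''Gcnt'' ''Gcap'' s') ?x s1 (map_pmf (\<lambda>x. (fst x, (1, 1) + snd x)) (expl \<kappa> g R v (hit \<kappa> g R dc th)))"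
      using s1(2) by (simp add: accr_def)
    moreover have "map_pmf (\<lambda>x. (fst x, (1, 1) + snd x)) D = map_pmf (\<lambda>x. (0, 1, 1) + x) D" for D :: "outcome pmf"
      by (intro map_pmf_cong) (auto simp: prod_eq_iff)
    ultimately show "ref s' (accr ''Gcnt'' ''Gcap'' s') ?x s1 (map_pmf (\<lambda>x. (0, 1, 1) + x) (expl \<kappa> g R v (hit \<kappa> g R dc th)))" by simp
  qed (use s' in simp_all)
qed (use ok tbW s in \<open>simp_all add: mainc_def samplec_def wr_explorec wr_hitc del: tb.simps\<close>)

lemma ref_sdegc:
  assumes ok: "okc \<beta> sdegc" and tbW: "tb \<beta> sdegc * bb M \<le> WW"
    and s: "good s" "scalar s ''Gsum'' \<le> scalar s ''Gsmx''"
  shows "ref s (accr ''Gsum'' ''Gsmx'' s) sdegc s (forp (scalar s ''Gmq'') (map_pmf (\<lambda>v. (d v, 1, 1)) (pmf_of_set V)))"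
proof -
  let ?e = "clamp (eadd (Var ''Gsum'') (Var ''Md'')) (Var ''Gsmx'')"
  let ?a = "Assign ''Gsum'' ?e"
  have ma: "map_pmf (\<lambda>v. (d v, 1, 1)) (pmf_of_set V) = bind_pmf (pmf_of_set V) (\<lambda>v. return_pmf (d v, 1::nat, 1::nat))"
    by (simp add: map_pmf_def)
  show ?thesis unfolding sdegc_def ma
  proof (rule ref_for)
    fix s' assume s': "good s'" "scalar s' ''Gsum'' \<le> scalar s' ''Gsmx''"
    have oks: "okc \<beta> (samplec ?a)" "okc \<beta> ?a" using ok by (auto simp: sdegc_def forc_def samplec_def)
    have tbs: "tb \<beta> (samplec ?a) * bb M \<le> WW" by (rule le_WW[OF _ tbW]) (simp add: sdegc_def forc_def)
    show "ref s' (accr ''Gsum'' ''Gsmx'' s') (samplec ?a) s' (bind_pmf (pmf_of_set V) (\<lambda>v. return_pmf (d v, 1, 1)))"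
    proof (rule ref_samplec[OF oks(1) tbs s'(1)])
      fix s1 v assume s1: "good s1" "\<And>x. x \<noteq> ''Mv'' \<Longrightarrow> x \<noteq> ''Md'' \<Longrightarrow> scalar s1 x = scalar s' x"
        "scalar s1 ''Md'' = d v" "cst s' s1 (1, 1)"
        "time s1 + tb \<beta> ?a * bb M \<le> time s' + tb \<beta> (samplec ?a) * bb M"
      let ?s2 = "assign ''Gsum'' (val s1 ?e) (charge (expr_time s1 ?e) s1)"
      have a2: "adv s1 ?s2 (tb \<beta> ?a)" by (rule assign_adv(2)[OF s1(1) oks(2)]) simp
      have "cst s' ?s2 (1, 1)" using a2 s1(4,5) tbs unfolding adv_def cst_def by (simp del: tb.simps)
      moreover have "accr ''Gsum'' ''Gsmx'' s' ?s2 (d v)" using s1(2,3) by (simp add: accr_def)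
      ultimately show "ref s' (accr ''Gsum'' ''Gsmx'' s') ?a s1 (return_pmf (d v, 1, 1))"
        by (simp add: ref_def del: state_simps)
    qed
  qed (use ok tbW s in \<open>simp_all add: sdegc_def samplec_def del: tb.simps\<close>)
qed

end

section \<open>Programs for one guess and for the search\<close>

definition levA :: com where
  "levA = Seq (Assign ''Gsm'' (emul (Var ''Gkk'') (eadd (ediv (Var ''n'') (Var ''Gtt'')) (Const 1))))
    (Seq (Assign ''Gsmx'' (emul (Var ''Gsm'') (Var ''n'')))
    (Seq (Assign ''Gsum'' (Const 0)) (Assign ''Gmq'' (Var ''Gsm''))))"

definition mhE :: expr where
  "mhE = eadd (ediv (emul (Var ''n'') (Var ''Gsum'')) (Var ''Gsm'')) (Const 1)"

definition levB :: com where
  "levB = Seq (Assign ''Gma'' mhE) (Seq (Assign ''Gsum'' (Const 0)) (Assign ''Gmq'' (Var ''Gsm'')))"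

definition levC :: com where
  "levC = Seq (Assign ''Gmb'' mhE) (Seq (Assign ''Gmh'' (clamp (Var ''Gma'') (Var ''Gmb'')))
    (Seq (Assign ''Gkap'' (Const 1)) (Assign ''Gki'' (eadd (Var ''Gll'') (Const 1)))))"

text \<open>The clamp gives \<kappa> a static bound and preserves the doubled value, since \<kappa>
  \<le> \<kappa>^2 < q in this branch.\<close>

definition kstepc :: com where
  "kstepc = Cond (eless (emul (Var ''Gkap'') (Var ''Gkap'')) (Var ''Gmh''))
     (Assign ''Gkap'' (clamp (emul (Const 2) (Var ''Gkap'')) (emul (Const 2) (Var ''Gmh'')))) Skip"

definition levD :: com where
  "levD = Seq (Assign ''Gtq'' (emul (Var ''Gtt'') (Var ''Gtt'')))
    (Seq (Assign ''Ggap'' (eadd (ediv (Var ''Gtq'') (Var ''Gkap'')) (Const 1)))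
    (Seq (Assign ''Grep'' (eadd (ediv (Var ''Gkap'') (Var ''Gtq'')) (Const 1)))
    (Seq (Assign ''Gdcap'' (ediv (emul (Var ''Gmh'') (Var ''Ghh'')) (Var ''Gtt'')))
    (Seq (Assign ''Ggk'' (emul (Var ''Ggap'') (Var ''Gkap'')))
    (Seq (Assign ''Gthr'' (ediv (eadd (emul (emul (emul (Const 200) (Var ''Gpp'')) (Var ''Gtq'')) (Var ''Grep''))
      (esub (Var ''Ggk'') (Const 1))) (Var ''Ggk'')))
    (Seq (Assign ''Gcap'' (emul (emul (emul (emul (Const 12) (Var ''n'')) (Var ''n'')) (Var ''Gsm'')) (Var ''Grep'')))
    (Seq (Assign ''Gcnt'' (Const 0)) (Assign ''Gmq'' (Var ''Gsm'')))))))))"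

text \<open>Acceptance ends the search by setting the round bound \<open>Gbb\<close> to 0; otherwise
  guess and bound advance as in \<open>sched\<close>.\<close>

definition levF :: com where
  "levF = Seq (Assign ''Gnu'' (emul (emul (emul (Var ''n'') (Var ''Ggap'')) (Var ''Gkap'')) (Var ''Gcnt'')))
    (Seq (Assign ''Gde'' (emul (emul (Const 6) (Var ''Gsm'')) (Var ''Grep'')))
    (Cond (eless (emul (Const 2) (Var ''Gnu'')) (emul (Var ''Gde'') (emul (emul (Var ''Gtt'') (Var ''Gtt'')) (Var ''Gtt''))))
      (Cond (eless (Var ''Gbb'') (Var ''Gtt'')) (Assign ''Gtt'' (ediv (Var ''Gtt'') (Const 2)))
        (Seq (Assign ''Gtt'' (Var ''n'')) (Assign ''Gbb'' (ediv (Var ''Gbb'') (Const 2)))))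
      (Seq (Assign ''num'' (Var ''Gnu'')) (Seq (Assign ''den'' (Var ''Gde'')) (Assign ''Gbb'' (Const 0))))))"

definition levelc :: com where
  "levelc = Seq levA (Seq sdegc (Seq levB (Seq sdegc (Seq levC (Seq (forc ''Gki'' kstepc) (Seq levD (Seq mainc levF)))))))"

definition searchc :: com where "searchc = While (Var ''Gbb'') levelc"

section \<open>Correctness of the blocks and of the search loop\<close>

locale algorithm = refinement + guess
begin

definition det :: "state \<Rightarrow> com \<Rightarrow> state \<Rightarrow> bool" where
  "det s c s' \<longleftrightarrow> exc c s = return_spmf s' \<and> adv s s' (tb \<beta> c)"

lemma det_good: "det s c s' \<Longrightarrow> good s'" by (simp add: det_def adv_def)

lemma det_seq: "det s c1 s1 \<Longrightarrow> det s1 c2 s2 \<Longrightarrow> det s (Seq c1 c2) s2"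
  using adv_trans by (auto simp: det_def)

lemma det_assign:
  assumes "good s" "okc \<beta> (Assign x e)" "x \<noteq> ''n''" "val s e = k"
  shows "\<exists>s'. det s (Assign x e) s' \<and> scalar s' = (scalar s)(x := k)"
  using assign_adv[OF assms(1-3)] assms(4) unfolding det_def by (metis state_simps(1,4))

lemma det_cond:
  assumes "good s" "val s e \<noteq> 0 \<Longrightarrow> det (charge (1 + expr_time s e) s) c1 s'"
    "val s e = 0 \<Longrightarrow> det (charge (1 + expr_time s e) s) c2 s'"
  shows "det s (Cond e c1 c2) s'"
proof -
  note a = adv_charge[OF assms(1), of e]
  show ?thesis
  proof (cases "val s e = 0")
    case True
    from assms(3)[OF True] have "exc c2 (charge (1 + expr_time s e) s) = return_spmf s'"
      "adv (charge (1 + expr_time s e) s) s' (tb \<beta> c2)" by (auto simp: det_def)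
    note h = this
    show ?thesis using h(1) True adv_mono[OF adv_trans[OF a h(2)], of "tb \<beta> (Cond e c1 c2)"] by (simp add: det_def)
  next
    case False
    from assms(2)[OF False] have "exc c1 (charge (1 + expr_time s e) s) = return_spmf s'"
      "adv (charge (1 + expr_time s e) s) s' (tb \<beta> c1)" by (auto simp: det_def)
    note h = this
    show ?thesis using h(1) False adv_mono[OF adv_trans[OF a h(2)], of "tb \<beta> (Cond e c1 c2)"] by (simp add: det_def)
  qed
qed

lemma det_cst: "det s c s' \<Longrightarrow> tb \<beta> c * bb M \<le> WW \<Longrightarrow> cst s s' (1, 0)"
  using cst_of_adv by (auto simp: det_def)

lemma cst_mono: "cst s s' (a, k) \<Longrightarrow> a \<le> b \<Longrightarrow> cst s s' (b, k)"
  unfolding cst_def fst_conv snd_conv using mult_le_mono1[of a b WW] by linarith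

lemma ref_set: "ref s0 \<Phi> c s D \<Longrightarrow> ref s0 (\<lambda>s' x. \<Phi> s' x \<and> x \<in> fst ` set_pmf D) c s D"
  unfolding ref_def by (erule rel_spmf_mono_strong) auto

lemma ref_map0: "ref s1 \<Phi> c s D \<Longrightarrow> cst s0 s1 p \<Longrightarrow> ref s0 \<Phi> c s (map_pmf (\<lambda>x. (fst x, p + snd x)) D)"
  using ref_map[of s1 \<Phi> c s D s0 p \<Phi> id] by simp

definition params :: "state \<Rightarrow> bool" where
  "params s \<longleftrightarrow> scalar s ''Gpp'' = P \<and> scalar s ''Gll'' = L \<and> scalar s ''Gkk'' = K \<and> scalar s ''Ghh'' = Hc"

lemma levA_det:
  assumes "good s" "okc \<beta> levA" "params s" "scalar s ''Gtt'' = \<tau>"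
  obtains s' where "det s levA s'" "scalar s' = (scalar s)(''Gsm'' := samples \<tau>, ''Gsmx'' := samples \<tau> * n, ''Gsum'' := 0,
    ''Gmq'' := samples \<tau>)"
proof -
  have n: "scalar s ''n'' = n" using assms(1) by (simp add: good_def)
  obtain s1 where s1: "det s (Assign ''Gsm'' (emul (Var ''Gkk'') (eadd (ediv (Var ''n'') (Var ''Gtt'')) (Const 1)))) s1"
    "scalar s1 = (scalar s)(''Gsm'' := samples \<tau>)"
    by (atomize_elim, rule det_assign[OF assms(1)]) (use assms n in \<open>auto simp: levA_def params_def samples_def\<close>)
  obtain s2 where s2: "det s1 (Assign ''Gsmx'' (emul (Var ''Gsm'') (Var ''n''))) s2"
    "scalar s2 = (scalar s1)(''Gsmx'' := samples \<tau> * n)"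
    by (atomize_elim, rule det_assign[OF det_good[OF s1(1)]]) (use assms(2) n s1(2) in \<open>auto simp: levA_def\<close>)
  obtain s3 where s3: "det s2 (Assign ''Gsum'' (Const 0)) s3" "scalar s3 = (scalar s2)(''Gsum'' := 0)"
    by (atomize_elim, rule det_assign[OF det_good[OF s2(1)]]) (use assms(2) in \<open>auto simp: levA_def\<close>)
  obtain s4 where s4: "det s3 (Assign ''Gmq'' (Var ''Gsm'')) s4" "scalar s4 = (scalar s3)(''Gmq'' := samples \<tau>)"
    by (atomize_elim, rule det_assign[OF det_good[OF s3(1)]]) (use assms(2) s3 s2 s1 in \<open>auto simp: levA_def\<close>)
  show thesis
    by (rule that[of s4]) (use det_seq[OF s1(1) det_seq[OF s2(1) det_seq[OF s3(1) s4(1)]]] s1 s2 s3 s4 in \<open>auto simp: levA_def\<close>)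
qed

lemma levB_det:
  assumes "good s" "okc \<beta> levB" "scalar s ''Gsum'' = x" "scalar s ''Gsm'' = samples \<tau>"
  obtains s' where "det s levB s'" "scalar s' = (scalar s)(''Gma'' := mh1 \<tau> x, ''Gsum'' := 0, ''Gmq'' := samples \<tau>)"
proof -
  have n: "scalar s ''n'' = n" using assms(1) by (simp add: good_def)
  obtain s1 where s1: "det s (Assign ''Gma'' mhE) s1" "scalar s1 = (scalar s)(''Gma'' := mh1 \<tau> x)"
    by (atomize_elim, rule det_assign[OF assms(1)]) (use assms n in \<open>auto simp: levB_def mhE_def mh1_def\<close>)
  obtain s3 where s3: "det s1 (Assign ''Gsum'' (Const 0)) s3" "scalar s3 = (scalar s1)(''Gsum'' := 0)"
    by (atomize_elim, rule det_assign[OF det_good[OF s1(1)]]) (use assms(2) in \<open>auto simp: levB_def\<close>)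
  obtain s4 where s4: "det s3 (Assign ''Gmq'' (Var ''Gsm'')) s4" "scalar s4 = (scalar s3)(''Gmq'' := samples \<tau>)"
    by (atomize_elim, rule det_assign[OF det_good[OF s3(1)]]) (use assms s3 s1 in \<open>auto simp: levB_def\<close>)
  show thesis
    by (rule that[of s4]) (use det_seq[OF s1(1) det_seq[OF s3(1) s4(1)]] s1 s3 s4 in \<open>auto simp: levB_def\<close>)
qed

lemma levC_det:
  assumes "good s" "okc \<beta> levC" "scalar s ''Gsum'' = x" "scalar s ''Gsm'' = samples \<tau>" "params s" "scalar s ''Gma'' = q1"
  obtains s' where "det s levC s'" "scalar s' = (scalar s)(''Gmb'' := mh1 \<tau> x, ''Gmh'' := min q1 (mh1 \<tau> x), ''Gkap'' := 1,
    ''Gki'' := L + 1)"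
proof -
  have n: "scalar s ''n'' = n" using assms(1) by (simp add: good_def)
  obtain s1 where s1: "det s (Assign ''Gmb'' mhE) s1" "scalar s1 = (scalar s)(''Gmb'' := mh1 \<tau> x)"
    by (atomize_elim, rule det_assign[OF assms(1)]) (use assms n in \<open>auto simp: levC_def mhE_def mh1_def\<close>)
  obtain s2 where s2: "det s1 (Assign ''Gmh'' (clamp (Var ''Gma'') (Var ''Gmb''))) s2" "scalar s2 = (scalar s1)(''Gmh'' := min q1 (mh1 \<tau> x))"
    by (atomize_elim, rule det_assign[OF det_good[OF s1(1)]]) (use assms s1 in \<open>auto simp: levC_def\<close>)
  obtain s3 where s3: "det s2 (Assign ''Gkap'' (Const 1)) s3" "scalar s3 = (scalar s2)(''Gkap'' := 1)"
    by (atomize_elim, rule det_assign[OF det_good[OF s2(1)]]) (use assms(2) in \<open>auto simp: levC_def\<close>)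
  obtain s4 where s4: "det s3 (Assign ''Gki'' (eadd (Var ''Gll'') (Const 1))) s4" "scalar s4 = (scalar s3)(''Gki'' := L + 1)"
    by (atomize_elim, rule det_assign[OF det_good[OF s3(1)]]) (use assms s3 s2 s1 in \<open>auto simp: levC_def params_def\<close>)
  show thesis
    by (rule that[of s4]) (use det_seq[OF s1(1) det_seq[OF s2(1) det_seq[OF s3(1) s4(1)]]] s1 s2 s3 s4 in \<open>auto simp: levC_def\<close>)
qed

lemma kstepc_det:
  assumes "good s" "okc \<beta> kstepc" "scalar s ''Gmh'' = q" "scalar s ''Gkap'' = \<kappa>"
  obtains s' where "det s kstepc s'" "scalar s' = (scalar s)(''Gkap'' := kstep q \<kappa>)"
proof -
  let ?e = "eless (emul (Var ''Gkap'') (Var ''Gkap'')) (Var ''Gmh'')"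
  let ?s = "charge (1 + expr_time s ?e) s"
  have g: "good ?s" by (rule adv_good[OF adv_charge[OF assms(1)]])
  show thesis
  proof (cases "\<kappa> * \<kappa> < q")
    case True
    have k: "\<kappa> \<le> q" using True by (metis le_square less_imp_le_nat order_trans)
    obtain s1 where s1: "det ?s (Assign ''Gkap'' (clamp (emul (Const 2) (Var ''Gkap'')) (emul (Const 2) (Var ''Gmh'')))) s1"
      "scalar s1 = (scalar ?s)(''Gkap'' := 2 * \<kappa>)"
      by (atomize_elim, rule det_assign[OF g]) (use assms k in \<open>auto simp: kstepc_def\<close>)
    show thesis
      by (rule that[of s1]) (use s1 True assms in \<open>auto simp: kstepc_def kstep_def intro!: det_cond\<close>)
  next
    case False
    have "det ?s Skip (charge 1 ?s)" using skip_adv[OF adv_refl[OF g]] by (simp add: det_def)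
    then have "det s kstepc (charge 1 ?s)"
      unfolding kstepc_def by (intro det_cond assms(1)) (use False assms in auto)
    then show thesis by (rule that) (use False assms in \<open>auto simp: kstep_def\<close>)
  qed
qed

text \<open>Every pass is paid as an abstract step; this is the origin of the summand L in the cost
  of a guess.\<close>

lemma kloop_det:
  assumes ok: "okc \<beta> (forc ''Gki'' kstepc)" and tbW: "tb \<beta> (forc ''Gki'' kstepc) * bb M \<le> WW"
  shows "good s \<Longrightarrow> scalar s ''Gmh'' = q \<Longrightarrow> scalar s ''Gkap'' = \<kappa> \<Longrightarrow> scalar s ''Gki'' = j \<Longrightarrow>
    \<exists>s'. exc (forc ''Gki'' kstepc) s = return_spmf s' \<and> cst s s' (j + 1, 0) \<and>
      scalar s' = (scalar s)(''Gki'' := 0, ''Gkap'' := (kstep q ^^ j) \<kappa>)"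
proof (induction j arbitrary: s \<kappa>)
  let ?pay = "\<lambda>s. charge (1 + expr_time s (Var ''Gki'')) s"
  let ?dec = "Assign ''Gki'' (esub (Var ''Gki'') (Const 1))"
  have T: "tb \<beta> (forc ''Gki'' kstepc) = 1 + tX \<beta> (Var ''Gki'') + (tb \<beta> ?dec + tb \<beta> kstepc)"
    by (simp only: forc_def tb.simps)
  have unroll: "exc (forc ''Gki'' kstepc) s = (if scalar s ''Gki'' \<noteq> 0
      then bind_spmf (exc (Seq ?dec kstepc) (?pay s)) (exc (forc ''Gki'' kstepc))
      else return_spmf (?pay s))" for s
    unfolding forc_def exec.simps(6) by (subst loop.simps) simp
  {
    case 0
    have "cst s (?pay s) (1, 0)" by (rule cst_of_adv[OF adv_charge[OF 0(1)] le_WW[OF _ tbW]]) (simp add: T)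
    moreover have "scalar (?pay s) = (scalar s)(''Gki'' := 0, ''Gkap'' := \<kappa>)" using 0 by (auto simp: fun_eq_iff)
    ultimately show ?case using unroll[of s] 0 by auto
  next
    case (Suc j)
    have g: "good (?pay s)" by (rule adv_good[OF adv_charge[OF Suc.prems(1)]])
    obtain s1 where s1: "det (?pay s) ?dec s1" "scalar s1 = (scalar (?pay s))(''Gki'' := j)"
      by (atomize_elim, rule det_assign[OF g]) (use ok Suc.prems in \<open>auto simp: forc_def\<close>)
    obtain s2 where s2: "det s1 kstepc s2" "scalar s2 = (scalar s1)(''Gkap'' := kstep q \<kappa>)"
      by (rule kstepc_det[OF det_good[OF s1(1)], of q \<kappa>]) (use ok s1 Suc.prems in \<open>auto simp: forc_def\<close>)
    note d = det_seq[OF s1(1) s2(1)]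
    obtain s3 where s3: "exc (forc ''Gki'' kstepc) s2 = return_spmf s3" "cst s2 s3 (j + 1, 0)"
      "scalar s3 = (scalar s2)(''Gki'' := 0, ''Gkap'' := (kstep q ^^ j) (kstep q \<kappa>))"
      by (atomize_elim, rule Suc.IH[OF det_good[OF s2(1)]]) (use s2 s1 Suc.prems in simp_all)
    have "adv s s2 (1 + tX \<beta> (Var ''Gki'') + tb \<beta> (Seq ?dec kstepc))"
using d unfolding det_def by (intro adv_trans[OF adv_charge[OF Suc.prems(1)]]) blast
    then have "cst s s2 (1, 0)" by (rule cst_of_adv) (rule le_WW[OF _ tbW], simp add: T)
    from cst_trans[OF this s3(2)] have "cst s s3 (Suc j + 1, 0)" by simp
    moreover have "exc (forc ''Gki'' kstepc) s = return_spmf s3"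
      using unroll[of s] Suc.prems d s3(1) by (simp add: det_def)
    moreover have "scalar s3 = (scalar s)(''Gki'' := 0, ''Gkap'' := (kstep q ^^ Suc j) \<kappa>)"
      using s3(3) s2 s1 by (auto simp: fun_eq_iff funpow_swap1)
    ultimately show ?case by blast
  }
qed

lemma levD_det:
  assumes "good s" "okc \<beta> levD" "params s" "scalar s ''Gsm'' = samples \<tau>" "scalar s ''Gmh'' = q" "scalar s ''Gkap'' = \<kappa>"
    "scalar s ''Gtt'' = \<tau>"
  obtains s' where "det s levD s'" "scalar s' = (scalar s)(''Gtq'' := \<tau> * \<tau>, ''Ggap'' := g_of \<tau> \<kappa>, ''Grep'' := R_of \<tau> \<kappa>,
    ''Gdcap'' := dcap_of \<tau> q, ''Ggk'' := g_of \<tau> \<kappa> * \<kappa>, ''Gthr'' := thr_of \<tau> \<kappa>, ''Gcap'' := cap \<tau> (R_of \<tau> \<kappa>), ''Gcnt'' := 0,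
    ''Gmq'' := samples \<tau>)"
proof -
  have n: "scalar s ''n'' = n" using assms(1) by (simp add: good_def)
  obtain s1 where s1: "det s (Assign ''Gtq'' (emul (Var ''Gtt'') (Var ''Gtt''))) s1" "scalar s1 = (scalar s)(''Gtq'' := \<tau> * \<tau>)"
    by (atomize_elim, rule det_assign[OF assms(1)]) (use assms in \<open>auto simp: levD_def\<close>)
  obtain s2 where s2: "det s1 (Assign ''Ggap'' (eadd (ediv (Var ''Gtq'') (Var ''Gkap'')) (Const 1))) s2"
    "scalar s2 = (scalar s1)(''Ggap'' := g_of \<tau> \<kappa>)"
    by (atomize_elim, rule det_assign[OF det_good[OF s1(1)]]) (use assms s1 in \<open>auto simp: levD_def g_of_def\<close>)
  obtain s3 where s3: "det s2 (Assign ''Grep'' (eadd (ediv (Var ''Gkap'') (Var ''Gtq'')) (Const 1))) s3"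
    "scalar s3 = (scalar s2)(''Grep'' := R_of \<tau> \<kappa>)"
    by (atomize_elim, rule det_assign[OF det_good[OF s2(1)]]) (use assms s1 s2 in \<open>auto simp: levD_def R_of_def\<close>)
  obtain s4 where s4: "det s3 (Assign ''Gdcap'' (ediv (emul (Var ''Gmh'') (Var ''Ghh'')) (Var ''Gtt''))) s4"
    "scalar s4 = (scalar s3)(''Gdcap'' := dcap_of \<tau> q)"
    by (atomize_elim, rule det_assign[OF det_good[OF s3(1)]]) (use assms s1 s2 s3 in \<open>auto simp: levD_def dcap_of_def params_def\<close>)
  obtain s5 where s5: "det s4 (Assign ''Ggk'' (emul (Var ''Ggap'') (Var ''Gkap''))) s5"
    "scalar s5 = (scalar s4)(''Ggk'' := g_of \<tau> \<kappa> * \<kappa>)"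
    by (atomize_elim, rule det_assign[OF det_good[OF s4(1)]]) (use assms s1 s2 s3 s4 in \<open>auto simp: levD_def\<close>)
  obtain s6 where s6: "det s5 (Assign ''Gthr'' (ediv (eadd (emul (emul (emul (Const 200) (Var ''Gpp'')) (Var ''Gtq'')) (Var ''Grep''))
      (esub (Var ''Ggk'') (Const 1))) (Var ''Ggk''))) s6"
    "scalar s6 = (scalar s5)(''Gthr'' := thr_of \<tau> \<kappa>)"
    by (atomize_elim, rule det_assign[OF det_good[OF s5(1)]]) (use assms s1 s2 s3 s4 s5 in \<open>auto simp: levD_def thr_of_def params_def\<close>)
  obtain s7 where s7: "det s6 (Assign ''Gcap'' (emul (emul (emul (emul (Const 12) (Var ''n'')) (Var ''n'')) (Var ''Gsm'')) (Var ''Grep''))) s7"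
    "scalar s7 = (scalar s6)(''Gcap'' := cap \<tau> (R_of \<tau> \<kappa>))"
    by (atomize_elim, rule det_assign[OF det_good[OF s6(1)]]) (use assms n s1 s2 s3 s4 s5 s6 in \<open>auto simp: levD_def cap_def\<close>)
  obtain s8 where s8: "det s7 (Assign ''Gcnt'' (Const 0)) s8" "scalar s8 = (scalar s7)(''Gcnt'' := 0)"
    by (atomize_elim, rule det_assign[OF det_good[OF s7(1)]]) (use assms in \<open>auto simp: levD_def\<close>)
  obtain s9 where s9: "det s8 (Assign ''Gmq'' (Var ''Gsm'')) s9" "scalar s9 = (scalar s8)(''Gmq'' := samples \<tau>)"
    by (atomize_elim, rule det_assign[OF det_good[OF s8(1)]]) (use assms s1 s2 s3 s4 s5 s6 s7 s8 in \<open>auto simp: levD_def\<close>)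
  show thesis
    by (rule that[of s9])
      (use det_seq[OF s1(1) det_seq[OF s2(1) det_seq[OF s3(1) det_seq[OF s4(1) det_seq[OF s5(1) det_seq[OF s6(1)
        det_seq[OF s7(1) det_seq[OF s8(1) s9(1)]]]]]]]] s1 s2 s3 s4 s5 s6 s7 s8 s9 in \<open>auto simp: levD_def\<close>)
qed

definition moved :: "state \<Rightarrow> nat \<Rightarrow> nat \<Rightarrow> state \<Rightarrow> (nat \<times> nat) option \<Rightarrow> bool" where
  "moved s \<tau> b s' r \<longleftrightarrow> (case r of None \<Rightarrow> scalar s' ''num'' = scalar s ''num'' \<and> scalar s' ''den'' = scalar s ''den'' \<and>
       scalar s' ''Gtt'' = (if \<tau> \<le> b then n else \<tau> div 2) \<and> scalar s' ''Gbb'' = (if \<tau> \<le> b then b div 2 else b)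
     | Some (x, y) \<Rightarrow> scalar s' ''num'' = x \<and> scalar s' ''den'' = y \<and> scalar s' ''Gbb'' = 0)"

lemma levF_det:
  assumes "good s" "okc \<beta> levF" "scalar s ''Gsm'' = samples \<tau>" "scalar s ''Gkap'' = \<kappa>"
    "scalar s ''Gtt'' = \<tau>" "scalar s ''Gbb'' = b" "scalar s ''Ggap'' = g_of \<tau> \<kappa>" "scalar s ''Grep'' = R_of \<tau> \<kappa>"
    "scalar s ''Gcnt'' = min x (cap \<tau> (R_of \<tau> \<kappa>))"
  obtains s' where "det s levF s'" "moved s \<tau> b s' (decide \<tau> \<kappa> x)"
proof -
  have n: "scalar s ''n'' = n" using assms(1) by (simp add: good_def)
  let ?nu = "n * g_of \<tau> \<kappa> * \<kappa> * min x (cap \<tau> (R_of \<tau> \<kappa>))" and ?de = "6 * samples \<tau> * R_of \<tau> \<kappa>"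
  obtain s1 where s1: "det s (Assign ''Gnu'' (emul (emul (emul (Var ''n'') (Var ''Ggap'')) (Var ''Gkap'')) (Var ''Gcnt''))) s1"
    "scalar s1 = (scalar s)(''Gnu'' := ?nu)"
    by (atomize_elim, rule det_assign[OF assms(1)]) (use assms n in \<open>auto simp: levF_def\<close>)
  obtain s2 where s2: "det s1 (Assign ''Gde'' (emul (emul (Const 6) (Var ''Gsm'')) (Var ''Grep''))) s2"
    "scalar s2 = (scalar s1)(''Gde'' := ?de)"
    by (atomize_elim, rule det_assign[OF det_good[OF s1(1)]]) (use assms s1 in \<open>auto simp: levF_def\<close>)
  let ?c1 = "eless (emul (Const 2) (Var ''Gnu'')) (emul (Var ''Gde'') (emul (emul (Var ''Gtt'') (Var ''Gtt'')) (Var ''Gtt'')))"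
  let ?c2 = "eless (Var ''Gbb'') (Var ''Gtt'')"
  let ?C = "Cond ?c1
      (Cond ?c2 (Assign ''Gtt'' (ediv (Var ''Gtt'') (Const 2)))
        (Seq (Assign ''Gtt'' (Var ''n'')) (Assign ''Gbb'' (ediv (Var ''Gbb'') (Const 2)))))
      (Seq (Assign ''num'' (Var ''Gnu'')) (Seq (Assign ''den'' (Var ''Gde'')) (Assign ''Gbb'' (Const 0))))"
  let ?s3 = "charge (1 + expr_time s2 ?c1) s2"
  let ?s4 = "charge (1 + expr_time ?s3 ?c2) ?s3"
  have g3: "good ?s3" by (rule adv_good[OF adv_charge[OF det_good[OF s2(1)]]])
  have g4: "good ?s4" by (rule adv_good[OF adv_charge[OF g3]])
  have v1: "val s2 ?c1 \<noteq> 0 \<longleftrightarrow> \<not> ?de * (\<tau> * \<tau> * \<tau>) \<le> 2 * ?nu" using s1 s2 assms by auto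
  have v2: "val ?s3 ?c2 \<noteq> 0 \<longleftrightarrow> \<not> \<tau> \<le> b" using s1 s2 assms by auto
  have sc: "scalar s2 ''Gnu'' = ?nu" "scalar s2 ''Gde'' = ?de" "scalar s2 ''Gtt'' = \<tau>" "scalar s2 ''Gbb'' = b" "scalar s2 ''n'' = n"
    "scalar s2 ''num'' = scalar s ''num''" "scalar s2 ''den'' = scalar s ''den''" using s1 s2 assms n by simp_all
  have "\<exists>s'. det s2 ?C s' \<and> moved s \<tau> b s' (decide \<tau> \<kappa> x)"
  proof (cases "?de * (\<tau> * \<tau> * \<tau>) \<le> 2 * ?nu")
    case True
    obtain s5 where s5: "det ?s3 (Assign ''num'' (Var ''Gnu'')) s5" "scalar s5 = (scalar ?s3)(''num'' := ?nu)"
      by (atomize_elim, rule det_assign[OF g3]) (use assms sc in \<open>auto simp: levF_def\<close>)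
    obtain s6 where s6: "det s5 (Assign ''den'' (Var ''Gde'')) s6" "scalar s6 = (scalar s5)(''den'' := ?de)"
      by (atomize_elim, rule det_assign[OF det_good[OF s5(1)]]) (use assms sc s5 in \<open>auto simp: levF_def\<close>)
    obtain s7 where s7: "det s6 (Assign ''Gbb'' (Const 0)) s7" "scalar s7 = (scalar s6)(''Gbb'' := 0)"
      by (atomize_elim, rule det_assign[OF det_good[OF s6(1)]]) (use assms in \<open>auto simp: levF_def\<close>)
    have "det s2 ?C s7"
      by (rule det_cond[OF det_good[OF s2(1)]])
        (use True v1 det_seq[OF s5(1) det_seq[OF s6(1) s7(1)]] in auto)
    moreover have "decide \<tau> \<kappa> x = Some (?nu, ?de)" unfolding decide_def Let_def using True by (rule if_P)
    ultimately show ?thesis using s7 s6 s5 by (intro exI[of _ s7]) (simp add: moved_def)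
  next
    case False
    have dn: "decide \<tau> \<kappa> x = None" unfolding decide_def Let_def using False by (rule if_not_P)
    show ?thesis
    proof (cases "\<tau> \<le> b")
      case True
      obtain s5 where s5: "det ?s4 (Assign ''Gtt'' (Var ''n'')) s5" "scalar s5 = (scalar ?s4)(''Gtt'' := n)"
        by (atomize_elim, rule det_assign[OF g4]) (use assms sc in \<open>auto simp: levF_def\<close>)
      obtain s6 where s6: "det s5 (Assign ''Gbb'' (ediv (Var ''Gbb'') (Const 2))) s6" "scalar s6 = (scalar s5)(''Gbb'' := b div 2)"
        by (atomize_elim, rule det_assign[OF det_good[OF s5(1)]]) (use assms sc s5 in \<open>auto simp: levF_def\<close>)
      have "det s2 ?C s6"
        by (rule det_cond[OF det_good[OF s2(1)]], rule det_cond[OF g3])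
          (use False True v1 v2 det_seq[OF s5(1) s6(1)] in blast)+
      then show ?thesis using s6 s5 sc True unfolding dn by (intro exI[of _ s6]) (simp add: moved_def)
    next
      case b: False
      obtain s5 where s5: "det ?s4 (Assign ''Gtt'' (ediv (Var ''Gtt'') (Const 2))) s5" "scalar s5 = (scalar ?s4)(''Gtt'' := \<tau> div 2)"
        by (atomize_elim, rule det_assign[OF g4]) (use assms sc in \<open>auto simp: levF_def\<close>)
      have "det s2 ?C s5"
        by (rule det_cond[OF det_good[OF s2(1)]], rule det_cond[OF g3])
          (use False b v1 v2 s5(1) in blast)+
      then show ?thesis using s5 sc b unfolding dn by (intro exI[of _ s5]) (simp add: moved_def)
    qed
  qed
  then obtain s' where "det s2 ?C s'" "moved s \<tau> b s' (decide \<tau> \<kappa> x)" by blast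
  then show thesis using that[of s'] det_seq[OF s1(1) det_seq[OF s2(1)]] by (simp add: levF_def)
qed


lemma ref_level:
  assumes ok: "okc \<beta> levelc" and tbW: "tb \<beta> levelc * bb M \<le> WW"
    and s: "good s" "params s" "scalar s ''Gtt'' = \<tau>" "scalar s ''Gbb'' = b" and \<tau>: "1 \<le> \<tau>" "\<tau> \<le> n"
  shows "ref s (moved s \<tau> b) levelc s (level \<tau>)"
proof -
  note [simp] = wr_explorec wr_hitc
  have wrs: "wr sdegc = {''Gmq'', ''Mv'', ''Md'', ''Gsum''}" by (auto simp: sdegc_def forc_def samplec_def)
  have oks: "okc \<beta> levA" "okc \<beta> sdegc" "okc \<beta> levB" "okc \<beta> levC" "okc \<beta> (forc ''Gki'' kstepc)" "okc \<beta> levD" "okc \<beta> mainc" "okc \<beta> levF"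
    using ok by (auto simp: levelc_def)
  have T: "tb \<beta> levelc = tb \<beta> levA + (tb \<beta> sdegc + (tb \<beta> levB + (tb \<beta> sdegc + (tb \<beta> levC + (tb \<beta> (forc ''Gki'' kstepc) +
    (tb \<beta> levD + (tb \<beta> mainc + tb \<beta> levF)))))))" by (simp only: levelc_def tb.simps)
  have W: "tb \<beta> levA * bb M \<le> WW" "tb \<beta> sdegc * bb M \<le> WW" "tb \<beta> levB * bb M \<le> WW" "tb \<beta> levC * bb M \<le> WW"
    "tb \<beta> (forc ''Gki'' kstepc) * bb M \<le> WW" "tb \<beta> levD * bb M \<le> WW" "tb \<beta> mainc * bb M \<le> WW" "(0 + tb \<beta> levF) * bb M \<le> WW"
    by (rule le_WW[OF _ tbW], simp add: T)+
  let ?D = "forp (samples \<tau>) sdeg"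
  let ?q = "\<lambda>x x'. min (mh1 \<tau> x) (mh1 \<tau> x')"
  define F2 where "F2 x x' = map_pmf (\<lambda>z. (fst z, (L + 7, 0) + snd z))
     (map_pmf (\<lambda>z. (decide \<tau> (kap (L + 1) (?q x x')) (fst z), (1, 0) + snd z)) (mainp \<tau> (?q x x')))" for x x'
  define F1 where "F1 x = map_pmf (\<lambda>z. (fst z, (1, 0) + snd z)) (bind_pmf ?D (\<lambda>x'. map_pmf (\<lambda>y. (fst y, snd x' + snd y)) (F2 x (fst x'))))" for x
  obtain sA where sA: "det s levA sA" "scalar sA = (scalar s)(''Gsm'' := samples \<tau>, ''Gsmx'' := samples \<tau> * n, ''Gsum'' := 0, ''Gmq'' := samples \<tau>)"
    by (rule levA_det[OF s(1) oks(1) s(2,3)])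
  let ?rest2 = "Seq levC (Seq (forc ''Gki'' kstepc) (Seq levD (Seq mainc levF)))"
  let ?rest1 = "Seq levB (Seq sdegc ?rest2)"
  have sd: "ref s' (\<lambda>s'' x. scalar s'' ''Gsum'' = x) sdegc s' ?D"
    if s': "good s'" "scalar s' ''Gsum'' = 0" "scalar s' ''Gsmx'' = samples \<tau> * n" "scalar s' ''Gmq'' = samples \<tau>" for s'
  proof -
    have "ref s' (accr ''Gsum'' ''Gsmx'' s') sdegc s' ?D"
      using ref_sdegc[OF oks(2) W(2) s'(1)] s' by (simp add: sdeg_def)
    from ref_set[OF this] show ?thesis
      unfolding ref_def
    proof (rule rel_spmf_mono)
      fix s'' x assume h: "(accr ''Gsum'' ''Gsmx'' s' s'' (fst x) \<and> fst x \<in> fst ` set_pmf ?D) \<and> cst s' s'' (snd x)"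
      then have "fst x \<le> samples \<tau> * n" using sdeg_sum_le[OF \<tau>] by auto
      then show "scalar s'' ''Gsum'' = fst x \<and> cst s' s'' (snd x)" using h s' by (auto simp: accr_def)
    qed
  qed
  have "ref sA (moved s \<tau> b) (Seq sdegc ?rest1) sA (bind_pmf ?D (\<lambda>x. map_pmf (\<lambda>y. (fst y, snd x + snd y)) (F1 (fst x))))"
  proof (rule ref_bind2)
    show "ref sA (\<lambda>s'' x. scalar s'' ''Gsum'' = x) sdegc sA ?D" by (rule sd) (use sA det_good in auto)
    fix s1 x assume s1: "s1 \<in> set_spmf (exc sdegc sA)" "good s1" "scalar s1 ''Gsum'' = x"
    note f1 = conjunct1[OF exec_frame[OF s1(1)], rule_format, unfolded wrs]
    obtain sB where sB: "det s1 levB sB" "scalar sB = (scalar s1)(''Gma'' := mh1 \<tau> x, ''Gsum'' := 0, ''Gmq'' := samples \<tau>)"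
      by (rule levB_det[OF s1(2) oks(3) s1(3), of \<tau>]) (use f1 sA in simp_all)
    have "ref sB (moved s \<tau> b) (Seq sdegc ?rest2) sB (bind_pmf ?D (\<lambda>x'. map_pmf (\<lambda>y. (fst y, snd x' + snd y)) (F2 x (fst x'))))"
    proof (rule ref_bind2)
      show "ref sB (\<lambda>s'' x. scalar s'' ''Gsum'' = x) sdegc sB ?D"
        by (rule sd) (use sB f1 sA det_good in auto)
      fix s2 x' assume s2: "s2 \<in> set_spmf (exc sdegc sB)" "good s2" "scalar s2 ''Gsum'' = x'"
      note f2 = conjunct1[OF exec_frame[OF s2(1)], rule_format, unfolded wrs]
      let ?qq = "?q x x'"
      let ?\<kappa> = "kap (L + 1) ?qq"
      have p2: "params s2" using s(2) f2 f1 sB sA by (simp add: params_def)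
      obtain sC where sC: "det s2 levC sC" "scalar sC = (scalar s2)(''Gmb'' := mh1 \<tau> x', ''Gmh'' := ?qq, ''Gkap'' := 1, ''Gki'' := L + 1)"
        by (rule levC_det[OF s2(2) oks(4) s2(3) _ p2, of \<tau> "mh1 \<tau> x"]) (use f2 f1 sB sA in simp_all)
      obtain sK where sK: "exc (forc ''Gki'' kstepc) sC = return_spmf sK" "cst sC sK (L + 1 + 1, 0)"
        "scalar sK = (scalar sC)(''Gki'' := 0, ''Gkap'' := (kstep ?qq ^^ (L + 1)) 1)"
        by (atomize_elim, rule kloop_det[OF oks(5) W(5) det_good[OF sC(1)]]) (use sC in simp_all)
      have gK: "good sK" using sK(2) by (simp add: cst_def)
      have kK: "scalar sK ''Gkap'' = ?\<kappa>" using sK(3) by (simp add: kap_def)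
      have pK: "params sK" using p2 sC sK(3) by (simp add: params_def)
      obtain sD where sD: "det sK levD sD" "scalar sD = (scalar sK)(''Gtq'' := \<tau> * \<tau>, ''Ggap'' := g_of \<tau> ?\<kappa>, ''Grep'' := R_of \<tau> ?\<kappa>,
        ''Gdcap'' := dcap_of \<tau> ?qq, ''Ggk'' := g_of \<tau> ?\<kappa> * ?\<kappa>, ''Gthr'' := thr_of \<tau> ?\<kappa>, ''Gcap'' := cap \<tau> (R_of \<tau> ?\<kappa>), ''Gcnt'' := 0,
        ''Gmq'' := samples \<tau>)"
        by (rule levD_det[OF gK oks(6) pK, of \<tau> ?qq ?\<kappa>]) (use kK sK(3) sC f2 f1 sB sA s in simp_all)
      \<comment> \<open>L + 2 steps for the loop and one for each neighboring block, rounded up. The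
        first block, the one between the estimates and the last one add three, which makes L +
        10.\<close>
      have c: "cst s2 sD (L + 7, 0)"
        by (rule cst_mono[OF cst_trans[OF cst_trans[OF det_cst[OF sC(1) W(4)] sK(2)] det_cst[OF sD(1) W(6)], simplified]]) simp
      note gD = det_good[OF sD(1)]
      have gl: "globs ?\<kappa> (g_of \<tau> ?\<kappa>) (R_of \<tau> ?\<kappa>) (dcap_of \<tau> ?qq) (thr_of \<tau> ?\<kappa>) sD"
        using sD(2) kK kap_pos[of "L + 1" ?qq] by (simp add: globs_def g_of_def)
      have "ref sD (moved s \<tau> b) (Seq mainc levF) sD
         (map_pmf (\<lambda>z. (decide \<tau> ?\<kappa> (fst z), (1, 0) + snd z)) (mainp \<tau> ?qq))"
      proof (rule ref_post[OF _ adv_refl[OF gD] W(8)])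
        show "ref sD (accr ''Gcnt'' ''Gcap'' sD) mainc sD (mainp \<tau> ?qq)"
          using ref_mainc[OF oks(7) W(7) gD gl] sD(2) by (simp add: mainp_def Let_def)
        fix s3 z assume s3: "s3 \<in> set_spmf (exc mainc sD)" "accr ''Gcnt'' ''Gcap'' sD s3 z" "good s3"
        note f3 = conjunct1[OF exec_frame[OF s3(1)], rule_format]
        have g3: "scalar s3 y = scalar sD y" if "y \<in> {''Gsm'', ''Gkap'', ''Gtt'', ''Gbb'', ''Ggap'', ''Grep'', ''num'', ''den''}" for y
          by (rule f3) (use that in \<open>auto simp: mainc_def forc_def samplec_def\<close>)
        obtain s4 where s4: "det s3 levF s4" "moved s3 \<tau> b s4 (decide \<tau> ?\<kappa> z)"
          by (rule levF_det[OF s3(3) oks(8), of \<tau> ?\<kappa> b z])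
            (use g3 s3(2) sD(2) kK sK(3) sC f2 f1 sB sA s in \<open>simp_all add: accr_def\<close>)
        have nd: "scalar s3 ''num'' = scalar s ''num''" "scalar s3 ''den'' = scalar s ''den''"
          using g3[of "''num''"] g3[of "''den''"] sD(2) sK(3) sC f2 f1 sB sA by simp_all
        have "moved s \<tau> b s4 (decide \<tau> ?\<kappa> z)"
          using s4(2) unfolding moved_def nd .
        then show "\<exists>s4. exc levF s3 = return_spmf s4 \<and> adv s3 s4 (tb \<beta> levF) \<and> moved s \<tau> b s4 (decide \<tau> ?\<kappa> z)"
          using s4(1) by (auto simp: det_def)
      qed
      from ref_map0[OF this c] have "ref s2 (moved s \<tau> b) (Seq mainc levF) sD (F2 x x')" by (simp add: F2_def)
      moreover have "exc levC s2 = return_spmf sC" "exc levD sK = return_spmf sD" using sC(1) sD(1) by (simp_all add: det_def)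
      ultimately show "ref s2 (moved s \<tau> b) ?rest2 s2 (F2 x x')" using sK(1) by (blast intro: ref_seq)
    qed
    from ref_map0[OF this det_cst[OF sB(1) W(3)]] have "ref s1 (moved s \<tau> b) (Seq sdegc ?rest2) sB (F1 x)" by (simp add: F1_def)
    then show "ref s1 (moved s \<tau> b) ?rest1 s1 (F1 x)"
      using sB(1) by (intro ref_seq[of levB]) (auto simp: det_def)
  qed
  from ref_map0[OF this det_cst[OF sA(1) W(1)]]
  have "ref s (moved s \<tau> b) levelc s (map_pmf (\<lambda>z. (fst z, (1, 0) + snd z)) (bind_pmf ?D (\<lambda>x. map_pmf (\<lambda>y. (fst y, snd x + snd y)) (F1 (fst x)))))"
    using sA(1) unfolding levelc_def by (intro ref_seq[of levA]) (auto simp: det_def)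
  also have "map_pmf (\<lambda>z. (fst z, (1, 0) + snd z)) (bind_pmf ?D (\<lambda>x. map_pmf (\<lambda>y. (fst y, snd x + snd y)) (F1 (fst x)))) = level \<tau>"
    unfolding level_def F1_def F2_def Let_def map_bind_pmf map_pmf_comp case_prod_unfold
    by (intro bind_pmf_cong map_pmf_cong refl) (simp add: prod_eq_iff)
  finally show ?thesis .
qed

text \<open>A search without answer leaves 0/0, which \<open>result\<close> evaluates to 0, the
  correct value if there is no triangle.\<close>

definition found :: "state \<Rightarrow> (nat \<times> nat) option \<Rightarrow> bool" where
  "found s r \<longleftrightarrow> (case r of None \<Rightarrow> scalar s ''num'' = 0 \<and> scalar s ''den'' = 0 | Some (x, y) \<Rightarrow> scalar s ''num'' = x \<and> scalar s ''den'' = y)"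

lemma ref_search:
  assumes ok: "okc \<beta> searchc" and tbW: "2 * tb \<beta> searchc * bb M \<le> WW"
  shows "n' = n \<Longrightarrow> good s \<Longrightarrow> params s \<Longrightarrow> scalar s ''Gtt'' = \<tau> \<Longrightarrow> scalar s ''Gbb'' = b \<Longrightarrow> 1 \<le> \<tau> \<Longrightarrow> \<tau> \<le> n \<Longrightarrow>
    scalar s ''num'' = 0 \<Longrightarrow> scalar s ''den'' = 0 \<Longrightarrow> ref s found searchc s (search level (sched n' \<tau> b))"
proof (induction n' \<tau> b arbitrary: s rule: sched.induct)
  case (1 n' \<tau> b s)
  let ?e = "Var ''Gbb''"
  let ?pay = "\<lambda>s. charge (1 + expr_time s ?e) s"
  have T: "tb \<beta> searchc = 1 + tX \<beta> ?e + tb \<beta> levelc" by (simp only: searchc_def tb.simps)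
  have okl: "okc \<beta> levelc" using ok by (simp add: searchc_def)
  have WL: "tb \<beta> levelc * bb M \<le> WW" and WP: "(1 + tX \<beta> ?e) * bb M \<le> WW" and WP2: "(1 + tX \<beta> ?e + (1 + tX \<beta> ?e)) * bb M \<le> WW"
    by (rule le_WW[OF _ tbW], simp add: T)+
  have unroll: "exc searchc s = (if scalar s ''Gbb'' \<noteq> 0 then bind_spmf (exc levelc (?pay s)) (exc searchc)
      else return_spmf (?pay s))" for s
    unfolding searchc_def exec.simps(6) by (subst loop.simps) simp
  note a0 = adv_charge[OF 1(4), of ?e]
  show ?case
  proof (cases "b = 0")
    case True
    show ?thesis unfolding True sched_0 search.simps
      by (rule ref_return[OF _ a0 WP]) (use True 1 unroll[of s] in \<open>simp_all add: found_def\<close>)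
  next
    case False
    define xs where "xs = (if \<tau> \<le> b then sched n' n' (b div 2) else sched n' (\<tau> div 2) b)"
    have sch: "sched n' \<tau> b = \<tau> # xs" using False 1(8) unfolding xs_def by (subst sched.simps) simp
    let ?s1 = "?pay s"
    note g1 = adv_good[OF a0]
    have p1: "params ?s1" using 1(5) by (simp add: params_def)
    have wrl: "x \<notin> wr levelc" if "x \<in> {''Gpp'', ''Gll'', ''Gkk'', ''Ghh''}" for x
      using that by (auto simp: levelc_def levA_def sdegc_def levB_def levC_def kstepc_def levD_def mainc_def levF_def forc_def
        samplec_def wr_explorec wr_hitc)
    have "ref ?s1 (moved ?s1 \<tau> b) levelc ?s1 (level \<tau>)"
      by (rule ref_level[OF okl WL g1 p1]) (use 1 in simp_all)
    then have "ref s found (Seq levelc searchc) ?s1 (search level (\<tau> # xs))"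
      unfolding search_Cons
    proof (rule ref_bind)
      fix s2 y assume s2: "s2 \<in> set_spmf (exc levelc ?s1)" "moved ?s1 \<tau> b s2 (fst y)" "cst ?s1 s2 (snd y)"
      note f2 = conjunct1[OF exec_frame[OF s2(1)], rule_format, OF wrl]
      have g2: "good s2" using s2(3) by (simp add: cst_def)
      have p2: "params s2" using p1 f2 by (simp add: params_def)
      show "ref s found searchc s2 (if fst y \<noteq> None then return_pmf (fst y, fst (snd y) + 1, snd (snd y))
         else map_pmf (\<lambda>z. (fst z, fst (snd y) + fst (snd z) + 1, snd (snd y) + snd (snd z))) (search level xs))"
      proof (cases "fst y")
        case (Some r)
        then have b2: "scalar s2 ''Gbb'' = 0" and f: "found (?pay s2) (fst y)"
          using s2(2) by (auto simp: moved_def found_def split: prod.splits)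
        note a3 = adv_charge[OF g2, of ?e]
        \<comment> \<open>After a success one abstract step pays for two tests of the guard, before
          and after the guess; the budget 2 * tb leaves room for both.\<close>
        have q: "time (?pay s2) \<le> time s2 + (1 + tX \<beta> ?e) * bb M" "time s2 \<le> time ?s1 + fst (snd y) * WW"
          "time ?s1 \<le> time s + (1 + tX \<beta> ?e) * bb M"
          using a3 s2(3) a0 by (auto simp: adv_def cst_def)
        have "time (?pay s2) \<le> time s + (fst (snd y) + 1) * WW"
          using q WP2 unfolding add_mult_distrib by linarith
        moreover have "queries (?pay s2) + pot (arr s) \<le> queries s + pot (arr (?pay s2)) + 2 * snd (snd y)"
          using s2(3) a0 a3 unfolding adv_def cst_def by simp
        ultimately have "cst s (?pay s2) (fst (snd y) + 1, snd (snd y))"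
          using adv_good[OF a3] unfolding cst_def by simp
        then show ?thesis using Some f unroll[of s2] b2 by (simp add: ref_def del: state_simps)
      next
        case None
        have m: "scalar s2 ''num'' = 0" "scalar s2 ''den'' = 0" "scalar s2 ''Gtt'' = (if \<tau> \<le> b then n else \<tau> div 2)"
          "scalar s2 ''Gbb'' = (if \<tau> \<le> b then b div 2 else b)"
          using s2(2) 1 unfolding None moved_def by simp_all
        have "ref s2 found searchc s2 (search level xs)"
        proof (cases "\<tau> \<le> b")
          case True
          show ?thesis unfolding xs_def if_P[OF True]
            by (rule 1(1)) (use True False 1 m g2 p2 n0 in auto)
        next
          case nb: False
          show ?thesis unfolding xs_def if_not_P[OF nb]
            by (rule 1(2)) (use nb False 1 m g2 p2 in auto)
        qed
        moreover have "cst s s2 ((1, 0) + snd y)" using cst_trans[OF cst_of_adv[OF a0 WP] s2(3)] .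
        ultimately have "ref s found searchc s2 (map_pmf (\<lambda>z. (fst z, ((1, 0) + snd y) + snd z)) (search level xs))"
          by (rule ref_map0)
        also have "map_pmf (\<lambda>z. (fst z, ((1, 0) + snd y) + snd z)) (search level xs) =
          map_pmf (\<lambda>z. (fst z, fst (snd y) + fst (snd z) + 1, snd (snd y) + snd (snd z))) (search level xs)"
          by (intro map_pmf_cong) (auto simp: prod_eq_iff)
        finally show ?thesis using None by simp
      qed
    qed
    then show ?thesis unfolding sch ref_def using unroll[of s] False 1(7) by simp
  qed
qed

end

section \<open>Initialization and total cost\<close>

text \<open>Obtained by evaluating \<^const>\<open>wE\<close> on the assigned expressions, in program order, with base \<open>n * P\<close>.\<close>

definition bexp :: "vname \<Rightarrow> nat" where
  "bexp x = (case map_of [(''Ggi'', 102), (''Gkk'', 100207), (''Ghh'', 135), (''Gsm'', 100210), (''Gsmx'', 100211),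
     (''Gsum'', 100211), (''Gmq'', 100210), (''Gma'', 100214), (''Gmb'', 100214), (''Gmh'', 100214), (''Gkap'', 100216),
     (''Gki'', 3), (''Gtq'', 2), (''Ggap'', 4), (''Grep'', 100218), (''Gdcap'', 100349), (''Ggk'', 100220),
     (''Gthr'', 200642), (''Gcap'', 200442), (''Gcnt'', 200442), (''Gnu'', 300663), (''Gde'', 200434),
     (''num'', 300663), (''den'', 200434), (''Ghc'', 200642),
     (''Hq'', 100224), (''Hi'', 10), (''Hr'', 3), (''Hj'', 100219),
     (''Mq'', 100224), (''Mi'', 10), (''Mr'', 3), (''Mj'', 100219)] x of None \<Rightarrow> 1 | Some k \<Rightarrow> k)"

definition constc :: com where
  "constc = Seq (Assign ''Ggi'' (emul (emul (Const 100) (Var ''Gll'')) (Var ''Gll'')))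
    (Seq (Assign ''Gkk'' (emul (emul (emul (emul (emul (Const 100000) (Var ''Gpp'')) (Var ''Gpp'')) (Var ''Gpp'')) (Var ''Ggi'')) (Var ''Ggi'')))
    (Seq (Assign ''Ghh'' (emul (emul (Const 32) (Var ''Gpp'')) (Var ''Ggi'')))
    (Seq (Assign ''Gtt'' (Var ''n'')) (Assign ''Gbb'' (Var ''n'')))))"

lemma okA_clamp [simp]: "okA \<beta> k (clamp a b) \<longleftrightarrow> wE \<beta> a \<le> k \<or> wE \<beta> b \<le> k"
  by (auto simp: okA_def clamp_def)

lemma okA_le [simp]: "wE \<beta> e \<le> k \<Longrightarrow> okA \<beta> k e"
  by (simp add: okA_def)

lemma okc_incc: "okc bexp incc" by (simp add: incc_def bexp_def)

lemma okc_exploreH: "okc bexp (explorec (CHR ''H'') incc)"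
  by (simp add: explorec_def edgec_def wedgec_def forc_def swapc_def nbrc_def pairc_def degc_def touchc_def
    roundE_def slotE_def precE_def idx_def okc_incc bexp_def)

lemma okc_constc: "okc bexp constc" by (simp add: constc_def bexp_def)


lemma okc_hitc: "okc bexp hitc"
  by (simp add: hitc_def lightc_def okc_exploreH) (simp add: bexp_def)

lemma okc_exploreM: "okc bexp (explorec (CHR ''M'') hitc)"
  by (simp add: explorec_def edgec_def wedgec_def forc_def swapc_def nbrc_def pairc_def degc_def touchc_def
    roundE_def slotE_def precE_def idx_def okc_hitc bexp_def)

lemma okc_searchc: "okc bexp searchc"
  by (simp add: searchc_def levelc_def mainc_def sdegc_def forc_def samplec_def okc_exploreM)
    (simp add: levA_def levB_def levC_def kstepc_def levD_def levF_def mhE_def bexp_def)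


section \<open>Initialization and the complete program\<close>

definition epsc :: com where
  "epsc = While (eeq (Var ''Geps'') (Const 0)) (Seq (Assign ''Gek'' (eadd (Var ''Gek'') (Const 1)))
     (Seq (EpsDigits ''Geps'' (Var ''Gek'')) (Assign ''Gpp'' (emul (Const 2) (Var ''Gpp'')))))"

definition logc :: com where
  "logc = While (Var ''Gnn'') (Seq (Assign ''Gnn'' (ediv (Var ''Gnn'') (Const 2))) (Assign ''Gll'' (eadd (Var ''Gll'') (Const 1))))"

definition initc :: com where
  "initc = Seq (Assign ''Gek'' (Const 1)) (Seq (EpsDigits ''Geps'' (Var ''Gek'')) (Seq (Assign ''Gpp'' (Const 2))
     (Seq epsc (Seq (Assign ''Gll'' (Const 1)) (Seq (Assign ''Gnn'' (ediv (Var ''n'') (Const 2))) logc)))))"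

text \<open>Below 3 vertices the output 0/0 is correct. From 3 on ln n \<ge> 1, so that powers of ln
  n can absorb constants.\<close>

definition program :: com where
  "program = Cond (eless (Var ''n'') (Const 3)) Skip (Seq initc (Seq constc searchc))"

lemma bits_le: "bits i \<le> i"
  by (rule bits_less) (rule less_exp)

lemma bits_exp: "bits (2 ^ k) \<le> k + 1"
  by (rule bits_less) simp

lemma bits_le_of_bool: "bits (of_bool b) \<le> 1"
  using bits_le[of "of_bool b"] by (cases b) auto

definition idle :: "state \<Rightarrow> state \<Rightarrow> nat \<Rightarrow> bool" where
  "idle s s' c \<longleftrightarrow> arr s' = arr s \<and> queries s' = queries s \<and> time s' \<le> time s + c"

text \<open>k is the place of the first binary digit 1 of \<epsilon>, so P = 2^k is at least
  1/\<epsilon> and below 2/\<epsilon>. Reading ever longer prefixes costs O(k^2) altogether.\<close>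

lemma epsc_det:
  fixes \<epsilon> :: real
  assumes k: "1 \<le> \<epsilon> * 2 ^ k" "\<And>i. i < k \<Longrightarrow> \<epsilon> * 2 ^ i < 1" and \<epsilon>: "0 < \<epsilon>"
  shows "i + j = k \<Longrightarrow> 1 \<le> i \<Longrightarrow> scalar s ''Gek'' = i \<Longrightarrow> scalar s ''Gpp'' = 2 ^ i \<Longrightarrow> scalar s ''Geps'' = nat \<lfloor>\<epsilon> * 2 ^ i\<rfloor> \<Longrightarrow>
    \<exists>s'. exec n \<epsilon> E nbr epsc s = return_spmf s' \<and> idle s s' ((j + 1) * (50 * (k + 1))) \<and>
      scalar s' = (scalar s)(''Gek'' := k, ''Gpp'' := 2 ^ k, ''Geps'' := nat \<lfloor>\<epsilon> * 2 ^ k\<rfloor>)"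
proof (induction j arbitrary: i s)
  let ?g = "eeq (Var ''Geps'') (Const 0)"
  let ?pay = "\<lambda>s. charge (1 + expr_time s ?g) s"
  let ?e1 = "eadd (Var ''Gek'') (Const 1)" and ?e2 = "emul (Const 2) (Var ''Gpp'')"
  let ?body = "Seq (Assign ''Gek'' ?e1) (Seq (EpsDigits ''Geps'' (Var ''Gek'')) (Assign ''Gpp'' ?e2))"
  have unroll: "exec n \<epsilon> E nbr epsc s = (if val s ?g \<noteq> 0
      then bind_spmf (exec n \<epsilon> E nbr ?body (?pay s)) (exec n \<epsilon> E nbr epsc) else return_spmf (?pay s))" for s
    unfolding epsc_def exec.simps(6) by (subst loop.simps) simp
  \<comment> \<open>The first nonzero prefix has value 1, so every number read has at most one
    bit.\<close>
  have "nat \<lfloor>\<epsilon> * 2 ^ i\<rfloor> \<le> 1" if "i \<le> k" "1 \<le> i" for i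
  proof -
    have "\<epsilon> * 2 ^ i < 2" using k(2)[of "i - 1"] that by (cases i) auto
    then show ?thesis by linarith
  qed
  then have b: "bits (nat \<lfloor>\<epsilon> * 2 ^ i\<rfloor>) \<le> 1" if "i \<le> k" "1 \<le> i" for i
    using bits_le[of "nat \<lfloor>\<epsilon> * 2 ^ i\<rfloor>"] that le_trans by blast
  have pay: "time (?pay s) \<le> time s + 10" if "scalar s ''Geps'' = nat \<lfloor>\<epsilon> * 2 ^ i\<rfloor>" "i \<le> k" "1 \<le> i" for i s
    using b[of i] bits_le[of 0] bits_le_of_bool[of "nat \<lfloor>\<epsilon> * 2 ^ i\<rfloor> = 0"] that
    by (simp add: bits_def floorlog_def)
  {
    case 0
    have "nat \<lfloor>\<epsilon> * 2 ^ k\<rfloor> \<noteq> 0" using k(1) by simp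
    then have "exec n \<epsilon> E nbr epsc s = return_spmf (?pay s)" using unroll[of s] 0 by simp
    moreover have "idle s (?pay s) ((0 + 1) * (50 * (k + 1)))" using pay[of s k] 0 by (auto simp: idle_def)
    moreover have "scalar (?pay s) = (scalar s)(''Gek'' := k, ''Gpp'' := 2 ^ k, ''Geps'' := nat \<lfloor>\<epsilon> * 2 ^ k\<rfloor>)"
      using 0 by (auto simp: fun_eq_iff)
    ultimately show ?case by blast
  next
    case (Suc j)
    have ik: "i < k" using Suc.prems(1) by simp
    have z: "nat \<lfloor>\<epsilon> * 2 ^ i\<rfloor> = 0" using k(2)[OF ik] by (simp add: floor_less_iff)
    let ?s1 = "?pay s"
    define s2 where "s2 = assign ''Gek'' (val ?s1 ?e1) (charge (expr_time ?s1 ?e1) ?s1)"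
    define s3 where "s3 = assign ''Geps'' (nat \<lfloor>\<epsilon> * 2 ^ val s2 (Var ''Gek'')\<rfloor>) (charge (expr_time s2 (Var ''Gek'') + val s2 (Var ''Gek'')) s2)"
    define s4 where "s4 = assign ''Gpp'' (val s3 ?e2) (charge (expr_time s3 ?e2) s3)"
    have ex: "exec n \<epsilon> E nbr ?body ?s1 = return_spmf s4" by (simp add: s4_def s3_def s2_def)
    have sc2: "scalar s2 = (scalar s)(''Gek'' := i + 1)" using Suc.prems by (simp add: s2_def)
    have sc3: "scalar s3 = (scalar s2)(''Geps'' := nat \<lfloor>\<epsilon> * 2 ^ (i + 1)\<rfloor>)" using sc2 by (simp add: s3_def)
    have sc4: "scalar s4 = (scalar s3)(''Gpp'' := 2 ^ (i + 1))" using sc3 sc2 Suc.prems by (simp add: s4_def)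
    have t2: "time s2 \<le> time ?s1 + 4 * (k + 2)"
    proof -
      have "bits (Suc i) \<le> k" using bits_le[of "Suc i"] ik by linarith
      moreover have "bits i \<le> k" using bits_le[of i] ik by linarith
      moreover have "bits (Suc 0) \<le> 1" using bits_le[of "Suc 0"] by simp
      ultimately show ?thesis using Suc.prems by (simp add: s2_def)
    qed
    have t3: "time s3 \<le> time s2 + (2 * k + 3)"
      using bits_le[of "Suc i"] b[of "i + 1"] ik sc2 by (simp add: s3_def)
    have t4: "time s4 \<le> time s3 + (3 * k + 12)"
      using bits_exp[of i] bits_exp[of "i + 1"] bits_le[of 2] ik sc3 sc2 Suc.prems by (simp add: s4_def)
    have t: "time s4 \<le> time s + 50 * (k + 1)" 
    proof -
      have "t4 \<le> t + 50 * (k + 1)" if "t1 \<le> t + 10" "t2 \<le> t1 + 4 * (k + 2)" "t3 \<le> t2 + (2 * k + 3)" "t4 \<le> t3 + (3 * k + 12)"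
        for t t1 t2 t3 t4 :: nat using that by presburger
      from this[OF pay[OF Suc.prems(5) less_imp_le[OF ik] Suc.prems(2)] t2 t3 t4] show ?thesis .
    qed
    obtain s' where s': "exec n \<epsilon> E nbr epsc s4 = return_spmf s'" "idle s4 s' ((j + 1) * (50 * (k + 1)))"
      "scalar s' = (scalar s4)(''Gek'' := k, ''Gpp'' := 2 ^ k, ''Geps'' := nat \<lfloor>\<epsilon> * 2 ^ k\<rfloor>)"
      by (atomize_elim, rule Suc.IH[of "i + 1"]) (use Suc.prems sc4 sc3 sc2 in simp_all)
    have "exec n \<epsilon> E nbr epsc s = return_spmf s'" using unroll[of s] Suc.prems z ex s'(1) by simp
    moreover have "idle s s' ((Suc j + 1) * (50 * (k + 1)))"
    proof -
      have "arr s4 = arr s" "queries s4 = queries s" by (simp_all add: s4_def s3_def s2_def)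
      then show ?thesis using s'(2) t by (simp add: idle_def)
    qed
    moreover have "scalar s' = (scalar s)(''Gek'' := k, ''Gpp'' := 2 ^ k, ''Geps'' := nat \<lfloor>\<epsilon> * 2 ^ k\<rfloor>)"
      unfolding s'(3) sc4 sc3 sc2 by (auto simp: fun_eq_iff)
    ultimately show ?case by blast
  }
qed

lemma logc_det:
  shows "scalar s ''Gnn'' = y \<Longrightarrow> y < 2 ^ j \<Longrightarrow> (0 < j \<Longrightarrow> 2 ^ (j - 1) \<le> y) \<Longrightarrow> j \<le> l \<Longrightarrow> scalar s ''Gll'' + j \<le> l \<Longrightarrow>
    \<exists>s'. exec n \<epsilon> E nbr logc s = return_spmf s' \<and> idle s s' ((j + 1) * (20 * (l + 1))) \<and>
      scalar s' = (scalar s)(''Gnn'' := 0, ''Gll'' := scalar s ''Gll'' + j)"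
proof (induction j arbitrary: y s)
  let ?g = "Var ''Gnn''"
  let ?pay = "\<lambda>s. charge (1 + expr_time s ?g) s"
  let ?e1 = "ediv (Var ''Gnn'') (Const 2)" and ?e2 = "eadd (Var ''Gll'') (Const 1)"
  let ?body = "Seq (Assign ''Gnn'' ?e1) (Assign ''Gll'' ?e2)"
  have unroll: "exec n \<epsilon> E nbr logc s = (if val s ?g \<noteq> 0
      then bind_spmf (exec n \<epsilon> E nbr ?body (?pay s)) (exec n \<epsilon> E nbr logc) else return_spmf (?pay s))" for s
    unfolding logc_def exec.simps(6) by (subst loop.simps) simp
  {
    case 0
    then have y: "scalar s ''Gnn'' = 0" by simp
    then have "exec n \<epsilon> E nbr logc s = return_spmf (?pay s)" using unroll[of s] by simp
    moreover have "idle s (?pay s) ((0 + 1) * (20 * (l + 1)))" using y bits_le[of 0] by (auto simp: idle_def)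
    moreover have "scalar (?pay s) = (scalar s)(''Gnn'' := 0, ''Gll'' := scalar s ''Gll'' + 0)"
      using y by (auto simp: fun_eq_iff)
    ultimately show ?case by blast
  next
    case (Suc j)
    let ?s1 = "?pay s"
    define s2 where "s2 = assign ''Gnn'' (val ?s1 ?e1) (charge (expr_time ?s1 ?e1) ?s1)"
    define s3 where "s3 = assign ''Gll'' (val s2 ?e2) (charge (expr_time s2 ?e2) s2)"
    have ex: "exec n \<epsilon> E nbr ?body ?s1 = return_spmf s3" by (simp add: s3_def s2_def)
    have sc2: "scalar s2 = (scalar s)(''Gnn'' := y div 2)" using Suc.prems by (simp add: s2_def)
    have sc3: "scalar s3 = (scalar s2)(''Gll'' := scalar s ''Gll'' + 1)" using sc2 by (simp add: s3_def)
    have by': "bits y \<le> l" "bits (y div 2) \<le> l"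
      using bits_less[OF Suc.prems(2)] bits_less[OF le_less_trans[OF div_le_dividend Suc.prems(2), of 2]] Suc.prems(4) by auto
    have b2: "bits 2 \<le> 2" by (rule bits_le)
    have t2: "time s2 \<le> time s + (4 * l + 10)"
      using by' b2 Suc.prems by (simp add: s2_def)
    have t3: "time s3 \<le> time s2 + (3 * l + 10)"
      using bits_le[of "scalar s ''Gll''"] bits_le[of "Suc (scalar s ''Gll'')"] bits_le[of "Suc 0"] Suc.prems sc2 by (simp add: s3_def)
    have y0: "y \<noteq> 0" using Suc.prems(3) by (metis zero_less_Suc diff_Suc_1 le_zero_eq power_not_zero zero_neq_numeral)
    obtain s' where s': "exec n \<epsilon> E nbr logc s3 = return_spmf s'" "idle s3 s' ((j + 1) * (20 * (l + 1)))"
      "scalar s' = (scalar s3)(''Gnn'' := 0, ''Gll'' := scalar s3 ''Gll'' + j)"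
    proof (atomize_elim, rule Suc.IH)
      show "scalar s3 ''Gnn'' = y div 2" by (simp add: sc3 sc2)
      show "y div 2 < 2 ^ j" using Suc.prems(2) by (simp add: less_mult_imp_div_less mult.commute)
      show "2 ^ (j - 1) \<le> y div 2" if "0 < j"
      proof -
        have "2 ^ (j - 1) * 2 = (2::nat) ^ j" using that by (cases j) auto
        then have "2 ^ (j - 1) * 2 \<le> y" using Suc.prems(3) by simp
        then show ?thesis by linarith
      qed
      show "j \<le> l" "scalar s3 ''Gll'' + j \<le> l" using Suc.prems by (simp_all add: sc3 sc2)
    qed
    have "exec n \<epsilon> E nbr logc s = return_spmf s'" using unroll[of s] Suc.prems y0 ex s'(1) by simp
    moreover have "idle s s' ((Suc j + 1) * (20 * (l + 1)))"
    proof -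
      have "arr s3 = arr s" "queries s3 = queries s" by (simp_all add: s3_def s2_def)
      then show ?thesis using s'(2) t2 t3 by (simp add: idle_def)
    qed
    moreover have "scalar s' = (scalar s)(''Gnn'' := 0, ''Gll'' := scalar s ''Gll'' + Suc j)"
      unfolding s'(3) sc3 sc2 by (auto simp: fun_eq_iff)
    ultimately show ?case by blast
  }
qed

lemma initc_det:
  fixes \<epsilon> :: real
  assumes k: "1 \<le> k" "1 \<le> \<epsilon> * 2 ^ k" "\<And>i. i < k \<Longrightarrow> \<epsilon> * 2 ^ i < 1" and \<epsilon>: "0 < \<epsilon>"
    and L: "2 \<le> L" "2 ^ (L - 1) \<le> n" "n < 2 ^ L"
  shows "\<exists>s'. exec n \<epsilon> E nbr initc (charge c (initial n)) = return_spmf s' \<and>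
      idle (initial n) s' (c + 100 * (k + L + 1) * (k + L + 1)) \<and>
      scalar s' = (\<lambda>_. 0)(''n'' := n, ''Gek'' := k, ''Gpp'' := 2 ^ k, ''Geps'' := nat \<lfloor>\<epsilon> * 2 ^ k\<rfloor>, ''Gll'' := L, ''Gnn'' := 0)"
proof -
  let ?s0 = "charge c (initial n)"
  define s1 where "s1 = assign ''Gek'' 1 (charge (expr_time ?s0 (Const 1)) ?s0)"
  define s2 where "s2 = assign ''Geps'' (nat \<lfloor>\<epsilon> * 2 ^ val s1 (Var ''Gek'')\<rfloor>) (charge (expr_time s1 (Var ''Gek'') + val s1 (Var ''Gek'')) s1)"
  define s3 where "s3 = assign ''Gpp'' 2 (charge (expr_time s2 (Const 2)) s2)"
  have sc3: "scalar s3 = (\<lambda>_. 0)(''n'' := n, ''Gek'' := 1, ''Geps'' := nat \<lfloor>\<epsilon> * 2 ^ 1\<rfloor>, ''Gpp'' := 2)"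
    by (simp add: s3_def s2_def s1_def initial_def)
  have "\<epsilon> < 1" using k(3)[of 0] k(1) by simp
  then have "nat \<lfloor>\<epsilon> * 2\<rfloor> \<le> 1" by linarith
  then have be: "bits (nat \<lfloor>\<epsilon> * 2\<rfloor>) \<le> 1" using bits_le[of "nat \<lfloor>\<epsilon> * 2\<rfloor>"] by linarith
  have id3: "arr s3 = arr (initial n)" "queries s3 = queries (initial n)" by (simp_all add: s3_def s2_def s1_def)
  have t3: "time s3 \<le> time (initial n) + c + 20"
    using be bits_le[of 1] bits_le[of 2] by (simp add: s3_def s2_def s1_def)
  obtain s4 where s4: "exec n \<epsilon> E nbr epsc s3 = return_spmf s4" "idle s3 s4 ((k - 1 + 1) * (50 * (k + 1)))"
      "scalar s4 = (scalar s3)(''Gek'' := k, ''Gpp'' := 2 ^ k, ''Geps'' := nat \<lfloor>\<epsilon> * 2 ^ k\<rfloor>)"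
    by (atomize_elim, rule epsc_det[OF k(2,3) \<epsilon>, of 1]) (use k(1) sc3 in simp_all)
  define s5 where "s5 = assign ''Gll'' 1 (charge (expr_time s4 (Const 1)) s4)"
  define s6 where "s6 = assign ''Gnn'' (n div 2) (charge (expr_time s5 (ediv (Var ''n'') (Const 2))) s5)"
  have sc6: "scalar s6 = (scalar s4)(''Gll'' := 1, ''Gnn'' := n div 2)" by (simp add: s6_def s5_def)
  have n4: "scalar s5 ''n'' = n" by (simp add: s5_def s4(3) sc3)
  have id6: "arr s6 = arr s4" "queries s6 = queries s4" by (simp_all add: s6_def s5_def)
  have "bits n \<le> L" "bits (n div 2) \<le> L" using bits_less[OF L(3)] bits_less[of "n div 2" L] L(3) by auto
  then have t6: "time s6 \<le> time s4 + (3 * L + 20)"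
    using bits_le[of 1] bits_le[of 2] n4 by (simp add: s6_def) (simp add: s5_def)
  have pw: "2 ^ (L - 1 - 1) \<le> n div 2" "n div 2 < 2 ^ (L - 1)"
  proof -
    obtain l where l: "L = Suc (Suc l)" using L(1) by (metis Suc_le_D numeral_2_eq_2 Suc_le_mono)
    show "2 ^ (L - 1 - 1) \<le> n div 2" "n div 2 < 2 ^ (L - 1)" using L(2,3) unfolding l by simp_all
  qed
  obtain s7 where s7: "exec n \<epsilon> E nbr logc s6 = return_spmf s7" "idle s6 s7 ((L - 1 + 1) * (20 * (L + 1)))"
      "scalar s7 = (scalar s6)(''Gnn'' := 0, ''Gll'' := scalar s6 ''Gll'' + (L - 1))"
    by (atomize_elim, rule logc_det[of s6 "n div 2" "L - 1" L]) (use pw L(1) sc6 in simp_all)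
  have "exec n \<epsilon> E nbr initc ?s0 = return_spmf s7"
  proof -
    have e1: "exec n \<epsilon> E nbr (Assign ''Gek'' (Const 1)) ?s0 = return_spmf s1" by (simp add: s1_def)
    have e2: "exec n \<epsilon> E nbr (EpsDigits ''Geps'' (Var ''Gek'')) s1 = return_spmf s2" by (simp add: s2_def)
    have e3: "exec n \<epsilon> E nbr (Assign ''Gpp'' (Const 2)) s2 = return_spmf s3" by (simp add: s3_def)
    have e5: "exec n \<epsilon> E nbr (Assign ''Gll'' (Const 1)) s4 = return_spmf s5" by (simp add: s5_def)
    have e6: "exec n \<epsilon> E nbr (Assign ''Gnn'' (ediv (Var ''n'') (Const 2))) s5 = return_spmf s6"
      by (simp add: s6_def n4)
    show ?thesis unfolding initc_def by (simp only: exec.simps(4) e1 e2 e3 s4(1) e5 e6 s7(1) return_bind_spmf)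
  qed
  moreover have "idle (initial n) s7 (c + 100 * (k + L + 1) * (k + L + 1))"
  proof -
    have "time s7 \<le> time (initial n) + c + 20 + k * (50 * (k + 1)) + (3 * L + 20) + L * (20 * (L + 1))"
      using s7(2) s4(2) t3 t6 k(1) L(1) unfolding idle_def by simp
    also have "\<dots> \<le> time (initial n) + (c + 100 * (k + L + 1) * (k + L + 1))"
      by (simp add: algebra_simps)
    finally show ?thesis using s7(2) s4(2) id3 id6 by (simp add: idle_def)
  qed
  moreover have "scalar s7 = (\<lambda>_. 0)(''n'' := n, ''Gek'' := k, ''Gpp'' := 2 ^ k, ''Geps'' := nat \<lfloor>\<epsilon> * 2 ^ k\<rfloor>, ''Gll'' := L, ''Gnn'' := 0)"
    unfolding s7(3) sc6 s4(3) sc3 using L(1) by (auto simp: fun_eq_iff)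
  ultimately show ?thesis by blast
qed


text \<open>D has full mass, so the coupled program diverges with probability 0 and the infinite
  cost of nontermination does not arise.\<close>

lemma expected_cost_le:
  fixes h :: "'a \<Rightarrow> real"
  assumes r: "rel_spmf R p (spmf_of_pmf D)" and h: "\<And>s x. R s x \<Longrightarrow> real (f s) \<le> h x" and D: "fin D"
  shows "expected_cost f p \<le> ennreal (ev D h)"
proof -
  obtain pq where pq: "\<And>x y. (x, y) \<in> set_pmf pq \<Longrightarrow> rel_option R x y" "map_pmf fst pq = p" "map_pmf snd pq = spmf_of_pmf D"
    using r unfolding rel_pmf.simps by blast
  let ?F = "\<lambda>r. case r of None \<Rightarrow> \<top> | Some s \<Rightarrow> (of_nat (f s) :: ennreal)"
  let ?H = "\<lambda>r. case r of None \<Rightarrow> \<top> | Some x \<Rightarrow> ennreal (max 0 (h x))"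
  have h0: "0 \<le> h x" if "x \<in> set_pmf D" for x
  proof -
    have "Some x \<in> set_pmf (map_pmf snd pq)" using that unfolding pq(3) by (simp add: spmf_of_pmf_def)
    then obtain y where "(y, Some x) \<in> set_pmf pq" by auto
    then obtain s where "R s x" using pq(1)[of y "Some x"] by (cases y) auto
    then show ?thesis using h[of s x] of_nat_0_le_iff[of "f s"] by linarith
  qed
  have "expected_cost f p = (\<integral>\<^sup>+ z. ?F (fst z) \<partial>measure_pmf pq)"
    unfolding expected_cost_def pq(2)[symmetric] infinity_ennreal_def by simp
  also have "\<dots> \<le> (\<integral>\<^sup>+ z. ?H (snd z) \<partial>measure_pmf pq)"
  proof (intro nn_integral_mono_AE, unfold AE_measure_pmf_iff, intro ballI)
    fix z assume "z \<in> set_pmf pq"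
    then have "rel_option R (fst z) (snd z)" using pq(1)[of "fst z" "snd z"] by simp
    then show "?F (fst z) \<le> ?H (snd z)"
    proof (cases rule: option.rel_cases)
      case (Some s x)
      have "ennreal (real (f s)) \<le> ennreal (max 0 (h x))" using h[OF Some(3)] by (intro ennreal_leI) simp
      then show ?thesis using Some by (simp add: ennreal_of_nat_eq_real_of_nat)
    qed simp
  qed
  also have "\<dots> = (\<integral>\<^sup>+ z. ?H z \<partial>measure_pmf (spmf_of_pmf D))" unfolding pq(3)[symmetric] by simp
  also have "\<dots> = (\<integral>\<^sup>+ x. ennreal (max 0 (h x)) \<partial>measure_pmf D)" by (simp add: spmf_of_pmf_def)
  also have "\<dots> = (\<integral>\<^sup>+ x. ennreal (h x) \<partial>measure_pmf D)"
    by (intro nn_integral_cong_AE) (use h0 in \<open>auto simp: AE_measure_pmf_iff max_absorb2\<close>)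
  also have "\<dots> = ennreal (ev D h)"
    by (intro nn_integral_eq_integral) (use D h0 in \<open>auto simp: AE_measure_pmf_iff intro: integrable_measure_pmf_finite\<close>)
  finally show ?thesis .
qed

lemma measure_rel_ge:
  assumes r: "rel_spmf R p (spmf_of_pmf D)" and h: "\<And>s x. R s x \<Longrightarrow> x \<notin> B \<Longrightarrow> s \<in> A"
  shows "1 - measure_pmf.prob D B \<le> measure (measure_spmf p) A"
proof -
  have "rel_spmf R\<inverse>\<inverse> (spmf_of_pmf D) p"
    using r by (simp add: option.rel_conversep pmf.rel_conversep)
  from rel_spmf_measureD[OF this, of "- B"]
  have "measure (measure_spmf (spmf_of_pmf D)) (- B) \<le> measure (measure_spmf p) {y. \<exists>x\<in>- B. R y x}" by simp
  also have "\<dots> \<le> measure (measure_spmf p) A"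
    by (rule finite_measure.finite_measure_mono) (use h measure_spmf.finite_measure_axioms in auto)
  also have "measure (measure_spmf (spmf_of_pmf D)) (- B) = 1 - measure_pmf.prob D B"
    using measure_pmf.prob_compl[of B D] by (simp add: measure_spmf_spmf_of_pmf Compl_eq_Diff_UNIV)
  finally show ?thesis .
qed

section \<open>Final assembly: accuracy, costs and constants\<close>

locale counting = algorithm n E nbr \<epsilon> bexp "n * P" "2 * tb bexp searchc * bb (n * P)" P L
  for n E nbr \<epsilon> P L +
  fixes k :: nat
  assumes n3: "3 \<le> n" and \<epsilon>: "0 < \<epsilon>" and k: "1 \<le> k" "1 \<le> \<epsilon> * 2 ^ k" "\<And>i. i < k \<Longrightarrow> \<epsilon> * 2 ^ i < 1" and Pk: "P = 2 ^ k"
begin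

abbreviation "MM \<equiv> n * P"
abbreviation "W1 \<equiv> 2 * tb bexp searchc * bb MM"

text \<open>Time until the search starts; from then on time is counted in steps of length
  \<open>W1\<close>.\<close>

definition "T0 = L + 11 + 100 * (k + L + 1) * (k + L + 1) + tb bexp constc * bb MM"

definition outcome_rel :: "state \<Rightarrow> answer \<Rightarrow> bool" where
  "outcome_rel s x \<longleftrightarrow> found s (fst x) \<and> time s \<le> T0 + fst (snd x) * W1 \<and> queries s \<le> 6 * m + 2 * snd (snd x) \<and>
     queries s \<le> time s"

lemma L_le_n: "L \<le> n"
  using less_exp[of "L - 1"] L by linarith

lemma constc_det:
  assumes "good s" "scalar s ''Gpp'' = P" "scalar s ''Gll'' = L"
  obtains s' where "det s constc s'" "scalar s' = (scalar s)(''Ggi'' := Gi, ''Gkk'' := K, ''Ghh'' := Hc, ''Gtt'' := n, ''Gbb'' := n)"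
proof -
  have n: "scalar s ''n'' = n" using assms(1) by (simp add: good_def)
  note ok = okc_constc[unfolded constc_def]
  obtain s1 where s1: "det s (Assign ''Ggi'' (emul (emul (Const 100) (Var ''Gll'')) (Var ''Gll''))) s1"
    "scalar s1 = (scalar s)(''Ggi'' := Gi)"
    by (atomize_elim, rule det_assign[OF assms(1)]) (use assms ok in \<open>auto simp: Gi_def\<close>)
  obtain s2 where s2: "det s1 (Assign ''Gkk'' (emul (emul (emul (emul (emul (Const 100000) (Var ''Gpp'')) (Var ''Gpp'')) (Var ''Gpp'')) (Var ''Ggi'')) (Var ''Ggi''))) s2"
    "scalar s2 = (scalar s1)(''Gkk'' := K)"
    by (atomize_elim, rule det_assign[OF det_good[OF s1(1)]]) (use assms ok s1 in \<open>auto simp: K_def\<close>)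
  obtain s3 where s3: "det s2 (Assign ''Ghh'' (emul (emul (Const 32) (Var ''Gpp'')) (Var ''Ggi''))) s3"
    "scalar s3 = (scalar s2)(''Ghh'' := Hc)"
    by (atomize_elim, rule det_assign[OF det_good[OF s2(1)]]) (use assms ok s1 s2 in \<open>auto simp: Hc_def\<close>)
  obtain s4 where s4: "det s3 (Assign ''Gtt'' (Var ''n'')) s4" "scalar s4 = (scalar s3)(''Gtt'' := n)"
    by (atomize_elim, rule det_assign[OF det_good[OF s3(1)]]) (use n ok s1 s2 s3 in auto)
  obtain s5 where s5: "det s4 (Assign ''Gbb'' (Var ''n'')) s5" "scalar s5 = (scalar s4)(''Gbb'' := n)"
    by (atomize_elim, rule det_assign[OF det_good[OF s4(1)]]) (use n ok s1 s2 s3 s4 in auto)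
  show thesis
    by (rule that[of s5])
      (use det_seq[OF s1(1) det_seq[OF s2(1) det_seq[OF s3(1) det_seq[OF s4(1) s5(1)]]]] s1 s2 s3 s4 s5 in \<open>auto simp: constc_def\<close>)
qed

lemma run_rel: "rel_spmf outcome_rel (run program n \<epsilon> E nbr) (spmf_of_pmf (search lev guesses))"
proof -
  let ?c = "eless (Var ''n'') (Const 3)"
  let ?s0 = "charge (1 + expr_time (initial n) ?c) (initial n)"
  obtain s1 where s1: "exc initc ?s0 = return_spmf s1"
    "idle (initial n) s1 (1 + expr_time (initial n) ?c + 100 * (k + L + 1) * (k + L + 1))"
    "scalar s1 = (\<lambda>_. 0)(''n'' := n, ''Gek'' := k, ''Gpp'' := 2 ^ k, ''Geps'' := nat \<lfloor>\<epsilon> * 2 ^ k\<rfloor>, ''Gll'' := L, ''Gnn'' := 0)"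
    using initc_det[OF k(1-3) \<epsilon> L, of E nbr] by blast
  have a1: "arr s1 = (\<lambda>_ _. 0)" "queries s1 = 0" using s1(2) by (simp_all add: idle_def initial_def)
  have "bits n \<le> L" using bits_less[OF L(3)] .
  then have t1: "time s1 \<le> L + 11 + 100 * (k + L + 1) * (k + L + 1)"
    using s1(2) bits_le[of 3] bits_le_of_bool[of "n < 3"] by (simp add: idle_def initial_def)
  have C: "CI (arr s1)" and p0: "pot (arr s1) = 0" by (simp_all add: CI_def a1 pot_def)
  have "bnd bexp MM s1" unfolding bnd_def
  proof (intro conjI allI)
    fix x
    have "nat \<lfloor>\<epsilon> * 2 ^ k\<rfloor> \<le> 1"
    proof -
      have "\<epsilon> * 2 ^ k < 2" using k(3)[of "k - 1"] k(1) by (cases k) auto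
      then show ?thesis by linarith
    qed
    moreover have "1 \<le> MM" "n \<le> MM" "2 ^ k \<le> MM" using n3 Pk by (simp_all add: Suc_le_eq)
    moreover have "k \<le> 2 ^ k" using less_exp[of k] by simp
    ultimately have "nat \<lfloor>\<epsilon> * 2 ^ k\<rfloor> \<le> MM" "k \<le> MM" "L \<le> MM" "n \<le> MM" "2 ^ k \<le> MM"
      using L_le_n by (blast intro: order_trans)+
    then show "scalar s1 x \<le> MM ^ bexp x" by (simp add: s1(3) bexp_def)
  qed (simp add: a1)
  then have g1: "good s1" using C by (simp add: good_def s1(3))
  obtain s2 where s2: "det s1 constc s2" "scalar s2 = (scalar s1)(''Ggi'' := Gi, ''Gkk'' := K, ''Ghh'' := Hc, ''Gtt'' := n, ''Gbb'' := n)"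
    by (rule constc_det[OF g1]) (simp_all add: s1(3) Pk)
  have t2: "time s2 \<le> T0" and q2: "queries s2 \<le> pot (arr s2)"
    using s2(1) t1 a1 p0 by (simp_all add: T0_def det_def adv_def)
  have "ref s2 found searchc s2 (search level (sched n n n))"
    by (rule ref_search[OF okc_searchc order_refl refl det_good[OF s2(1)]])
      (use n3 in \<open>simp_all add: s2(2) s1(3) params_def Pk[symmetric]\<close>)
  then have r: "rel_spmf (\<lambda>s' x. found s' (fst x) \<and> cst s2 s' (snd x)) (exc searchc s2) (spmf_of_pmf (search lev guesses))"
    unfolding ref_def search_lev .
  have e: "run program n \<epsilon> E nbr = exc searchc s2"
    unfolding run_def program_def using n3 s1(1) s2(1) by (simp add: det_def initial_def)
  show ?thesis unfolding e
  proof (rule rel_spmf_mono_strong[OF r])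
    fix s' x assume h: "found s' (fst x) \<and> cst s2 s' (snd x)" and s': "s' \<in> set_spmf (exc searchc s2)"
    \<comment> \<open>Applied to the whole program, for which both counters start at 0.\<close>
    from exec_frame[of s' n \<epsilon> E nbr program "initial n"] s' have "queries s' \<le> time s'"
      unfolding e[unfolded run_def, symmetric] by (simp add: initial_def)
    moreover have "pot (arr s') \<le> 6 * m" using h by (intro pot_le) (simp add: cst_def good_def)
    ultimately show "outcome_rel s' x" using h t2 q2 unfolding outcome_rel_def cst_def by linarith
  qed
qed

lemma inverse_P: "1 / P \<le> \<epsilon>"
  using k(2) by (simp add: Pk divide_le_eq)

lemma accurate: "5 / 6 \<le> measure (measure_spmf (run program n \<epsilon> E nbr))
    {s. (1 - \<epsilon>) * real t \<le> result s \<and> result s \<le> (1 + \<epsilon>) * real t}"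
proof (cases "t = 0")
  case True
  have "1 - measure_pmf.prob (search lev guesses) {y. fst y \<noteq> None} \<le> measure (measure_spmf (run program n \<epsilon> E nbr))
    {s. (1 - \<epsilon>) * real t \<le> result s \<and> result s \<le> (1 + \<epsilon>) * real t}"
    by (rule measure_rel_ge[OF run_rel]) (auto simp: outcome_rel_def found_def result_def True split: option.splits)
  then show ?thesis unfolding search_no_triangles[OF True] by simp
next
  case False
  then have t: "1 \<le> t" by simp
  have "1 - measure_pmf.prob (search lev guesses) {y. fst y \<in> insert None (Some ` Bad)} \<le> measure (measure_spmf (run program n \<epsilon> E nbr))
    {s. (1 - \<epsilon>) * real t \<le> result s \<and> result s \<le> (1 + \<epsilon>) * real t}"
  proof (rule measure_rel_ge[OF run_rel])
    fix s and x :: answer assume h: "outcome_rel s x" "x \<notin> {y. fst y \<in> insert None (Some ` Bad)}"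
    then obtain r where r: "fst x = Some r" "r \<notin> Bad" by (cases "fst x") auto
    have "result s = real (fst r) / real (snd r)"
      using h(1) r(1) by (auto simp: outcome_rel_def found_def result_def split: prod.splits)
    then have "\<bar>result s - t\<bar> \<le> 1 / P * t" using r(2) n3 by (simp add: Bad_def not_less)
    also have "\<dots> \<le> \<epsilon> * t" by (intro mult_right_mono inverse_P) simp
    finally have "\<bar>result s - t\<bar> \<le> \<epsilon> * t" .
    then show "s \<in> {s. (1 - \<epsilon>) * real t \<le> result s \<and> result s \<le> (1 + \<epsilon>) * real t}"
      unfolding mem_Collect_eq left_diff_distrib distrib_right by (simp add: abs_le_iff)
  qed
  then show ?thesis using search_fail[OF t] by linarith
qed


text \<open>All quantities are expressed by the single number P L. The exponent 9 comes from the
  time: 8 from \<open>K * Hc\<close> and the L^2 guesses, and one from the bit length.\<close>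

lemma parameter_sizes:
  shows "real (bb MM) \<le> 2 * (real P * L)" "real T0 \<le> (912 + 2 * real (tb bexp constc)) * (real P * L) ^ 9"
    "real K * Hc * (real L * L) \<le> 3200000000000 * (real P * L) ^ 8" "real K * (real L * L) \<le> 1000000000 * (real P * L) ^ 9"
    "4 \<le> real P * L"
proof -
  let ?X = "real P * L"
  have PL: "2 \<le> real P" "2 \<le> real L" using P L by simp_all
  have PX: "real P \<le> ?X" using mult_left_mono[of 1 "real L" "real P"] PL by simp
  have LX: "real L \<le> ?X" using mult_right_mono[of 1 "real P" "real L"] PL by simp
  show X4: "4 \<le> ?X" using mult_mono[of 2 "real P" 2 "real L"] PL by simp
  have "n * P < 2 ^ L * 2 ^ P" using L(3) less_exp[of P] P by (intro mult_strict_mono) auto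
  then have "bits MM \<le> L + P" by (intro bits_less) (simp add: power_add)
  then have b: "real (bb MM) \<le> 1 + real L + real P" by (simp add: bb_def)
  have "0 \<le> (real P - 1) * (real L - 1)" using PL by simp
  then have "1 + real L + real P \<le> 2 + ?X" by (simp add: algebra_simps)
  with b X4 show bb: "real (bb MM) \<le> 2 * ?X" by linarith
  have kP: "real k \<le> real P" using less_exp[of k] by (simp add: Pk flip: of_nat_power)
  have "real k + L + 1 \<le> 3 * ?X" using kP PX LX X4 by linarith
  then have "(real k + L + 1) * (real k + L + 1) \<le> (3 * ?X) * (3 * ?X)" by (intro mult_mono) auto
  moreover have "100 * a \<le> 900 * x\<^sup>2" if "a \<le> (3 * x) * (3 * x)" for a x :: real
    using that by (simp add: power2_eq_square)
  ultimately have q: "100 * ((real k + L + 1) * (real k + L + 1)) \<le> 900 * ?X\<^sup>2" by blast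
  have XX: "?X \<le> ?X\<^sup>2" using self_le_power[of ?X 2] X4 by simp
  have "real (tb bexp constc) * bb MM \<le> real (tb bexp constc) * (2 * ?X\<^sup>2)"
    using bb XX by (intro mult_left_mono) auto
  moreover have "real L + 11 \<le> 12 * ?X\<^sup>2" using LX X4 XX by linarith
  ultimately have "(real L + 11) + 100 * ((real k + L + 1) * (real k + L + 1)) + real (tb bexp constc) * bb MM
      \<le> 12 * ?X\<^sup>2 + 900 * ?X\<^sup>2 + real (tb bexp constc) * (2 * ?X\<^sup>2)"
    by (intro add_mono q)
  then have "real T0 \<le> 12 * ?X\<^sup>2 + 900 * ?X\<^sup>2 + real (tb bexp constc) * (2 * ?X\<^sup>2)"
    by (simp only: T0_def of_nat_add of_nat_mult of_nat_numeral of_nat_1 mult.assoc)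
  also have "\<dots> = (912 + 2 * real (tb bexp constc)) * ?X\<^sup>2" by (simp add: algebra_simps)
  also have "\<dots> \<le> (912 + 2 * real (tb bexp constc)) * ?X ^ 9"
    using X4 by (intro mult_left_mono power_increasing) auto
  finally show "real T0 \<le> (912 + 2 * real (tb bexp constc)) * ?X ^ 9" .
  have K: "real K * (real L * L) = 1000000000 * (real P ^ 3 * real L ^ 6)"
  proof -
    have "100000 * x * x * x * (100 * y * y) * (100 * y * y) * (y * y) = 1000000000 * (x ^ 3 * y ^ 6)" for x y :: real
      by algebra
    from this[of P L] show ?thesis by (simp only: K_def Gi_def of_nat_mult of_nat_numeral)
  qed
  have H: "real K * Hc * (real L * L) = 3200000000000 * (real P ^ 4 * real L ^ 8)"
  proof -
    have "100000 * x * x * x * (100 * y * y) * (100 * y * y) * (32 * x * (100 * y * y)) * (y * y) = 3200000000000 * (x ^ 4 * y ^ 8)"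
      for x y :: real by algebra
    from this[of P L] show ?thesis by (simp only: K_def Gi_def Hc_def of_nat_mult of_nat_numeral)
  qed
  have "real P ^ 4 * real L ^ 8 \<le> real P ^ 8 * real L ^ 8"
    using PL by (intro mult_right_mono power_increasing) auto
  then show "real K * Hc * (real L * L) \<le> 3200000000000 * ?X ^ 8" unfolding H power_mult_distrib by simp
  have "real P ^ 3 * real L ^ 6 \<le> real P ^ 9 * real L ^ 9"
    using PL by (intro mult_mono power_increasing) auto
  then show "real K * (real L * L) \<le> 1000000000 * ?X ^ 9" unfolding K power_mult_distrib by simp
qed

text \<open>It depends on the program text and its static bounds only, not on the parameters of the
  locale; the theorem asks for one constant for all inputs.\<close>

definition C1 :: real where
  "C1 = 1000 + 2 * real (tb bexp constc) + 126000000000000 + 2304000000000000000000 * real (tb bexp searchc)"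

lemma fin_search_lev: "fin (search lev guesses)"
  by (rule fin_search) (rule fin_lev)

text \<open>Queries are bounded by the time as well as by 6m plus twice the samples; the comparison
  of m with Z decides which bound is used.\<close>

lemma costs:
  assumes t: "1 \<le> t"
  defines "Y \<equiv> n / root 3 t" and "Z \<equiv> m * sqrt m / t"
  shows "expected_cost time (run program n \<epsilon> E nbr) \<le> ennreal ((Y + Z) * (C1 * (real P * L) ^ 9))"
    "expected_cost queries (run program n \<epsilon> E nbr) \<le> ennreal ((Y + min (real m) Z) * (C1 * (real P * L) ^ 9))"
proof -
  let ?X = "real P * L" and ?D = "search lev guesses"
  note r = root_facts[OF t] and s = parameter_sizes
  have Y1: "1 \<le> Y" using r by (simp add: Y_def)
  have Z0: "0 \<le> Z" by (simp add: Z_def)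
  have C1: "C1 \<ge> 912 + 2 * real (tb bexp constc) + 2304000000000000000000 * real (tb bexp searchc)"
    "C1 \<ge> 6" "C1 \<ge> 126000000000000" by (simp_all add: C1_def)
  have X9: "1 \<le> ?X ^ 9" using s(5) by (intro one_le_power) simp
  have steps: "ev ?D (\<lambda>z. real (fst (snd z))) \<le> 576000000000000000000 * ?X ^ 8 * (Y + Z)"
  proof -
    have "ev ?D (\<lambda>z. real (fst (snd z))) \<le> 180000000 * (real K * Hc * (real L * L)) * (Y + Z)"
      using search_steps[OF t] by (simp add: Y_def Z_def mult_ac)
    also have "\<dots> \<le> 180000000 * (3200000000000 * ?X ^ 8) * (Y + Z)"
      using s(3) Y1 Z0 by (intro mult_right_mono mult_left_mono) auto
    finally show ?thesis by simp
  qed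
  have smp: "ev ?D (\<lambda>z. real (snd (snd z))) \<le> 63000000000000 * ?X ^ 9 * Y"
  proof -
    have "ev ?D (\<lambda>z. real (snd (snd z))) \<le> 63000 * (real K * (real L * L)) * Y"
      using search_samples[OF t] by (simp add: Y_def mult_ac)
    also have "\<dots> \<le> 63000 * (1000000000 * ?X ^ 9) * Y"
      using s(4) Y1 by (intro mult_right_mono mult_left_mono) auto
    finally show ?thesis by (simp add: mult_ac)
  qed
  let ?hT = "\<lambda>x :: answer. real T0 + real W1 * real (fst (snd x))"
  let ?hQ = "\<lambda>x :: answer. 6 * real m + 2 * real (snd (snd x))"
  have "ev ?D ?hT = real T0 + real W1 * ev ?D (\<lambda>z. real (fst (snd z)))"
    using fin_search_lev by (simp add: integrable_measure_pmf_finite)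
  also have "\<dots> \<le> (912 + 2 * real (tb bexp constc)) * ?X ^ 9 * (Y + Z) + 2304000000000000000000 * real (tb bexp searchc) * ?X ^ 9 * (Y + Z)"
  proof (rule add_mono)
    have "real T0 * 1 \<le> (912 + 2 * real (tb bexp constc)) * ?X ^ 9 * (Y + Z)"
      using s(2) Y1 Z0 by (intro mult_mono) auto
    then show "real T0 \<le> (912 + 2 * real (tb bexp constc)) * ?X ^ 9 * (Y + Z)" by simp
    have "real W1 \<le> 2 * real (tb bexp searchc) * (2 * ?X)"
      using mult_left_mono[OF s(1), of "2 * real (tb bexp searchc)"] by simp
    then have "real W1 * ev ?D (\<lambda>z. real (fst (snd z))) \<le> (2 * real (tb bexp searchc) * (2 * ?X)) * (576000000000000000000 * ?X ^ 8 * (Y + Z))"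
      using steps by (intro mult_mono) auto
    also have "\<dots> = 2304000000000000000000 * real (tb bexp searchc) * ?X ^ 9 * (Y + Z)"
    proof -
      have "(2 * T * (2 * X)) * (576000000000000000000 * X ^ 8 * U) = 2304000000000000000000 * T * X ^ 9 * U" for T X U :: real
        by algebra
      then show ?thesis .
    qed
    finally show "real W1 * ev ?D (\<lambda>z. real (fst (snd z))) \<le> 2304000000000000000000 * real (tb bexp searchc) * ?X ^ 9 * (Y + Z)" .
  qed
  also have "\<dots> = (912 + 2 * real (tb bexp constc) + 2304000000000000000000 * real (tb bexp searchc)) * (?X ^ 9 * (Y + Z))"
    by (simp only: distrib_right mult.assoc)
  also have "\<dots> \<le> C1 * (?X ^ 9 * (Y + Z))"
    using C1(1) X9 Y1 Z0 by (intro mult_right_mono) auto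
  finally have eT: "ev ?D ?hT \<le> (Y + Z) * (C1 * ?X ^ 9)" by (simp only: mult_ac)
  have "expected_cost time (run program n \<epsilon> E nbr) \<le> ennreal (ev ?D ?hT)"
  proof (rule expected_cost_le[OF run_rel _ fin_search_lev])
    fix s x assume "outcome_rel s x"
    then have "real (time s) \<le> real (T0 + fst (snd x) * W1)" unfolding outcome_rel_def of_nat_le_iff by blast
    then show "real (time s) \<le> ?hT x" by (simp add: mult.commute)
  qed
  then show "expected_cost time (run program n \<epsilon> E nbr) \<le> ennreal ((Y + Z) * (C1 * ?X ^ 9))"
    using ennreal_leI[OF eT] by (rule order_trans)
  have qT: "expected_cost queries (run program n \<epsilon> E nbr) \<le> ennreal (ev ?D ?hT)"
  proof (rule expected_cost_le[OF run_rel _ fin_search_lev])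
    fix s x assume "outcome_rel s x"
    then have "real (queries s) \<le> real (T0 + fst (snd x) * W1)" unfolding outcome_rel_def of_nat_le_iff by linarith
    then show "real (queries s) \<le> ?hT x" by (simp add: mult.commute)
  qed
  have qQ: "expected_cost queries (run program n \<epsilon> E nbr) \<le> ennreal (ev ?D ?hQ)"
  proof (rule expected_cost_le[OF run_rel _ fin_search_lev])
    fix s x assume "outcome_rel s x"
    then have "real (queries s) \<le> real (6 * m + 2 * snd (snd x))" unfolding outcome_rel_def of_nat_le_iff by blast
    then show "real (queries s) \<le> ?hQ x" by simp
  qed
  have "ev ?D ?hQ = 6 * real m + 2 * ev ?D (\<lambda>z. real (snd (snd z)))"
    using fin_search_lev by (simp add: integrable_measure_pmf_finite)
  also have "\<dots> \<le> C1 * ?X ^ 9 * m + C1 * ?X ^ 9 * Y"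
  proof (rule add_mono)
    have "6 * 1 \<le> C1 * ?X ^ 9" using C1(2) X9 by (intro mult_mono) auto
    then show "6 * real m \<le> C1 * ?X ^ 9 * m" by (intro mult_right_mono) auto
    have "2 * ev ?D (\<lambda>z. real (snd (snd z))) \<le> 126000000000000 * (?X ^ 9 * Y)"
    proof -
      have "2 * x \<le> 126000000000000 * (y * z)" if "x \<le> 63000000000000 * y * z" for x y z :: real
        using that by (simp add: mult_ac)
      from this[OF smp] show ?thesis .
    qed
    also have "\<dots> \<le> C1 * (?X ^ 9 * Y)" using C1(3) X9 Y1 by (intro mult_right_mono) auto
    finally show "2 * ev ?D (\<lambda>z. real (snd (snd z))) \<le> C1 * ?X ^ 9 * Y" by (simp only: mult_ac)
  qed
  finally have eQ: "ev ?D ?hQ \<le> (Y + m) * (C1 * ?X ^ 9)" by (simp add: algebra_simps)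
  show "expected_cost queries (run program n \<epsilon> E nbr) \<le> ennreal ((Y + min (real m) Z) * (C1 * ?X ^ 9))"
  proof (cases "real m \<le> Z")
    case True
    then show ?thesis using order_trans[OF qQ ennreal_leI[OF eQ]] by (simp add: min_absorb1)
  next
    case False
    then show ?thesis using order_trans[OF qT ennreal_leI[OF eT]] by (simp add: min_absorb2)
  qed
qed

text \<open>From 2^(L-1) \<le> n and ln 2 \<ge> 1/2 follows L - 1 \<le> 2 ln n, and ln n \<ge> 1
  absorbs the 1. P < 2/\<epsilon> holds because k is least. Hence 6 = 2 * 3.\<close>

lemma parameter_bound: "real P * L \<le> 6 * (ln n * (1 / \<epsilon>))"
proof -
  have "exp 1 \<le> real n" using exp_le n3 by linarith
  then have l1: "1 \<le> ln (real n)" using n3 by (subst ln_ge_iff) auto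
  have "real (2 ^ (L - 1)) \<le> real n" using L(2) by (simp only: of_nat_le_iff)
  then have "ln ((2::real) ^ (L - 1)) \<le> ln n" by (intro ln_mono) auto
  then have "real (L - 1) * ln 2 \<le> ln n" by (simp add: ln_realpow)
  moreover have "real (L - 1) * (1 / 2) \<le> real (L - 1) * ln 2"
    using ln2_ge_two_thirds by (intro mult_left_mono) auto
  ultimately have "real (L - 1) \<le> 2 * ln n" by linarith
  then have "real L \<le> 3 * ln n" using L(1) l1 by (simp add: of_nat_diff)
  moreover have "real P \<le> 2 * (1 / \<epsilon>)"
  proof -
    have "\<epsilon> * 2 ^ (k - 1) < 1" using k(1) k(3)[of "k - 1"] by simp
    moreover have "(2::real) ^ k = 2 * 2 ^ (k - 1)" using k(1) by (cases k) auto
    ultimately show ?thesis using \<epsilon> by (simp add: Pk field_simps)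
  qed
  ultimately have "real P * L \<le> (2 * (1 / \<epsilon>)) * (3 * ln n)"
    using \<epsilon> by (intro mult_mono) auto
  then show ?thesis by simp
qed

lemma final_factor: "C1 * (real P * L) ^ 9 \<le> C1 * 6 ^ 9 * ln n ^ 9 * (1 / \<epsilon>) ^ 9"
proof -
  have "(real P * L) ^ 9 \<le> (6 * (ln n * (1 / \<epsilon>))) ^ 9" by (intro power_mono parameter_bound) simp
  then have "C1 * (real P * L) ^ 9 \<le> C1 * (6 * (ln n * (1 / \<epsilon>))) ^ 9"
    by (intro mult_left_mono) (simp_all add: C1_def)
  then show ?thesis by (simp only: power_mult_distrib mult.assoc)
qed

end

lemma small_graph:
  assumes "n < 3"
  shows "triangles n E = {}" "run program n \<epsilon> E nbr = return_spmf (charge 1 (charge (1 + expr_time (initial n) (eless (Var ''n'') (Const 3))) (initial n)))"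
proof -
  have "card T \<noteq> 3" if "T \<subseteq> {1..n}" for T using card_mono[OF _ that] assms by simp
  then show "triangles n E = {}" by (auto simp: triangles_def)
  show "run program n \<epsilon> E nbr = return_spmf (charge 1 (charge (1 + expr_time (initial n) (eless (Var ''n'') (Const 3))) (initial n)))"
    using assms by (simp add: run_def program_def initial_def)
qed

lemma counting_exists:
  fixes \<epsilon> :: real
  assumes \<epsilon>: "0 < \<epsilon>" "\<epsilon> < 1" and g: "simple_graph n E" "neighbor_order n E nbr" and n3: "3 \<le> n"
  obtains P L k where "counting n E nbr \<epsilon> P L k"
proof -
  obtain j where "1 / \<epsilon> < 2 ^ j" using real_arch_pow[of 2 "1 / \<epsilon>"] by auto
  then have j: "1 \<le> \<epsilon> * 2 ^ j" using \<epsilon> by (simp add: field_simps)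
  define k where "k = (LEAST i. 1 \<le> \<epsilon> * 2 ^ i)"
  have k: "1 \<le> \<epsilon> * 2 ^ k" unfolding k_def by (rule LeastI[of _ j]) (rule j)
  have kl: "\<epsilon> * 2 ^ i < 1" if "i < k" for i using not_less_Least[of i] that unfolding k_def by force
  have k1: "1 \<le> k" using k \<epsilon> by (cases k) auto
  have "\<exists>j. n < 2 ^ j" using less_exp by blast
  define L where "L = (LEAST i. n < 2 ^ i)"
  have L: "n < 2 ^ L" unfolding L_def using \<open>\<exists>j. n < 2 ^ j\<close> by (rule LeastI_ex)
  have L2: "2 \<le> L"
  proof (rule ccontr)
    assume "\<not> 2 \<le> L"
    then have "L = 0 \<or> L = 1" by linarith
    then show False using L n3 by auto
  qed
  have L1: "2 ^ (L - 1) \<le> n" using not_less_Least[of "L - 1" "\<lambda>i. n < 2 ^ i"] L2 unfolding L_def[symmetric] by simp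
  have P: "2 \<le> (2::nat) ^ k" using power_increasing[OF k1, of "2::nat"] by simp
  have MM: "2 \<le> n * 2 ^ k" "n \<le> n * 2 ^ k" using mult_le_mono[of 1 n 2 "2 ^ k"] P n3 by simp_all
  have "counting n E nbr \<epsilon> (2 ^ k) L k"
    by unfold_locales (rule MM | use \<epsilon> g n3 k kl k1 L L1 L2 P in simp)+
  then show thesis by (rule that)
qed

theorem mainTheorem1:
  shows "\<exists>(prog :: com) (C :: real) (a :: nat) (b :: nat).
    \<forall>(n :: nat) (\<epsilon> :: real) (E :: nat set set) (nbr :: nat \<Rightarrow> nat \<Rightarrow> nat) (m :: nat) (t :: nat).
      0 < \<epsilon> \<and> \<epsilon> < 1 \<and> simple_graph n E \<and> neighbor_order n E nbr \<and>
      m = card E \<and> t = card (triangles n E) \<longrightarrow>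
        measure (measure_spmf (run prog n \<epsilon> E nbr))
          {s. (1 - \<epsilon>) * real t \<le> result s \<and> result s \<le> (1 + \<epsilon>) * real t} \<ge> 5 / 6 \<and>
        (t \<ge> 1 \<longrightarrow>
          expected_cost queries (run prog n \<epsilon> E nbr)
            \<le> ennreal ((real n / root 3 (real t) + min (real m) (real m powr (3 / 2) / real t))
                * (C * ln (real n) ^ a * (1 / \<epsilon>) ^ b)) \<and>
          expected_cost time (run prog n \<epsilon> E nbr)
            \<le> ennreal ((real n / root 3 (real t) + real m powr (3 / 2) / real t)
                * (C * ln (real n) ^ a * (1 / \<epsilon>) ^ b)))"
proof -
  let ?C = "counting.C1 * 6 ^ 9"
  have pw: "real m powr (3 / 2) = m * sqrt m" for m :: nat
  proof (cases "m = 0")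
    case False
    have "real m powr (3 / 2) = real m powr (1 + 1 / 2)" by simp
    also have "\<dots> = m * sqrt m" using False by (simp only: powr_add powr_one powr_half_sqrt of_nat_0_le_iff)
    finally show ?thesis .
  qed simp
  have main: "measure (measure_spmf (run program n \<epsilon> E nbr))
          {s. (1 - \<epsilon>) * real t \<le> result s \<and> result s \<le> (1 + \<epsilon>) * real t} \<ge> 5 / 6 \<and>
        (t \<ge> 1 \<longrightarrow>
          expected_cost queries (run program n \<epsilon> E nbr)
            \<le> ennreal ((real n / root 3 (real t) + min (real m) (real m powr (3 / 2) / real t))
                * (?C * ln (real n) ^ 9 * (1 / \<epsilon>) ^ 9)) \<and>
          expected_cost time (run program n \<epsilon> E nbr)
            \<le> ennreal ((real n / root 3 (real t) + real m powr (3 / 2) / real t)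
                * (?C * ln (real n) ^ 9 * (1 / \<epsilon>) ^ 9)))"
    if h: "0 < \<epsilon>" "\<epsilon> < 1" "simple_graph n E" "neighbor_order n E nbr" "m = card E" "t = card (triangles n E)"
    for n m t :: nat and \<epsilon> :: real and E nbr
  proof (cases "n < 3")
    case True
    note sg = small_graph[OF True]
    show ?thesis unfolding h(6) sg
      by (simp add: measure_spmf_return_spmf measure_return result_def initial_def)
  next
    case False
    then obtain P L k where "counting n E nbr \<epsilon> P L k" using counting_exists[OF h(1-4)] by auto
    then interpret counting n E nbr \<epsilon> P L k .
    have up: "U * (counting.C1 * (real P * L) ^ 9) \<le> U * (?C * ln n ^ 9 * (1 / \<epsilon>) ^ 9)" if "0 \<le> U" for U
      using final_factor that by (intro mult_left_mono) auto
    show ?thesis unfolding h(5,6) pw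
      using accurate costs order_trans[OF costs(1) ennreal_leI[OF up]] order_trans[OF costs(2) ennreal_leI[OF up]] by simp
  qed
  show ?thesis
    by (rule exI[of _ program], rule exI[of _ ?C], rule exI[of _ 9], rule exI[of _ 9]) (use main in blast)
qed

end
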